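(* Let $(M,g)$ be a Lorentzian manifold of dimension $n$, $H\subset M$ a null hypersurface and $L$ a null-geodesic vector field on $H$. For every $z\in H$, the function $t\mapsto W_L(z,t)$ is twice differentiable on its interval of definition and satisfies $$W_L''(z,t)+\frac{(W_L'(z,t))^2}{n-2}\ \le\ -\mathrm{Ric}_{\Psi_L(z,t)}(L,L),$$ where $'$ denotes differentiation with respect to $t$.
   Context: Lorentzian manifolds $(M,g)$ are smooth of dimension $n\ge3$, with $g$ of class $C^2$ and signature $(-,+,\dots,+)$, time-oriented; hypersurfaces are of class $C^2$. A hypersurface $H\subset M$ is null if $g|_{TH}$ is degenerate; then $\mathscr N H=\{v\in TM|_H: g(v,w)=0\ \forall w\in TH\}$ is a line sub-bundle of $TH$. A null-geodesic vector field on $H$ is a nowhere vanishing future-directed $C^1$ section $L$ of $\mathscr NH$ with $\nabla_LL=0$. $\Psi_L(z,t)=\exp_z(tL(z))$ whenever this lies in $H$. For $z\in H$, choose a basis $e_1,\dots,e_{n-1}$ of $T_zH$ and extend it by parallel transport along $t\mapsto\Psi_L(z,t)$ (it stays a basis of $TH$). Let $J_i(t)$ be the Jacobi field along this geodesic, i.e. $J_i''+R(L,J_i)L=0$, with $J_i(0)=e_i$, $J_i'(0)=\nabla_{e_i}L$; it is tangent to $H$. Write $J_i(t)=\sum_jJ_{ij}(z,t)e_j$ and let $\det J_L(z,t)=\det(J_{ij}(z,t))_{i,j}$, which does not depend on the choice of basis. Define $W_L(z,t)=\log\det J_L(z,t)$; it is defined for $t$ in the connected component containing $0$ of $\{t:\Psi_L(z,t)\in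 H\}$, where $\det J_L(z,t)>0$. *)

theory Defs
  imports "HOL-Analysis.Analysis" "Jordan_Normal_Form.Determinant"
begin

no_notation Matrix.vec_index (infixl "$" 100)

section \<open>Functions of class C^k on open sets\<close>

primrec Ck_on :: "nat \<Rightarrow> ('a::euclidean_space \<Rightarrow> 'b::real_normed_vector) \<Rightarrow> 'a set \<Rightarrow> bool" where
  "Ck_on 0 f S \<longleftrightarrow> continuous_on S f"
| "Ck_on (Suc k) f S \<longleftrightarrow>
     f differentiable_on S \<and> (\<forall>b\<in>Basis. Ck_on k (\<lambda>x. frechet_derivative f (at x) b) S)"

definition partial_deriv :: "'n \<Rightarrow> (real^'n \<Rightarrow> real) \<Rightarrow> real^'n \<Rightarrow> real" where
  "partial_deriv i f x = frechet_derivative f (at x) (axis i 1)"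

section \<open>Smooth manifolds and tangent vectors\<close>

text \<open>The manifold is the whole type \<open>'m\<close>. A chart is a pair (domain, coordinate map); the
  coordinate map is only meaningful on the domain. The atlas need not be maximal.\<close>

type_synonym ('m, 'n) chart = "'m set \<times> ('m \<Rightarrow> real^'n)"

definition chart_inv :: "('m, 'n::finite) chart \<Rightarrow> real^'n \<Rightarrow> 'm" where
  "chart_inv c = inv_into (fst c) (snd c)"

definition transition :: "('m, 'n::finite) chart \<Rightarrow> ('m, 'n) chart \<Rightarrow> real^'n \<Rightarrow> real^'n" where
  "transition c d = snd d \<circ> chart_inv c"

definition smooth_atlas ::
    "('m::{t2_space, second_countable_topology}, 'n::finite) chart set \<Rightarrow> bool" where
  "smooth_atlas A \<longleftrightarrow>
     (\<Union>c\<in>A. fst c) = UNIV \<and>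
     (\<forall>c\<in>A. open (fst c) \<and> open (snd c ` fst c) \<and>
        homeomorphism (fst c) (snd c ` fst c) (snd c) (chart_inv c)) \<and>
     (\<forall>c\<in>A. \<forall>d\<in>A. \<forall>k. Ck_on k (transition c d) (snd c ` (fst c \<inter> fst d)))"

text \<open>A tangent vector at \<open>p\<close> is the family of its component vectors in the charts around \<open>p\<close>,
  related by the Jacobian matrices of the transition maps. The value 0 at all other charts only
  ensures that equal tangent vectors are equal functions.\<close>

type_synonym ('m, 'n) tvec = "('m, 'n) chart \<Rightarrow> real^'n"

definition tzero :: "('m, 'n::finite) tvec" where
  "tzero = (\<lambda>c. 0)"

definition tscale :: "real \<Rightarrow> ('m, 'n::finite) tvec \<Rightarrow> ('m, 'n) tvec" where
  "tscale r v = (\<lambda>c. r *\<^sub>R v c)"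

definition tadd :: "('m, 'n::finite) tvec \<Rightarrow> ('m, 'n) tvec \<Rightarrow> ('m, 'n) tvec" where
  "tadd v w = (\<lambda>c. v c + w c)"

definition lincomb :: "nat \<Rightarrow> (nat \<Rightarrow> real) \<Rightarrow> (nat \<Rightarrow> ('m, 'n::finite) tvec) \<Rightarrow> ('m, 'n) tvec" where
  "lincomb m a e = (\<lambda>c. \<Sum>i<m. a i *\<^sub>R e i c)"

definition basis_of :: "nat \<Rightarrow> (nat \<Rightarrow> ('m, 'n::finite) tvec) \<Rightarrow> ('m, 'n) tvec set \<Rightarrow> bool" where
  "basis_of m e S \<longleftrightarrow>
     (\<forall>i<m. e i \<in> S) \<and>
     (\<forall>a. lincomb m a e = tzero \<longrightarrow> (\<forall>i<m. a i = 0)) \<and>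
     (\<forall>v\<in>S. \<exists>a. v = lincomb m a e)"

context
  fixes A :: "('m::{t2_space, second_countable_topology}, 'n::finite) chart set"
begin

definition tangent_space :: "'m \<Rightarrow> ('m, 'n) tvec set" where
  "tangent_space p = {v.
     (\<forall>c\<in>A. \<forall>d\<in>A. p \<in> fst c \<inter> fst d \<longrightarrow>
        v d = frechet_derivative (transition c d) (at (snd c p)) (v c)) \<and>
     (\<forall>c. \<not> (c \<in> A \<and> p \<in> fst c) \<longrightarrow> v c = 0)}"

text \<open>The coordinate vector of index \<open>i\<close> of the chart \<open>c\<close> at \<open>p\<close>.\<close>

definition coord_vec :: "('m, 'n) chart \<Rightarrow> 'm \<Rightarrow> 'n \<Rightarrow> ('m, 'n) tvec" where
  "coord_vec c p i = (\<lambda>d. if d \<in> A \<and> p \<in> fst d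
     then frechet_derivative (transition c d) (at (snd c p)) (axis i 1) else 0)"

definition has_velocity ::
    "real set \<Rightarrow> (real \<Rightarrow> 'm) \<Rightarrow> ('m, 'n) tvec \<Rightarrow> real \<Rightarrow> bool" where
  "has_velocity I \<gamma> v t \<longleftrightarrow>
     v \<in> tangent_space (\<gamma> t) \<and>
     (\<forall>c\<in>A. \<gamma> t \<in> fst c \<longrightarrow> ((\<lambda>s. snd c (\<gamma> s)) has_vector_derivative v c) (at t within I))"

end

section \<open>Lorentzian metrics, Levi-Civita connection and curvature\<close>

type_synonym ('m, 'n) metric = "'m \<Rightarrow> ('m, 'n) tvec \<Rightarrow> ('m, 'n) tvec \<Rightarrow> real"

context
  fixes A :: "('m::{t2_space, second_countable_topology}, 'n::finite) chart set"
    and g :: "('m, 'n) metric"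
begin

definition lorentz_form :: "'m \<Rightarrow> bool" where
  "lorentz_form p \<longleftrightarrow>
     (\<forall>u\<in>tangent_space A p. \<forall>v\<in>tangent_space A p. g p u v = g p v u) \<and>
     (\<forall>u\<in>tangent_space A p. \<forall>v\<in>tangent_space A p. \<forall>w\<in>tangent_space A p. \<forall>a b.
        g p (tadd (tscale a u) (tscale b v)) w = a * g p u w + b * g p v w) \<and>
     (\<exists>(b :: 'n \<Rightarrow> ('m, 'n) tvec) i0. (\<forall>i. b i \<in> tangent_space A p) \<and>
        (\<forall>i j. g p (b i) (b j) = (if i \<noteq> j then 0 else if i = i0 then -1 else 1)))"

text \<open>The Gram matrix of \<open>g\<close> in the chart \<open>c\<close>, as a function of the coordinates \<open>x\<close>.\<close>

definition gram :: "('m, 'n) chart \<Rightarrow> real^'n \<Rightarrow> real^'n^'n" where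
  "gram c x = (\<chi> i j. g (chart_inv c x) (coord_vec A c (chart_inv c x) i)
                                         (coord_vec A c (chart_inv c x) j))"

text \<open>The data of a Lorentzian manifold: atlas \<open>A\<close>, metric \<open>g\<close> and a continuous timelike vector
  field \<open>T\<close> giving the time orientation.\<close>

definition lorentzian_manifold :: "('m \<Rightarrow> ('m, 'n) tvec) \<Rightarrow> bool" where
  "lorentzian_manifold T \<longleftrightarrow>
     smooth_atlas A \<and>
     (\<forall>p. lorentz_form p) \<and>
     (\<forall>c\<in>A. \<forall>i j. Ck_on 2 (\<lambda>x. gram c x $ i $ j) (snd c ` fst c)) \<and>
     (\<forall>p. T p \<in> tangent_space A p \<and> g p (T p) (T p) < 0) \<and>
     (\<forall>c\<in>A. continuous_on (fst c) (\<lambda>p. T p c))"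

definition future_directed :: "('m \<Rightarrow> ('m, 'n) tvec) \<Rightarrow> 'm \<Rightarrow> ('m, 'n) tvec \<Rightarrow> bool" where
  "future_directed T p v \<longleftrightarrow>
     v \<in> tangent_space A p \<and> v \<noteq> tzero \<and> g p v v \<le> 0 \<and> g p v (T p) < 0"

text \<open>\<open>christoffel c x k i j\<close> has upper index \<open>k\<close> and lower indices \<open>i\<close>, \<open>j\<close>.\<close>

definition christoffel :: "('m, 'n) chart \<Rightarrow> real^'n \<Rightarrow> 'n \<Rightarrow> 'n \<Rightarrow> 'n \<Rightarrow> real" where
  "christoffel c x k i j = 1/2 * (\<Sum>l\<in>UNIV. matrix_inv (gram c x) $ k $ l *
     (partial_deriv i (\<lambda>y. gram c y $ j $ l) x
      + partial_deriv j (\<lambda>y. gram c y $ i $ l) x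
      - partial_deriv l (\<lambda>y. gram c y $ i $ j) x))"

text \<open>\<open>W\<close> is the covariant derivative at time \<open>t\<close> of the vector field \<open>V\<close> along the curve \<open>\<gamma>\<close>.\<close>

definition has_cov_deriv ::
    "real set \<Rightarrow> (real \<Rightarrow> 'm) \<Rightarrow> (real \<Rightarrow> ('m, 'n) tvec) \<Rightarrow> ('m, 'n) tvec \<Rightarrow> real \<Rightarrow> bool" where
  "has_cov_deriv I \<gamma> V W t \<longleftrightarrow>
     (\<forall>s\<in>I. V s \<in> tangent_space A (\<gamma> s)) \<and> W \<in> tangent_space A (\<gamma> t) \<and>
     (\<forall>c\<in>A. \<gamma> t \<in> fst c \<longrightarrow> (\<exists>\<gamma>' V'.
        ((\<lambda>s. snd c (\<gamma> s)) has_vector_derivative \<gamma>') (at t within I) \<and>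
        ((\<lambda>s. V s c) has_vector_derivative V') (at t within I) \<and>
        W c = V' + (\<chi> k. \<Sum>i\<in>UNIV. \<Sum>j\<in>UNIV.
                 christoffel c (snd c (\<gamma> t)) k i j * \<gamma>' $ i * V t c $ j)))"

definition geodesic :: "real set \<Rightarrow> (real \<Rightarrow> 'm) \<Rightarrow> (real \<Rightarrow> ('m, 'n) tvec) \<Rightarrow> bool" where
  "geodesic I \<gamma> V \<longleftrightarrow>
     open I \<and> is_interval I \<and> continuous_on I \<gamma> \<and>
     (\<forall>t\<in>I. has_velocity A I \<gamma> (V t) t \<and> has_cov_deriv I \<gamma> V tzero t)"

definition exp_rel :: "'m \<Rightarrow> ('m, 'n) tvec \<Rightarrow> 'm \<Rightarrow> bool" where
  "exp_rel p v q \<longleftrightarrow>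
     (\<exists>I \<gamma> V. {0..1} \<subseteq> I \<and> geodesic I \<gamma> V \<and> \<gamma> 0 = p \<and> V 0 = v \<and> \<gamma> 1 = q)"

text \<open>The exponential map, and its domain. Geodesics are unique as \<open>g\<close> is of class C^2.\<close>

definition exp_dom :: "'m \<Rightarrow> ('m, 'n) tvec set" where
  "exp_dom p = {v. \<exists>q. exp_rel p v q}"

definition exp_map :: "'m \<Rightarrow> ('m, 'n) tvec \<Rightarrow> 'm" where
  "exp_map p v = (THE q. exp_rel p v q)"

text \<open>Components of the curvature in a chart, for the sign convention
  \<open>R(X,Y)Z = \<nabla>_[X,Y] Z - \<nabla>_X \<nabla>_Y Z + \<nabla>_Y \<nabla>_X Z\<close>, in which the Jacobi equation along a geodesic
  with velocity \<open>L\<close> is \<open>J'' + R(L,J)L = 0\<close> and \<open>Ric(Y,Z)\<close> is the trace of \<open>V \<mapsto> R(Y,V)Z\<close>.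
  The resulting Ricci tensor is the usual one.\<close>

definition curvature_comp ::
    "('m, 'n) chart \<Rightarrow> real^'n \<Rightarrow> real^'n \<Rightarrow> real^'n \<Rightarrow> real^'n \<Rightarrow> real^'n" where
  "curvature_comp c x X Y Z = (\<chi> l. \<Sum>i\<in>UNIV. \<Sum>j\<in>UNIV. \<Sum>k\<in>UNIV.
     (partial_deriv j (\<lambda>y. christoffel c y l i k) x
      - partial_deriv i (\<lambda>y. christoffel c y l j k) x
      + (\<Sum>m\<in>UNIV. christoffel c x l j m * christoffel c x m i k
                  - christoffel c x l i m * christoffel c x m j k))
     * X $ i * Y $ j * Z $ k)"

definition curvature ::
    "'m \<Rightarrow> ('m, 'n) tvec \<Rightarrow> ('m, 'n) tvec \<Rightarrow> ('m, 'n) tvec \<Rightarrow> ('m, 'n) tvec" where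
  "curvature p X Y Z = (\<lambda>c. if c \<in> A \<and> p \<in> fst c
     then curvature_comp c (snd c p) (X c) (Y c) (Z c) else 0)"

text \<open>The trace does not depend on the chart in which it is computed.\<close>

definition ricci :: "'m \<Rightarrow> ('m, 'n) tvec \<Rightarrow> ('m, 'n) tvec \<Rightarrow> real" where
  "ricci p Y Z = (let c = (SOME c. c \<in> A \<and> p \<in> fst c)
     in \<Sum>i\<in>UNIV. curvature p Y (coord_vec A c p i) Z c $ i)"

end

section \<open>Null hypersurfaces and null-geodesic vector fields\<close>

context
  fixes A :: "('m::{t2_space, second_countable_topology}, 'n::finite) chart set"
    and g :: "('m, 'n) metric"
    and H :: "'m set"
begin

definition hypersurface :: bool where
  "hypersurface \<longleftrightarrow>
     (\<forall>p\<in>H. \<forall>c\<in>A. p \<in> fst c \<longrightarrow>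
       (\<exists>V (f :: real^'n \<Rightarrow> real). open V \<and> snd c p \<in> V \<and> V \<subseteq> snd c ` fst c \<and> Ck_on 2 f V \<and>
          (\<forall>x\<in>V. \<exists>i. partial_deriv i f x \<noteq> 0) \<and>
          (\<forall>x\<in>V. chart_inv c x \<in> H \<longleftrightarrow> f x = 0)))"

definition curve_in :: "real \<Rightarrow> (real \<Rightarrow> 'm) \<Rightarrow> 'm \<Rightarrow> ('m, 'n) tvec \<Rightarrow> bool" where
  "curve_in \<epsilon> \<sigma> p v \<longleftrightarrow>
     0 < \<epsilon> \<and> continuous_on {-\<epsilon><..<\<epsilon>} \<sigma> \<and> \<sigma> ` {-\<epsilon><..<\<epsilon>} \<subseteq> H \<and>
     \<sigma> 0 = p \<and> has_velocity A {-\<epsilon><..<\<epsilon>} \<sigma> v 0"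

definition tangent_space_H :: "'m \<Rightarrow> ('m, 'n) tvec set" where
  "tangent_space_H p = {v. \<exists>\<epsilon> \<sigma>. curve_in \<epsilon> \<sigma> p v}"

definition null_hypersurface :: bool where
  "null_hypersurface \<longleftrightarrow>
     hypersurface \<and>
     (\<forall>p\<in>H. \<exists>v\<in>tangent_space_H p. v \<noteq> tzero \<and> (\<forall>w\<in>tangent_space_H p. g p v w = 0))"

definition normal_space :: "'m \<Rightarrow> ('m, 'n) tvec set" where
  "normal_space p = {v \<in> tangent_space A p. \<forall>w\<in>tangent_space_H p. g p v w = 0}"

text \<open>\<open>L\<close> is of class C^1 on \<open>H\<close>: its components locally extend to C^1 functions of the
  coordinates of \<open>M\<close>. Values of \<open>L\<close> outside \<open>H\<close> are irrelevant.\<close>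

definition C1_along :: "('m \<Rightarrow> ('m, 'n) tvec) \<Rightarrow> bool" where
  "C1_along L \<longleftrightarrow>
     (\<forall>p\<in>H. \<forall>c\<in>A. p \<in> fst c \<longrightarrow>
       (\<exists>V (F :: real^'n \<Rightarrow> real^'n). open V \<and> snd c p \<in> V \<and> Ck_on 1 F V \<and>
          (\<forall>q\<in>H \<inter> fst c. snd c q \<in> V \<longrightarrow> L q c = F (snd c q))))"

text \<open>The covariant derivative of \<open>L\<close> at \<open>p\<close> in a direction \<open>v\<close> tangent to \<open>H\<close>, computed along any
  curve in \<open>H\<close> with velocity \<open>v\<close> at \<open>p\<close>.\<close>

definition nabla :: "('m \<Rightarrow> ('m, 'n) tvec) \<Rightarrow> 'm \<Rightarrow> ('m, 'n) tvec \<Rightarrow> ('m, 'n) tvec" where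
  "nabla L p v = (THE w. \<exists>\<epsilon> \<sigma>. curve_in \<epsilon> \<sigma> p v \<and>
     has_cov_deriv A g {-\<epsilon><..<\<epsilon>} \<sigma> (\<lambda>s. L (\<sigma> s)) w 0)"

definition null_geodesic_field :: "('m \<Rightarrow> ('m, 'n) tvec) \<Rightarrow> ('m \<Rightarrow> ('m, 'n) tvec) \<Rightarrow> bool" where
  "null_geodesic_field T L \<longleftrightarrow>
     C1_along L \<and>
     (\<forall>p\<in>H. L p \<in> normal_space p \<and> L p \<noteq> tzero \<and> future_directed A g T p (L p) \<and>
        nabla L p (L p) = tzero)"

end

section \<open>The logarithmic Jacobian determinant\<close>

context
  fixes A :: "('m::{t2_space, second_countable_topology}, 'n::finite) chart set"
    and g :: "('m, 'n) metric"
    and H :: "'m set"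
    and L :: "'m \<Rightarrow> ('m, 'n) tvec"
begin

definition Psi :: "'m \<Rightarrow> real \<Rightarrow> 'm" where
  "Psi z t = exp_map A g z (tscale t (L z))"

definition Psi_interval :: "'m \<Rightarrow> real set" where
  "Psi_interval z =
     connected_component_set {t. tscale t (L z) \<in> exp_dom A g z \<and> Psi z t \<in> H} 0"

definition parallel_along :: "'m \<Rightarrow> (real \<Rightarrow> ('m, 'n) tvec) \<Rightarrow> bool" where
  "parallel_along z E \<longleftrightarrow>
     (\<forall>t\<in>Psi_interval z. has_cov_deriv A g (Psi_interval z) (Psi z) E tzero t)"

text \<open>\<open>J\<close> satisfies \<open>J'' + R(L,J)L = 0\<close> and has covariant derivative \<open>J'\<close>.\<close>

definition jacobi_field :: "'m \<Rightarrow> (real \<Rightarrow> ('m, 'n) tvec) \<Rightarrow> (real \<Rightarrow> ('m, 'n) tvec) \<Rightarrow> bool" where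
  "jacobi_field z J J' \<longleftrightarrow>
     (\<forall>t\<in>Psi_interval z.
        has_cov_deriv A g (Psi_interval z) (Psi z) J (J' t) t \<and>
        has_cov_deriv A g (Psi_interval z) (Psi z) J'
          (tscale (-1) (curvature A g (Psi z t) (L (Psi z t)) (J t) (L (Psi z t)))) t)"

text \<open>Here \<open>e\<close> is a basis of the tangent space of \<open>H\<close> at \<open>z\<close>, \<open>E i\<close> the parallel extension of
  \<open>e i\<close>, \<open>J i\<close> the Jacobi fields and \<open>a\<close> the matrix of their components at time \<open>t\<close>. The
  determinant does not depend on \<open>e\<close>.\<close>

definition det_J :: "'m \<Rightarrow> real \<Rightarrow> real" where
  "det_J z t = (let m = CARD('n) - 1 in
     THE d. \<exists>e E J J' a.
       basis_of m e (tangent_space_H A H z) \<and>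
       (\<forall>i<m. parallel_along z (E i) \<and> E i 0 = e i) \<and>
       (\<forall>i<m. jacobi_field z (J i) (J' i) \<and> J i 0 = e i \<and> J' i 0 = nabla A g H L z (e i)) \<and>
       (\<forall>i<m. J i t = lincomb m (a i) (\<lambda>j. E j t)) \<and>
       d = Determinant.det (Matrix.mat m m (\<lambda>(i, j). a i j)))"

definition W :: "'m \<Rightarrow> real \<Rightarrow> real" where
  "W z t = ln (det_J z t)"

end

end

theory Submission
  imports Defs
begin

text \<open>
Along the null geodesic through \<open>z\<close> the Jacobi fields \<open>J\<^sub>i\<close> satisfy the first-order equation
\<open>J' = \<nabla>\<^sub>J L\<close>, so in a parallel frame of \<open>TH\<close> their matrix solves \<open>a' = a b\<close>, where \<open>b\<close> is the
matrix of the Weingarten map \<open>v \<mapsto> \<nabla>\<^sub>v L\<close>. By Liouville's formula \<open>W' = tr b\<close>. In a parallel null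
frame \<open>L, e\<^sub>1, ..., e\<^sub>m, N\<close>, \<open>m = n - 2\<close>, the Jacobi equation becomes the Riccati equation
\<open>b' = - b\<^sup>2 - R(L, \<cdot>)L\<close>; the block of \<open>b\<close> on \<open>e\<^sub>1, ..., e\<^sub>m\<close> is symmetric and carries the whole
trace, and \<open>tr R(L, \<cdot>)L = Ric(L, L)\<close>. The inequality is then Cauchy--Schwarz for the diagonal of
this block.

As \<open>L\<close> is only \<open>C\<^sup>1\<close>, differentiating \<open>\<nabla>\<^sub>J L\<close> needs an argument that replaces the flow of \<open>L\<close>: if
\<open>DF(F) = q\<close> near the curve \<open>\<gamma>\<close> with \<open>\<gamma>' = F(\<gamma>)\<close>, and \<open>u' = DF(\<gamma>) u\<close>, then \<open>\<gamma> + \<epsilon> u\<close> is an integral curve of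
\<open>F\<close> up to \<open>o(\<epsilon>)\<close>, and comparing \<open>F\<close> along the two curves yields \<open>(DF(\<gamma>) u)' = Dq(\<gamma>) u\<close>.
\<close>

no_notation Matrix.scalar_prod (infix "\<bullet>" 70)

section \<open>Differentiable functions\<close>

text \<open>\<open>det_J\<close> is a definite description over all bases, parallel frames and
  Jacobi fields, so the determinant has to be shown independent of every choice before it can be
  differentiated; the uniqueness theorems for geodesics, parallel fields and Jacobi fields serve
  this purpose. \<open>Psi\<close> is assembled from a separate geodesic for each time, and that its
  velocity is \<open>L\<close> is a result: a null geodesic inside \<open>H\<close> is tangent to
  the null line bundle, and its factor against \<open>L\<close> is constant. Two obstacles shape the
  calculus. \<open>L\<close> lives on \<open>H\<close> only, whereas derivatives are taken on open
  sets of a chart; a C^1 retraction \<rho> onto \<open>H\<close> turns identities on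
  \<open>H\<close> into identities between functions of \<rho> x. And b is at first merely
  continuous in t; its differentiability is read off from a Jacobi field that starts as a frame
  vector, where the terms not known to be differentiable carry a factor that vanishes at that time.
  The interval of definition may contain its endpoints or shrink to one point, so all derivatives
  along the curve are taken within it.\<close>

abbreviation fd :: "('a::real_normed_vector \<Rightarrow> 'b::real_normed_vector) \<Rightarrow> 'a \<Rightarrow> 'a \<Rightarrow> 'b" where
  "fd f x \<equiv> frechet_derivative f (at x)"

text \<open>Continuity of the derivative is asked one direction at a time. In finite dimension this
  amounts to continuity in operator norm and needs no topology on linear maps.\<close>

definition C1_on :: "('a::euclidean_space \<Rightarrow> 'b::real_normed_vector) \<Rightarrow> 'a set \<Rightarrow> bool" where
  "C1_on f S \<longleftrightarrow> (\<forall>x\<in>S. f differentiable at x) \<and> (\<forall>v. continuous_on S (\<lambda>x. fd f x v))"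

lemma fd_eq: "(f has_derivative f') (at x) \<Longrightarrow> fd f x = f'"
  using frechet_derivative_at by metis

lemma C1_onD: "C1_on f S \<Longrightarrow> x \<in> S \<Longrightarrow> (f has_derivative fd f x) (at x)"
  by (simp add: C1_on_def frechet_derivative_works)

lemma C1_on_linear: "C1_on f S \<Longrightarrow> x \<in> S \<Longrightarrow> linear (fd f x)"
  using C1_onD has_derivative_linear by blast

lemma C1_onI:
  assumes "\<And>x. x \<in> S \<Longrightarrow> (f has_derivative f' x) (at x)"
    and "\<And>v. continuous_on S (\<lambda>x. f' x v)"
  shows "C1_on f S"
proof -
  have "fd f x = f' x" if "x \<in> S" for x
    using assms(1)[OF that] by (rule fd_eq)
  then have "continuous_on S (\<lambda>x. fd f x v)" for v
    using assms(2)[of v] by (simp cong: continuous_on_cong_simp)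
  then show ?thesis
    using assms(1) unfolding C1_on_def differentiable_def by blast
qed

lemma C1_on_subset: "C1_on f S \<Longrightarrow> T \<subseteq> S \<Longrightarrow> C1_on f T"
  unfolding C1_on_def by (meson continuous_on_subset subsetD)

lemma C1_on_continuous: "C1_on f S \<Longrightarrow> continuous_on S f"
  by (meson C1_onD continuous_at_imp_continuous_on has_derivative_continuous)

lemma C1_on_fd_continuous: "C1_on f S \<Longrightarrow> continuous_on S (\<lambda>x. fd f x v)"
  by (simp add: C1_on_def)

lemma linear_euclid_sum:
  fixes l :: "'a::euclidean_space \<Rightarrow> 'b::real_vector"
  assumes "linear l"
  shows "l v = (\<Sum>b\<in>Basis. (v \<bullet> b) *\<^sub>R l b)"
proof -
  have "l v = l (\<Sum>b\<in>Basis. (v \<bullet> b) *\<^sub>R b)" by (simp add: euclidean_representation)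
  also have "\<dots> = (\<Sum>b\<in>Basis. (v \<bullet> b) *\<^sub>R l b)"
    by (simp add: linear_sum[OF assms] linear_cmul[OF assms])
  finally show ?thesis .
qed

text \<open>Expanding the direction in the standard basis turns joint continuity in point and
  direction into continuity of finitely many directional derivatives.\<close>

lemma C1_on_continuous_compose:
  fixes f :: "'a::euclidean_space \<Rightarrow> 'b::real_normed_vector"
  assumes f: "C1_on f S" and x: "continuous_on K x" "x ` K \<subseteq> S" and v: "continuous_on K v"
  shows "continuous_on K (\<lambda>t. fd f (x t) (v t))"
proof -
  have eq: "fd f (x t) (v t) = (\<Sum>b\<in>Basis. (v t \<bullet> b) *\<^sub>R fd f (x t) b)" if "t \<in> K" for t
    using that x(2) by (intro linear_euclid_sum C1_on_linear[OF f]) auto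
  have "continuous_on K (\<lambda>t. fd f (x t) b)" for b
    using f x by (auto simp: C1_on_def intro: continuous_on_compose2)
  then have "continuous_on K (\<lambda>t. \<Sum>b\<in>Basis. (v t \<bullet> b) *\<^sub>R fd f (x t) b)"
    by (intro continuous_intros v) auto
  then show ?thesis
    by (subst continuous_on_cong[OF refl eq])
qed

lemma C1_on_cong:
  assumes "open S" "\<And>x. x \<in> S \<Longrightarrow> f x = g x"
  shows "C1_on f S \<longleftrightarrow> C1_on g S"
proof -
  have imp: "C1_on g S" if f: "C1_on f S" and eq: "\<And>x. x \<in> S \<Longrightarrow> f x = g x"
    for f g :: "'a \<Rightarrow> 'b"
  proof (rule C1_onI[where f' = "fd f"])
    fix x assume "x \<in> S"
    show "(g has_derivative fd f x) (at x)"
      by (rule has_derivative_transform_within_open[OF C1_onD[OF f \<open>x \<in> S\<close>] assms(1) \<open>x \<in> S\<close> eq])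
  qed (use f in \<open>simp add: C1_on_def\<close>)
  show ?thesis
    using imp[of f g] imp[of g f] assms(2) by metis
qed

lemma fd_cong:
  assumes "open S" "\<And>x. x \<in> S \<Longrightarrow> f x = g x" "x \<in> S"
  shows "fd f x = fd g x"
proof -
  have "(f has_derivative D) (at x) \<longleftrightarrow> (g has_derivative D) (at x)" for D
    using has_derivative_transform_within_open[of f D x UNIV S g]
      has_derivative_transform_within_open[of g D x UNIV S f] assms by auto
  then show ?thesis by (simp add: frechet_derivative_def)
qed

lemma C1_on_const: "C1_on (\<lambda>x. c) S"
  by (rule C1_onI[where f' = "\<lambda>x v. 0"]) auto

lemma C1_on_bounded_linear:
  assumes "bounded_linear l" shows "C1_on l S"
  by (rule C1_onI[where f' = "\<lambda>x. l"]) (use assms in \<open>auto intro: bounded_linear_imp_has_derivative\<close>)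

lemma C1_on_add:
  assumes "C1_on f S" "C1_on g S" shows "C1_on (\<lambda>x. f x + g x) S"
  by (rule C1_onI[where f' = "\<lambda>x v. fd f x v + fd g x v"])
    (use assms in \<open>auto intro!: has_derivative_add C1_onD continuous_intros simp: C1_on_def\<close>)

lemma C1_on_compose:
  fixes f :: "'a::euclidean_space \<Rightarrow> 'b::euclidean_space" and g :: "'b \<Rightarrow> 'c::real_normed_vector"
  assumes f: "C1_on f S" and g: "C1_on g T" and "f ` S \<subseteq> T"
  shows "C1_on (\<lambda>x. g (f x)) S" "x \<in> S \<Longrightarrow> fd (\<lambda>x. g (f x)) x = (\<lambda>v. fd g (f x) (fd f x v))"
proof -
  have d: "((\<lambda>x. g (f x)) has_derivative (\<lambda>v. fd g (f x) (fd f x v))) (at x)" if "x \<in> S" for x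
    using has_derivative_compose[OF C1_onD[OF f that] C1_onD[OF g]] assms(3) that by blast
  show "C1_on (\<lambda>x. g (f x)) S"
    by (rule C1_onI[OF d], assumption, rule C1_on_continuous_compose[OF g])
      (use assms f in \<open>auto simp: C1_on_continuous C1_on_def\<close>)
  show "x \<in> S \<Longrightarrow> fd (\<lambda>x. g (f x)) x = (\<lambda>v. fd g (f x) (fd f x v))"
    by (rule fd_eq[OF d])
qed

lemma C1_on_bilinear:
  assumes f: "C1_on f S" and g: "C1_on g S" and p: "bounded_bilinear p"
  shows "C1_on (\<lambda>x. p (f x) (g x)) S"
proof -
  have cont: "continuous_on S (\<lambda>x. p (h x) (k x))" if "continuous_on S h" "continuous_on S k" for h k
    using bounded_bilinear.continuous_on[OF p that] .
  show ?thesis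
  proof (rule C1_onI[where f' = "\<lambda>x v. p (f x) (fd g x v) + p (fd f x v) (g x)"])
    show "((\<lambda>x. p (f x) (g x)) has_derivative (\<lambda>v. p (f x) (fd g x v) + p (fd f x v) (g x))) (at x)"
      if "x \<in> S" for x
      by (rule bounded_bilinear.FDERIV[OF p C1_onD[OF f that] C1_onD[OF g that]])
    show "continuous_on S (\<lambda>x. p (f x) (fd g x v) + p (fd f x v) (g x))" for v
      using f g by (intro continuous_on_add cont C1_on_continuous C1_on_fd_continuous)
  qed
qed

lemmas C1_on_mult = C1_on_bilinear[OF _ _ bounded_bilinear_mult]
lemmas C1_on_scaleR = C1_on_bilinear[OF _ _ bounded_bilinear_scaleR]

lemma C1_on_sum:
  "(\<And>i. i \<in> I \<Longrightarrow> C1_on (f i) S) \<Longrightarrow> C1_on (\<lambda>x. \<Sum>i\<in>I. f i x) S"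
  by (induction I rule: infinite_finite_induct) (auto intro: C1_on_const C1_on_add)

lemma C1_on_prod:
  fixes f :: "'i \<Rightarrow> 'a::euclidean_space \<Rightarrow> real"
  shows "(\<And>i. i \<in> I \<Longrightarrow> C1_on (f i) S) \<Longrightarrow> C1_on (\<lambda>x. \<Prod>i\<in>I. f i x) S"
  by (induction I rule: infinite_finite_induct) (auto intro: C1_on_const C1_on_mult)

lemma C1_on_minus: "C1_on f S \<Longrightarrow> C1_on (\<lambda>x. - f x) S"
  using C1_on_scaleR[OF C1_on_const[where c = "-1"], of f S] by simp

lemma C1_on_diff: "C1_on f S \<Longrightarrow> C1_on g S \<Longrightarrow> C1_on (\<lambda>x. f x - g x) S"
  using C1_on_add[OF _ C1_on_minus, of f S g] by simp

lemma C1_on_divide: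
  fixes f g :: "'a::euclidean_space \<Rightarrow> real"
  assumes "C1_on f S" "C1_on g S" "\<And>x. x \<in> S \<Longrightarrow> g x \<noteq> 0"
  shows "C1_on (\<lambda>x. f x / g x) S"
proof -
  have "C1_on (\<lambda>x. inverse (g x)) S"
  proof (rule C1_onI[where f' = "\<lambda>x v. - (inverse (g x) * fd g x v * inverse (g x))"])
    show "((\<lambda>x. inverse (g x)) has_derivative (\<lambda>v. - (inverse (g x) * fd g x v * inverse (g x)))) (at x)"
      if "x \<in> S" for x
      by (rule Deriv.has_derivative_inverse[OF assms(3)[OF that] C1_onD[OF assms(2) that]])
    have "continuous_on S (\<lambda>x. inverse (g x))"
      by (rule continuous_on_inverse[OF C1_on_continuous[OF assms(2)]]) (use assms(3) in blast)
    then show "continuous_on S (\<lambda>x. - (inverse (g x) * fd g x v * inverse (g x)))" for v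
      using assms(2) by (intro continuous_on_minus continuous_on_mult C1_on_fd_continuous)
  qed
  then show ?thesis
    using C1_on_mult[OF assms(1)] by (simp add: divide_inverse)
qed

lemma C1_on_component:
  fixes f :: "'a::euclidean_space \<Rightarrow> 'b::real_normed_vector ^ 'n"
  shows "C1_on f S \<Longrightarrow> C1_on (\<lambda>x. f x $ i) S"
  by (rule C1_onI[where f' = "\<lambda>x v. fd f x v $ i"])
    (auto simp: C1_on_def intro!: continuous_intros
      bounded_linear.has_derivative[OF bounded_linear_vec_nth] C1_onD)

lemma C1_on_vec:
  fixes f :: "'n::finite \<Rightarrow> 'a::euclidean_space \<Rightarrow> real"
  assumes "\<And>i. C1_on (f i) S"
  shows "C1_on (\<lambda>x. \<chi> i. f i x) S"
proof -
  have "(\<lambda>x. \<chi> i. f i x) = (\<lambda>x. \<Sum>i\<in>UNIV. f i x *\<^sub>R axis i 1)"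
    by (simp add: fun_eq_iff Finite_Cartesian_Product.vec_eq_iff axis_def if_distrib cong: if_cong)
  then show ?thesis
    by (auto intro!: C1_on_sum C1_on_scaleR C1_on_const assms)
qed

section \<open>Functions of class C^k and symmetry of second derivatives\<close>

lemma Ck_on_cong:
  assumes "open S" "\<And>x. x \<in> S \<Longrightarrow> f x = g x"
  shows "Ck_on k f S \<longleftrightarrow> Ck_on k g S"
  using assms(2)
proof (induction k arbitrary: f g)
  case 0
  then show ?case by (simp cong: continuous_on_cong)
next
  case (Suc k)
  have e: "fd f x = fd g x" if "x \<in> S" for x
    by (rule fd_cong[OF assms(1) Suc.prems that])
  have "f differentiable at x \<longleftrightarrow> g differentiable at x" if "x \<in> S" for x
    using has_derivative_transform_within_open[of f _ x UNIV S g]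
      has_derivative_transform_within_open[of g _ x UNIV S f] assms(1) that Suc.prems
    unfolding differentiable_def by metis
  then have "f differentiable_on S \<longleftrightarrow> g differentiable_on S"
    using assms(1) by (simp add: differentiable_on_eq_differentiable_at)
  then show ?case
    using Suc.IH[of "\<lambda>x. fd f x b" "\<lambda>x. fd g x b" for b] e by simp
qed

lemma Ck_on_SucD:
  assumes "Ck_on (Suc k) f S" "open S"
  shows "\<And>x. x \<in> S \<Longrightarrow> (f has_derivative fd f x) (at x)" "\<And>v. Ck_on k (\<lambda>x. fd f x v) S"
    "Ck_on k f S"
proof -
  \<comment> \<open>\<open>Ck_on\<close> speaks of basis directions only. Any other direction is a
    finite combination of them, so closure under such combinations gives all directions.\<close>
  have lin: "Ck_on k (\<lambda>x. \<Sum>i\<in>I. c i *\<^sub>R h i x) S"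
    if "\<And>i. i \<in> I \<Longrightarrow> Ck_on k (h i) S" "finite I" for k I c and h :: "'a \<Rightarrow> 'a \<Rightarrow> 'b"
    using that
  proof (induction k arbitrary: h)
    case 0
    then show ?case by (auto intro!: continuous_intros)
  next
    case (Suc k)
    have d: "((\<lambda>x. \<Sum>i\<in>I. c i *\<^sub>R h i x) has_derivative (\<lambda>v. \<Sum>i\<in>I. c i *\<^sub>R fd (h i) x v)) (at x)"
      if "x \<in> S" for x
    proof -
      have "(h i has_derivative fd (h i) x) (at x)" if "i \<in> I" for i
        using Suc.prems(1)[OF that] \<open>x \<in> S\<close> assms(2)
        by (simp add: differentiable_on_eq_differentiable_at frechet_derivative_works)
      then show ?thesis
        by (intro has_derivative_sum bounded_linear.has_derivative[OF bounded_linear_scaleR_right])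
    qed
    have eq: "fd (\<lambda>x. \<Sum>i\<in>I. c i *\<^sub>R h i x) x v = (\<Sum>i\<in>I. c i *\<^sub>R fd (h i) x v)" if "x \<in> S" for x v
      using fd_eq[OF d[OF that]] by simp
    have "Ck_on k (\<lambda>x. \<Sum>i\<in>I. c i *\<^sub>R fd (h i) x b) S" if "b \<in> Basis" for b
      using Suc.IH[of "\<lambda>i x. fd (h i) x b"] Suc.prems that by simp
    then have "Ck_on k (\<lambda>x. fd (\<lambda>x. \<Sum>i\<in>I. c i *\<^sub>R h i x) x b) S" if "b \<in> Basis" for b
      using that by (subst Ck_on_cong[OF assms(2) eq])
    moreover have "(\<lambda>x. \<Sum>i\<in>I. c i *\<^sub>R h i x) differentiable_on S"
      using d assms(2) by (meson differentiable_def differentiable_on_eq_differentiable_at)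
    ultimately show ?case by simp
  qed
  show *: "(f has_derivative fd f x) (at x)" if "x \<in> S" for x
    using assms that by (simp add: differentiable_on_eq_differentiable_at frechet_derivative_works)
  show "Ck_on k (\<lambda>x. fd f x v) S" for v
  proof -
    have "Ck_on k (\<lambda>x. \<Sum>b\<in>Basis. (v \<bullet> b) *\<^sub>R fd f x b) S"
      using lin[where I = Basis and h = "\<lambda>b x. fd f x b"] assms(1) by simp
    moreover have eq: "fd f x v = (\<Sum>b\<in>Basis. (v \<bullet> b) *\<^sub>R fd f x b)" if "x \<in> S" for x
      by (rule linear_euclid_sum[OF has_derivative_linear[OF *[OF that]]])
    ultimately show ?thesis by (subst Ck_on_cong[OF assms(2) eq])
  qed
  show "Ck_on k f S"
    using assms(1)
  proof (induction k arbitrary: f)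
    case 0
    then show ?case by (simp add: differentiable_imp_continuous_on)
  next
    case (Suc k)
    then show ?case by (metis Ck_on.simps(2))
  qed
qed

lemma Ck_on_C1:
  assumes "Ck_on (Suc k) f S" "open S"
  shows "C1_on f S"
proof (rule C1_onI[OF Ck_on_SucD(1)[OF assms]])
  fix v
  have "Ck_on k h S \<Longrightarrow> continuous_on S h" for k and h :: "'a \<Rightarrow> 'b"
    by (cases k) (auto simp: differentiable_imp_continuous_on)
  then show "continuous_on S (\<lambda>x. fd f x v)"
    using Ck_on_SucD(2)[OF assms] by blast
qed

lemma Ck2_on_fd_C1:
  assumes "Ck_on (Suc (Suc k)) f S" "open S"
  shows "C1_on (\<lambda>x. fd f x v) S"
  by (rule Ck_on_C1[OF Ck_on_SucD(2)[OF assms] assms(2)])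

text \<open>Schwarz: the second difference of f over a small parallelogram is symmetric in u and v.
  Two applications of the mean value theorem turn it into h^2 times a mixed derivative at a nearby
  point, in either order, and continuity at x closes the gap as h tends to 0.\<close>

lemma second_derivative_symmetric:
  fixes f :: "'a::euclidean_space \<Rightarrow> real"
  assumes S: "open S" "x \<in> S" and f: "C1_on f S" and f2: "\<And>v. C1_on (\<lambda>x. fd f x v) S"
  shows "fd (\<lambda>y. fd f y u) x v = fd (\<lambda>y. fd f y v) x u"
proof -
  obtain r where r: "r > 0" "ball x r \<subseteq> S" using S openE by blast
  \<comment> \<open>Every point of the parallelogram with sides h u and h v lies within h c of x;
    the summand 1 keeps c positive for u = v = 0.\<close>
  define c where "c = norm u + norm v + 1"
  have c: "c > 0" by (simp add: c_def add_nonneg_pos)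
  have mvt: "\<exists>\<xi>. dist \<xi> x \<le> h * c \<and>
      f (x + h *\<^sub>R u + h *\<^sub>R v) - f (x + h *\<^sub>R u) - (f (x + h *\<^sub>R v) - f x) = h * h * fd (\<lambda>y. fd f y u) \<xi> v"
    if h: "h > 0" "h * c < r" and uv: "norm u + norm v + 1 = c" for h u v
  proof -
    have inS: "x + s *\<^sub>R u + t *\<^sub>R v \<in> S \<and> dist (x + s *\<^sub>R u + t *\<^sub>R v) x \<le> h * c"
      if "0 \<le> s" "s \<le> h" "0 \<le> t" "t \<le> h" for s t
    proof -
      have "norm (s *\<^sub>R u + t *\<^sub>R v) \<le> s * norm u + t * norm v"
        using norm_triangle_ineq[of "s *\<^sub>R u" "t *\<^sub>R v"] that by simp
      also have "\<dots> \<le> h * norm u + h * norm v"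
        using that by (intro add_mono mult_right_mono) auto
      also have "\<dots> \<le> h * c" using uv h by (simp add: algebra_simps flip: uv)
      finally have "dist (x + s *\<^sub>R u + t *\<^sub>R v) x \<le> h * c" by (simp add: dist_norm add.assoc)
      moreover from this have "x + s *\<^sub>R u + t *\<^sub>R v \<in> ball x r" using h by (simp add: dist_commute)
      ultimately show ?thesis using r by auto
    qed
    have line: "((\<lambda>s. k (y + s *\<^sub>R w)) has_real_derivative fd k (y + s *\<^sub>R w) w) (at s)"
      if "C1_on k S" "y + s *\<^sub>R w \<in> S" for k y s w
    proof -
      have "((\<lambda>s. y + s *\<^sub>R w) has_derivative (\<lambda>h. h *\<^sub>R w)) (at s)"
        by (auto intro!: derivative_eq_intros)
      from has_derivative_compose[OF this C1_onD[OF that]]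
      have "((\<lambda>s. k (y + s *\<^sub>R w)) has_derivative (\<lambda>h. fd k (y + s *\<^sub>R w) (h *\<^sub>R w))) (at s)" .
      moreover have "fd k (y + s *\<^sub>R w) (h *\<^sub>R w) = fd k (y + s *\<^sub>R w) w * h" for h
        using linear_cmul[OF C1_on_linear[OF that]] by simp
      ultimately show ?thesis by (simp add: has_field_derivative_def)
    qed
    let ?g = "\<lambda>s. f (x + h *\<^sub>R v + s *\<^sub>R u) - f (x + s *\<^sub>R u)"
    let ?g' = "\<lambda>s. fd f (x + h *\<^sub>R v + s *\<^sub>R u) u - fd f (x + s *\<^sub>R u) u"
    have "\<exists>s>0. s < h \<and> ?g h - ?g 0 = (h - 0) * ?g' s"
    proof (rule MVT2)
      fix s assume "0 \<le> s" "s \<le> h"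
      then show "(?g has_real_derivative ?g' s) (at s)"
        using inS[of s h] inS[of s 0] h
        by (intro DERIV_diff line f) (auto simp: algebra_simps)
    qed (use h in auto)
    then obtain s where s: "s > 0" "s < h" "?g h - ?g 0 = h * ?g' s" by auto
    let ?k = "\<lambda>t. fd f (x + s *\<^sub>R u + t *\<^sub>R v) u"
    have "\<exists>t>0. t < h \<and> ?k h - ?k 0 = (h - 0) * fd (\<lambda>y. fd f y u) (x + s *\<^sub>R u + t *\<^sub>R v) v"
      by (rule MVT2) (use h s inS[of s] in \<open>auto intro!: line f2\<close>)
    then obtain t where t: "t > 0" "t < h" "?k h - ?k 0 = h * fd (\<lambda>y. fd f y u) (x + s *\<^sub>R u + t *\<^sub>R v) v"
      by auto
    have "?g h - ?g 0 = h * (?k h - ?k 0)"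
      using s(3) by (simp add: algebra_simps)
    then have "?g h - ?g 0 = h * h * fd (\<lambda>y. fd f y u) (x + s *\<^sub>R u + t *\<^sub>R v) v"
      by (simp only: t(3) mult.assoc)
    then show ?thesis
      using inS[of s t] s t by (intro exI[of _ "x + s *\<^sub>R u + t *\<^sub>R v"]) (auto simp: algebra_simps)
  qed
  \<comment> \<open>A null sequence with h c < r, so that all parallelograms stay in the
    ball.\<close>
  define h where "h n = r / (c * (real n + 2))" for n
  have hpos: "h n > 0" "h n * c < r" for n
  proof -
    show "h n > 0" using r c by (simp add: h_def)
    have "r < r * (real n + 2)" using mult_strict_left_mono[of 1 "real n + 2" r] r by simp
    then show "h n * c < r" using r c by (simp add: h_def divide_less_eq)
  qed
  have "\<exists>\<xi> \<eta>. dist \<xi> x \<le> h n * c \<and> dist \<eta> x \<le> h n * c \<and>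
      fd (\<lambda>y. fd f y u) \<xi> v = fd (\<lambda>y. fd f y v) \<eta> u" for n
  proof -
    obtain \<xi> where \<xi>: "dist \<xi> x \<le> h n * c"
      "f (x + h n *\<^sub>R u + h n *\<^sub>R v) - f (x + h n *\<^sub>R u) - (f (x + h n *\<^sub>R v) - f x)
        = h n * h n * fd (\<lambda>y. fd f y u) \<xi> v"
      using mvt[OF hpos, of u v n] by (auto simp: c_def)
    obtain \<eta> where \<eta>: "dist \<eta> x \<le> h n * c"
      "f (x + h n *\<^sub>R v + h n *\<^sub>R u) - f (x + h n *\<^sub>R v) - (f (x + h n *\<^sub>R u) - f x)
        = h n * h n * fd (\<lambda>y. fd f y v) \<eta> u"
      using mvt[OF hpos, of v u n] by (auto simp: c_def)
    have "h n * h n * fd (\<lambda>y. fd f y u) \<xi> v = h n * h n * fd (\<lambda>y. fd f y v) \<eta> u"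
      using \<xi>(2) \<eta>(2) by (simp add: algebra_simps)
    then show ?thesis
      using \<xi>(1) \<eta>(1) hpos(1)[of n] by (metis mult_eq_0_iff mult_left_cancel less_irrefl)
  qed
  then obtain \<xi> \<eta> where \<xi>: "\<And>n. dist (\<xi> n) x \<le> h n * c" "\<And>n. dist (\<eta> n) x \<le> h n * c"
      "\<And>n. fd (\<lambda>y. fd f y u) (\<xi> n) v = fd (\<lambda>y. fd f y v) (\<eta> n) u"
    by metis
  have "(\<lambda>n. r * inverse (real (Suc n))) \<longlonglongrightarrow> r * 0"
    by (intro tendsto_mult LIMSEQ_inverse_real_of_nat tendsto_const)
  moreover have "h n * c \<le> r * inverse (real (Suc n))" for n
  proof -
    have "h n * c = r / (real n + 2)" using c by (simp add: h_def)
    also have "\<dots> \<le> r / (real n + 1)" using r by (intro divide_left_mono) auto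
    finally show ?thesis by (simp add: divide_inverse add.commute)
  qed
  ultimately have lim: "y \<longlonglongrightarrow> x" if "\<And>n. dist (y n) x \<le> h n * c" for y
  proof -
    have "(\<lambda>n. dist (y n) x) \<longlonglongrightarrow> 0"
    proof (rule tendsto_sandwich[of "\<lambda>_. 0" _ _ "\<lambda>n. r * inverse (real (Suc n))"])
      show "\<forall>\<^sub>F n in sequentially. dist (y n) x \<le> r * inverse (real (Suc n))"
        using that \<open>\<And>n. h n * c \<le> r * inverse (real (Suc n))\<close> by (auto intro: always_eventually order_trans)
    qed (use \<open>(\<lambda>n. r * inverse (real (Suc n))) \<longlonglongrightarrow> r * 0\<close> in auto)
    then show ?thesis using tendsto_dist_iff by blast
  qed
  have cont: "isCont (\<lambda>y. fd (\<lambda>y. fd f y a) y b) x" for a b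
    using f2[of a] S continuous_on_eq_continuous_at unfolding C1_on_def by blast
  have "(\<lambda>n. fd (\<lambda>y. fd f y u) (\<xi> n) v) \<longlonglongrightarrow> fd (\<lambda>y. fd f y u) x v"
    using isCont_tendsto_compose[OF cont lim[OF \<xi>(1)]] by simp
  moreover have "(\<lambda>n. fd (\<lambda>y. fd f y v) (\<eta> n) u) \<longlonglongrightarrow> fd (\<lambda>y. fd f y v) x u"
    using isCont_tendsto_compose[OF cont lim[OF \<xi>(2)]] by simp
  ultimately show ?thesis
    using \<xi>(3) LIMSEQ_unique by simp
qed

section \<open>Uniform estimates along compact arcs and the variation of an integral curve\<close>

lemma C1_on_uniform_bound:
  fixes f :: "'a::euclidean_space \<Rightarrow> 'b::real_normed_vector"
  assumes f: "C1_on f S" and "compact C" "C \<subseteq> S"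
  obtains B where "B > 0" "\<And>x v. x \<in> C \<Longrightarrow> norm (fd f x v) \<le> B * norm v"
proof -
  have "\<exists>B. \<forall>x\<in>C. norm (fd f x b) \<le> B" for b
  proof -
    have "compact ((\<lambda>x. fd f x b) ` C)"
      by (intro compact_continuous_image continuous_on_subset[OF C1_on_fd_continuous[OF f]] assms)
    then obtain B where "\<forall>y\<in>(\<lambda>x. fd f x b) ` C. norm y \<le> B"
      using compact_imp_bounded bounded_iff by blast
    then show ?thesis by auto
  qed
  then obtain B where B: "\<And>b x. x \<in> C \<Longrightarrow> norm (fd f x b) \<le> B b" by metis
  define M where "M = (\<Sum>b\<in>Basis. \<bar>B b\<bar>) + 1"
  have "norm (fd f x v) \<le> M * norm v" if x: "x \<in> C" for x v
  proof -
    have "fd f x v = (\<Sum>b\<in>Basis. (v \<bullet> b) *\<^sub>R fd f x b)"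
      using x assms(3) by (intro linear_euclid_sum C1_on_linear[OF f]) auto
    also have "norm \<dots> \<le> (\<Sum>b\<in>Basis. norm v * \<bar>B b\<bar>)"
    proof (rule sum_norm_le)
      fix b :: 'a assume "b \<in> Basis"
      then have "\<bar>v \<bullet> b\<bar> * norm (fd f x b) \<le> norm v * \<bar>B b\<bar>"
        using B[OF x, of b] by (intro mult_mono Basis_le_norm) auto
      then show "norm ((v \<bullet> b) *\<^sub>R fd f x b) \<le> norm v * \<bar>B b\<bar>" by simp
    qed
    also have "\<dots> \<le> M * norm v"
      by (simp add: M_def sum_distrib_left[symmetric] algebra_simps)
    finally show ?thesis .
  qed
  moreover have "M > 0" by (simp add: M_def sum_nonneg add_nonneg_pos)
  ultimately show ?thesis using that by blast
qed

lemma compact_perturbation: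
  fixes x u :: "real \<Rightarrow> 'a::euclidean_space"
  assumes "open S" "compact K" "continuous_on K x" "continuous_on K u" "x ` K \<subseteq> S"
  obtains d where "d > 0" "\<And>t s. t \<in> K \<Longrightarrow> \<bar>s\<bar> \<le> d \<Longrightarrow> x t + s *\<^sub>R u t \<in> S"
proof -
  have "compact (x ` K)" "compact (u ` K)"
    using assms by (auto intro: compact_continuous_image)
  then obtain e where e: "e > 0" "(\<Union>p\<in>x ` K. ball p e) \<subseteq> S"
    using compact_subset_open_imp_ball_epsilon_subset[of "x ` K" S] assms by metis
  obtain B where B: "B > 0" "\<And>t. t \<in> K \<Longrightarrow> norm (u t) \<le> B"
    using compact_imp_bounded[OF \<open>compact (u ` K)\<close>] bounded_pos[of "u ` K"] by auto
  have "x t + s *\<^sub>R u t \<in> S" if "t \<in> K" "\<bar>s\<bar> \<le> e / (2 * B)" for t s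
  proof -
    have "\<bar>s\<bar> * norm (u t) \<le> e / (2 * B) * B"
      using that B e by (intro mult_mono) auto
    also have "\<dots> < e" using B e by simp
    finally have "x t + s *\<^sub>R u t \<in> ball (x t) e" by (simp add: dist_norm)
    then show ?thesis using e that by blast
  qed
  then show ?thesis using that[of "e / (2 * B)"] e B by auto
qed

text \<open>The function r |-> h(x + r u) - r Dh(x) u has derivative Dh(x + r u) u - Dh(x) u.
  Uniform continuity of Dh(x + r u) u on the compact set of all t in K and r in [0, d0] makes this
  small uniformly in t, and the mean value inequality does the rest.\<close>

lemma C1_on_uniform_differentiable:
  fixes h :: "'a::euclidean_space \<Rightarrow> 'b::real_normed_vector" and x u :: "real \<Rightarrow> 'a"
  assumes h: "C1_on h S" and S: "open S" and K: "compact K"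
    and x: "continuous_on K x" "x ` K \<subseteq> S" and u: "continuous_on K u" and e: "e > 0"
  shows "\<exists>d>0. \<forall>s t. 0 < s \<longrightarrow> s < d \<longrightarrow> t \<in> K \<longrightarrow>
    norm (h (x t + s *\<^sub>R u t) - h (x t) - s *\<^sub>R fd h (x t) (u t)) \<le> e * s"
proof -
  obtain d0 where d0: "d0 > 0" "\<And>t s. t \<in> K \<Longrightarrow> \<bar>s\<bar> \<le> d0 \<Longrightarrow> x t + s *\<^sub>R u t \<in> S"
    using compact_perturbation[OF S K x(1) u x(2)] by blast
  let ?P = "\<lambda>p. fd h (x (fst p) + snd p *\<^sub>R u (fst p)) (u (fst p))"
  have "uniformly_continuous_on (K \<times> {0..d0}) ?P"
  proof (rule compact_uniformly_continuous)
    have xu: "continuous_on (K \<times> {0..d0}) (\<lambda>p. x (fst p))" "continuous_on (K \<times> {0..d0}) (\<lambda>p. u (fst p))"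
      by (rule continuous_on_compose2[OF x(1)] continuous_on_compose2[OF u];
          force intro: continuous_intros)+
    show "continuous_on (K \<times> {0..d0}) ?P"
      by (rule C1_on_continuous_compose[OF h]) (use xu d0 in \<open>auto intro!: continuous_intros\<close>)
  qed (use K in \<open>auto intro: compact_Times\<close>)
  then obtain d1 where d1: "d1 > 0" "\<And>p q. p \<in> K \<times> {0..d0} \<Longrightarrow> q \<in> K \<times> {0..d0} \<Longrightarrow> dist q p < d1 \<Longrightarrow> dist (?P q) (?P p) < e"
    unfolding uniformly_continuous_on_def using e by metis
  define d where "d = min d0 d1"
  have "norm (h (x t + s *\<^sub>R u t) - h (x t) - s *\<^sub>R fd h (x t) (u t)) \<le> e * s"
    if s: "0 < s" "s < d" and t: "t \<in> K" for s t
  proof -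
    let ?k = "\<lambda>r. h (x t + r *\<^sub>R u t) - r *\<^sub>R fd h (x t) (u t)"
    have "norm (?k s - ?k 0) \<le> e * norm (s - 0)"
    proof (rule differentiable_bound[of "{0..s}" ?k "\<lambda>r v. v *\<^sub>R (?P (t, r) - ?P (t, 0))"])
      fix r assume r: "r \<in> {0..s}"
      then have inS: "x t + r *\<^sub>R u t \<in> S" using d0 s t by (auto simp: d_def)
      have "((\<lambda>r. x t + r *\<^sub>R u t) has_derivative (\<lambda>v. v *\<^sub>R u t)) (at r)"
        by (auto intro!: derivative_eq_intros)
      from has_derivative_compose[OF this C1_onD[OF h inS]]
      have "((\<lambda>r. h (x t + r *\<^sub>R u t)) has_derivative (\<lambda>v. v *\<^sub>R ?P (t, r))) (at r)"
        by (simp add: linear_cmul[OF C1_on_linear[OF h inS]])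
      then have "(?k has_derivative (\<lambda>v. v *\<^sub>R ?P (t, r) - v *\<^sub>R fd h (x t) (u t))) (at r)"
        by (intro has_derivative_diff) (auto intro!: derivative_eq_intros)
      then show "(?k has_derivative (\<lambda>v. v *\<^sub>R (?P (t, r) - ?P (t, 0)))) (at r within {0..s})"
        by (auto simp: scaleR_diff_right intro: has_derivative_at_withinI)
      have "dist (?P (t, r)) (?P (t, 0)) < e"
        using r s t by (intro d1(2)) (auto simp: d_def dist_prod_def dist_real_def)
      then show "onorm (\<lambda>v. v *\<^sub>R (?P (t, r) - ?P (t, 0))) \<le> e"
        by (intro onorm_bound) (use e in \<open>auto simp: dist_norm mult.commute[of e] intro!: mult_left_mono\<close>)
    qed (use s in auto)
    then show ?thesis using s by (simp add: algebra_simps)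
  qed
  moreover have "d > 0" using d0 d1 by (simp add: d_def)
  ultimately show ?thesis by blast
qed

text \<open>Formally this is the product rule, but F need not have a second derivative. Instead the
  difference quotients \<open>f n\<close> of F between \<gamma> and the perturbed curve
  \<open>y n\<close> converge to \<open>fd F (\<gamma> t) (u t)\<close>, and their derivatives
  converge uniformly, so that the limit may be differentiated.\<close>

lemma C1_flow_variation:
  fixes F q :: "'a::euclidean_space \<Rightarrow> 'a" and \<gamma> u :: "real \<Rightarrow> 'a"
  assumes S: "open S" and F: "C1_on F S" and q: "C1_on q S"
    and Fq: "\<And>x. x \<in> S \<Longrightarrow> fd F x (F x) = q x"
    and K: "compact K" "convex K"
    and \<gamma>: "\<And>t. t \<in> K \<Longrightarrow> \<gamma> t \<in> S"
      "\<And>t. t \<in> K \<Longrightarrow> (\<gamma> has_vector_derivative F (\<gamma> t)) (at t within K)"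
    and u: "\<And>t. t \<in> K \<Longrightarrow> (u has_vector_derivative fd F (\<gamma> t) (u t)) (at t within K)"
    and t: "t \<in> K"
  shows "((\<lambda>t. fd F (\<gamma> t) (u t)) has_vector_derivative fd q (\<gamma> t) (u t)) (at t within K)"
proof -
  have cont: "continuous_on K \<gamma>" "continuous_on K u"
    using \<gamma>(2) u by (auto simp: continuous_on_eq_continuous_within intro: has_vector_derivative_continuous)
  have img: "\<gamma> ` K \<subseteq> S" using \<gamma>(1) by auto
  obtain d where d: "d > 0" "\<And>t s. t \<in> K \<Longrightarrow> \<bar>s\<bar> \<le> d \<Longrightarrow> \<gamma> t + s *\<^sub>R u t \<in> S"
    using compact_perturbation[OF S K(1) cont img] by blast
  \<comment> \<open>The compact set swept out by the perturbed curves; it supplies one bound B for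
    the derivative of F on all of them.\<close>
  let ?C = "(\<lambda>p. \<gamma> (fst p) + snd p *\<^sub>R u (fst p)) ` (K \<times> {0..d})"
  have xu: "continuous_on (K \<times> {0..d}) (\<lambda>p. \<gamma> (fst p))" "continuous_on (K \<times> {0..d}) (\<lambda>p. u (fst p))"
    by (rule continuous_on_compose2[OF cont(1)] continuous_on_compose2[OF cont(2)];
        force intro: continuous_intros)+
  have "compact ?C"
    by (intro compact_continuous_image compact_Times K continuous_intros xu) auto
  then obtain B where B: "B > 0" "\<And>x v. x \<in> ?C \<Longrightarrow> norm (fd F x v) \<le> B * norm v"
  proof (rule C1_on_uniform_bound[OF F])
    show "?C \<subseteq> S" using d by auto
  qed (use that in blast)
  define \<epsilon> where "\<epsilon> n = d * inverse (real (Suc n))" for n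
  have \<epsilon>: "\<epsilon> n > 0" "\<epsilon> n \<le> d" for n
    using d by (auto simp: \<epsilon>_def field_simps)
  have \<epsilon>0: "\<epsilon> \<longlonglongrightarrow> 0"
    using tendsto_mult_right_zero[OF LIMSEQ_inverse_real_of_nat, of d] unfolding \<epsilon>_def .
  define y where "y n t = \<gamma> t + \<epsilon> n *\<^sub>R u t" for n t
  have yS: "y n t \<in> S" "y n t \<in> ?C" if "t \<in> K" for n t
  proof -
    have "\<bar>\<epsilon> n\<bar> \<le> d" using \<epsilon>[of n] by simp
    then show "y n t \<in> S" using that d(2) by (simp add: y_def)
    show "y n t \<in> ?C"
      using that \<epsilon>[of n] unfolding y_def by (intro image_eqI[of _ _ "(t, \<epsilon> n)"]) auto
  qed
  define f where "f n t = (1 / \<epsilon> n) *\<^sub>R (F (y n t) - F (\<gamma> t))" for n t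
  \<comment> \<open>The defect of \<open>y n\<close> as an integral curve: its derivative is
    \<open>F (y n t) + r n t\<close>, and \<open>r n\<close> is o(\<epsilon> n) uniformly on K. On
    the main part \<open>F (y n t)\<close> the derivative of F is known to be q.\<close>
  define r where "r n t = F (\<gamma> t) + \<epsilon> n *\<^sub>R fd F (\<gamma> t) (u t) - F (y n t)" for n t
  define f' where "f' n t h = h *\<^sub>R ((1 / \<epsilon> n) *\<^sub>R (q (y n t) + fd F (y n t) (r n t) - q (\<gamma> t)))" for n t h
  have lin: "linear (fd F x)" if "x \<in> S" for x using C1_on_linear[OF F that] .
  have df: "(f n has_derivative f' n t) (at t within K)" if "t \<in> K" for n t
  proof -
    have "(y n has_vector_derivative F (\<gamma> t) + \<epsilon> n *\<^sub>R fd F (\<gamma> t) (u t)) (at t within K)"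
      unfolding y_def using \<gamma>(2)[OF that] u[OF that] by (auto intro!: derivative_eq_intros)
    then have "((\<lambda>t. F (y n t)) has_derivative (\<lambda>h. fd F (y n t) (h *\<^sub>R (F (\<gamma> t) + \<epsilon> n *\<^sub>R fd F (\<gamma> t) (u t))))) (at t within K)"
      unfolding has_vector_derivative_def
      using has_derivative_compose[of "y n" _ t K F "fd F (y n t)"] C1_onD[OF F yS(1)[OF that, of n]] by blast
    moreover have "F (\<gamma> t) + \<epsilon> n *\<^sub>R fd F (\<gamma> t) (u t) = F (y n t) + r n t" by (simp add: r_def)
    ultimately have 1: "((\<lambda>t. F (y n t)) has_derivative (\<lambda>h. h *\<^sub>R (q (y n t) + fd F (y n t) (r n t)))) (at t within K)"
      by (simp only: linear_cmul[OF lin[OF yS(1)[OF that]]] linear_add[OF lin[OF yS(1)[OF that]]] Fq[OF yS(1)[OF that]])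
    have 2: "((\<lambda>t. F (\<gamma> t)) has_derivative (\<lambda>h. h *\<^sub>R q (\<gamma> t))) (at t within K)"
      using has_derivative_compose[OF \<gamma>(2)[OF that, unfolded has_vector_derivative_def] C1_onD[OF F \<gamma>(1)[OF that]]]
      by (simp add: linear_cmul[OF lin[OF \<gamma>(1)[OF that]]] Fq[OF \<gamma>(1)[OF that]])
    have "f' n t = (\<lambda>h. (1 / \<epsilon> n) *\<^sub>R (h *\<^sub>R (q (y n t) + fd F (y n t) (r n t)) - h *\<^sub>R q (\<gamma> t)))"
      by (auto simp: f'_def scaleR_diff_right mult.commute)
    then show ?thesis
      unfolding f_def using bounded_linear.has_derivative[OF bounded_linear_scaleR_right has_derivative_diff[OF 1 2]]
      by simp
  qed
  define g' where "g' t h = h *\<^sub>R fd q (\<gamma> t) (u t)" for t h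
  \<comment> \<open>The first-order estimate, uniform on K; it is applied to q for the main part and
    to F for the defect.\<close>
  have small: "\<forall>\<^sub>F n in sequentially. \<forall>t\<in>K. norm (h (y n t) - h (\<gamma> t) - \<epsilon> n *\<^sub>R fd h (\<gamma> t) (u t)) \<le> e * \<epsilon> n"
    if h: "C1_on h S" and e: "e > 0" for h :: "'a \<Rightarrow> 'a" and e
  proof -
    obtain d' where d': "d' > 0" "\<And>s t. 0 < s \<Longrightarrow> s < d' \<Longrightarrow> t \<in> K \<Longrightarrow>
        norm (h (\<gamma> t + s *\<^sub>R u t) - h (\<gamma> t) - s *\<^sub>R fd h (\<gamma> t) (u t)) \<le> e * s"
      using C1_on_uniform_differentiable[OF h S K(1) cont(1) img cont(2) e] by blast
    have "\<forall>\<^sub>F n in sequentially. \<epsilon> n < d'"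
      using order_tendstoD(2)[OF \<epsilon>0 d'(1)] .
    then show ?thesis
      by eventually_elim (use d' \<epsilon> in \<open>auto simp: y_def\<close>)
  qed
  have unif: "\<forall>\<^sub>F n in sequentially. \<forall>t\<in>K. \<forall>h. norm (f' n t h - g' t h) \<le> e * norm h" if "e > 0" for e
  proof -
    have e2: "e / 2 > 0" "e / (2 * B) > 0" using that B by auto
    show ?thesis
      using small[OF q e2(1)] small[OF F e2(2)]
    proof eventually_elim
      case (elim n)
      show ?case
      proof (intro ballI allI)
        fix t h assume t: "t \<in> K"
        let ?a = "q (y n t) - q (\<gamma> t) - \<epsilon> n *\<^sub>R fd q (\<gamma> t) (u t)"
        have eq: "f' n t h - g' t h = (h / \<epsilon> n) *\<^sub>R (?a + fd F (y n t) (r n t))"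
          using \<epsilon>[of n] by (simp add: f'_def g'_def scaleR_diff_right scaleR_add_right)
        have "norm (r n t) \<le> e / (2 * B) * \<epsilon> n"
          using elim(2) t unfolding r_def by (metis (no_types, lifting) norm_minus_commute diff_diff_eq)
        then have "norm (fd F (y n t) (r n t)) \<le> B * (e / (2 * B) * \<epsilon> n)"
          using B(2)[OF yS(2)[OF t]] B(1) by (meson mult_left_mono order_trans less_imp_le)
        also have "\<dots> = e / 2 * \<epsilon> n" using B by simp
        finally have "norm (?a + fd F (y n t) (r n t)) \<le> e / 2 * \<epsilon> n + e / 2 * \<epsilon> n"
          using elim(1) t by (intro norm_triangle_le add_mono) auto
        then have "\<bar>h\<bar> / \<epsilon> n * norm (?a + fd F (y n t) (r n t)) \<le> \<bar>h\<bar> / \<epsilon> n * (e * \<epsilon> n)"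
          using \<epsilon>[of n] by (intro mult_left_mono) auto
        then show "norm (f' n t h - g' t h) \<le> e * norm h"
          unfolding eq using \<epsilon>[of n] by (simp add: mult.commute)
      qed
    qed
  qed
  have lim: "(\<lambda>n. f n t) \<longlonglongrightarrow> fd F (\<gamma> t) (u t)" if "t \<in> K" for t
  proof (rule metric_LIMSEQ_I)
    fix e :: real assume "e > 0"
    then have "e / 2 > 0" by simp
    from small[OF F this] have "\<forall>\<^sub>F n in sequentially. dist (f n t) (fd F (\<gamma> t) (u t)) < e"
    proof eventually_elim
      case (elim n)
      have "f n t - fd F (\<gamma> t) (u t) = (1 / \<epsilon> n) *\<^sub>R (F (y n t) - F (\<gamma> t) - \<epsilon> n *\<^sub>R fd F (\<gamma> t) (u t))"
        using \<epsilon>[of n] by (simp add: f_def scaleR_diff_right)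
      then have "dist (f n t) (fd F (\<gamma> t) (u t)) \<le> (1 / \<epsilon> n) * (e / 2 * \<epsilon> n)"
        using elim that \<epsilon>[of n] unfolding dist_norm by (auto simp: divide_le_eq)
      also have "\<dots> < e" using \<epsilon>[of n] \<open>e > 0\<close> by simp
      finally show ?case .
    qed
    then show "\<exists>N. \<forall>n\<ge>N. dist (f n t) (fd F (\<gamma> t) (u t)) < e"
      by (simp add: eventually_sequentially)
  qed
  obtain g where g: "\<And>t. t \<in> K \<Longrightarrow> (\<lambda>n. f n t) \<longlonglongrightarrow> g t" "\<And>t. t \<in> K \<Longrightarrow> (g has_derivative g' t) (at t within K)"
    using has_derivative_sequence[OF K(2) df unif t lim[OF t]] by blast
  have "g s = fd F (\<gamma> s) (u s)" if "s \<in> K" for s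
    using LIMSEQ_unique[OF g(1)[OF that] lim[OF that]] .
  then have "((\<lambda>t. fd F (\<gamma> t) (u t)) has_derivative g' t) (at t within K)"
    by (intro has_derivative_transform[OF t _ g(2)[OF t]]) simp
  then show ?thesis unfolding g'_def has_vector_derivative_def .
qed

section \<open>Ordinary differential equations\<close>

text \<open>Both Q and its negation are relatively open in the connected set I. Continuation
  arguments below, for differential equations as well as for geodesics, take this form.\<close>

lemma local_constancy:
  fixes I :: "real set"
  assumes "is_interval I" "s \<in> I" "Q s" "t \<in> I"
    and loc: "\<And>t. t \<in> I \<Longrightarrow> \<exists>d>0. (\<exists>r\<in>I \<inter> ball t d. Q r) \<longrightarrow> (\<forall>r\<in>I \<inter> ball t d. Q r)"
  shows "Q t"
proof -
  obtain d where d: "\<And>t. t \<in> I \<Longrightarrow> d t > 0"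
    "\<And>t. t \<in> I \<Longrightarrow> (\<exists>r\<in>I \<inter> ball t (d t). Q r) \<longrightarrow> (\<forall>r\<in>I \<inter> ball t (d t). Q r)"
    using loc by metis
  define A where "A = (\<Union>t\<in>{t\<in>I. Q t}. ball t (d t))"
  define B where "B = (\<Union>t\<in>{t\<in>I. \<not> Q t}. ball t (d t))"
  have "connected I" using assms(1) is_interval_connected by blast
  moreover have "open A" "open B" by (auto simp: A_def B_def)
  moreover have "I \<subseteq> A \<union> B" using d(1) by (fastforce simp: A_def B_def)
  moreover have qa: "Q r" if r: "r \<in> A" "r \<in> I" for r
  proof -
    obtain t where "t \<in> I" "Q t" "r \<in> ball t (d t)" using r unfolding A_def by blast
    moreover have "t \<in> I \<inter> ball t (d t)" using d(1) \<open>t \<in> I\<close> by simp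
    ultimately show ?thesis using d(2)[of t] that(2) by blast
  qed
  moreover have qb: "\<not> Q r" if r: "r \<in> B" "r \<in> I" for r
  proof -
    obtain t where "t \<in> I" "\<not> Q t" "r \<in> ball t (d t)" using r unfolding B_def by blast
    moreover have "t \<in> I \<inter> ball t (d t)" using d(1) \<open>t \<in> I\<close> by simp
    ultimately show ?thesis using d(2)[of t] that(2) by blast
  qed
  moreover have "A \<inter> B \<inter> I = {}" using qa qb by blast
  moreover have "A \<inter> I \<noteq> {}" using assms d(1) by (force simp: A_def)
  ultimately have "B \<inter> I = {}" unfolding connected_def by blast
  then show ?thesis using \<open>I \<subseteq> A \<union> B\<close> qa assms by blast
qed

lemma is_interval_Int_ball: "is_interval I \<Longrightarrow> is_interval (I \<inter> ball (t::real) d)"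
  by (simp add: is_interval_Int is_interval_ball_real)

text \<open>On a segment for which |K| times the length is at most 1/2, the maximum m of |f| obeys m
  \<le> m/2 once f vanishes at one end; hence vanishing is a locally constant property.\<close>

lemma gronwall_zero:
  fixes f :: "real \<Rightarrow> 'a::real_normed_vector"
  assumes J: "is_interval J" and s: "s \<in> J" "f s = 0" and t: "t \<in> J"
    and f: "\<And>t. t \<in> J \<Longrightarrow> (f has_vector_derivative f' t) (at t within J)"
    and K: "\<And>t. t \<in> J \<Longrightarrow> norm (f' t) \<le> K * norm (f t)"
  shows "f t = 0"
proof (rule local_constancy[OF J s(1), where Q = "\<lambda>t. f t = 0"])
  fix t assume "t \<in> J"
  \<comment> \<open>Two points of the ball are at distance at most 2d, and |K| 2d \<le> 1/2.\<close>
  define d where "d = 1 / (4 * (\<bar>K\<bar> + 1))"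
  have dpos: "d > 0" by (simp add: d_def add_nonneg_pos)
  have "f b = 0" if a: "a \<in> J \<inter> ball t d" "f a = 0" and b: "b \<in> J \<inter> ball t d" for a b
  proof -
    let ?C = "closed_segment a b"
    have sub: "?C \<subseteq> J" using closed_segment_subset[of a J b] a b J by (simp add: is_interval_convex_1)
    have "continuous_on ?C f"
      using f sub by (meson continuous_on_eq_continuous_within continuous_on_subset has_vector_derivative_continuous)
    then have "\<exists>m\<in>?C. \<forall>x\<in>?C. norm (f x) \<le> norm (f m)"
      by (intro continuous_attains_sup continuous_on_norm) auto
    then obtain m where m: "m \<in> ?C" "\<And>x. x \<in> ?C \<Longrightarrow> norm (f x) \<le> norm (f m)" by auto
    have "norm (f m - f a) \<le> (\<bar>K\<bar> * norm (f m)) * norm (m - a)"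
    proof (rule differentiable_bound[of ?C f "\<lambda>x h. h *\<^sub>R f' x"])
      fix x assume x: "x \<in> ?C"
      show "(f has_derivative (\<lambda>h. h *\<^sub>R f' x)) (at x within ?C)"
        using f[of x] x sub has_derivative_subset[of f _ x J ?C] unfolding has_vector_derivative_def by blast
      have "norm (f' x) \<le> \<bar>K\<bar> * norm (f x)"
        using K[of x] x sub by (meson abs_ge_self mult_right_mono norm_ge_zero order_trans subsetD)
      also have "\<dots> \<le> \<bar>K\<bar> * norm (f m)" by (rule mult_left_mono[OF m(2)[OF x]]) auto
      finally have "norm (f' x) \<le> \<bar>K\<bar> * norm (f m)" .
      from mult_left_mono[OF this abs_ge_zero, of h for h]
      have "norm (h *\<^sub>R f' x) \<le> (\<bar>K\<bar> * norm (f m)) * norm h" for h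
        by (simp only: norm_scaleR real_norm_def mult.commute[of _ "\<bar>h\<bar>"])
      then show "onorm (\<lambda>h. h *\<^sub>R f' x) \<le> \<bar>K\<bar> * norm (f m)"
        by (intro onorm_bound) auto
    qed (use m in auto)
    also have "\<dots> \<le> (\<bar>K\<bar> * norm (f m)) * (2 * d)"
    proof (intro mult_left_mono)
      have "norm (m - a) \<le> norm (b - a)" using segment_bound(1)[OF m(1)] .
      also have "\<dots> \<le> 2 * d" using a b by (auto simp: dist_real_def)
      finally show "norm (m - a) \<le> 2 * d" .
    qed auto
    also have "\<dots> \<le> norm (f m) * (1 / 2)"
    proof -
      have "\<bar>K\<bar> * (2 * d) \<le> 1 / 2" by (simp add: d_def field_simps)
      from mult_left_mono[OF this, of "norm (f m)"] show ?thesis by (simp add: mult_ac)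
    qed
    finally have "norm (f m) \<le> 0" using a by simp
    then show ?thesis using m(2)[of b] by simp
  qed
  then show "\<exists>d>0. (\<exists>r\<in>J \<inter> ball t d. f r = 0) \<longrightarrow> (\<forall>r\<in>J \<inter> ball t d. f r = 0)"
    using dpos by blast
qed (rule s t)+

text \<open>Global solutions from local ones. \<open>P\<close> may be any condition that depends on
  the germ only, and \<open>X\<close> prescribes where the values lie: everything for a linear
  system, the tangent spaces along a curve for parallel transport, where no single chart need
  suffice. In \<open>ex\<close> the window around t is the same for all initial times and values,
  which is why continuation reaches all of I.\<close>

lemma patch_solutions:
  fixes I :: "real set" and P :: "(real \<Rightarrow> 'v) \<Rightarrow> real \<Rightarrow> bool"
  assumes I: "is_interval I" and t0: "t0 \<in> I" and v: "v \<in> X t0"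
    and germ: "\<And>V V' t d. t \<in> I \<Longrightarrow> d > 0 \<Longrightarrow> P V t \<Longrightarrow> (\<And>r. r \<in> I \<inter> ball t d \<Longrightarrow> V r = V' r) \<Longrightarrow> P V' t"
    and ex: "\<And>t. t \<in> I \<Longrightarrow> \<exists>d>0. \<forall>s\<in>I \<inter> ball t d. \<forall>v\<in>X s. \<exists>V. V s = v \<and>
       (\<forall>r\<in>I \<inter> ball t d. V r \<in> X r \<and> P V r)"
    and uniq: "\<And>t. t \<in> I \<Longrightarrow> \<exists>d>0. \<forall>J V V' s. is_interval J \<longrightarrow> J \<subseteq> I \<inter> ball t d \<longrightarrow> openin (top_of_set I) J \<longrightarrow>
       (\<forall>r\<in>J. V r \<in> X r \<and> P V r) \<longrightarrow> (\<forall>r\<in>J. V' r \<in> X r \<and> P V' r) \<longrightarrow>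
       s \<in> J \<longrightarrow> V s = V' s \<longrightarrow> (\<forall>r\<in>J. V r = V' r)"
  shows "\<exists>V. V t0 = v \<and> (\<forall>t\<in>I. V t \<in> X t \<and> P V t)"
proof -
  \<comment> \<open>Partial solutions live on relatively open intervals, so that at each point of
    the domain, an endpoint of I included, the germ is determined.\<close>
  define sol where "sol J V \<longleftrightarrow> is_interval J \<and> J \<subseteq> I \<and> openin (top_of_set I) J \<and> t0 \<in> J \<and> V t0 = v \<and>
    (\<forall>r\<in>J. V r \<in> X r \<and> P V r)" for J V
  have opn: "openin (top_of_set I) (I \<inter> ball t d)" for t d by (simp add: openin_open_Int)
  have agree: "V r = V' r" if "sol J V" "sol J' V'" "r \<in> J" "r \<in> J'" for J J' V V' r
  proof (rule local_constancy[where I = "J \<inter> J'" and s = t0 and Q = "\<lambda>r. V r = V' r"])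
    show ii: "is_interval (J \<inter> J')" using that by (auto simp: sol_def is_interval_Int)
    fix t assume t: "t \<in> J \<inter> J'"
    then have "t \<in> I" using that by (auto simp: sol_def)
    from uniq[OF this] obtain d where d: "d > 0" "\<forall>J V V' s. is_interval J \<longrightarrow> J \<subseteq> I \<inter> ball t d \<longrightarrow> openin (top_of_set I) J \<longrightarrow>
       (\<forall>r\<in>J. V r \<in> X r \<and> P V r) \<longrightarrow> (\<forall>r\<in>J. V' r \<in> X r \<and> P V' r) \<longrightarrow>
       s \<in> J \<longrightarrow> V s = V' s \<longrightarrow> (\<forall>r\<in>J. V r = V' r)" by (elim exE conjE)
    have o: "openin (top_of_set I) (J \<inter> J' \<inter> ball t d)"
    proof -
      have "J \<inter> J' \<inter> ball t d = (J \<inter> J') \<inter> (I \<inter> ball t d)" using that by (auto simp: sol_def)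
      then show ?thesis using that opn[of t d] by (auto simp: sol_def)
    qed
    have "\<forall>r\<in>J \<inter> J' \<inter> ball t d. V r = V' r" if "s \<in> J \<inter> J' \<inter> ball t d" "V s = V' s" for s
      by (intro ballI, rule d(2)[rule_format, where V = V and V' = V' and s = s, OF is_interval_Int_ball[OF ii, of t d] _ o _ _ that])
        (use \<open>sol J V\<close> \<open>sol J' V'\<close> in \<open>auto simp: sol_def\<close>)
    then show "\<exists>d>0. (\<exists>r\<in>J \<inter> J' \<inter> ball t d. V r = V' r) \<longrightarrow> (\<forall>r\<in>J \<inter> J' \<inter> ball t d. V r = V' r)"
      using d(1) by blast
  qed (use that in \<open>auto simp: sol_def\<close>)
  have reach: "\<exists>J V. sol J V \<and> t \<in> J" if "t \<in> I" for t
  proof (rule local_constancy[OF I t0, where Q = "\<lambda>t. \<exists>J V. sol J V \<and> t \<in> J"])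
    obtain d where d: "d > 0" "\<forall>s\<in>I \<inter> ball t0 d. \<forall>v\<in>X s. \<exists>V. V s = v \<and> (\<forall>r\<in>I \<inter> ball t0 d. V r \<in> X r \<and> P V r)"
      using ex[OF t0] by blast
    then obtain V where "V t0 = v" "\<forall>r\<in>I \<inter> ball t0 d. V r \<in> X r \<and> P V r"
      using t0 v by (metis Int_iff centre_in_ball)
    then have "sol (I \<inter> ball t0 d) V"
      using d(1) t0 is_interval_Int_ball[OF I] opn by (auto simp: sol_def)
    then show "\<exists>J V. sol J V \<and> t0 \<in> J" using t0 d(1) by auto
  next
    fix t assume t: "t \<in> I"
    obtain d1 where d1: "d1 > 0" "\<forall>s\<in>I \<inter> ball t d1. \<forall>v\<in>X s. \<exists>V. V s = v \<and>
        (\<forall>r\<in>I \<inter> ball t d1. V r \<in> X r \<and> P V r)"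
      using ex[OF t] by blast
    obtain d2 where d2: "d2 > 0" "\<forall>J V V' s. is_interval J \<longrightarrow> J \<subseteq> I \<inter> ball t d2 \<longrightarrow> openin (top_of_set I) J \<longrightarrow>
       (\<forall>r\<in>J. V r \<in> X r \<and> P V r) \<longrightarrow> (\<forall>r\<in>J. V' r \<in> X r \<and> P V' r) \<longrightarrow>
       s \<in> J \<longrightarrow> V s = V' s \<longrightarrow> (\<forall>r\<in>J. V r = V' r)" using uniq[OF t] by (elim exE conjE)
    define d where "d = min d1 d2"
    have "\<exists>J V. sol J V \<and> b \<in> J" if a: "a \<in> I \<inter> ball t d" "sol J V" "a \<in> J" and b: "b \<in> I \<inter> ball t d" for a b J V
    proof -
      let ?N = "I \<inter> ball t d"
      have "V a \<in> X a" using a by (auto simp: sol_def)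
      moreover have "a \<in> I \<inter> ball t d1" using a(1) by (auto simp: d_def)
      ultimately obtain V' where V': "V' a = V a" "\<forall>r\<in>I \<inter> ball t d1. V' r \<in> X r \<and> P V' r"
        using d1(2) by blast
      have JN: "openin (top_of_set I) (J \<inter> ?N)" using a opn[of t d] by (auto simp: sol_def)
      have eq: "\<forall>r\<in>J \<inter> ?N. V r = V' r"
        by (intro ballI, rule d2(2)[rule_format, where V = V and V' = V' and s = a, OF _ _ JN])
          (use a V' I in \<open>auto simp: sol_def d_def intro!: is_interval_Int is_interval_ball_real\<close>)
      \<comment> \<open>V' takes the value of V at a, so the two agree on the overlap and
        glue.\<close>
      define U where "U r = (if r \<in> J then V r else V' r)" for r
      have UV': "U r = V' r" if "r \<in> ?N" for r using eq that by (auto simp: U_def)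
      have oin: "\<exists>e>0. I \<inter> ball r e \<subseteq> M" if "openin (top_of_set I) M" "r \<in> M" for M r
        using that by (auto simp: openin_contains_ball Int_commute)
      have "U r \<in> X r \<and> P U r" if r: "r \<in> J \<union> ?N" for r
      proof (cases "r \<in> J")
        case True
        obtain e where e: "e > 0" "I \<inter> ball r e \<subseteq> J"
          using oin[of J r] a(2) True by (auto simp: sol_def)
        have "P U r"
          by (rule germ[OF _ e(1), of r V]) (use a(2) True e in \<open>auto simp: sol_def U_def\<close>)
        then show ?thesis using True a(2) by (auto simp: U_def sol_def)
      next
        case False
        then have rN: "r \<in> ?N" using r by auto
        obtain e where e: "e > 0" "I \<inter> ball r e \<subseteq> ?N"
          using oin[OF opn rN] by auto
        have "P U r"
          by (rule germ[OF _ e(1), of r V']) (use rN e UV' V' in \<open>auto simp: d_def subset_iff\<close>)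
        then show ?thesis using rN V'(2) UV'[OF rN] by (auto simp: d_def)
      qed
      moreover have "is_interval (J \<union> ?N)"
      proof -
        have "connected (J \<union> ?N)"
          by (rule connected_Un) (use a is_interval_Int_ball[OF I] in \<open>auto simp: sol_def is_interval_connected_1\<close>)
        then show ?thesis by (simp add: is_interval_connected_1)
      qed
      moreover have "openin (top_of_set I) (J \<union> ?N)" using a(2) opn[of t d] by (auto simp: sol_def)
      ultimately have "sol (J \<union> ?N) U" using a(2) by (auto simp: sol_def U_def)
      then show ?thesis using b by blast
    qed
    then show "\<exists>d>0. (\<exists>r\<in>I \<inter> ball t d. \<exists>J V. sol J V \<and> r \<in> J) \<longrightarrow> (\<forall>r\<in>I \<inter> ball t d. \<exists>J V. sol J V \<and> r \<in> J)"
      using d1(1) d2(1) by (intro exI[of _ d]) (auto simp: d_def)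
  qed (use that in auto)
  then obtain JJ VV where JV: "\<And>t. t \<in> I \<Longrightarrow> sol (JJ t) (VV t) \<and> t \<in> JJ t" by metis
  \<comment> \<open>Each time uses its own partial solution; by \<open>agree\<close> these coincide
    near t.\<close>
  define V where "V t = VV t t" for t
  have "V t \<in> X t \<and> P V t" if t: "t \<in> I" for t
  proof -
    obtain e where e: "e > 0" "I \<inter> ball t e \<subseteq> JJ t"
      using JV[OF t] by (auto simp: sol_def openin_contains_ball Int_commute)
    have "V r = VV t r" if "r \<in> I \<inter> ball t e" for r
    proof -
      have "r \<in> I" "r \<in> JJ t" using that e by auto
      then show ?thesis
        unfolding V_def using agree[of "JJ r" "VV r" "JJ t" "VV t" r] JV[of r] JV[OF \<open>t \<in> I\<close>] by blast
    qed
    moreover have "P (VV t) t" "VV t t \<in> X t" using JV[OF t] by (auto simp: sol_def)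
    ultimately show ?thesis
      using germ[OF t e(1), of "VV t" V] by (auto simp: V_def)
  qed
  moreover have "V t0 = v" using JV[OF t0] by (auto simp: V_def sol_def)
  ultimately show ?thesis by blast
qed

text \<open>The interval may be open, closed or half open. The left margin vanishes only if t is the
  left end of I, and likewise on the right, so the compact window is still a relative neighbourhood
  of t.\<close>

lemma interval_compact_nbhd:
  assumes "is_interval (I::real set)" "t \<in> I" "e > 0"
  obtains a b d where "d > 0" "a \<le> t" "t \<le> b" "{a..b} \<subseteq> I" "I \<inter> ball t d \<subseteq> {a..b}" "b - a \<le> e"
proof -
  have ivl: "x \<in> I" if "y \<in> I" "z \<in> I" "y \<le> x" "x \<le> z" for x y z
    using assms(1) that by (meson mem_is_interval_1_I)
  have "\<exists>a. a \<le> t \<and> a \<in> I \<and> t - a \<le> e / 2 \<and> (a = t \<longrightarrow> \<not> (\<exists>s\<in>I. s < t))"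
  proof (cases "\<exists>s\<in>I. s < t")
    case True
    then obtain s where "s \<in> I" "s < t" by blast
    then show ?thesis
      using assms ivl[of s t "max (t - e / 2) s"] by (intro exI[of _ "max (t - e / 2) s"]) (auto simp: max_def)
  qed (use assms in \<open>auto intro!: exI[of _ t]\<close>)
  then obtain a where at: "a \<le> t" "a \<in> I" "t - a \<le> e / 2" "a = t \<Longrightarrow> \<not> (\<exists>s\<in>I. s < t)" by blast
  have "\<exists>b. t \<le> b \<and> b \<in> I \<and> b - t \<le> e / 2 \<and> (b = t \<longrightarrow> \<not> (\<exists>s\<in>I. s > t))"
  proof (cases "\<exists>s\<in>I. s > t")
    case True
    then obtain s where "s \<in> I" "s > t" by blast
    then show ?thesis
      using assms ivl[of t s "min (t + e / 2) s"] by (intro exI[of _ "min (t + e / 2) s"]) (auto simp: min_def)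
  qed (use assms in \<open>auto intro!: exI[of _ t]\<close>)
  then obtain b where bt: "t \<le> b" "b \<in> I" "b - t \<le> e / 2" "b = t \<Longrightarrow> \<not> (\<exists>s\<in>I. s > t)" by blast
  define d where "d = min (if a < t then t - a else 1) (if t < b then b - t else 1)"
  have d: "d > 0" by (auto simp: d_def)
  have "I \<inter> ball t d \<subseteq> {a..b}"
  proof
    fix x assume x: "x \<in> I \<inter> ball t d"
    have "a \<le> x"
      using x at(1,4) by (cases "a = t") (auto simp: d_def dist_real_def not_less split: if_splits)
    moreover have "x \<le> b"
      using x bt(1,4) by (cases "b = t") (auto simp: d_def dist_real_def not_less split: if_splits)
    ultimately show "x \<in> {a..b}" by simp
  qed
  moreover have "{a..b} \<subseteq> I" using ivl[OF at(2) bt(2)] by auto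
  ultimately show ?thesis using that[OF d at(1) bt(1)] at(3) bt(3) by auto
qed

section \<open>Linear differential equations\<close>

lemma bounded_bilinear_local_bound:
  fixes p :: "'b::real_normed_vector \<Rightarrow> 'a::real_normed_vector \<Rightarrow> 'a"
  assumes p: "bounded_bilinear p" and A: "continuous_on I A" and t: "t \<in> I"
  obtains d M where "d > 0" "M > 0" "\<And>r x. r \<in> I \<inter> ball (t::real) d \<Longrightarrow> norm (p (A r) x) \<le> M * norm x"
proof -
  obtain K where K: "K > 0" "\<And>a x. norm (p a x) \<le> norm a * norm x * K"
    using bounded_bilinear.pos_bounded[OF p] by blast
  obtain d where d: "d > 0" "\<And>r. r \<in> I \<Longrightarrow> dist r t < d \<Longrightarrow> dist (A r) (A t) < 1"
  proof -
    have "\<exists>d>0. \<forall>r\<in>I. dist r t < d \<longrightarrow> dist (A r) (A t) < 1"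
      using A[unfolded continuous_on_iff, THEN bspec, OF t, THEN spec, of 1] by simp
    then show ?thesis using that by blast
  qed
  have "norm (p (A r) x) \<le> ((norm (A t) + 1) * K) * norm x" if "r \<in> I \<inter> ball t d" for r x
  proof -
    have "norm (A r) \<le> norm (A t) + 1"
      using d(2)[of r] that norm_triangle_sub[of "A r" "A t"] by (auto simp: dist_norm abs_minus_commute)
    then have "norm (A r) * (norm x * K) \<le> (norm (A t) + 1) * (norm x * K)"
      using K by (intro mult_right_mono) auto
    then show ?thesis using K(2)[of "A r" x] by (simp add: mult_ac)
  qed
  moreover have "(norm (A t) + 1) * K > 0" using K by (simp add: add_nonneg_pos)
  ultimately show ?thesis using that d by blast
qed

text \<open>The product is an arbitrary bounded bilinear map, which covers matrix-vector systems as
  well as the scalar equation of a determinant.\<close>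

lemma linear_ode_unique:
  fixes p :: "'b::real_normed_vector \<Rightarrow> 'a::real_normed_vector \<Rightarrow> 'a"
  assumes p: "bounded_bilinear p" and A: "continuous_on I A" and I: "is_interval I"
    and V: "\<And>t. t \<in> I \<Longrightarrow> (V has_vector_derivative p (A t) (V t)) (at t within I)"
    and V': "\<And>t. t \<in> I \<Longrightarrow> (V' has_vector_derivative p (A t) (V' t)) (at t within I)"
    and s: "s \<in> I" "V s = V' s" and t: "t \<in> I"
  shows "V t = V' t"
proof (rule local_constancy[OF I s(1), where Q = "\<lambda>t. V t = V' t"])
  fix t assume "t \<in> I"
  then obtain d M where d: "d > 0" "M > 0" "\<And>r x. r \<in> I \<inter> ball t d \<Longrightarrow> norm (p (A r) x) \<le> M * norm x"
    using bounded_bilinear_local_bound[OF p A] by metis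
  have "V b = V' b" if "a \<in> I \<inter> ball t d" "V a = V' a" "b \<in> I \<inter> ball t d" for a b
  proof -
    have "V b - V' b = 0"
    proof (rule gronwall_zero[OF is_interval_Int_ball[OF I] that(1) _ that(3)])
      fix r assume r: "r \<in> I \<inter> ball t d"
      have "((\<lambda>t. V t - V' t) has_vector_derivative (p (A r) (V r) - p (A r) (V' r))) (at r within I)"
        using V V' r by (auto intro: has_vector_derivative_diff)
      then show "((\<lambda>t. V t - V' t) has_vector_derivative p (A r) (V r - V' r)) (at r within I \<inter> ball t d)"
        by (simp add: bounded_bilinear.diff_right[OF p] has_vector_derivative_within_subset)
      show "norm (p (A r) (V r - V' r)) \<le> M * norm (V r - V' r)" using d r by auto
    qed (use that in simp)
    then show ?thesis by simp
  qed
  then show "\<exists>d>0. (\<exists>r\<in>I \<inter> ball t d. V r = V' r) \<longrightarrow> (\<forall>r\<in>I \<inter> ball t d. V r = V' r)"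
    using d(1) by blast
qed (rule s t)+

text \<open>Existence by a contraction. The radius d is found before s and v are chosen, as
  \<open>patch_solutions\<close> requires.\<close>

lemma linear_ode_local:
  fixes p :: "'b::real_normed_vector \<Rightarrow> 'a::euclidean_space \<Rightarrow> 'a"
  assumes p: "bounded_bilinear p" and A: "continuous_on I A" and I: "is_interval I" and t: "t \<in> I"
  shows "\<exists>d>0. \<forall>s\<in>I \<inter> ball t d. \<forall>v. \<exists>V. V s = v \<and>
    (\<forall>r\<in>I \<inter> ball t d. (V has_vector_derivative p (A r) (V r)) (at r within I))"
proof -
  obtain d1 M where d1: "d1 > 0" "M > 0" "\<And>r x. r \<in> I \<inter> ball t d1 \<Longrightarrow> norm (p (A r) x) \<le> M * norm x"
    using bounded_bilinear_local_bound[OF p A t] by metis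
  \<comment> \<open>Windows of length e make the integral operator a contraction with factor M e =
    1/2.\<close>
  define e where "e = 1 / (2 * M)"
  have e: "e > 0" using d1 by (simp add: e_def)
  have "t \<in> I \<inter> ball t d1" using t d1 by auto
  then obtain a b d2 where ab: "d2 > 0" "a \<le> t" "t \<le> b" "{a..b} \<subseteq> I \<inter> ball t d1"
      "I \<inter> ball t d1 \<inter> ball t d2 \<subseteq> {a..b}" "b - a \<le> e"
    using interval_compact_nbhd[OF is_interval_Int_ball[OF I], of t t d1 e] e by metis
  define d where "d = min d1 d2"
  have d: "d > 0" "I \<inter> ball t d \<subseteq> {a..b}"
  proof -
    show "d > 0" using d1 ab by (simp add: d_def)
    have "ball t d \<subseteq> ball t d1 \<inter> ball t d2" by (simp add: d_def subset_ball)
    then have "I \<inter> ball t d \<subseteq> I \<inter> ball t d1 \<inter> ball t d2" unfolding Int_assoc by (rule Int_mono[OF order_refl])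
    then show "I \<inter> ball t d \<subseteq> {a..b}" using ab(5) by (rule order_trans)
  qed
  have bnd: "norm (p (A r) x) \<le> M * norm x" if "r \<in> {a..b}" for r x using d1(3) ab(4) that by blast
  have Ac: "continuous_on {a..b} A" using A ab(4) by (meson Int_subset_iff continuous_on_subset order_trans)
  have within: "at r within I = at r within {a..b}" if "r \<in> I \<inter> ball t d" for r
    by (rule at_within_nhd[of r "ball t d"]) (use that d ab in auto)
  have "\<exists>V. V s = v \<and> (\<forall>r\<in>{a..b}. (V has_vector_derivative p (A r) (V r)) (at r within {a..b}))"
    if s: "s \<in> {a..b}" for s v
  proof -
    define f where "f x \<tau> = p (A \<tau>) (apply_bcontfun x \<tau>)" for x :: "real \<Rightarrow>\<^sub>C 'a" and \<tau>
    define h where "h x r = integral {a..r} (f x)" for x r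
    \<comment> \<open>The retraction of the line onto [a, b]. Composition with it makes the
      integrals bounded continuous functions on the whole line, the complete space in which the
      fixed point is sought.\<close>
    define cl where "cl r = max a (min b r)" for r
    have cl: "cl r \<in> {a..b}" for r using ab by (auto simp: cl_def)
    have clid: "cl r = r" if "r \<in> {a..b}" for r using that by (auto simp: cl_def)
    have fc: "continuous_on {a..b} (f x)" for x
      unfolding f_def
      by (rule bounded_bilinear.continuous_on[OF p Ac]) (simp add: continuous_on_apply_bcontfun)
    have hd: "(h x has_vector_derivative f x r) (at r within {a..b})" if "r \<in> {a..b}" for x r
      unfolding h_def by (rule integral_has_vector_derivative[OF fc that])
    have hc: "continuous_on {a..b} (h x)" for x
      using hd by (meson continuous_on_eq_continuous_within has_vector_derivative_continuous)
    define \<Phi> where "\<Phi> x r = v + (h x (cl r) - h x s)" for x r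
    have mem: "\<Phi> x \<in> bcontfun" for x
    proof -
      have "continuous_on UNIV (\<lambda>r. h x (cl r))"
      proof (rule continuous_on_compose2[OF hc])
        show "continuous_on UNIV cl" unfolding cl_def by (intro continuous_intros)
        show "cl ` UNIV \<subseteq> {a..b}" using cl by (rule image_subsetI)
      qed
      moreover have "bounded (range (\<lambda>r. h x (cl r)))"
        by (rule bounded_subset[OF compact_imp_bounded[OF compact_continuous_image[OF hc compact_Icc]]])
          (rule image_subsetI, rule imageI, rule cl)
      ultimately have "(\<lambda>r. h x (cl r)) \<in> bcontfun" by (simp add: bcontfun_def)
      from plus_cont[OF const_bcontfun[of "v - h x s"] this]
      show ?thesis unfolding \<Phi>_def by (simp add: algebra_simps)
    qed
    have "\<exists>!x. Bcontfun (\<Phi> x) = x"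
    proof (rule banach_fix_type[of "1 / 2"])
      show "\<forall>x y. dist (Bcontfun (\<Phi> x)) (Bcontfun (\<Phi> y)) \<le> 1 / 2 * dist x y"
      proof (intro allI dist_bound)
        fix x y r
        let ?D = "\<lambda>r. h x r - h y r"
        have "norm (?D (cl r) - ?D s) \<le> (M * dist x y) * norm (cl r - s)"
        proof (rule differentiable_bound[of "{a..b}" ?D "\<lambda>r z. z *\<^sub>R (f x r - f y r)"])
          fix r assume r: "r \<in> {a..b}"
          show "(?D has_derivative (\<lambda>z. z *\<^sub>R (f x r - f y r))) (at r within {a..b})"
            using has_vector_derivative_diff[OF hd[OF r] hd[OF r]] unfolding has_vector_derivative_def .
          have "norm (f x r - f y r) \<le> M * norm (apply_bcontfun x r - apply_bcontfun y r)"
            unfolding f_def bounded_bilinear.diff_right[OF p, symmetric] by (rule bnd[OF r])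
          also have "\<dots> \<le> M * dist x y"
            using d1 dist_bounded[of x r y] by (intro mult_left_mono) (auto simp: dist_norm)
          finally have 1: "norm (f x r - f y r) \<le> M * dist x y" .
          show "onorm (\<lambda>z. z *\<^sub>R (f x r - f y r)) \<le> M * dist x y"
          proof (rule onorm_bound)
            show "norm (z *\<^sub>R (f x r - f y r)) \<le> M * dist x y * norm z" for z
              using mult_left_mono[OF 1 abs_ge_zero, of z] by (simp only: norm_scaleR real_norm_def mult.commute)
          qed (use d1 in auto)
        qed (use cl s in auto)
        also have "\<dots> \<le> (M * dist x y) * e"
          using cl[of r] s ab d1 by (intro mult_left_mono) auto
        also have "\<dots> = 1 / 2 * dist x y" using d1 by (simp add: e_def)
        finally show "dist (apply_bcontfun (Bcontfun (\<Phi> x)) r) (apply_bcontfun (Bcontfun (\<Phi> y)) r) \<le> 1 / 2 * dist x y"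
          by (simp add: Bcontfun_inverse mem \<Phi>_def dist_norm algebra_simps)
      qed
    qed auto
    then obtain x where "Bcontfun (\<Phi> x) = x" by blast
    then have x: "apply_bcontfun x = \<Phi> x" using Bcontfun_inverse[OF mem[of x]] by simp
    have "(\<Phi> x has_vector_derivative p (A r) (\<Phi> x r)) (at r within {a..b})" if r: "r \<in> {a..b}" for r
    proof (rule has_vector_derivative_transform[OF r])
      show "\<Phi> x y = v + (h x y - h x s)" if "y \<in> {a..b}" for y using clid[OF that] by (simp add: \<Phi>_def)
      have "((\<lambda>y. v + (h x y - h x s)) has_vector_derivative 0 + (f x r - 0)) (at r within {a..b})"
        by (intro has_vector_derivative_add has_vector_derivative_diff hd[OF r] has_vector_derivative_const)
      then show "((\<lambda>y. v + (h x y - h x s)) has_vector_derivative p (A r) (\<Phi> x r)) (at r within {a..b})"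
        by (simp add: f_def x)
    qed
    moreover have "\<Phi> x s = v" using clid[OF s] by (simp add: \<Phi>_def)
    ultimately show ?thesis by blast
  qed
  then have "\<forall>s\<in>I \<inter> ball t d. \<forall>v. \<exists>V. V s = v \<and>
    (\<forall>r\<in>I \<inter> ball t d. (V has_vector_derivative p (A r) (V r)) (at r within I))"
    using d(2) within by (metis subsetD)
  then show ?thesis using d(1) by blast
qed

lemma linear_ode_exists:
  fixes p :: "'b::real_normed_vector \<Rightarrow> 'a::euclidean_space \<Rightarrow> 'a"
  assumes p: "bounded_bilinear p" and A: "continuous_on I A" and I: "is_interval I" and s: "s \<in> I"
  shows "\<exists>V. V s = v \<and> (\<forall>t\<in>I. (V has_vector_derivative p (A t) (V t)) (at t within I))"
proof -
  have "\<exists>V. V s = v \<and> (\<forall>t\<in>I. V t \<in> (UNIV :: 'a set) \<and> (V has_vector_derivative p (A t) (V t)) (at t within I))"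
  proof (rule patch_solutions[OF I s])
    fix V V' :: "real \<Rightarrow> 'a" and t d
    assume t: "t \<in> I" "d > 0" and V: "(V has_vector_derivative p (A t) (V t)) (at t within I)"
      and eq: "\<And>r. r \<in> I \<inter> ball t d \<Longrightarrow> V r = V' r"
    have "V t = V' t" using eq[of t] t by auto
    then show "(V' has_vector_derivative p (A t) (V' t)) (at t within I)"
      using has_vector_derivative_transform_within[OF V t(2,1), of V'] eq by (simp add: dist_commute)
  next
    fix t assume t: "t \<in> I"
    show "\<exists>d>0. \<forall>s\<in>I \<inter> ball t d. \<forall>v\<in>UNIV. \<exists>V. V s = v \<and>
      (\<forall>r\<in>I \<inter> ball t d. V r \<in> UNIV \<and> (V has_vector_derivative p (A r) (V r)) (at r within I))"
      using linear_ode_local[OF p A I t] by simp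
    show "\<exists>d>0. \<forall>J V V' s. is_interval J \<longrightarrow> J \<subseteq> I \<inter> ball t d \<longrightarrow> openin (top_of_set I) J \<longrightarrow>
       (\<forall>r\<in>J. V r \<in> UNIV \<and> (V has_vector_derivative p (A r) (V r)) (at r within I)) \<longrightarrow>
       (\<forall>r\<in>J. V' r \<in> UNIV \<and> (V' has_vector_derivative p (A r) (V' r)) (at r within I)) \<longrightarrow>
       s \<in> J \<longrightarrow> V s = V' s \<longrightarrow> (\<forall>r\<in>J. V r = V' r)"
    proof (intro exI[of _ 1] conjI allI impI ballI)
      fix J V V' s r
      assume J: "is_interval J" "J \<subseteq> I \<inter> ball t 1" and sr: "s \<in> J" "V s = V' s" "r \<in> J"
        and V: "\<forall>r\<in>J. V r \<in> UNIV \<and> (V has_vector_derivative p (A r) (V r)) (at r within I)"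
        and V': "\<forall>r\<in>J. V' r \<in> UNIV \<and> (V' has_vector_derivative p (A r) (V' r)) (at r within I)"
      have JI: "J \<subseteq> I" using J by auto
      show "V r = V' r"
        by (rule linear_ode_unique[where V = V and V' = V' and s = s, OF p continuous_on_subset[OF A JI] J(1) _ _ sr])
          (use V V' JI in \<open>auto intro: has_vector_derivative_within_subset\<close>)
    qed simp
  qed simp
  then show ?thesis by blast
qed

text \<open>P erases the i-th coordinate, and \<phi> replaces it by f, which is a local
  diffeomorphism with inverse g. Then \<rho> = g \<circ> P moves x along the i-th axis into the
  level set. As \<rho> depends on P x alone and \<open>P (\<rho> x) = P x\<close>, its derivatives
  at x and at \<rho> x coincide.\<close>

lemma level_set_retraction:
  fixes f :: "real^'n \<Rightarrow> real"
  assumes V: "open V" "p \<in> V" and f: "C1_on f V" and fp: "f p = 0" and i: "fd f p (axis i 1) \<noteq> 0"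
  obtains N \<rho> where "open N" "p \<in> N" "N \<subseteq> V" "C1_on \<rho> N" "\<And>x. x \<in> N \<Longrightarrow> \<rho> x \<in> N \<and> f (\<rho> x) = 0"
    "\<And>x. x \<in> N \<Longrightarrow> f x = 0 \<Longrightarrow> \<rho> x = x" "\<And>x. x \<in> N \<Longrightarrow> fd \<rho> (\<rho> x) = fd \<rho> x"
    "\<And>x v. x \<in> N \<Longrightarrow> f x = 0 \<Longrightarrow> fd f x v = 0 \<Longrightarrow> fd \<rho> x v = v"
proof -
  define P where "P x = x - (x $ i) *\<^sub>R axis i 1" for x :: "real^'n"
  have Pbl: "bounded_linear P"
    unfolding P_def linear_conv_bounded_linear[symmetric] by (rule linearI) (simp_all add: algebra_simps)
  have Pi: "P x $ i = 0" "P (P x) = P x" for x by (auto simp: P_def axis_def)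
  have PP: "P (x + c *\<^sub>R axis i 1) = P x" for x c by (simp add: P_def algebra_simps axis_def)
  define U where "U = V \<inter> (\<lambda>x. fd f x (axis i 1)) -` (- {0})"
  have U: "open U" "p \<in> U" "U \<subseteq> V"
    unfolding U_def using V i continuous_open_preimage[OF C1_on_fd_continuous[OF f] V(1), of "- {0}"]
    by (auto simp: open_Compl)
  have fU: "C1_on f U" using C1_on_subset[OF f U(3)] .
  define \<phi> where "\<phi> x = P x + f x *\<^sub>R axis i 1" for x
  have \<phi>C1: "C1_on \<phi> U" unfolding \<phi>_def
    by (intro C1_on_add C1_on_bounded_linear Pbl C1_on_scaleR fU C1_on_const)
  have d\<phi>: "fd \<phi> x v = P v + fd f x v *\<^sub>R axis i 1" if "x \<in> U" for x v
  proof -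
    have "(\<phi> has_derivative (\<lambda>v. P v + fd f x v *\<^sub>R axis i 1)) (at x)"
      unfolding \<phi>_def
      by (intro has_derivative_add bounded_linear_imp_has_derivative Pbl
         bounded_linear.has_derivative[OF bounded_linear_scaleR_left C1_onD[OF fU that]])
    from fd_eq[OF this] show ?thesis by simp
  qed
  \<comment> \<open>The inverse of \<open>fd \<phi> x\<close>, solved by hand: a multiple of the
    axis vector is added so that the value of df becomes the i-th component of v.\<close>
  define \<phi>i where "\<phi>i x v = P v + ((v $ i - fd f x (P v)) / fd f x (axis i 1)) *\<^sub>R axis i 1" for x v
  have inv1: "fd \<phi> x (\<phi>i x v) = v" if "x \<in> U" for x v
  proof -
    have l: "linear (fd f x)" using C1_on_linear[OF fU that] .
    have nz: "fd f x (axis i 1) \<noteq> 0" using that by (auto simp: U_def)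
    have "fd f x (\<phi>i x v) = v $ i"
      unfolding \<phi>i_def using nz by (simp add: linear_add[OF l] linear_cmul[OF l])
    moreover have "P (\<phi>i x v) = P v" unfolding \<phi>i_def by (simp add: PP Pi)
    ultimately show ?thesis using d\<phi>[OF that] by (simp add: P_def)
  qed
  have inv2: "\<phi>i x (fd \<phi> x v) = v" if "x \<in> U" for x v
  proof -
    have l: "linear (fd f x)" using C1_on_linear[OF fU that] .
    have nz: "fd f x (axis i 1) \<noteq> 0" using that by (auto simp: U_def)
    have v: "fd f x v = fd f x (P v) + (v $ i) * fd f x (axis i 1)"
      by (simp add: P_def linear_diff[OF l] linear_cmul[OF l])
    have "P (fd \<phi> x v) = P v" "fd \<phi> x v $ i = fd f x v"
      using d\<phi>[OF that] by (simp_all add: PP Pi)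
    then show ?thesis using nz unfolding \<phi>i_def by (simp add: v) (simp add: P_def)
  qed
  have bl: "bounded_linear (fd \<phi> x)" if "x \<in> U" for x
    using C1_onD[OF \<phi>C1 that] has_derivative_bounded_linear by blast
  have bli: "bounded_linear (\<phi>i x)" if "x \<in> U" for x
  proof -
    have l: "linear (fd f x)" "linear P"
      using C1_on_linear[OF fU that] Pbl linear_conv_bounded_linear by auto
    have "linear (\<phi>i x)"
      by (rule linearI) (simp_all add: \<phi>i_def linear_add[OF l(1)] linear_add[OF l(2)] linear_cmul[OF l(1)]
          linear_cmul[OF l(2)] algebra_simps add_divide_distrib diff_divide_distrib)
    then show ?thesis by (simp add: linear_conv_bounded_linear)
  qed
  obtain U' W g g' where g: "open U'" "U' \<subseteq> U" "p \<in> U'" "open W" "\<phi> p \<in> W" "homeomorphism U' W \<phi> g"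
    "\<And>y. y \<in> W \<Longrightarrow> (g has_derivative (g' y)) (at y)"
    "\<And>y. y \<in> W \<Longrightarrow> g' y = inv_into UNIV (blinfun_apply (Blinfun (fd \<phi> (g y))))"
  proof (rule inverse_function_theorem[OF U(1) _ _ U(2), where f = \<phi> and f' = "\<lambda>x. Blinfun (fd \<phi> x)" and invf = "Blinfun (\<phi>i p)"])
    show "(\<phi> has_derivative blinfun_apply (Blinfun (fd \<phi> x))) (at x)" if "x \<in> U" for x
      using C1_onD[OF \<phi>C1 that] by (simp add: bounded_linear_Blinfun_apply[OF bl[OF that]])
    show "continuous_on U (\<lambda>x. Blinfun (fd \<phi> x))"
    proof (rule continuous_on_blinfun_componentwise)
      fix b :: "real^'n"
      show "continuous_on U (\<lambda>x. blinfun_apply (Blinfun (fd \<phi> x)) b)"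
        using C1_on_fd_continuous[OF \<phi>C1, of b]
        by (rule continuous_on_eq) (simp add: bounded_linear_Blinfun_apply bl)
    qed
    show "Blinfun (\<phi>i p) o\<^sub>L Blinfun (fd \<phi> p) = id_blinfun"
      by (rule blinfun_eqI) (simp add: bounded_linear_Blinfun_apply bl bli U inv2)
  qed blast
  have gU: "g y \<in> U'" "\<phi> (g y) = y" if "y \<in> W" for y
    using g(6) that by (auto simp: homeomorphism_def)
  have gid: "g (\<phi> x) = x" "\<phi> x \<in> W" if "x \<in> U'" for x
    using g(6) that by (auto simp: homeomorphism_def)
  have g'eq: "g' y = \<phi>i (g y)" if "y \<in> W" for y
  proof -
    have gy: "g y \<in> U" using gU(1)[OF that] g(2) by auto
    have "inv_into UNIV (fd \<phi> (g y)) = \<phi>i (g y)"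
      by (rule Hilbert_Choice.inv_equality) (use inv1 inv2 gy in auto)
    then show ?thesis using g(8)[OF that] by (simp add: bounded_linear_Blinfun_apply bl gy)
  qed
  have gc: "continuous_on W g" using g(6) by (auto simp: homeomorphism_def)
  have gC1: "C1_on g W"
  proof (rule C1_onI[OF g(7)])
    fix v
    have gWU: "g ` W \<subseteq> U" using gU g(2) by auto
    have nz: "fd f (g y) (axis i 1) \<noteq> 0" if "y \<in> W" for y using gWU that by (auto simp: U_def)
    have "continuous_on W (\<lambda>y. \<phi>i (g y) v)"
      unfolding \<phi>i_def
      by (intro continuous_intros C1_on_continuous_compose[OF fU gc gWU]) (use nz in auto)
    then show "continuous_on W (\<lambda>y. g' y v)"
      by (rule continuous_on_eq) (simp add: g'eq)
  qed
  define N where "N = U' \<inter> P -` W"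
  define \<rho> where "\<rho> x = g (P x)" for x
  have Pc: "continuous_on UNIV P" using Pbl linear_continuous_on by blast
  have N: "open N" "N \<subseteq> V" "P ` N \<subseteq> W"
    unfolding N_def using g(1,2,4) U(3) open_vimage[OF g(4) Pc] by auto
  have \<phi>0: "\<phi> x = P x" if "f x = 0" for x using that by (simp add: \<phi>_def)
  have pN: "p \<in> N" using g(3,5) \<phi>0[OF fp] by (simp add: N_def)
  have \<rho>C1: "C1_on \<rho> N" unfolding \<rho>_def
    by (rule C1_on_compose(1)[OF C1_on_bounded_linear[OF Pbl] gC1 N(3)])
  have d\<rho>: "fd \<rho> x = (\<lambda>v. fd g (P x) (P v))" if "x \<in> N" for x
  proof -
    have "fd \<rho> x = (\<lambda>v. fd g (P x) (fd P x v))"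
      unfolding \<rho>_def by (rule C1_on_compose(2)[OF C1_on_bounded_linear[OF Pbl] gC1 N(3) that])
    moreover have "fd P x = P" by (rule fd_eq[OF bounded_linear_imp_has_derivative[OF Pbl]])
    ultimately show ?thesis by simp
  qed
  have P\<phi>: "P (\<phi> x) = P x" "\<phi> x $ i = f x" for x
    unfolding \<phi>_def by (simp_all add: PP Pi)
  have P\<rho>: "P (\<rho> x) = P x" "f (\<rho> x) = 0" "\<rho> x \<in> N" if "x \<in> N" for x
  proof -
    have w: "P x \<in> W" using that N by auto
    have 1: "\<phi> (\<rho> x) = P x" unfolding \<rho>_def by (rule gU(2)[OF w])
    show 2: "P (\<rho> x) = P x" using P\<phi>(1)[of "\<rho> x"] 1 Pi by simp
    show "f (\<rho> x) = 0" using P\<phi>(2)[of "\<rho> x"] 1 Pi by simp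
    show "\<rho> x \<in> N" using gU(1)[OF w] 2 w by (simp add: N_def \<rho>_def)
  qed
  show ?thesis
  proof (rule that[OF N(1) pN N(2) \<rho>C1])
    show "\<rho> x \<in> N \<and> f (\<rho> x) = 0" if "x \<in> N" for x using P\<rho>[OF that] by simp
    show "\<rho> x = x" if "x \<in> N" "f x = 0" for x
      using gid(1)[of x] \<phi>0[OF that(2)] that by (simp add: \<rho>_def N_def)
    show "fd \<rho> (\<rho> x) = fd \<rho> x" if "x \<in> N" for x
      using d\<rho>[OF that] d\<rho>[OF P\<rho>(3)[OF that]] P\<rho>(1)[OF that] by simp
    show "fd \<rho> x v = v" if x: "x \<in> N" "f x = 0" "fd f x v = 0" for x v
    proof -
      have xU: "x \<in> U" using x g(2) by (auto simp: N_def)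
      have w: "P x \<in> W" using x N by auto
      have gx: "g (P x) = x" using gid(1)[of x] \<phi>0[OF x(2)] x by (simp add: N_def)
      have "fd \<phi> x v = P v" using d\<phi>[OF xU] x by simp
      moreover have "fd g (P x) = \<phi>i x" using fd_eq[OF g(7)[OF w]] g'eq[OF w] gx by simp
      ultimately show ?thesis using d\<rho>[OF x(1)] inv2[OF xU, of v] by simp
    qed
  qed
qed

section \<open>The Levi-Civita connection in a chart\<close>

lemma bounded_bilinear_matrix_vector:
  "bounded_bilinear ((*v) :: real^'n^'m \<Rightarrow> real^'n \<Rightarrow> real^'m)"
  unfolding bilinear_conv_bounded_bilinear[symmetric] bilinear_def
  by (auto intro!: linearI simp: matrix_vector_mult_add_rdistrib matrix_vector_right_distrib
      scaleR_matrix_vector_assoc[symmetric] matrix_vector_mult_scaleR)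

lemma matrix_inv_right:
  fixes M :: "real^'n^'n"
  assumes "invertible M" shows "M ** matrix_inv M = Finite_Cartesian_Product.mat 1"
  using someI_ex[OF assms[unfolded invertible_def]] by (simp add: matrix_inv_def)

text \<open>\<open>christoffel\<close> with the metric coefficients as an arbitrary matrix-valued
  function, so that the calculus in one chart can be done apart from the manifold.\<close>

definition chr :: "(real^'n \<Rightarrow> real^'n^'n) \<Rightarrow> real^'n \<Rightarrow> 'n \<Rightarrow> 'n \<Rightarrow> 'n \<Rightarrow> real" where
  "chr G x k i j = 1/2 * (\<Sum>l\<in>UNIV. matrix_inv (G x) $ k $ l *
     (partial_deriv i (\<lambda>y. G y $ j $ l) x
      + partial_deriv j (\<lambda>y. G y $ i $ l) x
      - partial_deriv l (\<lambda>y. G y $ i $ j) x))"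

definition Gam :: "(real^'n \<Rightarrow> real^'n^'n) \<Rightarrow> real^'n \<Rightarrow> real^'n \<Rightarrow> real^'n \<Rightarrow> real^'n" where
  "Gam G x u v = (\<chi> k. \<Sum>i\<in>UNIV. \<Sum>j\<in>UNIV. chr G x k i j * u $ i * v $ j)"

text \<open>The derivative of \<open>Gam\<close> in its base point in the direction w, with u and v
  held constant.\<close>

definition dGam :: "(real^'n \<Rightarrow> real^'n^'n) \<Rightarrow> real^'n \<Rightarrow> real^'n \<Rightarrow> real^'n \<Rightarrow> real^'n \<Rightarrow> real^'n" where
  "dGam G x w u v = (\<chi> k. \<Sum>i\<in>UNIV. \<Sum>j\<in>UNIV. fd (\<lambda>y. chr G y k i j) x w * u $ i * v $ j)"

text \<open>The index-free reading of \<open>curvature_comp\<close>, with the same sign convention;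
  \<open>curv_comp\<close> matches it with the components.\<close>

definition curv :: "(real^'n \<Rightarrow> real^'n^'n) \<Rightarrow> real^'n \<Rightarrow> real^'n \<Rightarrow> real^'n \<Rightarrow> real^'n \<Rightarrow> real^'n" where
  "curv G x X Y Z = dGam G x Y X Z - dGam G x X Y Z + Gam G x Y (Gam G x X Z) - Gam G x X (Gam G x Y Z)"

abbreviation ip :: "real^'n^'n \<Rightarrow> real^'n \<Rightarrow> real^'n \<Rightarrow> real" where
  "ip M u v \<equiv> u \<bullet> (M *v v)"

lemma ip_bilinear:
  "ip M (u + u') v = ip M u v + ip M u' v" "ip M u (v + v') = ip M u v + ip M u v'"
  "ip M (u - u') v = ip M u v - ip M u' v" "ip M u (v - v') = ip M u v - ip M u v'"
  "ip M (c *\<^sub>R u) v = c * ip M u v" "ip M u (c *\<^sub>R v) = c * ip M u v"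
  "ip M (- u) v = - ip M u v" "ip M u (- v) = - ip M u v" "ip M 0 v = 0" "ip M u 0 = 0"
  "ip M (sum f I) v = (\<Sum>i\<in>I. ip M (f i) v)" "ip M u (sum f I) = (\<Sum>i\<in>I. ip M u (f i))"
proof -
  interpret bounded_bilinear "(*v) :: real^'a^'a \<Rightarrow> real^'a \<Rightarrow> real^'a" by (rule bounded_bilinear_matrix_vector)
  show
  "ip M (u + u') v = ip M u v + ip M u' v" "ip M u (v + v') = ip M u v + ip M u v'"
  "ip M (u - u') v = ip M u v - ip M u' v" "ip M u (v - v') = ip M u v - ip M u v'"
  "ip M (c *\<^sub>R u) v = c * ip M u v" "ip M u (c *\<^sub>R v) = c * ip M u v"
  "ip M (- u) v = - ip M u v" "ip M u (- v) = - ip M u v" "ip M 0 v = 0" "ip M u 0 = 0"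
  "ip M (sum f I) v = (\<Sum>i\<in>I. ip M (f i) v)" "ip M u (sum f I) = (\<Sum>i\<in>I. ip M u (f i))"
    by (simp_all add: inner_add_left inner_add_right inner_diff_left inner_diff_right add_right diff_right
        scaleR_right minus_right zero_right inner_sum_left inner_sum_right sum_right)
qed

lemma ip_expand: "ip M u v = (\<Sum>i\<in>UNIV. \<Sum>j\<in>UNIV. M $ i $ j * u $ i * v $ j)"
  by (simp add: inner_vec_def matrix_vector_mult_def sum_distrib_left mult_ac)

lemma Gam_linear:
  "Gam G x (u + u') v = Gam G x u v + Gam G x u' v" "Gam G x u (v + v') = Gam G x u v + Gam G x u v'"
  "Gam G x (c *\<^sub>R u) v = c *\<^sub>R Gam G x u v" "Gam G x u (c *\<^sub>R v) = c *\<^sub>R Gam G x u v"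
  by (simp_all add: Gam_def Finite_Cartesian_Product.vec_eq_iff algebra_simps sum.distrib sum_distrib_left)

lemma dGam_linear:
  "dGam G x w (u + u') v = dGam G x w u v + dGam G x w u' v" "dGam G x w u (v + v') = dGam G x w u v + dGam G x w u v'"
  "dGam G x w (c *\<^sub>R u) v = c *\<^sub>R dGam G x w u v" "dGam G x w u (c *\<^sub>R v) = c *\<^sub>R dGam G x w u v"
  by (simp_all add: dGam_def Finite_Cartesian_Product.vec_eq_iff algebra_simps sum.distrib sum_distrib_left)

locale metric_chart =
  fixes U :: "(real^'n) set" and G :: "real^'n \<Rightarrow> real^'n^'n"
  assumes open_U: "open U"
    and sym: "x \<in> U \<Longrightarrow> G x $ i $ j = G x $ j $ i"
    and inv: "x \<in> U \<Longrightarrow> invertible (G x)"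
    and C2: "Ck_on 2 (\<lambda>x. G x $ i $ j) U"
begin

lemma C2': "Ck_on (Suc (Suc 0)) (\<lambda>x. G x $ i $ j) U"
  using C2[of i j] unfolding numeral_2_eq_2 .

lemma entry_C1: "C1_on (\<lambda>x. G x $ i $ j) U"
  by (rule Ck_on_C1[OF C2' open_U])

lemma G_eq: "G = (\<lambda>x. \<Sum>i\<in>UNIV. \<Sum>j\<in>UNIV. G x $ i $ j *\<^sub>R axis i (axis j 1))"
proof -
  have "(\<Sum>i\<in>UNIV. \<Sum>j\<in>UNIV. G x $ i $ j *\<^sub>R axis i (axis j 1)) $ k $ l = G x $ k $ l" for x k l
  proof -
    have "(\<Sum>i\<in>UNIV. \<Sum>j\<in>UNIV. G x $ i $ j *\<^sub>R axis i (axis j 1)) $ k $ l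
       = (\<Sum>i\<in>UNIV. \<Sum>j\<in>UNIV. if i = k then if j = l then G x $ i $ j else 0 else 0)"
      by (auto intro!: sum.cong simp: axis_def)
    also have "\<dots> = (\<Sum>i\<in>UNIV. if i = k then G x $ i $ l else 0)"
      by (intro sum.cong refl) auto
    finally show ?thesis by simp
  qed
  then show ?thesis by (simp add: fun_eq_iff Finite_Cartesian_Product.vec_eq_iff)
qed

lemma G_C1: "C1_on G U"
  by (subst G_eq) (intro C1_on_sum C1_on_scaleR C1_on_const entry_C1)

lemma fd_G_entry: "x \<in> U \<Longrightarrow> fd (\<lambda>y. G y $ i $ j) x w = fd G x w $ i $ j"
  by (rule fun_cong[OF fd_eq]) (intro bounded_linear.has_derivative[OF bounded_linear_vec_nth] C1_onD[OF G_C1])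

lemma partial_entry_C1: "C1_on (partial_deriv k (\<lambda>y. G y $ i $ j)) U"
  unfolding partial_deriv_def by (rule Ck2_on_fd_C1[OF C2' open_U])

lemma det_nz: "x \<in> U \<Longrightarrow> Determinants.det (G x) \<noteq> 0"
  using inv invertible_det_nz by blast

lemma det_C1:
  assumes "\<And>i j. C1_on (\<lambda>x. M x $ i $ j) U"
  shows "C1_on (\<lambda>x. Determinants.det (M x :: real^'n^'n)) U"
  unfolding Determinants.det_def by (intro C1_on_sum C1_on_mult C1_on_const C1_on_prod assms)

text \<open>By Cramer's rule the entries of the inverse are quotients of polynomials in the entries
  of G, with denominator det G.\<close>

lemma matrix_inv_C1: "C1_on (\<lambda>x. matrix_inv (G x) $ k $ l) U"
proof -
  have eq: "matrix_inv (G x) $ k $ l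
      = Determinants.det (\<chi> i j. if j = k then axis l 1 $ i else G x $ i $ j) / Determinants.det (G x)"
    if "x \<in> U" for x
  proof -
    have "G x *v (matrix_inv (G x) *v axis l 1) = axis l 1"
      using matrix_inv_right[OF inv[OF that]] by (simp add: matrix_vector_mul_assoc)
    then have "matrix_inv (G x) *v axis l 1 = (\<chi> k. Determinants.det (\<chi> i j. if j = k then axis l 1 $ i else G x $ i $ j) / Determinants.det (G x))"
      using cramer[OF det_nz[OF that]] by blast
    from arg_cong[OF this, of "\<lambda>v. v $ k"] show ?thesis
      by (simp add: matrix_vector_mult_basis column_def)
  qed
  have "C1_on (\<lambda>x. Determinants.det (\<chi> i j. if j = k then axis l 1 $ i else G x $ i $ j) / Determinants.det (G x)) U"
  proof (intro C1_on_divide det_C1 det_nz)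
    show "C1_on (\<lambda>x. (\<chi> i j. if j = k then axis l 1 $ i else G x $ i $ j) $ i $ j) U" for i j
      by (cases "j = k") (simp_all add: C1_on_const entry_C1)
  qed (rule entry_C1)
  then show ?thesis
    by (subst C1_on_cong[OF open_U eq])
qed

lemma chr_C1: "C1_on (\<lambda>x. chr G x k i j) U"
  unfolding chr_def
  by (intro C1_on_mult C1_on_const C1_on_sum matrix_inv_C1 C1_on_add C1_on_diff partial_entry_C1)

lemma partial_sym: "x \<in> U \<Longrightarrow> partial_deriv k (\<lambda>y. G y $ i $ j) x = partial_deriv k (\<lambda>y. G y $ j $ i) x"
  unfolding partial_deriv_def by (subst fd_cong[OF open_U sym]) auto

lemma chr_sym: "x \<in> U \<Longrightarrow> chr G x k i j = chr G x k j i"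
  using partial_sym[of x] unfolding chr_def by (simp add: add.commute)

lemma Gam_sym: "x \<in> U \<Longrightarrow> Gam G x u v = Gam G x v u"
  unfolding Gam_def Finite_Cartesian_Product.vec_eq_iff vec_lambda_beta
  by (intro allI, subst sum.swap, intro sum.cong refl) (use chr_sym[of x] in \<open>simp add: mult_ac\<close>)

lemma ip_sym: "x \<in> U \<Longrightarrow> ip (G x) u v = ip (G x) v u"
  unfolding ip_expand by (subst sum.swap) (intro sum.cong refl, use sym[of x] in \<open>simp add: mult_ac\<close>)

lemma fdG_sym: "x \<in> U \<Longrightarrow> fd G x w $ i $ j = fd G x w $ j $ i"
  unfolding fd_G_entry[symmetric] by (subst fd_cong[OF open_U sym]) auto

lemma dip_sym: "x \<in> U \<Longrightarrow> ip (fd G x w) u v = ip (fd G x w) v u"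
  unfolding ip_expand by (subst sum.swap) (intro sum.cong refl, use fdG_sym[of x w] in \<open>simp add: mult_ac\<close>)

text \<open>The Koszul formula for constant fields, whose brackets vanish. The metric properties of
  \<open>Gam\<close> and its transformation law are derived from it instead of the index
  formula.\<close>

lemma koszul:
  assumes x: "x \<in> U"
  shows "2 * ip (G x) w (Gam G x u v) = ip (fd G x u) v w + ip (fd G x v) u w - ip (fd G x w) u v"
proof -
  define s where "s l = (\<Sum>i\<in>UNIV. \<Sum>j\<in>UNIV. (partial_deriv i (\<lambda>y. G y $ j $ l) x
      + partial_deriv j (\<lambda>y. G y $ i $ l) x - partial_deriv l (\<lambda>y. G y $ i $ j) x) * u $ i * v $ j)" for l
  have lin: "linear (fd G x)" by (rule C1_on_linear[OF G_C1 x])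
  have fdv: "fd G x u $ i $ j = (\<Sum>k\<in>UNIV. u $ k * partial_deriv k (\<lambda>y. G y $ i $ j) x)" for u i j
  proof -
    have "fd G x u = (\<Sum>k\<in>UNIV. u $ k *\<^sub>R fd G x (axis k 1))"
      by (subst basis_expansion[symmetric, of u]) (simp only: linear_sum[OF lin] linear_cmul[OF lin] scalar_mult_eq_scaleR)
    then show ?thesis by (simp add: partial_deriv_def fd_G_entry[OF x])
  qed
  have G2: "Gam G x u v = (1/2) *\<^sub>R (matrix_inv (G x) *v (\<chi> l. s l))"
  proof -
    have "Gam G x u v $ k = 1/2 * (\<Sum>l\<in>UNIV. matrix_inv (G x) $ k $ l * s l)" for k
    proof -
      have "Gam G x u v $ k = (\<Sum>i\<in>UNIV. \<Sum>j\<in>UNIV. \<Sum>l\<in>UNIV. 1/2 * (matrix_inv (G x) $ k $ l * ((partial_deriv i (\<lambda>y. G y $ j $ l) x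
      + partial_deriv j (\<lambda>y. G y $ i $ l) x - partial_deriv l (\<lambda>y. G y $ i $ j) x) * u $ i * v $ j)))"
        by (simp add: Gam_def chr_def sum_distrib_left sum_distrib_right mult.assoc)
      also have "\<dots> = (\<Sum>i\<in>UNIV. \<Sum>l\<in>UNIV. \<Sum>j\<in>UNIV. 1/2 * (matrix_inv (G x) $ k $ l * ((partial_deriv i (\<lambda>y. G y $ j $ l) x
      + partial_deriv j (\<lambda>y. G y $ i $ l) x - partial_deriv l (\<lambda>y. G y $ i $ j) x) * u $ i * v $ j)))"
        by (intro sum.cong refl sum.swap)
      also have "\<dots> = (\<Sum>l\<in>UNIV. \<Sum>i\<in>UNIV. \<Sum>j\<in>UNIV. 1/2 * (matrix_inv (G x) $ k $ l * ((partial_deriv i (\<lambda>y. G y $ j $ l) x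
      + partial_deriv j (\<lambda>y. G y $ i $ l) x - partial_deriv l (\<lambda>y. G y $ i $ j) x) * u $ i * v $ j)))"
        by (rule sum.swap)
      also have "\<dots> = 1/2 * (\<Sum>l\<in>UNIV. matrix_inv (G x) $ k $ l * s l)"
        by (simp only: s_def sum_distrib_left)
      finally show ?thesis .
    qed
    then show ?thesis by (simp add: Finite_Cartesian_Product.vec_eq_iff matrix_vector_mult_def)
  qed
  have "G x *v Gam G x u v = (1/2) *\<^sub>R (\<chi> l. s l)"
    unfolding G2 using matrix_inv_right[OF inv[OF x]]
    by (simp add: matrix_vector_mult_scaleR matrix_vector_mul_assoc)
  then have "2 * ip (G x) w (Gam G x u v) = w \<bullet> (\<chi> l. s l)" by simp
  also have "\<dots> = (\<Sum>l\<in>UNIV. \<Sum>i\<in>UNIV. \<Sum>j\<in>UNIV. partial_deriv i (\<lambda>y. G y $ j $ l) x * u $ i * v $ j * w $ l)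
     + (\<Sum>l\<in>UNIV. \<Sum>i\<in>UNIV. \<Sum>j\<in>UNIV. partial_deriv j (\<lambda>y. G y $ i $ l) x * u $ i * v $ j * w $ l)
     - (\<Sum>l\<in>UNIV. \<Sum>i\<in>UNIV. \<Sum>j\<in>UNIV. partial_deriv l (\<lambda>y. G y $ i $ j) x * u $ i * v $ j * w $ l)"
    unfolding sum.distrib[symmetric] sum_subtractf[symmetric]
    by (simp add: inner_vec_def s_def sum_distrib_left algebra_simps)
  also have "(\<Sum>l\<in>UNIV. \<Sum>i\<in>UNIV. \<Sum>j\<in>UNIV. partial_deriv i (\<lambda>y. G y $ j $ l) x * u $ i * v $ j * w $ l)
      = ip (fd G x u) v w"
  proof -
    have "ip (fd G x u) v w = (\<Sum>j\<in>UNIV. \<Sum>l\<in>UNIV. \<Sum>i\<in>UNIV. partial_deriv i (\<lambda>y. G y $ j $ l) x * u $ i * v $ j * w $ l)"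
      by (simp add: ip_expand fdv sum_distrib_left sum_distrib_right mult_ac)
    also have "\<dots> = (\<Sum>l\<in>UNIV. \<Sum>j\<in>UNIV. \<Sum>i\<in>UNIV. partial_deriv i (\<lambda>y. G y $ j $ l) x * u $ i * v $ j * w $ l)"
      by (rule sum.swap)
    also have "\<dots> = (\<Sum>l\<in>UNIV. \<Sum>i\<in>UNIV. \<Sum>j\<in>UNIV. partial_deriv i (\<lambda>y. G y $ j $ l) x * u $ i * v $ j * w $ l)"
      by (intro sum.cong refl sum.swap)
    finally show ?thesis by simp
  qed
  also have "(\<Sum>l\<in>UNIV. \<Sum>i\<in>UNIV. \<Sum>j\<in>UNIV. partial_deriv j (\<lambda>y. G y $ i $ l) x * u $ i * v $ j * w $ l)
      = ip (fd G x v) u w"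
  proof -
    have "ip (fd G x v) u w = (\<Sum>i\<in>UNIV. \<Sum>l\<in>UNIV. \<Sum>j\<in>UNIV. partial_deriv j (\<lambda>y. G y $ i $ l) x * u $ i * v $ j * w $ l)"
      by (simp add: ip_expand fdv sum_distrib_left sum_distrib_right mult_ac)
    also have "\<dots> = (\<Sum>l\<in>UNIV. \<Sum>i\<in>UNIV. \<Sum>j\<in>UNIV. partial_deriv j (\<lambda>y. G y $ i $ l) x * u $ i * v $ j * w $ l)"
      by (rule sum.swap)
    finally show ?thesis by simp
  qed
  also have "(\<Sum>l\<in>UNIV. \<Sum>i\<in>UNIV. \<Sum>j\<in>UNIV. partial_deriv l (\<lambda>y. G y $ i $ j) x * u $ i * v $ j * w $ l)
      = ip (fd G x w) u v"
  proof -
    have "ip (fd G x w) u v = (\<Sum>i\<in>UNIV. \<Sum>j\<in>UNIV. \<Sum>l\<in>UNIV. partial_deriv l (\<lambda>y. G y $ i $ j) x * u $ i * v $ j * w $ l)"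
      by (simp add: ip_expand fdv sum_distrib_left sum_distrib_right mult_ac)
    also have "\<dots> = (\<Sum>i\<in>UNIV. \<Sum>l\<in>UNIV. \<Sum>j\<in>UNIV. partial_deriv l (\<lambda>y. G y $ i $ j) x * u $ i * v $ j * w $ l)"
      by (intro sum.cong refl sum.swap)
    also have "\<dots> = (\<Sum>l\<in>UNIV. \<Sum>i\<in>UNIV. \<Sum>j\<in>UNIV. partial_deriv l (\<lambda>y. G y $ i $ j) x * u $ i * v $ j * w $ l)"
      by (rule sum.swap)
    finally show ?thesis by simp
  qed
  finally show ?thesis .
qed

text \<open>Two instances of the Koszul formula add up to twice the derivative of G in the direction
  w; the other terms cancel.\<close>

lemma metric_compatible:
  assumes x: "x \<in> U"
  shows "ip (fd G x w) u v = ip (G x) (Gam G x w u) v + ip (G x) u (Gam G x w v)"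
  using koszul[OF x, where w = v and u = w and v = u] koszul[OF x, where w = u and u = w and v = v]
    ip_sym[OF x, of "Gam G x w u" v] dip_sym[OF x, where w = w and u = u and v = v]
    dip_sym[OF x, where w = u and u = w and v = v] dip_sym[OF x, where w = v and u = w and v = u] by simp

lemma Gam_has_derivative:
  assumes x: "x y \<in> U" "(x has_derivative x') (at y within S)"
    and u: "(u has_derivative u') (at y within S)" and v: "(v has_derivative v') (at y within S)"
  shows "((\<lambda>y. Gam G (x y) (u y) (v y)) has_derivative
    (\<lambda>h. dGam G (x y) (x' h) (u y) (v y) + Gam G (x y) (u' h) (v y) + Gam G (x y) (u y) (v' h))) (at y within S)"
proof -
  have c: "((\<lambda>y. chr G (x y) k i j) has_derivative (\<lambda>h. fd (\<lambda>z. chr G z k i j) (x y) (x' h))) (at y within S)" for k i j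
    by (rule has_derivative_compose[OF x(2) C1_onD[OF chr_C1 x(1)]])
  have comp: "((\<lambda>y. w y $ i) has_derivative (\<lambda>h. w' h $ i)) (at y within S)"
    if "(w has_derivative w') (at y within S)" for w w' i
    by (rule bounded_linear.has_derivative[OF bounded_linear_vec_nth that])
  have "((\<lambda>y. \<Sum>k\<in>UNIV. (\<Sum>i\<in>UNIV. \<Sum>j\<in>UNIV. chr G (x y) k i j * u y $ i * v y $ j) *\<^sub>R (axis k 1 :: real^'n)) has_derivative
     (\<lambda>h. \<Sum>k\<in>UNIV. (\<Sum>i\<in>UNIV. \<Sum>j\<in>UNIV. (chr G (x y) k i j * u y $ i) * v' h $ j +
        (chr G (x y) k i j * u' h $ i + fd (\<lambda>z. chr G z k i j) (x y) (x' h) * u y $ i) * v y $ j) *\<^sub>R axis k 1)) (at y within S)"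
    by (intro has_derivative_sum bounded_linear.has_derivative[OF bounded_linear_scaleR_left]
        bounded_bilinear.FDERIV[OF bounded_bilinear_mult] c comp u v)
  moreover have "(\<Sum>k\<in>UNIV. f k *\<^sub>R axis k 1) = ((\<chi> k. f k) :: real^'n)" for f :: "'n \<Rightarrow> real"
    by (simp add: Finite_Cartesian_Product.vec_eq_iff axis_def if_distrib sum.delta cong: if_cong)
  ultimately have "((\<lambda>y. Gam G (x y) (u y) (v y)) has_derivative
     (\<lambda>h. \<chi> k. \<Sum>i\<in>UNIV. \<Sum>j\<in>UNIV. (chr G (x y) k i j * u y $ i) * v' h $ j +
        (chr G (x y) k i j * u' h $ i + fd (\<lambda>z. chr G z k i j) (x y) (x' h) * u y $ i) * v y $ j)) (at y within S)"
    by (simp add: Gam_def)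
  moreover have "(\<chi> k. \<Sum>i\<in>UNIV. \<Sum>j\<in>UNIV. (chr G (x y) k i j * u y $ i) * v' h $ j +
        (chr G (x y) k i j * u' h $ i + fd (\<lambda>z. chr G z k i j) (x y) (x' h) * u y $ i) * v y $ j)
     = dGam G (x y) (x' h) (u y) (v y) + Gam G (x y) (u' h) (v y) + Gam G (x y) (u y) (v' h)" for h
    by (simp add: Finite_Cartesian_Product.vec_eq_iff Gam_def dGam_def sum.distrib[symmetric] algebra_simps)
  ultimately show ?thesis by simp
qed

lemma dGam_linear_dir: "x \<in> U \<Longrightarrow> linear (\<lambda>w. dGam G x w u v)"
proof (rule linearI)
  assume x: "x \<in> U"
  note l = C1_on_linear[OF chr_C1 x]
  show "dGam G x (a + b) u v = dGam G x a u v + dGam G x b u v" for a b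
    by (simp add: Finite_Cartesian_Product.vec_eq_iff dGam_def linear_add[OF l] sum.distrib[symmetric] algebra_simps)
  show "dGam G x (c *\<^sub>R a) u v = c *\<^sub>R dGam G x a u v" for c a
    by (simp add: Finite_Cartesian_Product.vec_eq_iff dGam_def linear_cmul[OF l] sum_distrib_left algebra_simps)
qed

lemma Gam_continuous:
  assumes "continuous_on K x" "x ` K \<subseteq> U" "continuous_on K u" "continuous_on K v"
  shows "continuous_on K (\<lambda>t. Gam G (x t) (u t) (v t))"
proof -
  have "continuous_on K (\<lambda>t. chr G (x t) k i j)" for k i j
    using continuous_on_compose2[OF C1_on_continuous[OF chr_C1] assms(1,2)] by simp
  then have "continuous_on K (\<lambda>t. \<Sum>i\<in>UNIV. \<Sum>j\<in>UNIV. chr G (x t) k i j * u t $ i * v t $ j)" for k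
    by (intro continuous_on_sum continuous_on_mult continuous_on_component assms)
  then show ?thesis unfolding Gam_def by (rule continuous_on_vec_lambda)
qed

lemma Gam_C1:
  assumes x: "C1_on x S" "x ` S \<subseteq> U" and u: "C1_on u S" and v: "C1_on v S"
  shows "C1_on (\<lambda>y. Gam G (x y) (u y) (v y)) S"
proof -
  have "C1_on (\<lambda>y. chr G (x y) k i j) S" for k i j
    by (rule C1_on_compose(1)[OF x(1) chr_C1 x(2)])
  then show ?thesis unfolding Gam_def
    by (intro C1_on_vec C1_on_sum C1_on_mult C1_on_component u v)
qed

text \<open>For constant Z the second derivative of g(Z, Z) is symmetric in its two directions. By
  \<open>metric_compatible\<close> it equals twice the product of Z with the terms
  \<open>dGam\<close> and \<open>Gam\<close> of \<open>Gam\<close>, plus a symmetric term, so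
  exchanging X and Y and subtracting leaves 2 g(R(X, Y)Z, Z).\<close>

lemma curv_ip_zero:
  assumes x: "x \<in> U"
  shows "ip (G x) (curv G x X Y Z) Z = 0"
proof -
  have H: "(\<Sum>i\<in>UNIV. \<Sum>j\<in>UNIV. fd (\<lambda>y. fd (\<lambda>y. G y $ i $ j) y w) x z * Z $ i * Z $ j)
     = 2 * (ip (G x) (dGam G x z w Z + Gam G x z (Gam G x w Z)) Z + ip (G x) (Gam G x w Z) (Gam G x z Z))" for w z
  proof -
    let ?f = "\<lambda>y. ip (fd G y w) Z Z" and ?g = "\<lambda>y. 2 * ip (G y) (Gam G y w Z) Z"
    have eq: "?f y = ?g y" if "y \<in> U" for y
      using metric_compatible[OF that, where w = w and u = Z and v = Z] ip_sym[OF that, of Z "Gam G y w Z"] by simp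
    have fc: "C1_on (\<lambda>y. fd (\<lambda>y. G y $ i $ j) y w) U" for i j
      by (rule Ck2_on_fd_C1[OF C2' open_U])
    have "((\<lambda>y. \<Sum>i\<in>UNIV. \<Sum>j\<in>UNIV. fd (\<lambda>y. G y $ i $ j) y w * Z $ i * Z $ j) has_derivative
      (\<lambda>z. \<Sum>i\<in>UNIV. \<Sum>j\<in>UNIV. fd (\<lambda>y. fd (\<lambda>y. G y $ i $ j) y w) x z * Z $ i * Z $ j)) (at x)"
      by (intro has_derivative_sum bounded_linear.has_derivative[OF bounded_linear_mult_left] C1_onD[OF fc x])
    then have 1: "(?f has_derivative (\<lambda>z. \<Sum>i\<in>UNIV. \<Sum>j\<in>UNIV. fd (\<lambda>y. fd (\<lambda>y. G y $ i $ j) y w) x z * Z $ i * Z $ j)) (at x)"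
      by (rule has_derivative_transform_within_open[OF _ open_U x]) (simp add: ip_expand fd_G_entry)
    have "((\<lambda>y. Gam G y w Z) has_derivative (\<lambda>h. dGam G x h w Z + Gam G x 0 Z + Gam G x w 0)) (at x)"
      by (rule Gam_has_derivative) (auto simp: x)
    moreover have "Gam G x 0 Z = 0" "Gam G x w 0 = 0" by (simp_all add: Gam_def Finite_Cartesian_Product.vec_eq_iff)
    ultimately have dG: "((\<lambda>y. Gam G y w Z) has_derivative (\<lambda>h. dGam G x h w Z)) (at x)" by simp
    have dM: "((\<lambda>y. G y *v Z) has_derivative (\<lambda>h. fd G x h *v Z)) (at x)"
      by (rule bounded_linear.has_derivative[OF bounded_bilinear.bounded_linear_left[OF bounded_bilinear_matrix_vector] C1_onD[OF G_C1 x]])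
    have 2: "(?g has_derivative (\<lambda>z. 2 * (Gam G x w Z \<bullet> (fd G x z *v Z) + dGam G x z w Z \<bullet> (G x *v Z)))) (at x)"
      by (intro bounded_linear.has_derivative[OF bounded_linear_mult_right] has_derivative_inner dG dM)
    have "(?g has_derivative (\<lambda>z. \<Sum>i\<in>UNIV. \<Sum>j\<in>UNIV. fd (\<lambda>y. fd (\<lambda>y. G y $ i $ j) y w) x z * Z $ i * Z $ j)) (at x)"
      by (rule has_derivative_transform_within_open[OF 1 open_U x eq])
    from has_derivative_unique[OF this 2]
    have "(\<Sum>i\<in>UNIV. \<Sum>j\<in>UNIV. fd (\<lambda>y. fd (\<lambda>y. G y $ i $ j) y w) x z * Z $ i * Z $ j)
      = 2 * (Gam G x w Z \<bullet> (fd G x z *v Z) + dGam G x z w Z \<bullet> (G x *v Z))"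
      by (rule fun_cong)
    then show ?thesis
      using metric_compatible[OF x, where w = z and u = "Gam G x w Z" and v = Z] by (simp add: ip_bilinear algebra_simps)
  qed
  have swap: "fd (\<lambda>y. fd (\<lambda>y. G y $ i $ j) y w) x z = fd (\<lambda>y. fd (\<lambda>y. G y $ i $ j) y z) x w" for w z i j
    by (rule second_derivative_symmetric[OF open_U x entry_C1 Ck2_on_fd_C1[OF C2' open_U]])
  have "(\<Sum>i\<in>UNIV. \<Sum>j\<in>UNIV. fd (\<lambda>y. fd (\<lambda>y. G y $ i $ j) y X) x Y * Z $ i * Z $ j)
    = (\<Sum>i\<in>UNIV. \<Sum>j\<in>UNIV. fd (\<lambda>y. fd (\<lambda>y. G y $ i $ j) y Y) x X * Z $ i * Z $ j)"
    by (intro sum.cong refl) (simp only: swap[where w = X and z = Y])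
  then show ?thesis
    unfolding H curv_def using ip_sym[OF x, of "Gam G x X Z" "Gam G x Y Z"] by (simp add: ip_bilinear)
qed

lemma curv_linear: "x \<in> U \<Longrightarrow> linear (\<lambda>Y. curv G x X Y Z)"
proof (rule linearI)
  assume x: "x \<in> U"
  show "curv G x X (a + b) Z = curv G x X a Z + curv G x X b Z" for a b
    using linear_add[OF dGam_linear_dir[OF x, of X Z], of a b] by (simp add: curv_def dGam_linear Gam_linear)
  show "curv G x X (c *\<^sub>R a) Z = c *\<^sub>R curv G x X a Z" for c a
    using linear_cmul[OF dGam_linear_dir[OF x, of X Z], of c a] by (simp add: curv_def dGam_linear Gam_linear algebra_simps)
qed

lemma curv_comp:
  assumes x: "x \<in> U"
  shows "curv G x X Y Z = (\<chi> l. \<Sum>i\<in>UNIV. \<Sum>j\<in>UNIV. \<Sum>k\<in>UNIV.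
     (partial_deriv j (\<lambda>y. chr G y l i k) x
      - partial_deriv i (\<lambda>y. chr G y l j k) x
      + (\<Sum>m\<in>UNIV. chr G x l j m * chr G x m i k
                  - chr G x l i m * chr G x m j k))
     * X $ i * Y $ j * Z $ k)"
proof -
  have fdv: "fd (\<lambda>y. chr G y l i k) x w = (\<Sum>j\<in>UNIV. partial_deriv j (\<lambda>y. chr G y l i k) x * w $ j)" for l i k w
  proof -
    note lin = C1_on_linear[OF chr_C1 x]
    show ?thesis
      by (subst basis_expansion[symmetric, of w])
        (simp only: linear_sum[OF lin] linear_cmul[OF lin] scalar_mult_eq_scaleR partial_deriv_def real_scaleR_def mult.commute)
  qed
  have "curv G x X Y Z $ l = (\<Sum>i\<in>UNIV. \<Sum>j\<in>UNIV. \<Sum>k\<in>UNIV.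
     (partial_deriv j (\<lambda>y. chr G y l i k) x
      - partial_deriv i (\<lambda>y. chr G y l j k) x
      + (\<Sum>m\<in>UNIV. chr G x l j m * chr G x m i k
                  - chr G x l i m * chr G x m j k))
     * X $ i * Y $ j * Z $ k)" for l
  proof -
    have t1: "dGam G x Y X Z $ l = (\<Sum>i\<in>UNIV. \<Sum>j\<in>UNIV. \<Sum>k\<in>UNIV. partial_deriv j (\<lambda>y. chr G y l i k) x * X $ i * Y $ j * Z $ k)" for X Y
    proof -
      have "dGam G x Y X Z $ l = (\<Sum>i\<in>UNIV. \<Sum>k\<in>UNIV. \<Sum>j\<in>UNIV. partial_deriv j (\<lambda>y. chr G y l i k) x * X $ i * Y $ j * Z $ k)"
        by (simp add: dGam_def fdv sum_distrib_left sum_distrib_right mult_ac)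
      also have "\<dots> = (\<Sum>i\<in>UNIV. \<Sum>j\<in>UNIV. \<Sum>k\<in>UNIV. partial_deriv j (\<lambda>y. chr G y l i k) x * X $ i * Y $ j * Z $ k)"
        by (intro sum.cong refl sum.swap)
      finally show ?thesis .
    qed
    have t2: "Gam G x Y (Gam G x X Z) $ l = (\<Sum>i\<in>UNIV. \<Sum>j\<in>UNIV. \<Sum>k\<in>UNIV. \<Sum>m\<in>UNIV. chr G x l j m * chr G x m i k * X $ i * Y $ j * Z $ k)" for X Y
    proof -
      have "Gam G x Y (Gam G x X Z) $ l = (\<Sum>j\<in>UNIV. \<Sum>m\<in>UNIV. \<Sum>i\<in>UNIV. \<Sum>k\<in>UNIV. chr G x l j m * chr G x m i k * X $ i * Y $ j * Z $ k)"
        by (simp add: Gam_def sum_distrib_left sum_distrib_right mult_ac)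
      also have "\<dots> = (\<Sum>j\<in>UNIV. \<Sum>i\<in>UNIV. \<Sum>m\<in>UNIV. \<Sum>k\<in>UNIV. chr G x l j m * chr G x m i k * X $ i * Y $ j * Z $ k)"
        by (intro sum.cong refl sum.swap)
      also have "\<dots> = (\<Sum>j\<in>UNIV. \<Sum>i\<in>UNIV. \<Sum>k\<in>UNIV. \<Sum>m\<in>UNIV. chr G x l j m * chr G x m i k * X $ i * Y $ j * Z $ k)"
        by (intro sum.cong refl sum.swap)
      also have "\<dots> = (\<Sum>i\<in>UNIV. \<Sum>j\<in>UNIV. \<Sum>k\<in>UNIV. \<Sum>m\<in>UNIV. chr G x l j m * chr G x m i k * X $ i * Y $ j * Z $ k)"
        by (rule sum.swap)
      finally show ?thesis .
    qed
    have s1: "dGam G x X Y Z $ l = (\<Sum>i\<in>UNIV. \<Sum>j\<in>UNIV. \<Sum>k\<in>UNIV. partial_deriv i (\<lambda>y. chr G y l j k) x * X $ i * Y $ j * Z $ k)"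
      unfolding t1 by (subst sum.swap) (simp add: mult_ac)
    have s2: "Gam G x X (Gam G x Y Z) $ l = (\<Sum>i\<in>UNIV. \<Sum>j\<in>UNIV. \<Sum>k\<in>UNIV. \<Sum>m\<in>UNIV. chr G x l i m * chr G x m j k * X $ i * Y $ j * Z $ k)"
      unfolding t2 by (subst sum.swap) (simp add: mult_ac)
    show ?thesis
      unfolding curv_def vector_add_component vector_minus_component t1[of Y X] s1 t2[of Y X] s2
      unfolding sum.distrib[symmetric] sum_subtractf[symmetric]
      by (intro sum.cong refl) (simp add: algebra_simps sum_distrib_left sum_distrib_right sum_subtractf sum.distrib)
  qed
  then show ?thesis by (simp add: Finite_Cartesian_Product.vec_eq_iff)
qed

end

section \<open>Charts, tangent vectors and covariant derivatives\<close>

locale lorentz =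
  fixes A :: "('m::{t2_space, second_countable_topology}, 'n::finite) chart set"
    and g :: "('m, 'n) metric" and T :: "'m \<Rightarrow> ('m, 'n) tvec"
  assumes lm: "lorentzian_manifold A g T"
begin

abbreviation dom :: "('m, 'n) chart \<Rightarrow> (real^'n) set" where "dom c \<equiv> snd c ` fst c"
abbreviation G :: "('m, 'n) chart \<Rightarrow> real^'n \<Rightarrow> real^'n^'n" where "G \<equiv> gram A g"
abbreviation TS :: "'m \<Rightarrow> ('m, 'n) tvec set" where "TS \<equiv> tangent_space A"

definition tdom :: "('m, 'n) chart \<Rightarrow> ('m, 'n) chart \<Rightarrow> (real^'n) set" where
  "tdom c d = snd c ` (fst c \<inter> fst d)"

text \<open>The inverse of reading off a tangent vector at q in the chart c, as
  \<open>tv_self\<close> and \<open>TS_tv\<close> show.\<close>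

definition tv :: "('m, 'n) chart \<Rightarrow> 'm \<Rightarrow> real^'n \<Rightarrow> ('m, 'n) tvec" where
  "tv c q w = (\<lambda>d. if d \<in> A \<and> q \<in> fst d then fd (transition c d) (snd c q) w else 0)"

lemma atlas: "smooth_atlas A" using lm by (simp add: lorentzian_manifold_def)

lemma chart_ex: obtains c where "c \<in> A" "q \<in> fst c"
  using atlas unfolding smooth_atlas_def by blast

lemma chart_open: "c \<in> A \<Longrightarrow> open (fst c)" "c \<in> A \<Longrightarrow> open (dom c)"
  and chart_homeo: "c \<in> A \<Longrightarrow> homeomorphism (fst c) (dom c) (snd c) (chart_inv c)"
  using atlas unfolding smooth_atlas_def by blast+

lemma chart_inv_simps:
  assumes "c \<in> A"
  shows "q \<in> fst c \<Longrightarrow> chart_inv c (snd c q) = q"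
    "x \<in> dom c \<Longrightarrow> snd c (chart_inv c x) = x" "x \<in> dom c \<Longrightarrow> chart_inv c x \<in> fst c"
  using chart_homeo[OF assms] unfolding homeomorphism_def by auto

lemma chart_cont: "c \<in> A \<Longrightarrow> continuous_on (fst c) (snd c)" "c \<in> A \<Longrightarrow> continuous_on (dom c) (chart_inv c)"
  using chart_homeo unfolding homeomorphism_def by auto

lemma tdom_eq: "c \<in> A \<Longrightarrow> tdom c d = dom c \<inter> chart_inv c -` fst d"
  using chart_inv_simps[of c] unfolding tdom_def by (auto intro!: image_eqI)

lemma tdom_open: "c \<in> A \<Longrightarrow> d \<in> A \<Longrightarrow> open (tdom c d)"
  unfolding tdom_eq using continuous_open_preimage[OF chart_cont(2) chart_open(2)] chart_open(1) by blast

lemma trans_apply: "c \<in> A \<Longrightarrow> q \<in> fst c \<Longrightarrow> transition c d (snd c q) = snd d q"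
  by (simp add: transition_def chart_inv_simps)

lemma tdomI: "q \<in> fst c \<Longrightarrow> q \<in> fst d \<Longrightarrow> snd c q \<in> tdom c d" by (auto simp: tdom_def)

lemma trans_Ck: "c \<in> A \<Longrightarrow> d \<in> A \<Longrightarrow> Ck_on k (transition c d) (tdom c d)"
  using atlas unfolding smooth_atlas_def tdom_def by blast

lemma trans_C1: "c \<in> A \<Longrightarrow> d \<in> A \<Longrightarrow> C1_on (transition c d) (tdom c d)"
  by (rule Ck_on_C1[OF trans_Ck tdom_open])

lemma trans_fd_C1: "c \<in> A \<Longrightarrow> d \<in> A \<Longrightarrow> C1_on (\<lambda>x. fd (transition c d) x v) (tdom c d)"
  by (rule Ck2_on_fd_C1[OF trans_Ck tdom_open])

lemma trans_linear: "c \<in> A \<Longrightarrow> d \<in> A \<Longrightarrow> q \<in> fst c \<Longrightarrow> q \<in> fst d \<Longrightarrow> linear (fd (transition c d) (snd c q))"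
  using C1_on_linear[OF trans_C1 tdomI] .

lemma trans_cocycle:
  assumes "c \<in> A" "d \<in> A" "e \<in> A" "q \<in> fst c" "q \<in> fst d" "q \<in> fst e"
  shows "fd (transition d e) (snd d q) (fd (transition c d) (snd c q) v) = fd (transition c e) (snd c q) v"
proof -
  let ?N = "tdom c d \<inter> tdom c e"
  have q: "snd c q \<in> ?N" using assms by (auto intro: tdomI)
  have N: "open ?N" using assms by (intro open_Int tdom_open)
  have img: "transition c d ` ?N \<subseteq> tdom d e"
    using assms chart_inv_simps[of c] by (auto simp: tdom_def trans_apply) (metis IntI image_eqI)
  have "fd (\<lambda>x. transition d e (transition c d x)) (snd c q)
      = (\<lambda>v. fd (transition d e) (transition c d (snd c q)) (fd (transition c d) (snd c q) v))"
    by (rule C1_on_compose(2)[OF C1_on_subset[OF trans_C1] trans_C1 img q]) (use assms in auto)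
  moreover have "fd (\<lambda>x. transition d e (transition c d x)) (snd c q) = fd (transition c e) (snd c q)"
  proof (rule fd_cong[OF N _ q])
    fix x assume "x \<in> ?N"
    then obtain p where p: "p \<in> fst c" "p \<in> fst d" "x = snd c p" by (auto simp: tdom_def)
    then show "transition d e (transition c d x) = transition c e x"
      using assms by (simp add: trans_apply)
  qed
  ultimately have "fd (transition c e) (snd c q) = (\<lambda>v. fd (transition d e) (snd d q) (fd (transition c d) (snd c q) v))"
    using assms by (simp add: trans_apply)
  then show ?thesis by simp
qed

lemma trans_self: "c \<in> A \<Longrightarrow> q \<in> fst c \<Longrightarrow> fd (transition c c) (snd c q) v = v"
proof -
  assume c: "c \<in> A" "q \<in> fst c"
  have "fd (transition c c) (snd c q) = fd (\<lambda>x. x) (snd c q)"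
    by (rule fd_cong[OF tdom_open[OF c(1) c(1)]]) (use c in \<open>auto simp: tdom_def trans_apply\<close>)
  also have "\<dots> = (\<lambda>x. x)" by (rule fd_eq) simp
  finally show ?thesis by simp
qed

lemma TS_iff:
  "v \<in> TS q \<longleftrightarrow> (\<forall>c\<in>A. \<forall>d\<in>A. q \<in> fst c \<inter> fst d \<longrightarrow> v d = fd (transition c d) (snd c q) (v c)) \<and>
     (\<forall>c. \<not> (c \<in> A \<and> q \<in> fst c) \<longrightarrow> v c = 0)"
  by (simp add: tangent_space_def)

lemma tv_TS: "c \<in> A \<Longrightarrow> q \<in> fst c \<Longrightarrow> tv c q w \<in> TS q"
  unfolding TS_iff tv_def by (simp add: trans_cocycle linear_0[OF trans_linear])

lemma tv_self: "c \<in> A \<Longrightarrow> q \<in> fst c \<Longrightarrow> tv c q w c = w"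
  by (simp add: tv_def trans_self)

lemma TS_trans: "v \<in> TS q \<Longrightarrow> c \<in> A \<Longrightarrow> d \<in> A \<Longrightarrow> q \<in> fst c \<Longrightarrow> q \<in> fst d \<Longrightarrow>
    v d = fd (transition c d) (snd c q) (v c)"
  unfolding TS_iff by blast

lemma TS_tv:
  assumes "v \<in> TS q" "c \<in> A" "q \<in> fst c"
  shows "tv c q (v c) = v"
proof
  fix d
  have "v d = 0" if "\<not> (d \<in> A \<and> q \<in> fst d)"
    using assms(1) that unfolding TS_iff by blast
  then show "tv c q (v c) d = v d"
    using TS_trans[OF assms(1,2) _ assms(3)] by (auto simp: tv_def)
qed

lemma TS_eqI: "v \<in> TS q \<Longrightarrow> w \<in> TS q \<Longrightarrow> c \<in> A \<Longrightarrow> q \<in> fst c \<Longrightarrow> v c = w c \<Longrightarrow> v = w"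
  using TS_tv by metis

lemma TS_zero [simp]: "tzero \<in> TS q"
  unfolding TS_iff tzero_def using trans_linear linear_0 by (metis IntE)

lemma TS_scale: "v \<in> TS q \<Longrightarrow> tscale r v \<in> TS q"
  unfolding TS_iff tscale_def using linear_cmul[OF trans_linear] by (metis IntE scale_zero_right)

lemma TS_add: "v \<in> TS q \<Longrightarrow> w \<in> TS q \<Longrightarrow> tadd v w \<in> TS q"
  unfolding TS_iff tadd_def using linear_add[OF trans_linear] by (metis IntE add_0)

lemma TS_sum: "(\<And>i. i \<in> I \<Longrightarrow> e i \<in> TS q) \<Longrightarrow> (\<lambda>c. \<Sum>i\<in>I. a i *\<^sub>R e i c) \<in> TS q"
proof (induction I rule: infinite_finite_induct)
  case (insert x F)
  then show ?case using TS_add[OF TS_scale[of "e x" q "a x"], of "\<lambda>c. \<Sum>i\<in>F. a i *\<^sub>R e i c"]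
    by (simp add: tadd_def tscale_def)
qed (use TS_zero in \<open>auto simp: tzero_def\<close>)

lemma coord_vec_tv: "coord_vec A c q i = tv c q (axis i 1)"
  by (simp add: coord_vec_def tv_def)

lemma tv_linear:
  assumes "c \<in> A" "q \<in> fst c"
  shows "tv c q (a *\<^sub>R u + b *\<^sub>R v) = tadd (tscale a (tv c q u)) (tscale b (tv c q v))"
  using assms linear_add[OF trans_linear] linear_cmul[OF trans_linear]
  by (auto simp: fun_eq_iff tv_def tadd_def tscale_def)

section \<open>The metric and its connection across charts\<close>

lemma lorentz_form: "lorentz_form A g q" using lm by (simp add: lorentzian_manifold_def)

lemma g_sym: "u \<in> TS q \<Longrightarrow> v \<in> TS q \<Longrightarrow> g q u v = g q v u"
  using lorentz_form[of q] by (simp add: lorentz_form_def)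

lemma g_lin: "u \<in> TS q \<Longrightarrow> v \<in> TS q \<Longrightarrow> w \<in> TS q \<Longrightarrow>
    g q (tadd (tscale a u) (tscale b v)) w = a * g q u w + b * g q v w"
  using lorentz_form[of q] by (simp add: lorentz_form_def)

lemma g_chart:
  assumes u: "u \<in> TS q" and v: "v \<in> TS q" and c: "c \<in> A" "q \<in> fst c"
  shows "g q u v = ip (G c (snd c q)) (u c) (v c)"
proof -
  have lin: "linear (\<lambda>x. g q (tv c q x) w)" if "w \<in> TS q" for w
  proof (rule linearI)
    show "g q (tv c q (x + y)) w = g q (tv c q x) w + g q (tv c q y) w" for x y
      using g_lin[OF tv_TS[OF c, of x] tv_TS[OF c, of y] that, of 1 1] tv_linear[OF c, of 1 x 1 y] by simp
    show "g q (tv c q (r *\<^sub>R x)) w = r *\<^sub>R g q (tv c q x) w" for r x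
      using g_lin[OF tv_TS[OF c, of x] tv_TS[OF c, of x] that, of r 0] tv_linear[OF c, of r x 0 x] by simp
  qed
  have ex: "g q (tv c q x) w = (\<Sum>i\<in>UNIV. x $ i * g q (tv c q (axis i 1)) w)" if "w \<in> TS q" for x w
    by (subst basis_expansion[symmetric, of x])
      (simp only: linear_sum[OF lin[OF that]] linear_cmul[OF lin[OF that]] scalar_mult_eq_scaleR real_scaleR_def)
  have "g q u v = (\<Sum>i\<in>UNIV. u c $ i * g q (tv c q (axis i 1)) v)"
    using ex[OF v, of "u c"] TS_tv[OF u c] by simp
  also have "\<dots> = (\<Sum>i\<in>UNIV. u c $ i * (\<Sum>j\<in>UNIV. v c $ j * g q (tv c q (axis i 1)) (tv c q (axis j 1))))"
  proof (intro sum.cong refl arg_cong2[where f = "(*)"])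
    fix i
    have "g q (tv c q (axis i 1)) v = g q (tv c q (v c)) (tv c q (axis i 1))"
      using g_sym[OF tv_TS[OF c] v] TS_tv[OF v c] by simp
    also have "\<dots> = (\<Sum>j\<in>UNIV. v c $ j * g q (tv c q (axis j 1)) (tv c q (axis i 1)))"
      by (rule ex[OF tv_TS[OF c]])
    finally show "g q (tv c q (axis i 1)) v = (\<Sum>j\<in>UNIV. v c $ j * g q (tv c q (axis i 1)) (tv c q (axis j 1)))"
      using g_sym[OF tv_TS[OF c] tv_TS[OF c]] by simp
  qed
  finally show ?thesis
    by (simp add: ip_expand gram_def chart_inv_simps c coord_vec_tv sum_distrib_left mult_ac)
qed

lemma metric_chart: assumes c: "c \<in> A" shows "metric_chart (dom c) (G c)"
proof
  show "open (dom c)" by (rule chart_open(2)[OF c])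
  show "Ck_on 2 (\<lambda>x. G c x $ i $ j) (dom c)" for i j
    using lm c by (simp add: lorentzian_manifold_def)
  fix x assume x: "x \<in> dom c"
  define q where "q = chart_inv c x"
  have q: "q \<in> fst c" "x = snd c q" using chart_inv_simps[OF c] x by (auto simp: q_def)
  show "G c x $ i $ j = G c x $ j $ i" for i j
    unfolding gram_def q_def[symmetric] using g_sym[OF tv_TS[OF c q(1)] tv_TS[OF c q(1)]] by (simp add: coord_vec_tv)
  obtain b :: "'n \<Rightarrow> ('m, 'n) tvec" and i0 where b: "\<And>i. b i \<in> TS q" "\<And>i j. g q (b i) (b j) = (if i \<noteq> j then 0 else if i = i0 then -1 else 1)"
    using lorentz_form[of q] unfolding lorentz_form_def by blast
  \<comment> \<open>With the orthonormal basis as columns of B, the matrix B^T G B is diagonal with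
    entries 1 and -1, so det G is nonzero.\<close>
  let ?B = "(\<chi> i j. b j c $ i) :: real^'n^'n"
  let ?D = "Finite_Cartesian_Product.transpose ?B ** (G c x ** ?B)"
  have D: "?D $ i $ j = g q (b i) (b j)" for i j
    unfolding g_chart[OF b(1) b(1) c q(1)] q(2)[symmetric] ip_expand
    by (simp add: matrix_matrix_mult_def Finite_Cartesian_Product.transpose_def sum_distrib_left mult_ac)
  have "Determinants.det ?D = (\<Prod>i\<in>UNIV. ?D $ i $ i)"
    by (rule Determinants.det_diagonal) (simp only: D b(2) simp_thms if_True)
  also have "\<dots> \<noteq> 0" by (simp only: D b(2) prod_zero_iff finite) auto
  finally have "Determinants.det (G c x) \<noteq> 0"
    by (auto simp: Determinants.det_mul)
  then show "invertible (G c x)" by (simp add: invertible_det_nz)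
qed

lemma christoffel_chr: "christoffel A g c = chr (G c)"
  by (simp add: fun_eq_iff christoffel_def chr_def)

lemma curvature_curv:
  assumes "c \<in> A" "q \<in> fst c"
  shows "curvature A g q X Y Z c = curv (G c) (snd c q) (X c) (Y c) (Z c)"
  using assms metric_chart.curv_comp[OF metric_chart[OF assms(1)], of "snd c q"]
  by (simp add: curvature_def curvature_comp_def christoffel_chr)

lemma has_cov_deriv_iff:
  "has_cov_deriv A g I \<gamma> V DV t \<longleftrightarrow> (\<forall>s\<in>I. V s \<in> TS (\<gamma> s)) \<and> DV \<in> TS (\<gamma> t) \<and>
     (\<forall>c\<in>A. \<gamma> t \<in> fst c \<longrightarrow> (\<exists>\<gamma>' V'.
        ((\<lambda>s. snd c (\<gamma> s)) has_vector_derivative \<gamma>') (at t within I) \<and>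
        ((\<lambda>s. V s c) has_vector_derivative V') (at t within I) \<and>
        DV c = V' + Gam (G c) (snd c (\<gamma> t)) \<gamma>' (V t c)))"
  by (simp add: has_cov_deriv_def christoffel_chr Gam_def)

lemma ip_trans:
  assumes "c \<in> A" "d \<in> A" "x \<in> tdom c d"
  shows "ip (G c x) u v = ip (G d (transition c d x)) (fd (transition c d) x u) (fd (transition c d) x v)"
proof -
  obtain q where q: "q \<in> fst c" "q \<in> fst d" "x = snd c q" using assms(3) by (auto simp: tdom_def)
  show ?thesis
    using g_chart[OF tv_TS[OF assms(1) q(1)] tv_TS[OF assms(1) q(1)] assms(1) q(1), of u v]
      g_chart[OF tv_TS[OF assms(1) q(1)] tv_TS[OF assms(1) q(1)] assms(2) q(2), of u v] assms q
    by (simp add: tv_self trans_apply) (simp add: tv_def)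
qed

lemma trans_second_sym:
  assumes "c \<in> A" "d \<in> A" "x \<in> tdom c d"
  shows "fd (\<lambda>y. fd (transition c d) y u) x v = fd (\<lambda>y. fd (transition c d) y v) x u"
proof -
  let ?f = "\<lambda>k y. transition c d y $ k"
  note o = tdom_open[OF assms(1,2)]
  have 1: "fd (?f k) y v = fd (transition c d) y v $ k" if "y \<in> tdom c d" for k y v
    by (rule fun_cong[OF fd_eq])
      (rule bounded_linear.has_derivative[OF bounded_linear_vec_nth C1_onD[OF trans_C1[OF assms(1,2)] that]])
  have 2: "C1_on (\<lambda>y. fd (?f k) y v) (tdom c d)" for k v
    by (subst C1_on_cong[OF o 1]) (simp_all add: C1_on_component[OF trans_fd_C1[OF assms(1,2)]])
  have 3: "fd (\<lambda>y. fd (?f k) y u) x v = fd (\<lambda>y. fd (transition c d) y u) x v $ k" for k u v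
  proof -
    have "fd (\<lambda>y. fd (?f k) y u) x = fd (\<lambda>y. fd (transition c d) y u $ k) x"
      by (rule fd_cong[OF o 1 assms(3)])
    also have "\<dots> = (\<lambda>v. fd (\<lambda>y. fd (transition c d) y u) x v $ k)"
      by (rule fd_eq)
        (rule bounded_linear.has_derivative[OF bounded_linear_vec_nth C1_onD[OF trans_fd_C1[OF assms(1,2)] assms(3)]])
    finally show ?thesis by simp
  qed
  have "fd (\<lambda>y. fd (?f k) y u) x v = fd (\<lambda>y. fd (?f k) y v) x u" for k
    by (rule second_derivative_symmetric[OF o assms(3) C1_on_component[OF trans_C1[OF assms(1,2)]] 2])
  then show ?thesis by (simp add: 3 Finite_Cartesian_Product.vec_eq_iff)
qed

text \<open>The transformation law of the Christoffel symbols. Both connections obey Koszul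
  formulas; differentiating the invariance \<open>ip_trans\<close> relates these up to second
  derivatives of the transition map, and the symmetry of the latter leaves just the inhomogeneous
  term.\<close>

lemma Gam_trans:
  assumes c: "c \<in> A" and d: "d \<in> A" and x: "x \<in> tdom c d"
  shows "fd (transition c d) x (Gam (G c) x u v)
    = Gam (G d) (transition c d x) (fd (transition c d) x u) (fd (transition c d) x v)
      + fd (\<lambda>y. fd (transition c d) y v) x u"
proof -
  interpret c: metric_chart "dom c" "G c" by (rule metric_chart[OF c])
  interpret d: metric_chart "dom d" "G d" by (rule metric_chart[OF d])
  let ?\<phi> = "transition c d"
  let ?J = "fd ?\<phi> x" and ?y = "?\<phi> x"
  obtain q where q: "q \<in> fst c" "q \<in> fst d" "x = snd c q" using x by (auto simp: tdom_def)
  have xc: "x \<in> dom c" using q by auto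
  have y: "?y = snd d q" "?y \<in> dom d" using q c by (auto simp: trans_apply)
  note o = tdom_open[OF c d]
  have lin: "linear ?J" by (rule C1_on_linear[OF trans_C1[OF c d] x])
  define H where "H w u = fd (\<lambda>y. fd ?\<phi> y u) x w" for w u
  have Hsym: "H u w = H w u" for u w unfolding H_def by (rule trans_second_sym[OF c d x])
  have der: "ip (fd (G c) x w) u v = ip (fd (G d) ?y (?J w)) (?J u) (?J v)
      + ip (G d ?y) (H w u) (?J v) + ip (G d ?y) (?J u) (H w v)" for u v w
  proof -
    have 1: "((\<lambda>y. ip (G c y) u v) has_derivative (\<lambda>w. ip (fd (G c) x w) u v)) (at x)"
      by (intro bounded_linear.has_derivative[OF bounded_linear_inner_right]
          bounded_linear.has_derivative[OF bounded_bilinear.bounded_linear_left[OF bounded_bilinear_matrix_vector]]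
          C1_onD[OF c.G_C1 xc])
    have dG: "((\<lambda>y. G d (?\<phi> y)) has_derivative (\<lambda>w. fd (G d) ?y (?J w))) (at x)"
      by (rule has_derivative_compose[OF C1_onD[OF trans_C1[OF c d] x] C1_onD[OF d.G_C1 y(2)]])
    have dJ: "((\<lambda>y. fd ?\<phi> y u) has_derivative (\<lambda>w. H w u)) (at x)" for u
      unfolding H_def by (rule C1_onD[OF trans_fd_C1[OF c d] x])
    have 2: "((\<lambda>y. ip (G d (?\<phi> y)) (fd ?\<phi> y u) (fd ?\<phi> y v)) has_derivative
       (\<lambda>w. ?J u \<bullet> (G d ?y *v H w v + fd (G d) ?y (?J w) *v ?J v) + H w u \<bullet> (G d ?y *v ?J v))) (at x)"
      by (intro has_derivative_inner dJ bounded_bilinear.FDERIV[OF bounded_bilinear_matrix_vector dG])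
    have "((\<lambda>y. ip (G c y) u v) has_derivative
       (\<lambda>w. ?J u \<bullet> (G d ?y *v H w v + fd (G d) ?y (?J w) *v ?J v) + H w u \<bullet> (G d ?y *v ?J v))) (at x)"
      by (rule has_derivative_transform_within_open[OF 2 o x]) (simp add: ip_trans[OF c d])
    from fun_cong[OF has_derivative_unique[OF 1 this], of w] show ?thesis
      by (simp add: inner_add_right)
  qed
  define s where "s = ?J (Gam (G c) x u v) - (Gam (G d) ?y (?J u) (?J v) + H u v)"
  have "ip (G d ?y) (?J w) s = 0" for w
  proof -
    have "2 * ip (G d ?y) (?J w) (?J (Gam (G c) x u v)) = ip (fd (G c) x u) v w + ip (fd (G c) x v) u w - ip (fd (G c) x w) u v"
      using c.koszul[OF xc, of w u v] ip_trans[OF c d x] by simp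
    also have "\<dots> = 2 * ip (G d ?y) (?J w) (Gam (G d) ?y (?J u) (?J v)) + 2 * ip (G d ?y) (?J w) (H u v)"
      unfolding der using d.koszul[OF y(2), of "?J w" "?J u" "?J v"] Hsym[of u v] Hsym[of u w] Hsym[of v w]
        d.ip_sym[OF y(2), of "?J w" "H u v"] d.ip_sym[OF y(2), of "?J v" "H w u"] by simp
    finally show ?thesis unfolding s_def ip_bilinear by simp
  qed
  \<comment> \<open>Every w is in the range of J, by the transition map back from d to c.\<close>
  then have "ip (G d ?y) w s = 0" for w
    using trans_cocycle[OF d c d q(2,1,2), of w] trans_self[OF d q(2)] q(3) by metis
  from this[of "G d ?y *v s"] have z: "G d ?y *v s = 0" by simp
  have "inj ((*v) (G d ?y))" using d.inv[OF y(2)] invertible_left_inverse matrix_left_invertible_injective by blast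
  then have "s = 0" using z injD[of "(*v) (G d ?y)" s 0] by simp
  then show ?thesis by (simp add: s_def H_def)
qed

text \<open>\<open>has_cov_deriv\<close> demands its formula in all charts. One chart suffices,
  because the inhomogeneous term of \<open>Gam_trans\<close> cancels the second derivative of the
  transition map that arises when the components are differentiated.\<close>

lemma has_cov_derivI:
  assumes c: "c \<in> A" "\<gamma> t \<in> fst c" and t: "t \<in> I" and V: "\<And>s. s \<in> I \<Longrightarrow> V s \<in> TS (\<gamma> s)"
    and cont: "continuous (at t within I) \<gamma>"
    and d\<gamma>: "((\<lambda>s. snd c (\<gamma> s)) has_vector_derivative \<gamma>') (at t within I)"
    and dV: "((\<lambda>s. V s c) has_vector_derivative V') (at t within I)"
  shows "has_cov_deriv A g I \<gamma> V (tv c (\<gamma> t) (V' + Gam (G c) (snd c (\<gamma> t)) \<gamma>' (V t c))) t"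
proof -
  let ?w = "V' + Gam (G c) (snd c (\<gamma> t)) \<gamma>' (V t c)"
  have "\<exists>\<gamma>' V'. ((\<lambda>s. snd d (\<gamma> s)) has_vector_derivative \<gamma>') (at t within I) \<and>
        ((\<lambda>s. V s d) has_vector_derivative V') (at t within I) \<and>
        tv c (\<gamma> t) ?w d = V' + Gam (G d) (snd d (\<gamma> t)) \<gamma>' (V t d)" if d: "d \<in> A" "\<gamma> t \<in> fst d" for d
  proof -
    let ?\<phi> = "transition c d" and ?x = "snd c (\<gamma> t)"
    let ?J = "fd ?\<phi> ?x"
    have x: "?x \<in> tdom c d" using c d by (auto intro: tdomI)
    have lin: "linear ?J" by (rule C1_on_linear[OF trans_C1[OF c(1) d(1)] x])
    have "\<forall>\<^sub>F s in at t within I. \<gamma> s \<in> fst c \<inter> fst d"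
      using cont c d open_Int[OF chart_open(1)[OF c(1)] chart_open(1)[OF d(1)]]
      by (intro topological_tendstoD[of \<gamma> "\<gamma> t"]) (auto simp: continuous_within)
    then obtain e where e: "e > 0" "\<And>s. s \<in> I \<Longrightarrow> dist s t < e \<Longrightarrow> \<gamma> s \<in> fst c \<inter> fst d"
      using c d unfolding eventually_at by (metis IntI)
    have 1: "((\<lambda>s. snd d (\<gamma> s)) has_vector_derivative ?J \<gamma>') (at t within I)"
    proof -
      have "((\<lambda>s. ?\<phi> (snd c (\<gamma> s))) has_vector_derivative ?J \<gamma>') (at t within I)"
        using has_derivative_compose[OF d\<gamma>[unfolded has_vector_derivative_def] C1_onD[OF trans_C1[OF c(1) d(1)] x]]
        unfolding has_vector_derivative_def linear_cmul[OF lin] .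
      then show ?thesis
        by (rule has_vector_derivative_transform_within[OF _ e(1) t]) (use e c in \<open>simp add: trans_apply\<close>)
    qed
    have 2: "((\<lambda>s. V s d) has_vector_derivative fd (\<lambda>y. fd ?\<phi> y (V t c)) ?x \<gamma>' + ?J V') (at t within I)"
    proof -
      \<comment> \<open>The components in d are the Jacobian at a moving point applied to a moving
        vector; expanding the vector in the standard basis reduces this to a product rule.\<close>
      have "((\<lambda>s. fd ?\<phi> (snd c (\<gamma> s)) b) has_vector_derivative fd (\<lambda>y. fd ?\<phi> y b) ?x \<gamma>') (at t within I)" for b
        using has_derivative_compose[OF d\<gamma>[unfolded has_vector_derivative_def] C1_onD[OF trans_fd_C1[OF c(1) d(1)] x]]
        unfolding has_vector_derivative_def linear_cmul[OF C1_on_linear[OF trans_fd_C1[OF c(1) d(1)] x]] .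
      then have "((\<lambda>s. \<Sum>b\<in>Basis. (V s c \<bullet> b) *\<^sub>R fd ?\<phi> (snd c (\<gamma> s)) b) has_vector_derivative
          (\<Sum>b\<in>Basis. (V t c \<bullet> b) *\<^sub>R fd (\<lambda>y. fd ?\<phi> y b) ?x \<gamma>' + (V' \<bullet> b) *\<^sub>R ?J b)) (at t within I)"
        by (intro has_vector_derivative_sum bounded_bilinear.has_vector_derivative[OF bounded_bilinear_scaleR]
            bounded_linear.has_vector_derivative[OF bounded_linear_inner_left] dV)
      moreover have "(\<Sum>b\<in>Basis. (V' \<bullet> b) *\<^sub>R ?J b) = ?J V'" by (rule linear_euclid_sum[OF lin, symmetric])
      moreover have "(\<Sum>b\<in>Basis. (V t c \<bullet> b) *\<^sub>R fd (\<lambda>y. fd ?\<phi> y b) ?x \<gamma>') = fd (\<lambda>y. fd ?\<phi> y (V t c)) ?x \<gamma>'"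
        unfolding trans_second_sym[OF c(1) d(1) x, of _ \<gamma>']
        by (rule linear_euclid_sum[OF C1_on_linear[OF trans_fd_C1[OF c(1) d(1)] x], symmetric])
      ultimately have "((\<lambda>s. \<Sum>b\<in>Basis. (V s c \<bullet> b) *\<^sub>R fd ?\<phi> (snd c (\<gamma> s)) b) has_vector_derivative
         fd (\<lambda>y. fd ?\<phi> y (V t c)) ?x \<gamma>' + ?J V') (at t within I)"
        by (simp add: sum.distrib)
      then show ?thesis
      proof (rule has_vector_derivative_transform_within[OF _ e(1) t])
        fix s assume s: "s \<in> I" "dist s t < e"
        have q: "\<gamma> s \<in> fst c" "\<gamma> s \<in> fst d" using e(2)[OF s] by auto
        show "(\<Sum>b\<in>Basis. (V s c \<bullet> b) *\<^sub>R fd ?\<phi> (snd c (\<gamma> s)) b) = V s d"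
          using linear_euclid_sum[OF trans_linear[OF c(1) d(1) q], of "V s c"] TS_trans[OF V[OF s(1)] c(1) d(1) q] by simp
      qed
    qed
    have Vd: "V t d = ?J (V t c)" by (rule TS_trans[OF V[OF t] c(1) d(1) c(2) d(2)])
    have "tv c (\<gamma> t) ?w d = ?J V' + ?J (Gam (G c) ?x \<gamma>' (V t c))"
      using d by (simp add: tv_def linear_add[OF lin])
    also have "\<dots> = (fd (\<lambda>y. fd ?\<phi> y (V t c)) ?x \<gamma>' + ?J V') + Gam (G d) (snd d (\<gamma> t)) (?J \<gamma>') (V t d)"
      unfolding Gam_trans[OF c(1) d(1) x] Vd trans_apply[OF c] by simp
    finally show ?thesis using 1 2 by blast
  qed
  then show ?thesis unfolding has_cov_deriv_iff using V tv_TS[OF c] by blast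
qed

lemma has_cov_derivD:
  assumes DV: "has_cov_deriv A g I \<gamma> V DV t" and c: "c \<in> A" "\<gamma> t \<in> fst c"
    and d\<gamma>: "((\<lambda>s. snd c (\<gamma> s)) has_vector_derivative \<gamma>') (at t within I)"
    and lim: "at t within I \<noteq> bot"
  shows "((\<lambda>s. V s c) has_vector_derivative DV c - Gam (G c) (snd c (\<gamma> t)) \<gamma>' (V t c)) (at t within I)"
proof -
  obtain \<gamma>'' V' where *: "((\<lambda>s. snd c (\<gamma> s)) has_vector_derivative \<gamma>'') (at t within I)"
    "((\<lambda>s. V s c) has_vector_derivative V') (at t within I)"
    "DV c = V' + Gam (G c) (snd c (\<gamma> t)) \<gamma>'' (V t c)"
    using DV c unfolding has_cov_deriv_iff by blast
  have "\<gamma>'' = \<gamma>'" by (rule vector_derivative_unique_within[OF lim *(1) d\<gamma>])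
  then show ?thesis using * by simp
qed

end

section \<open>Null hypersurfaces\<close>

lemma parallel_of_kernel:
  fixes n w :: "'a::euclidean_space"
  assumes "\<And>v. n \<bullet> v = 0 \<Longrightarrow> w \<bullet> v = 0" and "n \<noteq> 0"
  shows "w = (w \<bullet> n / (n \<bullet> n)) *\<^sub>R n"
proof -
  let ?v = "w - (w \<bullet> n / (n \<bullet> n)) *\<^sub>R n"
  have 1: "n \<bullet> ?v = 0" using assms(2) by (simp add: inner_diff_right inner_commute)
  then have "?v \<bullet> ?v = 0"
    using assms(1)[OF 1] by (simp add: inner_diff_left)
  then show ?thesis by simp
qed

context lorentz begin

text \<open>By the chain rule for transition maps a velocity can be checked in a single
  chart.\<close>

lemma velocityI:
  assumes c: "c \<in> A" "\<gamma> t \<in> fst c" and t: "t \<in> I" and v: "v \<in> TS (\<gamma> t)"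
    and cont: "continuous (at t within I) \<gamma>"
    and d\<gamma>: "((\<lambda>s. snd c (\<gamma> s)) has_vector_derivative v c) (at t within I)"
  shows "has_velocity A I \<gamma> v t"
  unfolding has_velocity_def
proof (intro conjI ballI impI v)
  fix d assume d: "d \<in> A" "\<gamma> t \<in> fst d"
  have x: "snd c (\<gamma> t) \<in> tdom c d" using c d by (auto intro: tdomI)
  have "\<forall>\<^sub>F s in at t within I. \<gamma> s \<in> fst c \<inter> fst d"
    using cont c d open_Int[OF chart_open(1)[OF c(1)] chart_open(1)[OF d(1)]]
    by (intro topological_tendstoD[of \<gamma> "\<gamma> t"]) (auto simp: continuous_within)
  then obtain e where e: "e > 0" "\<And>s. s \<in> I \<Longrightarrow> dist s t < e \<Longrightarrow> \<gamma> s \<in> fst c \<inter> fst d"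
    using c d unfolding eventually_at by (metis IntI)
  have "((\<lambda>s. transition c d (snd c (\<gamma> s))) has_vector_derivative fd (transition c d) (snd c (\<gamma> t)) (v c)) (at t within I)"
    using has_derivative_compose[OF d\<gamma>[unfolded has_vector_derivative_def] C1_onD[OF trans_C1[OF c(1) d(1)] x]]
    unfolding has_vector_derivative_def linear_cmul[OF C1_on_linear[OF trans_C1[OF c(1) d(1)] x]] .
  then have "((\<lambda>s. snd d (\<gamma> s)) has_vector_derivative fd (transition c d) (snd c (\<gamma> t)) (v c)) (at t within I)"
    by (rule has_vector_derivative_transform_within[OF _ e(1) t]) (use e c in \<open>simp add: trans_apply\<close>)
  then show "((\<lambda>s. snd d (\<gamma> s)) has_vector_derivative v d) (at t within I)"
    using TS_trans[OF v c(1) d(1) c(2) d(2)] by simp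
qed

lemma velocityD:
  "has_velocity A I \<gamma> v t \<Longrightarrow> v \<in> TS (\<gamma> t)"
  "has_velocity A I \<gamma> v t \<Longrightarrow> c \<in> A \<Longrightarrow> \<gamma> t \<in> fst c \<Longrightarrow>
    ((\<lambda>s. snd c (\<gamma> s)) has_vector_derivative v c) (at t within I)"
  by (auto simp: has_velocity_def)

lemma has_cov_deriv_unique:
  assumes "has_cov_deriv A g I \<gamma> V X t" "has_cov_deriv A g I \<gamma> V Y t" "at t within I \<noteq> bot"
  shows "X = Y"
proof -
  obtain c where c: "c \<in> A" "\<gamma> t \<in> fst c" using chart_ex .
  obtain \<gamma>' V' where 1: "((\<lambda>s. snd c (\<gamma> s)) has_vector_derivative \<gamma>') (at t within I)"
    "((\<lambda>s. V s c) has_vector_derivative V') (at t within I)" "X c = V' + Gam (G c) (snd c (\<gamma> t)) \<gamma>' (V t c)"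
    using assms(1) c unfolding has_cov_deriv_iff by blast
  have "Y c = X c"
    using vector_derivative_unique_within[OF assms(3) has_cov_derivD[OF assms(2) c 1(1) assms(3)] 1(2)] 1(3)
    by (simp add: diff_eq_eq)
  then show ?thesis
    using TS_eqI[OF _ _ c, of X Y] assms(1,2) unfolding has_cov_deriv_iff by metis
qed

lemma ip_nondeg: "c \<in> A \<Longrightarrow> x \<in> dom c \<Longrightarrow> G c x *v v = 0 \<Longrightarrow> v = 0"
proof -
  assume *: "c \<in> A" "x \<in> dom c" "G c x *v v = 0"
  interpret metric_chart "dom c" "G c" by (rule metric_chart[OF *(1)])
  have "inj ((*v) (G c x))" using inv[OF *(2)] invertible_left_inverse matrix_left_invertible_injective by blast
  then show "v = 0" using * injD[of "(*v) (G c x)" v 0] by simp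
qed

end

locale null_hyp = lorentz A g T
  for A :: "('m::{t2_space, second_countable_topology}, 'n::finite) chart set"
    and g :: "('m, 'n) metric" and T :: "'m \<Rightarrow> ('m, 'n) tvec" +
  fixes H :: "'m set" and L :: "'m \<Rightarrow> ('m, 'n) tvec"
  assumes nh: "null_hypersurface A g H" and ngf: "null_geodesic_field A g H T L"
begin

abbreviation TH :: "'m \<Rightarrow> ('m, 'n) tvec set" where "TH \<equiv> tangent_space_H A H"

definition defining :: "('m, 'n) chart \<Rightarrow> (real^'n) set \<Rightarrow> (real^'n \<Rightarrow> real) \<Rightarrow> bool" where
  "defining c V f \<longleftrightarrow> open V \<and> V \<subseteq> dom c \<and> Ck_on (Suc (Suc 0)) f V \<and> (\<forall>x\<in>V. \<exists>i. fd f x (axis i 1) \<noteq> 0) \<and>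
     (\<forall>x\<in>V. chart_inv c x \<in> H \<longleftrightarrow> f x = 0)"

lemma defining_ex:
  assumes "p \<in> H" "c \<in> A" "p \<in> fst c"
  obtains V f where "defining c V f" "snd c p \<in> V"
proof -
  have "hypersurface A H" using nh by (simp add: null_hypersurface_def)
  then have "\<exists>V (f :: real^'n \<Rightarrow> real). open V \<and> snd c p \<in> V \<and> V \<subseteq> dom c \<and> Ck_on 2 f V \<and>
          (\<forall>x\<in>V. \<exists>i. partial_deriv i f x \<noteq> 0) \<and> (\<forall>x\<in>V. chart_inv c x \<in> H \<longleftrightarrow> f x = 0)"
    using assms unfolding hypersurface_def by blast
  then show ?thesis
    using that unfolding defining_def partial_deriv_def numeral_2_eq_2 by blast
qed

lemma defining_C1:
  assumes "defining c V f"
  shows "C1_on f V" "C1_on (\<lambda>x. fd f x v) V"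
  using assms Ck_on_C1[of "Suc 0" f V] Ck2_on_fd_C1[of 0 f V v] unfolding defining_def by blast+

lemma defining_zero: "defining c V f \<Longrightarrow> c \<in> A \<Longrightarrow> q \<in> fst c \<Longrightarrow> snd c q \<in> V \<Longrightarrow> q \<in> H \<longleftrightarrow> f (snd c q) = 0"
  unfolding defining_def using chart_inv_simps(1) by metis

text \<open>Differentiating f = 0 along a curve in H gives one inclusion. For the other, the
  retraction onto the level set bends the straight line with direction v into a curve in H; its
  velocity is v because the derivative of the retraction fixes the kernel of df.\<close>

lemma TH_iff:
  assumes df: "defining c V f" and c: "c \<in> A" and p: "p \<in> H" "p \<in> fst c" "snd c p \<in> V"
  shows "v \<in> TH p \<longleftrightarrow> v \<in> TS p \<and> fd f (snd c p) (v c) = 0"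
proof
  let ?x = "snd c p"
  note fC1 = defining_C1(1)[OF df]
  have V: "open V" "V \<subseteq> dom c" using df by (auto simp: defining_def)
  {
    assume "v \<in> TH p"
    then obtain \<epsilon> \<sigma> where \<sigma>: "0 < \<epsilon>" "continuous_on {-\<epsilon><..<\<epsilon>} \<sigma>" "\<sigma> ` {-\<epsilon><..<\<epsilon>} \<subseteq> H" "\<sigma> 0 = p"
      "has_velocity A {-\<epsilon><..<\<epsilon>} \<sigma> v 0"
      unfolding tangent_space_H_def curve_in_def by blast
    let ?I = "{-\<epsilon><..<\<epsilon>}"
    have 0: "0 \<in> ?I" using \<sigma> by auto
    have vT: "v \<in> TS p" using velocityD(1)[OF \<sigma>(5)] \<sigma>(4) by simp
    have d: "((\<lambda>s. snd c (\<sigma> s)) has_vector_derivative v c) (at 0 within ?I)"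
      using velocityD(2)[OF \<sigma>(5) c] \<sigma>(4) p by simp
    have o: "open (fst c \<inter> snd c -` V)"
      by (rule continuous_open_preimage[OF chart_cont(1)[OF c] chart_open(1)[OF c] V(1)])
    have "continuous (at 0 within ?I) \<sigma>" using \<sigma>(2) 0 by (simp add: continuous_on_eq_continuous_within)
    then have "\<forall>\<^sub>F s in at 0 within ?I. \<sigma> s \<in> fst c \<inter> snd c -` V"
      using o p \<sigma>(4) by (intro topological_tendstoD[of \<sigma> p]) (auto simp: continuous_within)
    then obtain e where e: "e > 0" "\<And>s. s \<in> ?I \<Longrightarrow> dist s 0 < e \<Longrightarrow> \<sigma> s \<in> fst c \<inter> snd c -` V"
      using p \<sigma>(4) unfolding eventually_at by (metis IntI vimageI)
    have xV: "snd c (\<sigma> 0) \<in> V" using p \<sigma> by simp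
    have "((\<lambda>s. f (snd c (\<sigma> s))) has_vector_derivative fd f ?x (v c)) (at 0 within ?I)"
      using has_derivative_compose[OF d[unfolded has_vector_derivative_def] C1_onD[OF fC1 xV]]
      unfolding has_vector_derivative_def \<sigma>(4) linear_cmul[OF C1_on_linear[OF fC1 p(3)]] .
    then have "((\<lambda>s. 0) has_vector_derivative fd f ?x (v c)) (at 0 within ?I)"
    proof (rule has_vector_derivative_transform_within[OF _ e(1) 0])
      fix s assume s: "s \<in> ?I" "dist s 0 < e"
      then show "f (snd c (\<sigma> s)) = 0"
        using defining_zero[OF df c, of "\<sigma> s"] e(2)[OF s] imageI[OF s(1), of \<sigma>] \<sigma>(3) by blast
    qed
    moreover have "at 0 within ?I \<noteq> bot" using \<sigma>(1) by (simp add: at_within_open[OF 0])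
    ultimately have "fd f ?x (v c) = 0"
      using vector_derivative_unique_within has_vector_derivative_const by blast
    then show "v \<in> TS p \<and> fd f ?x (v c) = 0" using vT by simp
  }
  {
    assume v: "v \<in> TS p \<and> fd f ?x (v c) = 0"
    obtain i where i: "fd f ?x (axis i 1) \<noteq> 0" using df p by (auto simp: defining_def)
    have f0: "f ?x = 0" using defining_zero[OF df c p(2,3)] p(1) by simp
    obtain N \<rho> where N: "open N" "?x \<in> N" "N \<subseteq> V" "C1_on \<rho> N" "\<And>x. x \<in> N \<Longrightarrow> \<rho> x \<in> N \<and> f (\<rho> x) = 0"
      "\<And>x. x \<in> N \<Longrightarrow> f x = 0 \<Longrightarrow> \<rho> x = x"
      "\<And>x v. x \<in> N \<Longrightarrow> f x = 0 \<Longrightarrow> fd f x v = 0 \<Longrightarrow> fd \<rho> x v = v"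
      using level_set_retraction[OF V(1) p(3) fC1 f0 i] by metis
    let ?y = "\<lambda>s. ?x + s *\<^sub>R v c"
    have "isCont ?y 0" by (intro continuous_intros)
    then have "\<forall>\<^sub>F s in at 0. ?y s \<in> N"
      using N(1,2) by (intro topological_tendstoD[of ?y ?x]) (auto simp: isCont_def)
    then obtain \<epsilon> where e: "\<epsilon> > 0" "\<And>s. \<bar>s\<bar> < \<epsilon> \<Longrightarrow> ?y s \<in> N"
      using N(2) unfolding eventually_at by (metis add.right_neutral dist_0_norm dist_commute real_norm_def scaleR_zero_left UNIV_I)
    let ?I = "{-\<epsilon><..<\<epsilon>}"
    have yN: "?y ` ?I \<subseteq> N" using e(2) by auto
    define \<sigma> where "\<sigma> s = chart_inv c (\<rho> (?y s))" for s
    have \<rho>y: "\<rho> (?y s) \<in> N" "\<rho> (?y s) \<in> dom c" "f (\<rho> (?y s)) = 0" if "s \<in> ?I" for s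
      using N(3,5) yN that V(2) by blast+
    have sc: "snd c (\<sigma> s) = \<rho> (?y s)" "\<sigma> s \<in> fst c" if "s \<in> ?I" for s
      unfolding \<sigma>_def using chart_inv_simps[OF c] \<rho>y(2)[OF that] by auto
    have contyr: "continuous_on ?I (\<lambda>s. \<rho> (?y s))"
      by (rule continuous_on_compose2[OF C1_on_continuous[OF N(4)] _ yN]) (intro continuous_intros)
    have cont: "continuous_on ?I \<sigma>" unfolding \<sigma>_def
      by (rule continuous_on_compose2[OF chart_cont(2)[OF c] contyr]) (use \<rho>y in auto)
    have "chart_inv c x \<in> H" if "x \<in> V" "f x = 0" for x using df that by (auto simp: defining_def)
    then have inH: "\<sigma> ` ?I \<subseteq> H" unfolding \<sigma>_def using \<rho>y N(3) by blast
    have s0: "\<sigma> 0 = p" unfolding \<sigma>_def using N(6)[OF N(2) f0] chart_inv_simps(1)[OF c p(2)] by simp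
    have "(?y has_derivative (\<lambda>h. h *\<^sub>R v c)) (at 0)" by (auto intro!: derivative_eq_intros)
    moreover have "(\<rho> has_derivative fd \<rho> (?y 0)) (at (?y 0))" using C1_onD[OF N(4,2)] by simp
    ultimately have "((\<lambda>s. \<rho> (?y s)) has_derivative (\<lambda>h. fd \<rho> (?y 0) (h *\<^sub>R v c))) (at 0)"
      by (rule has_derivative_compose)
    then have "((\<lambda>s. \<rho> (?y s)) has_vector_derivative v c) (at 0)"
      using N(7)[OF N(2) f0, of "v c"] v linear_cmul[OF C1_on_linear[OF N(4,2)]]
      by (simp add: has_vector_derivative_def)
    then have dv: "((\<lambda>s. snd c (\<sigma> s)) has_vector_derivative v c) (at 0 within ?I)"
      by (rule has_vector_derivative_transform_within[OF has_vector_derivative_at_within e(1)])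
        (use e(1) sc in \<open>auto simp: dist_real_def\<close>)
    have "has_velocity A ?I \<sigma> v 0"
    proof (rule velocityI[OF c])
      show "\<sigma> 0 \<in> fst c" using s0 p by simp
      show "v \<in> TS (\<sigma> 0)" using v s0 by simp
      show "continuous (at 0 within ?I) \<sigma>" using cont e(1) by (simp add: continuous_on_eq_continuous_within)
      show "((\<lambda>s. snd c (\<sigma> s)) has_vector_derivative v c) (at 0 within ?I)" by (rule dv)
    qed (use e in auto)
    then have "curve_in A H \<epsilon> \<sigma> p v" unfolding curve_in_def using e(1) cont inH s0 by blast
    then show "v \<in> TH p" unfolding tangent_space_H_def by blast
  }
qed

lemma L_TS: "p \<in> H \<Longrightarrow> L p \<in> TS p" and L_nz: "p \<in> H \<Longrightarrow> L p \<noteq> tzero"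
  and L_perp: "p \<in> H \<Longrightarrow> w \<in> TH p \<Longrightarrow> g p (L p) w = 0"
  and nabla_LL: "p \<in> H \<Longrightarrow> nabla A g H L p (L p) = tzero"
  using ngf unfolding null_geodesic_field_def normal_space_def by auto

text \<open>The covector g(u, .) vanishes on the kernel of df, hence is a multiple of df, and the
  multiple is nonzero because g is nondegenerate. So all normals of H at a point are
  proportional.\<close>

lemma normal_covector:
  assumes df: "defining c V f" and c: "c \<in> A" and p: "p \<in> H" "p \<in> fst c" "snd c p \<in> V"
    and u: "u \<in> TS p" "u \<noteq> tzero" "\<And>w. w \<in> TH p \<Longrightarrow> g p u w = 0"
  obtains \<mu> where "\<mu> \<noteq> 0" "\<And>w. ip (G c (snd c p)) (u c) w = \<mu> * fd f (snd c p) w"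
proof -
  let ?x = "snd c p"
  have xd: "?x \<in> dom c" using p by auto
  interpret metric_chart "dom c" "G c" by (rule metric_chart[OF c])
  have lin: "linear (fd f ?x)" by (rule C1_on_linear[OF defining_C1(1)[OF df] p(3)])
  define n where "n = (\<Sum>i\<in>UNIV. fd f ?x (axis i 1) *\<^sub>R (axis i 1 :: real^'n))"
  have n: "n \<bullet> w = fd f ?x w" for w
    unfolding n_def
    by (subst (2) basis_expansion[symmetric, of w])
      (simp only: linear_sum[OF lin] linear_cmul[OF lin] scalar_mult_eq_scaleR inner_sum_left inner_scaleR_left
        inner_axis' real_scaleR_def mult.commute inner_real_def mult_1_right mult_1)
  have nz: "n \<noteq> 0" using df p(3) n unfolding defining_def by (metis inner_zero_left)
  let ?w = "G c ?x *v u c"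
  have wn: "?w = (?w \<bullet> n / (n \<bullet> n)) *\<^sub>R n"
  proof (rule parallel_of_kernel[OF _ nz])
    fix v assume "n \<bullet> v = 0"
    then have "tv c p v \<in> TH p"
      unfolding TH_iff[OF df c p] using tv_TS[OF c p(2)] by (simp add: n tv_self c p)
    from u(3)[OF this] show "?w \<bullet> v = 0"
      unfolding g_chart[OF u(1) tv_TS[OF c p(2)] c p(2)] tv_self[OF c p(2)] ip_sym[OF xd, of "u c"] by (simp add: inner_commute)
  qed
  have "u c \<noteq> 0"
    using TS_eqI[OF u(1) TS_zero c p(2)] u(2) by (auto simp: tzero_def)
  then have "?w \<noteq> 0" using ip_nondeg[OF c xd] by blast
  then have "?w \<bullet> n / (n \<bullet> n) \<noteq> 0" using wn by (metis scaleR_zero_left)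
  moreover have "ip (G c ?x) (u c) w = (?w \<bullet> n / (n \<bullet> n)) * fd f ?x w" for w
  proof -
    have "ip (G c ?x) (u c) w = ?w \<bullet> w" using ip_sym[OF xd, of "u c" w] by (simp add: inner_commute)
    also have "\<dots> = ((?w \<bullet> n / (n \<bullet> n)) *\<^sub>R n) \<bullet> w" using wn by simp
    finally show ?thesis by (simp add: n)
  qed
  ultimately show ?thesis using that by blast
qed

text \<open>By \<open>normal_covector\<close> for L, the kernel of df is the orthogonal complement
  of L.\<close>

lemma TH_perp:
  assumes p: "p \<in> H" shows "v \<in> TH p \<longleftrightarrow> v \<in> TS p \<and> g p (L p) v = 0"
proof -
  obtain c where c: "c \<in> A" "p \<in> fst c" using chart_ex .
  obtain V f where df: "defining c V f" "snd c p \<in> V" using defining_ex[OF p c] .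
  obtain \<mu> where \<mu>: "\<mu> \<noteq> 0" "\<And>w. ip (G c (snd c p)) (L p c) w = \<mu> * fd f (snd c p) w"
    using normal_covector[OF df(1) c(1) p c(2) df(2) L_TS[OF p] L_nz[OF p] L_perp[OF p]] by blast
  show ?thesis
    unfolding TH_iff[OF df(1) c(1) p c(2) df(2)] using g_chart[OF L_TS[OF p] _ c, of v] \<mu> by auto
qed

lemma TH_TS: "p \<in> H \<Longrightarrow> v \<in> TH p \<Longrightarrow> v \<in> TS p"
  using TH_perp by blast

text \<open>Nullity of H provides some tangent normal v, while L is a priori just normal. Both
  covectors are multiples of the same df, so L is a multiple of v and inherits its tangency.\<close>

lemma L_TH:
  assumes p: "p \<in> H" shows "L p \<in> TH p" "g p (L p) (L p) = 0"
proof -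
  obtain c where c: "c \<in> A" "p \<in> fst c" using chart_ex .
  obtain V f where df: "defining c V f" "snd c p \<in> V" using defining_ex[OF p c] .
  have xd: "snd c p \<in> dom c" using c by auto
  obtain \<mu> where \<mu>: "\<mu> \<noteq> 0" "\<And>w. ip (G c (snd c p)) (L p c) w = \<mu> * fd f (snd c p) w"
    using normal_covector[OF df(1) c(1) p c(2) df(2) L_TS[OF p] L_nz[OF p] L_perp[OF p]] by blast
  obtain v where v: "v \<in> TH p" "v \<noteq> tzero" "\<And>w. w \<in> TH p \<Longrightarrow> g p v w = 0"
    using nh p unfolding null_hypersurface_def by blast
  have vT: "v \<in> TS p" using TH_TS[OF p v(1)] .
  obtain \<nu> where \<nu>: "\<nu> \<noteq> 0" "\<And>w. ip (G c (snd c p)) (v c) w = \<nu> * fd f (snd c p) w"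
    using normal_covector[OF df(1) c(1) p c(2) df(2) vT v(2,3)] by blast
  interpret metric_chart "dom c" "G c" by (rule metric_chart[OF c(1)])
  have "ip (G c (snd c p)) (L p c - (\<mu> / \<nu>) *\<^sub>R v c) w = 0" for w
    using \<mu>(2) \<nu> by (simp add: ip_bilinear)
  then have "ip (G c (snd c p)) w (L p c - (\<mu> / \<nu>) *\<^sub>R v c) = 0" for w
    using ip_sym[OF xd] by metis
  from this[of "G c (snd c p) *v (L p c - (\<mu> / \<nu>) *\<^sub>R v c)"]
  have "G c (snd c p) *v (L p c - (\<mu> / \<nu>) *\<^sub>R v c) = 0" by simp
  from ip_nondeg[OF c(1) xd this] have "L p c = (\<mu> / \<nu>) *\<^sub>R v c" by simp
  moreover have "fd f (snd c p) (v c) = 0" using v(1) TH_iff[OF df(1) c(1) p c(2) df(2)] by blast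
  ultimately have "fd f (snd c p) (L p c) = 0"
    using linear_cmul[OF C1_on_linear[OF defining_C1(1)[OF df(1)] df(2)]] by simp
  then show "L p \<in> TH p" unfolding TH_iff[OF df(1) c(1) p c(2) df(2)] using L_TS[OF p] by simp
  then show "g p (L p) (L p) = 0" using L_perp[OF p] by blast
qed

end

section \<open>The Weingarten map and Jacobi fields\<close>

context null_hyp begin

text \<open>\<open>F\<close> extends \<open>L\<close> constantly along the fibres of a retraction onto \<open>H\<close>, so that the
  geodesic equation \<open>\<nabla>\<^sub>L L = 0\<close> holds in the form \<open>DF(F) = - \<Gamma>(F, F)\<close> on an open set and
  not only on \<open>H\<close>.\<close>

definition extension :: "('m, 'n) chart \<Rightarrow> (real^'n) set \<Rightarrow> (real^'n \<Rightarrow> real) \<Rightarrow> (real^'n \<Rightarrow> real^'n) \<Rightarrow>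
    (real^'n \<Rightarrow> real^'n) \<Rightarrow> bool" where
  "extension c N f \<rho> F \<longleftrightarrow> defining c N f \<and> C1_on \<rho> N \<and> C1_on F N \<and>
     (\<forall>x\<in>N. \<rho> x \<in> N \<and> f (\<rho> x) = 0) \<and> (\<forall>x\<in>N. f x = 0 \<longrightarrow> \<rho> x = x) \<and>
     (\<forall>x\<in>N. fd \<rho> (\<rho> x) = fd \<rho> x) \<and>
     (\<forall>x\<in>N. \<forall>v. f x = 0 \<longrightarrow> fd f x v = 0 \<longrightarrow> fd \<rho> x v = v) \<and>
     (\<forall>x\<in>N. F x = L (chart_inv c (\<rho> x)) c)"

lemma extension_ex:
  assumes p: "p \<in> H" and c: "c \<in> A" "p \<in> fst c"
  obtains N f \<rho> F where "extension c N f \<rho> F" "snd c p \<in> N"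
proof -
  let ?x = "snd c p"
  obtain V f where df: "defining c V f" "?x \<in> V" using defining_ex[OF p c] .
  have V: "open V" "V \<subseteq> dom c" using df by (auto simp: defining_def)
  have "C1_along A H L" using ngf by (simp add: null_geodesic_field_def)
  then obtain V0 F0 where F0: "open V0" "?x \<in> V0" "Ck_on 1 F0 V0" "\<And>q. q \<in> H \<inter> fst c \<Longrightarrow> snd c q \<in> V0 \<Longrightarrow> L q c = F0 (snd c q)"
  proof -
    have "\<exists>V F. open V \<and> ?x \<in> V \<and> Ck_on 1 F V \<and> (\<forall>q\<in>H \<inter> fst c. snd c q \<in> V \<longrightarrow> L q c = F (snd c q))"
      using \<open>C1_along A H L\<close>[unfolded C1_along_def, THEN bspec, OF p, THEN bspec, OF c(1), THEN mp, OF c(2)] .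
    then obtain V F where "open V" "?x \<in> V" "Ck_on 1 F V" "\<forall>q\<in>H \<inter> fst c. snd c q \<in> V \<longrightarrow> L q c = F (snd c q)"
      by (elim exE conjE)
    then show ?thesis by (intro that) auto
  qed
  have F0C1: "C1_on F0 V0" using Ck_on_C1[of 0 F0 V0] F0 by simp
  obtain i where i: "fd f ?x (axis i 1) \<noteq> 0" using df by (auto simp: defining_def)
  have f0: "f ?x = 0" using defining_zero[OF df(1) c df(2)] p by simp
  obtain N \<rho> where N: "open N" "?x \<in> N" "N \<subseteq> V" "C1_on \<rho> N" "\<And>x. x \<in> N \<Longrightarrow> \<rho> x \<in> N \<and> f (\<rho> x) = 0"
      "\<And>x. x \<in> N \<Longrightarrow> f x = 0 \<Longrightarrow> \<rho> x = x" "\<And>x. x \<in> N \<Longrightarrow> fd \<rho> (\<rho> x) = fd \<rho> x"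
      "\<And>x v. x \<in> N \<Longrightarrow> f x = 0 \<Longrightarrow> fd f x v = 0 \<Longrightarrow> fd \<rho> x v = v"
    using level_set_retraction[OF V(1) df(2) defining_C1(1)[OF df(1)] f0 i] by metis
  \<comment> \<open>The points that \<rho> moves into the domain of the local extension of L. Since
    \<rho> fixes its image, M is again mapped into itself.\<close>
  define M where "M = N \<inter> \<rho> -` V0"
  have M: "open M" "M \<subseteq> N" "?x \<in> M"
    unfolding M_def using continuous_open_preimage[OF C1_on_continuous[OF N(4)] N(1) F0(1)] N(2,6) f0 F0(2) by auto
  have \<rho>M: "\<rho> x \<in> M" "f (\<rho> x) = 0" "\<rho> x \<in> V0" if "x \<in> M" for x
    using that N(5)[of x] N(6)[of "\<rho> x"] by (auto simp: M_def)
  have dM: "defining c M f"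
  proof -
    have "Ck_on k h V \<Longrightarrow> Ck_on k h M" for k and h :: "real^'n \<Rightarrow> real"
    proof (induction k arbitrary: h)
      case 0
      then show ?case using M N(3) continuous_on_subset[of V h M] by auto
    next
      case (Suc k)
      then show ?case using M N(3) differentiable_on_subset[of h V M] by auto
    qed
    then show ?thesis using df(1) M N(3) unfolding defining_def by blast
  qed
  have LF: "L (chart_inv c (\<rho> x)) c = F0 (\<rho> x)" if "x \<in> M" for x
  proof -
    have "\<rho> x \<in> V" using \<rho>M[OF that] M N by auto
    then have "chart_inv c (\<rho> x) \<in> H" using df(1) \<rho>M(2)[OF that] by (auto simp: defining_def)
    moreover have "\<rho> x \<in> dom c" using \<open>\<rho> x \<in> V\<close> V(2) by auto
    ultimately show ?thesis using F0(4)[of "chart_inv c (\<rho> x)"] chart_inv_simps[OF c(1)] \<rho>M(3)[OF that] by auto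
  qed
  have img: "\<rho> ` M \<subseteq> V0" using \<rho>M by auto
  have "C1_on (\<lambda>x. F0 (\<rho> x)) M"
    by (rule C1_on_compose(1)[OF C1_on_subset[OF N(4) M(2)] F0C1 img])
  then have FC1: "C1_on (\<lambda>x. L (chart_inv c (\<rho> x)) c) M"
    by (subst C1_on_cong[OF M(1) LF])
  have "extension c M f \<rho> (\<lambda>x. L (chart_inv c (\<rho> x)) c)"
    unfolding extension_def
    by (intro conjI dM C1_on_subset[OF N(4) M(2)] FC1) (use \<rho>M M(2) N in auto)
  then show ?thesis using that M(3) by blast
qed

context
  fixes c N f \<rho> F
  assumes ext: "extension c N f \<rho> F" and c: "c \<in> A"
begin

lemma
  shows ext_def: "defining c N f" and ext_open: "open N" and ext_dom: "N \<subseteq> dom c"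
    and ext_\<rho>: "C1_on \<rho> N" and ext_F: "C1_on F N"
    and ext_\<rho>N: "x \<in> N \<Longrightarrow> \<rho> x \<in> N" and ext_f\<rho>: "x \<in> N \<Longrightarrow> f (\<rho> x) = 0"
    and ext_\<rho>id: "x \<in> N \<Longrightarrow> f x = 0 \<Longrightarrow> \<rho> x = x"
    and ext_d\<rho>: "x \<in> N \<Longrightarrow> fd \<rho> (\<rho> x) = fd \<rho> x"
    and ext_d\<rho>id: "x \<in> N \<Longrightarrow> f x = 0 \<Longrightarrow> fd f x v = 0 \<Longrightarrow> fd \<rho> x v = v"
    and ext_FL: "x \<in> N \<Longrightarrow> F x = L (chart_inv c (\<rho> x)) c"
  using ext unfolding extension_def defining_def by blast+

lemma ext_H:
  assumes "q \<in> H" "q \<in> fst c" "snd c q \<in> N"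
  shows "f (snd c q) = 0" "\<rho> (snd c q) = snd c q" "F (snd c q) = L q c"
    "v \<in> TH q \<longleftrightarrow> v \<in> TS q \<and> fd f (snd c q) (v c) = 0"
    "v \<in> TH q \<Longrightarrow> fd \<rho> (snd c q) (v c) = v c"
proof -
  show f: "f (snd c q) = 0" using defining_zero[OF ext_def c assms(2,3)] assms(1) by simp
  show \<rho>: "\<rho> (snd c q) = snd c q" by (rule ext_\<rho>id[OF assms(3) f])
  show "F (snd c q) = L q c" using ext_FL[OF assms(3)] \<rho> chart_inv_simps(1)[OF c assms(2)] by simp
  show t: "v \<in> TH q \<longleftrightarrow> v \<in> TS q \<and> fd f (snd c q) (v c) = 0" for v by (rule TH_iff[OF ext_def c assms])
  show "v \<in> TH q \<Longrightarrow> fd \<rho> (snd c q) (v c) = v c"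
    by (rule ext_d\<rho>id[OF assms(3) f]) (simp add: t)
qed

lemma ext_retract:
  assumes "x \<in> N"
  shows "chart_inv c (\<rho> x) \<in> H" "chart_inv c (\<rho> x) \<in> fst c" "snd c (chart_inv c (\<rho> x)) = \<rho> x"
proof -
  show "chart_inv c (\<rho> x) \<in> H" using ext_def ext_\<rho>N[OF assms] ext_f\<rho>[OF assms] by (auto simp: defining_def)
  have "\<rho> x \<in> dom c" using ext_\<rho>N[OF assms] ext_dom by auto
  then show "chart_inv c (\<rho> x) \<in> fst c" "snd c (chart_inv c (\<rho> x)) = \<rho> x" using chart_inv_simps[OF c] by auto
qed

lemma ext_curve:
  assumes I: "t \<in> I" "continuous (at t within I) \<sigma>" "\<sigma> ` I \<subseteq> H" and q: "\<sigma> t \<in> fst c" "snd c (\<sigma> t) \<in> N"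
    and d: "((\<lambda>s. snd c (\<sigma> s)) has_vector_derivative v) (at t within I)"
  shows "((\<lambda>s. L (\<sigma> s) c) has_vector_derivative fd F (snd c (\<sigma> t)) v) (at t within I)"
proof -
  have o: "open (fst c \<inter> snd c -` N)"
    by (rule continuous_open_preimage[OF chart_cont(1)[OF c] chart_open(1)[OF c] ext_open])
  have "\<forall>\<^sub>F s in at t within I. \<sigma> s \<in> fst c \<inter> snd c -` N"
    using o q I by (intro topological_tendstoD[of \<sigma> "\<sigma> t"]) (auto simp: continuous_within)
  then obtain e where e: "e > 0" "\<And>s. s \<in> I \<Longrightarrow> dist s t < e \<Longrightarrow> \<sigma> s \<in> fst c \<inter> snd c -` N"
    using q unfolding eventually_at by (metis IntI vimageI)
  have "((\<lambda>s. F (snd c (\<sigma> s))) has_vector_derivative fd F (snd c (\<sigma> t)) v) (at t within I)"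
    using has_derivative_compose[OF d[unfolded has_vector_derivative_def] C1_onD[OF ext_F q(2)]]
    unfolding has_vector_derivative_def linear_cmul[OF C1_on_linear[OF ext_F q(2)]] .
  then show ?thesis
  proof (rule has_vector_derivative_transform_within[OF _ e(1) I(1)])
    fix s assume s: "s \<in> I" "dist s t < e"
    have "\<sigma> s \<in> H" using I(3) s(1) by auto
    then show "F (snd c (\<sigma> s)) = L (\<sigma> s) c" using ext_H(3)[of "\<sigma> s"] e(2)[OF s] by auto
  qed
qed

text \<open>Along any curve in H with velocity v the chain rule through F gives the same derivative
  of L, so the description in \<open>nabla\<close> has exactly one solution; a curve exists as v is
  tangent.\<close>

lemma nabla_eq:
  assumes q: "q \<in> H" "q \<in> fst c" "snd c q \<in> N" and v: "v \<in> TH q"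
  shows "nabla A g H L q v = tv c q (fd F (snd c q) (v c) + Gam (G c) (snd c q) (v c) (L q c))"
proof -
  let ?w = "fd F (snd c q) (v c) + Gam (G c) (snd c q) (v c) (L q c)"
  let ?P = "\<lambda>w. \<exists>\<epsilon> \<sigma>. curve_in A H \<epsilon> \<sigma> q v \<and> has_cov_deriv A g {-\<epsilon><..<\<epsilon>} \<sigma> (\<lambda>s. L (\<sigma> s)) w 0"
  have cur: "((\<lambda>s. snd c (\<sigma> s)) has_vector_derivative v c) (at 0 within {-\<epsilon><..<\<epsilon>})"
    "((\<lambda>s. L (\<sigma> s) c) has_vector_derivative fd F (snd c q) (v c)) (at 0 within {-\<epsilon><..<\<epsilon>})"
    "at 0 within {-\<epsilon><..<\<epsilon>} \<noteq> bot" "0 \<in> {-\<epsilon><..<\<epsilon>}" "continuous (at 0 within {-\<epsilon><..<\<epsilon>}) \<sigma>" "\<sigma> 0 = q"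
    "\<sigma> ` {-\<epsilon><..<\<epsilon>} \<subseteq> H"
    if "curve_in A H \<epsilon> \<sigma> q v" for \<epsilon> \<sigma>
  proof -
    have \<sigma>: "0 < \<epsilon>" "continuous_on {-\<epsilon><..<\<epsilon>} \<sigma>" "\<sigma> ` {-\<epsilon><..<\<epsilon>} \<subseteq> H" "\<sigma> 0 = q"
      "has_velocity A {-\<epsilon><..<\<epsilon>} \<sigma> v 0" using that unfolding curve_in_def by blast+
    show 0: "0 \<in> {-\<epsilon><..<\<epsilon>}" using \<sigma>(1) by auto
    show d: "((\<lambda>s. snd c (\<sigma> s)) has_vector_derivative v c) (at 0 within {-\<epsilon><..<\<epsilon>})"
      using velocityD(2)[OF \<sigma>(5) c] \<sigma>(4) q by simp
    show ct: "continuous (at 0 within {-\<epsilon><..<\<epsilon>}) \<sigma>" using \<sigma>(2) 0 by (simp add: continuous_on_eq_continuous_within)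
    show "at 0 within {-\<epsilon><..<\<epsilon>} \<noteq> bot" using \<sigma>(1) by (simp add: at_within_open[OF 0])
    show "((\<lambda>s. L (\<sigma> s) c) has_vector_derivative fd F (snd c q) (v c)) (at 0 within {-\<epsilon><..<\<epsilon>})"
      using ext_curve[OF 0 ct \<sigma>(3) _ _ d] \<sigma>(4) q by simp
    show "\<sigma> 0 = q" "\<sigma> ` {-\<epsilon><..<\<epsilon>} \<subseteq> H" using \<sigma> by auto
  qed
  have "?P (tv c q ?w)"
  proof -
    obtain \<epsilon> \<sigma> where cu: "curve_in A H \<epsilon> \<sigma> q v" using v unfolding tangent_space_H_def by blast
    have LT: "L (\<sigma> s) \<in> TS (\<sigma> s)" if "s \<in> {-\<epsilon><..<\<epsilon>}" for s
      using cur(7)[OF cu] that by (intro L_TS) blast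
    have "has_cov_deriv A g {-\<epsilon><..<\<epsilon>} \<sigma> (\<lambda>s. L (\<sigma> s)) (tv c (\<sigma> 0) (fd F (snd c q) (v c) + Gam (G c) (snd c (\<sigma> 0)) (v c) (L (\<sigma> 0) c))) 0"
      by (rule has_cov_derivI[OF c _ cur(4)[OF cu] LT cur(5)[OF cu] cur(1)[OF cu] cur(2)[OF cu]])
        (use cur(6)[OF cu] q in auto)
    then show ?thesis using cu cur(6)[OF cu] by auto
  qed
  moreover have "w = tv c q ?w" if Pw: "?P w" for w
  proof -
    obtain \<epsilon> \<sigma> where cu: "curve_in A H \<epsilon> \<sigma> q v" "has_cov_deriv A g {-\<epsilon><..<\<epsilon>} \<sigma> (\<lambda>s. L (\<sigma> s)) w 0"
      using Pw by blast
    have "w c - Gam (G c) (snd c q) (v c) (L q c) = fd F (snd c q) (v c)"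
      using vector_derivative_unique_within[OF cur(3)[OF cu(1)] has_cov_derivD[OF cu(2) c _ cur(1)[OF cu(1)] cur(3)[OF cu(1)]] cur(2)[OF cu(1)]]
        cur(6)[OF cu(1)] q by simp
    then have "w c = ?w" by (simp add: diff_eq_eq)
    moreover have "w \<in> TS q" using cu(2) cur(6)[OF cu(1)] unfolding has_cov_deriv_iff by simp
    ultimately show ?thesis using TS_tv[OF _ c q(2), of w] by simp
  qed
  ultimately show ?thesis unfolding nabla_def by (rule the_equality)
qed

lemma nabla_c:
  assumes "q \<in> H" "q \<in> fst c" "snd c q \<in> N" "v \<in> TH q"
  shows "nabla A g H L q v c = fd F (snd c q) (v c) + Gam (G c) (snd c q) (v c) (L q c)"
  unfolding nabla_eq[OF assms] using tv_self[OF c assms(2)] .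

text \<open>On H this is \<nabla>_L L = 0. Off H, F = F \<circ> \<rho> makes \<open>fd F x\<close>
  the composition of \<open>fd F (\<rho> x)\<close> with \<open>fd \<rho> x\<close>, and the latter
  equals \<open>fd \<rho> (\<rho> x)\<close>, which fixes the tangent vector F x. Hence the base
  point \<rho> x in \<open>Gam\<close>.\<close>

lemma ext_geodesic:
  assumes x: "x \<in> N"
  shows "fd F x (F x) = - Gam (G c) (\<rho> x) (F x) (F x)"
proof -
  let ?q = "chart_inv c (\<rho> x)"
  note q = ext_retract[OF x]
  have qN: "snd c ?q \<in> N" using q(3) ext_\<rho>N[OF x] by simp
  have Fq: "F (\<rho> x) = L ?q c" "F x = L ?q c"
    using ext_H(3)[OF q(1,2) qN] q(3) ext_FL[OF x] by auto
  have "nabla A g H L ?q (L ?q) c = 0" using nabla_LL[OF q(1)] by (simp add: tzero_def)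
  then have 1: "fd F (\<rho> x) (F x) = - Gam (G c) (\<rho> x) (F x) (F x)"
    using nabla_c[OF q(1,2) qN L_TH(1)[OF q(1)]] q(3) Fq by (simp add: eq_neg_iff_add_eq_0)
  have t: "fd \<rho> (\<rho> x) (F x) = F x" "fd \<rho> x (F x) = F x"
    using ext_H(5)[OF q(1,2) qN L_TH(1)[OF q(1)]] q(3) Fq ext_d\<rho>[OF x] by simp_all
  have FF: "F y = F (\<rho> y)" if "y \<in> N" for y
    using ext_FL[OF that] ext_FL[OF ext_\<rho>N[OF that]] ext_\<rho>id[OF ext_\<rho>N[OF that] ext_f\<rho>[OF that]] by simp
  have img: "\<rho> ` N \<subseteq> N" using ext_\<rho>N by auto
  have "fd F x = fd (\<lambda>y. F (\<rho> y)) x" by (rule fd_cong[OF ext_open FF x])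
  also have "\<dots> = (\<lambda>v. fd F (\<rho> x) (fd \<rho> x v))" by (rule C1_on_compose(2)[OF ext_\<rho> ext_F img x])
  finally show ?thesis using 1 t by simp
qed

text \<open>Differentiate g(L, L) = 0 in the direction v; evaluation at \<rho> x makes this identity
  hold on an open set.\<close>

lemma nabla_perp_chart:
  assumes q: "q \<in> H" "q \<in> fst c" "snd c q \<in> N" and v: "v \<in> TH q"
  shows "ip (G c (snd c q)) (fd F (snd c q) (v c) + Gam (G c) (snd c q) (v c) (L q c)) (L q c) = 0"
proof -
  interpret metric_chart "dom c" "G c" by (rule metric_chart[OF c])
  let ?x = "snd c q"
  have xd: "?x \<in> dom c" using q by auto
  have \<rho>d: "\<rho> ` N \<subseteq> dom c" using ext_\<rho>N ext_dom by auto
  have dG: "((\<lambda>x. G c (\<rho> x)) has_derivative (\<lambda>v. fd (G c) (\<rho> ?x) (fd \<rho> ?x v))) (at ?x)"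
    by (rule has_derivative_compose[OF C1_onD[OF ext_\<rho> q(3)] C1_onD[OF G_C1]]) (use \<rho>d q in auto)
  have "((\<lambda>x. ip (G c (\<rho> x)) (F x) (F x)) has_derivative
     (\<lambda>v. F ?x \<bullet> (G c (\<rho> ?x) *v fd F ?x v + fd (G c) (\<rho> ?x) (fd \<rho> ?x v) *v F ?x) + fd F ?x v \<bullet> (G c (\<rho> ?x) *v F ?x))) (at ?x)"
    by (intro has_derivative_inner C1_onD[OF ext_F q(3)] bounded_bilinear.FDERIV[OF bounded_bilinear_matrix_vector dG])
  moreover have "ip (G c (\<rho> x)) (F x) (F x) = 0" if "x \<in> N" for x
    using g_chart[OF L_TS L_TS c, of "chart_inv c (\<rho> x)"] L_TH(2)[of "chart_inv c (\<rho> x)"] ext_retract[OF that]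
      ext_FL[OF that] by simp
  ultimately have "((\<lambda>x. 0) has_derivative
     (\<lambda>v. F ?x \<bullet> (G c (\<rho> ?x) *v fd F ?x v + fd (G c) (\<rho> ?x) (fd \<rho> ?x v) *v F ?x) + fd F ?x v \<bullet> (G c (\<rho> ?x) *v F ?x))) (at ?x)"
    by (rule has_derivative_transform_within_open[OF _ ext_open q(3)])
  from fun_cong[OF has_derivative_unique[OF has_derivative_const this], of "v c"]
  have "0 = F ?x \<bullet> (G c ?x *v fd F ?x (v c) + fd (G c) ?x (v c) *v F ?x) + fd F ?x (v c) \<bullet> (G c ?x *v F ?x)"
    using ext_H(2)[OF q] ext_H(5)[OF q v] by simp
  then have "0 = 2 * ip (G c ?x) (fd F ?x (v c)) (F ?x) + ip (fd (G c) ?x (v c)) (F ?x) (F ?x)"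
    using ip_sym[OF xd, of "F ?x" "fd F ?x (v c)"] by (simp add: inner_add_right)
  then show ?thesis
    using metric_compatible[OF xd, where w = "v c" and u = "F ?x" and v = "F ?x"]
      ip_sym[OF xd, of "F ?x" "Gam (G c) ?x (v c) (F ?x)"] ext_H(3)[OF q] by (simp add: ip_bilinear)
qed

text \<open>The second fundamental form of H is a multiple of the Hessian of f, up to a
  \<open>Gam\<close> term that is symmetric too. With \<open>k w\<close> = g(L, w) and
  \<open>m w\<close> = df(w), both at \<rho> x, proportionality is used in the cross-multiplied form
  \<open>km\<close>, so that the factor between them need not be treated as a function.\<close>

lemma nabla_sym_chart:
  assumes q: "q \<in> H" "q \<in> fst c" "snd c q \<in> N" and v: "v \<in> TH q" and w: "w \<in> TH q"
  shows "ip (G c (snd c q)) (fd F (snd c q) (v c) + Gam (G c) (snd c q) (v c) (L q c)) (w c)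
    = ip (G c (snd c q)) (fd F (snd c q) (w c) + Gam (G c) (snd c q) (w c) (L q c)) (v c)"
proof -
  interpret metric_chart "dom c" "G c" by (rule metric_chart[OF c])
  let ?x = "snd c q"
  have xd: "?x \<in> dom c" using q by auto
  have \<rho>d: "\<rho> ` N \<subseteq> dom c" using ext_\<rho>N ext_dom by auto
  note fC1 = defining_C1[OF ext_def]
  obtain i where i: "fd f ?x (axis i 1) \<noteq> 0" using ext_def q(3) by (auto simp: defining_def)
  define k where "k w x = ip (G c (\<rho> x)) (F x) w" for w x
  define m where "m w x = fd f (\<rho> x) w" for w x
  have img: "\<rho> ` N \<subseteq> N" using ext_\<rho>N by auto
  have mC1: "C1_on (m w) N" for w
    unfolding m_def by (rule C1_on_compose(1)[OF ext_\<rho> fC1(2) img])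
  have GC1: "C1_on (\<lambda>x. G c (\<rho> x)) N" by (rule C1_on_compose(1)[OF ext_\<rho> G_C1 \<rho>d])
  have kC1: "C1_on (k w) N" for w
    unfolding k_def by (intro C1_on_bilinear[OF ext_F _ bounded_bilinear_inner] C1_on_bilinear[OF GC1 C1_on_const bounded_bilinear_matrix_vector])
  have km: "k w x * m (axis i 1) x = k (axis i 1) x * m w x" if "x \<in> N" for w x
  proof -
    let ?p = "chart_inv c (\<rho> x)"
    note p = ext_retract[OF that]
    have pN: "snd c ?p \<in> N" using p(3) img that by auto
    obtain \<mu> where "\<And>w. ip (G c (snd c ?p)) (L ?p c) w = \<mu> * fd f (snd c ?p) w"
      using normal_covector[OF ext_def c p(1,2) pN L_TS[OF p(1)] L_nz[OF p(1)] L_perp[OF p(1)]] by blast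
    then have "k w x = \<mu> * m w x" for w using p(3) ext_FL[OF that] by (simp add: k_def m_def)
    then show ?thesis by simp
  qed
  \<comment> \<open>For tangent b both \<open>k b\<close> and \<open>m b\<close> vanish at the
    point, so differentiating \<open>km\<close> leaves only the derivatives of these two.\<close>
  have key: "fd (k b) ?x a * m (axis i 1) ?x = k (axis i 1) ?x * fd (\<lambda>y. fd f y b) ?x a" if a: "fd \<rho> ?x a = a" and b: "fd f ?x b = 0"
    for a b
  proof -
    have m0: "m b ?x = 0" using b ext_H(2)[OF q] by (simp add: m_def)
    have k0: "k b ?x = 0" using km[OF q(3), of b] m0 i ext_H(2)[OF q] by (simp add: m_def)
    have 1: "((\<lambda>x. k b x * m (axis i 1) x) has_derivative (\<lambda>h. k b ?x * fd (m (axis i 1)) ?x h + fd (k b) ?x h * m (axis i 1) ?x)) (at ?x)"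
      by (rule has_derivative_mult[OF C1_onD[OF kC1 q(3)] C1_onD[OF mC1 q(3)]])
    have 2: "((\<lambda>x. k (axis i 1) x * m b x) has_derivative (\<lambda>h. k (axis i 1) ?x * fd (m b) ?x h + fd (k (axis i 1)) ?x h * m b ?x)) (at ?x)"
      by (rule has_derivative_mult[OF C1_onD[OF kC1 q(3)] C1_onD[OF mC1 q(3)]])
    have "((\<lambda>x. k (axis i 1) x * m b x) has_derivative (\<lambda>h. k b ?x * fd (m (axis i 1)) ?x h + fd (k b) ?x h * m (axis i 1) ?x)) (at ?x)"
      by (rule has_derivative_transform_within_open[OF 1 ext_open q(3) km])
    from fun_cong[OF has_derivative_unique[OF this 2], of a]
    have "fd (k b) ?x a * m (axis i 1) ?x = k (axis i 1) ?x * fd (m b) ?x a"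
      using m0 k0 by simp
    moreover have "fd (m b) ?x a = fd (\<lambda>y. fd f y b) ?x a"
    proof -
      have "m b = (\<lambda>x. fd f (\<rho> x) b)" by (simp add: fun_eq_iff m_def)
      then show ?thesis
        using fun_cong[OF C1_on_compose(2)[OF ext_\<rho> fC1(2)[of b] img q(3)], of a] a ext_H(2)[OF q] by simp
    qed
    ultimately show ?thesis by simp
  qed
  have va: "fd \<rho> ?x (v c) = v c" "fd f ?x (v c) = 0" using ext_H(4,5)[OF q] v by blast+
  have wa: "fd \<rho> ?x (w c) = w c" "fd f ?x (w c) = 0" using ext_H(4,5)[OF q] w by blast+
  have "fd (\<lambda>y. fd f y (w c)) ?x (v c) = fd (\<lambda>y. fd f y (v c)) ?x (w c)"
    by (rule second_derivative_symmetric[OF ext_open q(3) fC1])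
  then have "fd (k (w c)) ?x (v c) * m (axis i 1) ?x = fd (k (v c)) ?x (w c) * m (axis i 1) ?x"
    using key[OF va(1) wa(2)] key[OF wa(1) va(2)] by simp
  then have sym: "fd (k (w c)) ?x (v c) = fd (k (v c)) ?x (w c)" using i ext_H(2)[OF q] by (simp add: m_def)
  \<comment> \<open>By metric compatibility the derivative of \<open>k b\<close> is g(\<nabla>_a L,
    b) plus a term symmetric in a and b.\<close>
  have dk: "fd (k b) ?x a = ip (G c ?x) (fd F ?x a + Gam (G c) ?x a (F ?x)) b + ip (G c ?x) (F ?x) (Gam (G c) ?x a b)"
    if a: "fd \<rho> ?x a = a" for a b
  proof -
    have dG: "((\<lambda>x. G c (\<rho> x)) has_derivative (\<lambda>v. fd (G c) (\<rho> ?x) (fd \<rho> ?x v))) (at ?x)"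
      by (rule has_derivative_compose[OF C1_onD[OF ext_\<rho> q(3)] C1_onD[OF G_C1]]) (use \<rho>d q in auto)
    have "(k b has_derivative (\<lambda>v. F ?x \<bullet> (fd (G c) (\<rho> ?x) (fd \<rho> ?x v) *v b) + fd F ?x v \<bullet> (G c (\<rho> ?x) *v b))) (at ?x)"
      unfolding k_def
      by (intro has_derivative_inner C1_onD[OF ext_F q(3)]
          bounded_linear.has_derivative[OF bounded_bilinear.bounded_linear_left[OF bounded_bilinear_matrix_vector] dG])
    from fun_cong[OF fd_eq[OF this], of a] show ?thesis
      using metric_compatible[OF xd, where w = a and u = "F ?x" and v = b] ext_H(2)[OF q] a by (simp add: ip_bilinear)
  qed
  show ?thesis
    using sym unfolding dk[OF va(1)] dk[OF wa(1)] Gam_sym[OF xd, of "w c" "v c"] ext_H(3)[OF q] by simp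
qed

text \<open>The left side is the covariant derivative of \<nabla>_u L along L: the value supplied by
  \<open>C1_flow_variation\<close>, then the product rule for \<open>Gam\<close> of u and L with u'
  = DF u and L' = DF L, then the connection term. All terms with DF u cancel, and DF L is known from
  the geodesic equation.\<close>

lemma curvature_identity:
  assumes q: "q \<in> H" "q \<in> fst c" "snd c q \<in> N" and u: "u \<in> TH q"
  shows "fd (\<lambda>x. - Gam (G c) (\<rho> x) (F x) (F x)) (snd c q) (u c)
      + (dGam (G c) (snd c q) (L q c) (u c) (L q c) + Gam (G c) (snd c q) (fd F (snd c q) (u c)) (L q c)
         + Gam (G c) (snd c q) (u c) (fd F (snd c q) (L q c)))
      + Gam (G c) (snd c q) (L q c) (fd F (snd c q) (u c) + Gam (G c) (snd c q) (u c) (L q c))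
    = - curv (G c) (snd c q) (L q c) (u c) (L q c)"
proof -
  interpret metric_chart "dom c" "G c" by (rule metric_chart[OF c])
  let ?x = "snd c q"
  have xd: "?x \<in> dom c" using q by auto
  have "((\<lambda>x. Gam (G c) (\<rho> x) (F x) (F x)) has_derivative
    (\<lambda>h. dGam (G c) (\<rho> ?x) (fd \<rho> ?x h) (F ?x) (F ?x) + Gam (G c) (\<rho> ?x) (fd F ?x h) (F ?x) + Gam (G c) (\<rho> ?x) (F ?x) (fd F ?x h))) (at ?x)"
    by (rule Gam_has_derivative[OF _ C1_onD[OF ext_\<rho> q(3)] C1_onD[OF ext_F q(3)] C1_onD[OF ext_F q(3)]])
      (use ext_H(2)[OF q] xd in simp)
  from fun_cong[OF fd_eq[OF has_derivative_minus[OF this]], of "u c"]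
  have 1: "fd (\<lambda>x. - Gam (G c) (\<rho> x) (F x) (F x)) ?x (u c)
    = - (dGam (G c) ?x (u c) (L q c) (L q c) + Gam (G c) ?x (fd F ?x (u c)) (L q c) + Gam (G c) ?x (L q c) (fd F ?x (u c)))"
    using ext_H(2,3)[OF q] ext_H(5)[OF q u] by simp
  have 2: "fd F ?x (L q c) = - Gam (G c) ?x (L q c) (L q c)"
    using ext_geodesic[OF q(3)] ext_H(2,3)[OF q] by simp
  have 3: "Gam (G c) ?x (u c) (- Gam (G c) ?x (L q c) (L q c)) = - Gam (G c) ?x (u c) (Gam (G c) ?x (L q c) (L q c))"
    using Gam_linear(4)[of "G c" ?x "u c" "-1" "Gam (G c) ?x (L q c) (L q c)"] by simp
  have 4: "Gam (G c) ?x (L q c) (fd F ?x (u c)) = Gam (G c) ?x (fd F ?x (u c)) (L q c)"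
    by (rule Gam_sym[OF xd])
  show ?thesis
    unfolding 1 2 3 Gam_linear 4 curv_def Gam_sym[OF xd, of "u c" "L q c"] by simp
qed

end

section \<open>The Weingarten map of H, free of charts\<close>

lemma nabla_TH:
  assumes p: "p \<in> H" and v: "v \<in> TH p" shows "nabla A g H L p v \<in> TH p"
proof -
  obtain c where c: "c \<in> A" "p \<in> fst c" using chart_ex .
  obtain N f \<rho> F where e: "extension c N f \<rho> F" "snd c p \<in> N" using extension_ex[OF p c] .
  have T: "nabla A g H L p v \<in> TS p" unfolding nabla_eq[OF e(1) c(1) p c(2) e(2) v] by (rule tv_TS[OF c])
  have "g p (nabla A g H L p v) (L p) = 0"
    unfolding g_chart[OF T L_TS[OF p] c] nabla_c[OF e(1) c(1) p c(2) e(2) v]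
    by (rule nabla_perp_chart[OF e(1) c(1) p c(2) e(2) v])
  then show ?thesis using T g_sym[OF T L_TS[OF p]] TH_perp[OF p] by simp
qed

lemma nabla_sym:
  assumes p: "p \<in> H" and v: "v \<in> TH p" and w: "w \<in> TH p"
  shows "g p (nabla A g H L p v) w = g p (nabla A g H L p w) v"
proof -
  obtain c where c: "c \<in> A" "p \<in> fst c" using chart_ex .
  obtain N f \<rho> F where e: "extension c N f \<rho> F" "snd c p \<in> N" using extension_ex[OF p c] .
  have T: "nabla A g H L p v \<in> TS p" "nabla A g H L p w \<in> TS p"
    using TH_TS[OF p nabla_TH[OF p]] v w by blast+
  show ?thesis
    unfolding g_chart[OF T(1) TH_TS[OF p w] c] g_chart[OF T(2) TH_TS[OF p v] c]
      nabla_c[OF e(1) c(1) p c(2) e(2) v] nabla_c[OF e(1) c(1) p c(2) e(2) w]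
    by (rule nabla_sym_chart[OF e(1) c(1) p c(2) e(2) v w])
qed

lemma nabla_lin:
  assumes p: "p \<in> H" and v: "\<And>i. i \<in> S \<Longrightarrow> e i \<in> TH p"
  shows "nabla A g H L p (\<lambda>c. \<Sum>i\<in>S. a i *\<^sub>R e i c) = (\<lambda>c. \<Sum>i\<in>S. a i *\<^sub>R nabla A g H L p (e i) c)"
    and "(\<lambda>c. \<Sum>i\<in>S. a i *\<^sub>R e i c) \<in> TH p"
proof -
  obtain c where c: "c \<in> A" "p \<in> fst c" using chart_ex .
  obtain N f \<rho> F where e: "extension c N f \<rho> F" "snd c p \<in> N" using extension_ex[OF p c] .
  have s: "(\<lambda>c. \<Sum>i\<in>S. a i *\<^sub>R e i c) \<in> TS p" using TS_sum[of S e p a] TH_TS[OF p] v by blast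
  have linf: "linear (fd f (snd c p))" by (rule C1_on_linear[OF defining_C1(1)[OF ext_def[OF e(1) c(1)]] e(2)])
  have linF: "linear (fd F (snd c p))" by (rule C1_on_linear[OF ext_F[OF e(1) c(1)] e(2)])
  have linG: "linear (\<lambda>v. Gam (G c) (snd c p) v (L p c))" by (rule linearI) (simp_all add: Gam_linear)
  have "fd f (snd c p) (e i c) = 0" if "i \<in> S" for i
    using v[OF that] ext_H(4)[OF e(1) c(1) p c(2) e(2)] by blast
  then show t: "(\<lambda>c. \<Sum>i\<in>S. a i *\<^sub>R e i c) \<in> TH p"
    unfolding ext_H(4)[OF e(1) c(1) p c(2) e(2)] using s by (simp add: linear_sum[OF linf] linear_cmul[OF linf])
  have n1: "nabla A g H L p (\<lambda>c. \<Sum>i\<in>S. a i *\<^sub>R e i c) \<in> TS p"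
    using TH_TS[OF p nabla_TH[OF p t]] .
  have n2: "(\<lambda>c. \<Sum>i\<in>S. a i *\<^sub>R nabla A g H L p (e i) c) \<in> TS p"
    using TS_sum[of S "\<lambda>i. nabla A g H L p (e i)" p a] TH_TS[OF p nabla_TH[OF p]] v by blast
  show "nabla A g H L p (\<lambda>c. \<Sum>i\<in>S. a i *\<^sub>R e i c) = (\<lambda>c. \<Sum>i\<in>S. a i *\<^sub>R nabla A g H L p (e i) c)"
  proof (rule TS_eqI[OF n1 n2 c])
    show "nabla A g H L p (\<lambda>c. \<Sum>i\<in>S. a i *\<^sub>R e i c) c = (\<Sum>i\<in>S. a i *\<^sub>R nabla A g H L p (e i) c)"
      unfolding nabla_c[OF e(1) c(1) p c(2) e(2) t] linear_sum[OF linF] linear_cmul[OF linF] linear_sum[OF linG] linear_cmul[OF linG]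
        sum.distrib[symmetric] scaleR_add_right[symmetric]
      by (intro sum.cong refl) (simp add: nabla_c[OF e(1) c(1) p c(2) e(2) v])
  qed
qed

end

section \<open>Covariant calculus along an integral curve of L\<close>

lemma (in metric_chart) curv_continuous:
  assumes x: "continuous_on K x" "x ` K \<subseteq> U" and "continuous_on K X" "continuous_on K Y" "continuous_on K Z"
  shows "continuous_on K (\<lambda>t. curv G (x t) (X t) (Y t) (Z t))"
proof -
  have d: "continuous_on K (\<lambda>t. dGam G (x t) (w t) (u t) (v t))"
    if "continuous_on K w" "continuous_on K u" "continuous_on K v" for w u v
  proof -
    have "continuous_on K (\<lambda>t. fd (\<lambda>y. chr G y k i j) (x t) (w t))" for k i j
      by (rule C1_on_continuous_compose[OF chr_C1 x that(1)])
    then have "continuous_on K (\<lambda>t. \<Sum>i\<in>UNIV. \<Sum>j\<in>UNIV. fd (\<lambda>y. chr G y k i j) (x t) (w t) * u t $ i * v t $ j)" for k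
      by (intro continuous_on_sum continuous_on_mult continuous_on_component that)
    then show ?thesis unfolding dGam_def by (rule continuous_on_vec_lambda)
  qed
  show ?thesis unfolding curv_def
    by (intro continuous_on_diff continuous_on_add d Gam_continuous x assms)
qed

lemma (in lorentz) metric_derivative:
  assumes v: "has_velocity A I \<gamma> v t" and cont: "continuous (at t within I) \<gamma>" and t: "t \<in> I"
    and lim: "at t within I \<noteq> bot"
    and X: "has_cov_deriv A g I \<gamma> X DX t" and Y: "has_cov_deriv A g I \<gamma> Y DY t"
  shows "((\<lambda>s. g (\<gamma> s) (X s) (Y s)) has_real_derivative g (\<gamma> t) DX (Y t) + g (\<gamma> t) (X t) DY) (at t within I)"
proof -
  obtain c where c: "c \<in> A" "\<gamma> t \<in> fst c" using chart_ex .
  interpret metric_chart "dom c" "G c" by (rule metric_chart[OF c(1)])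
  let ?x = "snd c (\<gamma> t)"
  have TSX: "\<And>s. s \<in> I \<Longrightarrow> X s \<in> TS (\<gamma> s)" "DX \<in> TS (\<gamma> t)" and TSY: "\<And>s. s \<in> I \<Longrightarrow> Y s \<in> TS (\<gamma> s)" "DY \<in> TS (\<gamma> t)"
    using X Y unfolding has_cov_deriv_iff by blast+
  have xd: "?x \<in> dom c" using c by auto
  have "\<forall>\<^sub>F s in at t within I. \<gamma> s \<in> fst c"
    using c cont chart_open(1)[OF c(1)] by (intro topological_tendstoD[of \<gamma> "\<gamma> t"]) (auto simp: continuous_within)
  then obtain d where d: "d > 0" "\<And>s. s \<in> I \<Longrightarrow> dist s t < d \<Longrightarrow> \<gamma> s \<in> fst c"
    using c unfolding eventually_at by metis
  let ?L = "v c"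
  note vc = velocityD(2)[OF v c]
  have dG: "((\<lambda>s. G c (snd c (\<gamma> s))) has_vector_derivative fd (G c) ?x ?L) (at t within I)"
    using has_derivative_compose[OF vc[unfolded has_vector_derivative_def] C1_onD[OF G_C1 xd]]
    unfolding has_vector_derivative_def linear_cmul[OF C1_on_linear[OF G_C1 xd]] .
  have "((\<lambda>s. ip (G c (snd c (\<gamma> s))) (X s c) (Y s c)) has_vector_derivative
     X t c \<bullet> (G c ?x *v (DY c - Gam (G c) ?x ?L (Y t c)) + fd (G c) ?x ?L *v Y t c)
      + (DX c - Gam (G c) ?x ?L (X t c)) \<bullet> (G c ?x *v Y t c)) (at t within I)"
    by (intro bounded_bilinear.has_vector_derivative[OF bounded_bilinear_inner] has_cov_derivD[OF X c vc lim] has_cov_derivD[OF Y c vc lim]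
        bounded_bilinear.has_vector_derivative[OF bounded_bilinear_matrix_vector dG])
  then have "((\<lambda>s. g (\<gamma> s) (X s) (Y s)) has_vector_derivative
     X t c \<bullet> (G c ?x *v (DY c - Gam (G c) ?x ?L (Y t c)) + fd (G c) ?x ?L *v Y t c)
      + (DX c - Gam (G c) ?x ?L (X t c)) \<bullet> (G c ?x *v Y t c)) (at t within I)"
  proof (rule has_vector_derivative_transform_within[OF _ d(1) t])
    fix s assume s: "s \<in> I" "dist s t < d"
    show "ip (G c (snd c (\<gamma> s))) (X s c) (Y s c) = g (\<gamma> s) (X s) (Y s)"
      using g_chart[OF TSX(1)[OF s(1)] TSY(1)[OF s(1)] c(1) d(2)[OF s]] by simp
  qed
  moreover have "X t c \<bullet> (G c ?x *v (DY c - Gam (G c) ?x ?L (Y t c)) + fd (G c) ?x ?L *v Y t c)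
      + (DX c - Gam (G c) ?x ?L (X t c)) \<bullet> (G c ?x *v Y t c) = g (\<gamma> t) DX (Y t) + g (\<gamma> t) (X t) DY"
    using metric_compatible[OF xd, where w = ?L and u = "X t c" and v = "Y t c"]
      g_chart[OF TSX(2) TSY(1)[OF t] c] g_chart[OF TSX(1)[OF t] TSY(2) c]
    by (simp add: inner_add_right ip_bilinear)
  ultimately show ?thesis by (simp add: has_real_derivative_iff_has_vector_derivative)
qed

text \<open>What is used of \<open>Psi\<close> on its interval. The interval may contain endpoints,
  where derivatives are one-sided; \<open>lim\<close> excludes a single point, at which derivatives
  would not be unique.\<close>

locale null_curve = null_hyp A g T H L
  for A :: "('m::{t2_space, second_countable_topology}, 'n::finite) chart set"
    and g :: "('m, 'n) metric" and T :: "'m \<Rightarrow> ('m, 'n) tvec" and H and L +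
  fixes I :: "real set" and \<gamma> :: "real \<Rightarrow> 'm"
  assumes I: "is_interval I" and lim: "t \<in> I \<Longrightarrow> at t within I \<noteq> bot"
    and in_H: "t \<in> I \<Longrightarrow> \<gamma> t \<in> H" and cont: "continuous_on I \<gamma>"
    and vel: "t \<in> I \<Longrightarrow> has_velocity A I \<gamma> (L (\<gamma> t)) t"
begin

abbreviation cov :: "(real \<Rightarrow> ('m, 'n) tvec) \<Rightarrow> ('m, 'n) tvec \<Rightarrow> real \<Rightarrow> bool" where
  "cov \<equiv> has_cov_deriv A g I \<gamma>"

abbreviation nab :: "real \<Rightarrow> ('m, 'n) tvec \<Rightarrow> ('m, 'n) tvec" where
  "nab t \<equiv> nabla A g H L (\<gamma> t)"

lemma cont_at: "t \<in> I \<Longrightarrow> continuous (at t within I) \<gamma>"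
  using cont by (simp add: continuous_on_eq_continuous_within)

lemma chart_nbhd:
  assumes t: "t \<in> I" and c: "c \<in> A" "\<gamma> t \<in> fst c" and N: "open N" "snd c (\<gamma> t) \<in> N"
  obtains d where "d > 0" "\<And>r. r \<in> I \<inter> ball t d \<Longrightarrow> \<gamma> r \<in> fst c \<and> snd c (\<gamma> r) \<in> N"
proof -
  have o: "open (fst c \<inter> snd c -` N)"
    by (rule continuous_open_preimage[OF chart_cont(1)[OF c(1)] chart_open(1)[OF c(1)] N(1)])
  have "\<forall>\<^sub>F s in at t within I. \<gamma> s \<in> fst c \<inter> snd c -` N"
    using o c N cont_at[OF t] by (intro topological_tendstoD[of \<gamma> "\<gamma> t"]) (auto simp: continuous_within)
  then obtain e where e: "e > 0" "\<And>s. s \<in> I \<Longrightarrow> s \<noteq> t \<Longrightarrow> dist s t < e \<Longrightarrow> \<gamma> s \<in> fst c \<inter> snd c -` N"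
    unfolding eventually_at by metis
  have "\<gamma> r \<in> fst c \<and> snd c (\<gamma> r) \<in> N" if "r \<in> I \<inter> ball t e" for r
    using e(2)[of r] that c N by (cases "r = t") (auto simp: dist_commute)
  then show ?thesis using that e(1) by blast
qed

lemma vel_c: "t \<in> I \<Longrightarrow> c \<in> A \<Longrightarrow> \<gamma> t \<in> fst c \<Longrightarrow>
    ((\<lambda>s. snd c (\<gamma> s)) has_vector_derivative L (\<gamma> t) c) (at t within I)"
  using velocityD(2)[OF vel] .

lemma within_ball: "r \<in> I \<inter> ball t d \<Longrightarrow> at r within I = at r within (I \<inter> ball t d)"
  by (rule at_within_nhd[of r "ball t d"]) auto

lemma cov_TS: "cov V X t \<Longrightarrow> s \<in> I \<Longrightarrow> V s \<in> TS (\<gamma> s)" "cov V X t \<Longrightarrow> X \<in> TS (\<gamma> t)"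
  unfolding has_cov_deriv_iff by blast+

lemma covD: "cov V X t \<Longrightarrow> t \<in> I \<Longrightarrow> c \<in> A \<Longrightarrow> \<gamma> t \<in> fst c \<Longrightarrow>
  ((\<lambda>s. V s c) has_vector_derivative X c - Gam (G c) (snd c (\<gamma> t)) (L (\<gamma> t) c) (V t c)) (at t within I)"
  by (rule has_cov_derivD[OF _ _ _ vel_c lim])

lemma covI: "c \<in> A \<Longrightarrow> \<gamma> t \<in> fst c \<Longrightarrow> t \<in> I \<Longrightarrow> (\<And>s. s \<in> I \<Longrightarrow> V s \<in> TS (\<gamma> s)) \<Longrightarrow>
  ((\<lambda>s. V s c) has_vector_derivative V') (at t within I) \<Longrightarrow>
  cov V (tv c (\<gamma> t) (V' + Gam (G c) (snd c (\<gamma> t)) (L (\<gamma> t) c) (V t c))) t"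
  by (rule has_cov_derivI[OF _ _ _ _ cont_at vel_c])

lemma cov_allI:
  assumes "\<And>s. s \<in> I \<Longrightarrow> V s \<in> TS (\<gamma> s)" "X \<in> TS (\<gamma> t)" "t \<in> I"
    "\<And>c. c \<in> A \<Longrightarrow> \<gamma> t \<in> fst c \<Longrightarrow>
      ((\<lambda>s. V s c) has_vector_derivative X c - Gam (G c) (snd c (\<gamma> t)) (L (\<gamma> t) c) (V t c)) (at t within I)"
  shows "cov V X t"
  unfolding has_cov_deriv_iff
proof (intro conjI ballI impI)
  fix c assume c: "c \<in> A" "\<gamma> t \<in> fst c"
  show "\<exists>\<gamma>' V'. ((\<lambda>s. snd c (\<gamma> s)) has_vector_derivative \<gamma>') (at t within I) \<and>
        ((\<lambda>s. V s c) has_vector_derivative V') (at t within I) \<and>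
        X c = V' + Gam (G c) (snd c (\<gamma> t)) \<gamma>' (V t c)"
    using vel_c[OF assms(3) c] assms(4)[OF c]
    by (intro exI[of _ "L (\<gamma> t) c"] exI[of _ "X c - Gam (G c) (snd c (\<gamma> t)) (L (\<gamma> t) c) (V t c)"]) simp
qed (use assms in auto)

lemma cov_unique: "cov V X t \<Longrightarrow> cov V Y t \<Longrightarrow> t \<in> I \<Longrightarrow> X = Y"
  using has_cov_deriv_unique lim by blast

lemma L_parallel:
  assumes t: "t \<in> I" shows "cov (\<lambda>s. L (\<gamma> s)) tzero t"
proof (rule cov_allI[OF _ TS_zero t])
  show "L (\<gamma> s) \<in> TS (\<gamma> s)" if "s \<in> I" for s using L_TS[OF in_H[OF that]] .
  fix c assume c: "c \<in> A" "\<gamma> t \<in> fst c"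
  obtain N f \<rho> F where e: "extension c N f \<rho> F" "snd c (\<gamma> t) \<in> N" using extension_ex[OF in_H[OF t] c] .
  have "\<gamma> ` I \<subseteq> H" using in_H by auto
  from ext_curve[OF e(1) c(1) t cont_at[OF t] this c(2) e(2) vel_c[OF t c]]
  show "((\<lambda>s. L (\<gamma> s) c) has_vector_derivative tzero c - Gam (G c) (snd c (\<gamma> t)) (L (\<gamma> t) c) (L (\<gamma> t) c)) (at t within I)"
    using ext_geodesic[OF e(1) c(1) e(2)] ext_H(2,3)[OF e(1) c(1) in_H[OF t] c(2) e(2)] by (simp add: tzero_def)
qed

lemma metric_deriv:
  assumes X: "cov X DX t" and Y: "cov Y DY t" and t: "t \<in> I"
  shows "((\<lambda>s. g (\<gamma> s) (X s) (Y s)) has_real_derivative g (\<gamma> t) DX (Y t) + g (\<gamma> t) (X t) DY) (at t within I)"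
  by (rule metric_derivative[OF vel[OF t] cont_at[OF t] t lim[OF t] X Y])

lemma cov_sum:
  assumes X: "\<And>i. i \<in> S \<Longrightarrow> cov (X i) (DX i) t" and t: "t \<in> I"
    and a: "\<And>i. i \<in> S \<Longrightarrow> ((\<lambda>s. a i s) has_real_derivative a' i) (at t within I)"
  shows "cov (\<lambda>s c. \<Sum>i\<in>S. a i s *\<^sub>R X i s c) (\<lambda>c. (\<Sum>i\<in>S. a' i *\<^sub>R X i t c) + (\<Sum>i\<in>S. a i t *\<^sub>R DX i c)) t"
proof (rule cov_allI[OF _ _ t])
  show "(\<lambda>c. \<Sum>i\<in>S. a i s *\<^sub>R X i s c) \<in> TS (\<gamma> s)" if "s \<in> I" for s
    by (rule TS_sum) (use cov_TS(1)[OF X that] in blast)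
  have "tadd (\<lambda>c. \<Sum>i\<in>S. a' i *\<^sub>R X i t c) (\<lambda>c. \<Sum>i\<in>S. a i t *\<^sub>R DX i c) \<in> TS (\<gamma> t)"
    by (intro TS_add TS_sum) (use cov_TS(1)[OF X t] cov_TS(2)[OF X] in blast)+
  then show "(\<lambda>c. (\<Sum>i\<in>S. a' i *\<^sub>R X i t c) + (\<Sum>i\<in>S. a i t *\<^sub>R DX i c)) \<in> TS (\<gamma> t)"
    by (simp add: tadd_def)
  fix c assume c: "c \<in> A" "\<gamma> t \<in> fst c"
  let ?Ga = "Gam (G c) (snd c (\<gamma> t)) (L (\<gamma> t) c)"
  have lin: "linear ?Ga" by (rule linearI) (simp_all add: Gam_linear)
  have "((\<lambda>s. \<Sum>i\<in>S. a i s *\<^sub>R X i s c) has_vector_derivative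
     (\<Sum>i\<in>S. a i t *\<^sub>R (DX i c - ?Ga (X i t c)) + a' i *\<^sub>R X i t c)) (at t within I)"
    by (intro has_vector_derivative_sum bounded_bilinear.has_vector_derivative[OF bounded_bilinear_scaleR] covD[OF X t c]
       a[unfolded has_real_derivative_iff_has_vector_derivative])
  moreover have "(\<Sum>i\<in>S. a i t *\<^sub>R (DX i c - ?Ga (X i t c)) + a' i *\<^sub>R X i t c)
     = (\<Sum>i\<in>S. a' i *\<^sub>R X i t c) + (\<Sum>i\<in>S. a i t *\<^sub>R DX i c) - ?Ga (\<Sum>i\<in>S. a i t *\<^sub>R X i t c)"
    by (simp add: linear_sum[OF lin] linear_cmul[OF lin] scaleR_diff_right sum.distrib sum_subtractf algebra_simps)
  ultimately show "((\<lambda>s. \<Sum>i\<in>S. a i s *\<^sub>R X i s c) has_vector_derivative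
     (\<Sum>i\<in>S. a' i *\<^sub>R X i t c) + (\<Sum>i\<in>S. a i t *\<^sub>R DX i c) - ?Ga (\<Sum>i\<in>S. a i t *\<^sub>R X i t c)) (at t within I)"
    by simp
qed

text \<open>In a chart the hypothesis reads u' = DF(\<gamma>) u, because the two \<open>Gam\<close>
  terms cancel by symmetry. So \<open>C1_flow_variation\<close> applies, with q from
  \<open>ext_geodesic\<close>, and \<open>curvature_identity\<close> evaluates the result.\<close>

lemma jacobi_of_weingarten:
  assumes J: "\<And>t. t \<in> I \<Longrightarrow> J t \<in> TH (\<gamma> t)" "\<And>t. t \<in> I \<Longrightarrow> cov J (nab t (J t)) t" and t: "t \<in> I"
  shows "cov (\<lambda>s. nab s (J s)) (tscale (-1) (curvature A g (\<gamma> t) (L (\<gamma> t)) (J t) (L (\<gamma> t)))) t"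
proof -
  let ?X = "tscale (-1) (curvature A g (\<gamma> t) (L (\<gamma> t)) (J t) (L (\<gamma> t)))"
  have nT: "nab s (J s) \<in> TS (\<gamma> s)" if "s \<in> I" for s
    using TH_TS[OF in_H[OF that] nabla_TH[OF in_H[OF that] J(1)[OF that]]] .
  have loc: "cov (\<lambda>s. nab s (J s)) (tv c (\<gamma> t) (- curv (G c) (snd c (\<gamma> t)) (L (\<gamma> t) c) (J t c) (L (\<gamma> t) c))) t"
    if c: "c \<in> A" "\<gamma> t \<in> fst c" for c
  proof -
    interpret metric_chart "dom c" "G c" by (rule metric_chart[OF c(1)])
    obtain N f \<rho> F where e: "extension c N f \<rho> F" "snd c (\<gamma> t) \<in> N" using extension_ex[OF in_H[OF t] c] .
    note ex = e(1) c(1)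
    obtain d where d: "d > 0" "\<And>r. r \<in> I \<inter> ball t d \<Longrightarrow> \<gamma> r \<in> fst c \<and> snd c (\<gamma> r) \<in> N"
      using chart_nbhd[OF t c ext_open[OF ex] e(2)] by metis
    have tJ: "t \<in> I \<inter> ball t d" using t d by auto
    \<comment> \<open>\<open>C1_flow_variation\<close> needs a compact interval; this one is a
      neighbourhood of t in I, so derivatives at t within it and within I agree.\<close>
    obtain a b d2 where ab: "d2 > 0" "a \<le> t" "t \<le> b" "{a..b} \<subseteq> I \<inter> ball t d"
      "I \<inter> ball t d \<inter> ball t d2 \<subseteq> {a..b}"
      by (rule interval_compact_nbhd[OF is_interval_Int_ball[OF I, of t d] tJ, of 1]) auto
    let ?K = "{a..b}"
    have tK: "t \<in> ?K" using ab by auto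
    have KI: "r \<in> I" "\<gamma> r \<in> fst c" "snd c (\<gamma> r) \<in> N" if "r \<in> ?K" for r
      using ab(4) d(2) that by blast+
    have KI': "?K \<subseteq> I" using KI by auto
    have atK: "at t within I = at t within ?K"
      by (rule at_within_nhd[of t "ball t d \<inter> ball t d2"]) (use ab d in auto)
    let ?x = "\<lambda>s. snd c (\<gamma> s)" and ?u = "\<lambda>s. J s c" and ?L = "\<lambda>s. L (\<gamma> s) c"
    have FL: "F (?x r) = ?L r" "\<rho> (?x r) = ?x r" if "r \<in> ?K" for r
      using ext_H(2,3)[OF ex in_H[OF KI(1)[OF that]] KI(2,3)[OF that]] by auto
    have nc: "nab r (J r) c = fd F (?x r) (?u r) + Gam (G c) (?x r) (?u r) (?L r)" if "r \<in> ?K" for r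
      by (rule nabla_c[OF ex in_H[OF KI(1)[OF that]] KI(2,3)[OF that] J(1)[OF KI(1)[OF that]]])
    have dx: "(?x has_vector_derivative ?L r) (at r within ?K)" if "r \<in> ?K" for r
      using has_vector_derivative_within_subset[OF vel_c[OF KI(1) c(1) KI(2)] KI'] that by blast
    have du: "(?u has_vector_derivative fd F (?x r) (?u r)) (at r within ?K)" if r: "r \<in> ?K" for r
    proof -
      have xd: "?x r \<in> dom c" using KI(2)[OF r] by auto
      have "(?u has_vector_derivative nab r (J r) c - Gam (G c) (?x r) (?L r) (?u r)) (at r within ?K)"
        by (rule has_vector_derivative_within_subset[OF covD[OF J(2)[OF KI(1)[OF r]] KI(1)[OF r] c(1) KI(2)[OF r]] KI'])
      then show ?thesis unfolding nc[OF r] Gam_sym[OF xd, of "?L r"] by simp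
    qed
    let ?q = "\<lambda>x. - Gam (G c) (\<rho> x) (F x) (F x)"
    have \<rho>d: "\<rho> ` N \<subseteq> dom c" using ext_\<rho>N[OF ex] ext_dom[OF ex] by auto
    have "((\<lambda>r. fd F (?x r) (?u r)) has_vector_derivative fd ?q (?x t) (?u t)) (at t within ?K)"
    proof (rule C1_flow_variation[OF ext_open[OF ex] ext_F[OF ex] _ ext_geodesic[OF ex] compact_Icc _ KI(3) _ du tK])
      show "C1_on ?q N" by (intro C1_on_minus Gam_C1[OF ext_\<rho>[OF ex] \<rho>d ext_F[OF ex] ext_F[OF ex]])
      show "(?x has_vector_derivative F (?x r)) (at r within ?K)" if "r \<in> ?K" for r
        using dx[OF that] FL(1)[OF that] by simp
    qed auto
    moreover have "((\<lambda>r. Gam (G c) (?x r) (?u r) (?L r)) has_vector_derivative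
       (dGam (G c) (?x t) (?L t) (?u t) (?L t) + Gam (G c) (?x t) (fd F (?x t) (?u t)) (?L t)
         + Gam (G c) (?x t) (?u t) (fd F (?x t) (?L t)))) (at t within ?K)"
    proof -
      have xd: "?x t \<in> dom c" using c by auto
      have "\<gamma> ` I \<subseteq> H" using in_H by auto
      then have dL: "(?L has_vector_derivative fd F (?x t) (?L t)) (at t within ?K)"
        using ext_curve[OF ex t cont_at[OF t] _ c(2) e(2) vel_c[OF t c]] has_vector_derivative_within_subset[OF _ KI'] by blast
      from Gam_has_derivative[OF xd dx[OF tK, unfolded has_vector_derivative_def] du[OF tK, unfolded has_vector_derivative_def]
          dL[unfolded has_vector_derivative_def]]
      show ?thesis
        by (simp add: has_vector_derivative_def linear_cmul[OF dGam_linear_dir[OF xd]] Gam_linear scaleR_add_right)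
    qed
    ultimately have "((\<lambda>r. fd F (?x r) (?u r) + Gam (G c) (?x r) (?u r) (?L r)) has_vector_derivative
       fd ?q (?x t) (?u t) + (dGam (G c) (?x t) (?L t) (?u t) (?L t) + Gam (G c) (?x t) (fd F (?x t) (?u t)) (?L t)
         + Gam (G c) (?x t) (?u t) (fd F (?x t) (?L t)))) (at t within ?K)"
      by (rule has_vector_derivative_add)
    then have "((\<lambda>r. nab r (J r) c) has_vector_derivative
       fd ?q (?x t) (?u t) + (dGam (G c) (?x t) (?L t) (?u t) (?L t) + Gam (G c) (?x t) (fd F (?x t) (?u t)) (?L t)
         + Gam (G c) (?x t) (?u t) (fd F (?x t) (?L t)))) (at t within I)"
      unfolding atK by (rule has_vector_derivative_transform[OF tK nc, rotated])
    from covI[OF c t nT this] show ?thesis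
      unfolding nc[OF tK] curvature_identity[OF ex in_H[OF t] c(2) e(2) J(1)[OF t]] .
  qed
  obtain c where c: "c \<in> A" "\<gamma> t \<in> fst c" using chart_ex .
  let ?Y = "tv c (\<gamma> t) (- curv (G c) (snd c (\<gamma> t)) (L (\<gamma> t) c) (J t c) (L (\<gamma> t) c))"
  \<comment> \<open>Along the curve, chart independence of this curvature vector follows from
    uniqueness: the covariant derivative of one field, computed in two charts, is one
    vector.\<close>
  have "?X d = ?Y d" for d
  proof (cases "d \<in> A \<and> \<gamma> t \<in> fst d")
    case True
    then have "?Y = tv d (\<gamma> t) (- curv (G d) (snd d (\<gamma> t)) (L (\<gamma> t) d) (J t d) (L (\<gamma> t) d))"
      using cov_unique[OF loc[OF c] loc[of d] t] by blast
    then show ?thesis using True by (simp add: tv_self tscale_def curvature_curv)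
  next
    case False
    then show ?thesis by (auto simp: tv_def tscale_def curvature_def)
  qed
  then have "?X = ?Y" by (rule ext)
  then show ?thesis using loc[OF c] by (simp only:)
qed

text \<open>The coefficient matrix of parallel transport in the chart c, by
  \<open>pm_eq\<close>.\<close>

definition pm :: "('m, 'n) chart \<Rightarrow> real \<Rightarrow> real^'n^'n" where
  "pm c r = (\<chi> k j. - (\<Sum>i\<in>UNIV. chr (G c) (snd c (\<gamma> r)) k i j * L (\<gamma> r) c $ i))"

lemma pm_eq: "pm c r *v v = - Gam (G c) (snd c (\<gamma> r)) (L (\<gamma> r) c) v"
proof -
  have "(pm c r *v v) $ k = (- Gam (G c) (snd c (\<gamma> r)) (L (\<gamma> r) c) v) $ k" for k
    unfolding Gam_def pm_def vector_uminus_component vec_lambda_beta matrix_vector_mult_def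
    by (subst sum.swap) (simp add: sum_negf sum_distrib_right)
  then show ?thesis by (simp add: Finite_Cartesian_Product.vec_eq_iff)
qed

lemma L_cont:
  assumes "c \<in> A" "J \<subseteq> I" "\<And>r. r \<in> J \<Longrightarrow> \<gamma> r \<in> fst c"
  shows "continuous_on J (\<lambda>r. L (\<gamma> r) c)" "continuous_on J (\<lambda>r. snd c (\<gamma> r))"
proof -
  have "continuous (at r within J) (\<lambda>r. L (\<gamma> r) c)" if "r \<in> J" for r
    using has_vector_derivative_continuous[OF has_vector_derivative_within_subset[OF covD[OF L_parallel]]] assms that by blast
  then show "continuous_on J (\<lambda>r. L (\<gamma> r) c)" by (simp add: continuous_on_eq_continuous_within)
  have "continuous (at r within J) (\<lambda>r. snd c (\<gamma> r))" if "r \<in> J" for r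
    using has_vector_derivative_continuous[OF has_vector_derivative_within_subset[OF vel_c]] assms that by blast
  then show "continuous_on J (\<lambda>r. snd c (\<gamma> r))" by (simp add: continuous_on_eq_continuous_within)
qed

lemma pm_cont:
  assumes "c \<in> A" "J \<subseteq> I" "\<And>r. r \<in> J \<Longrightarrow> \<gamma> r \<in> fst c"
  shows "continuous_on J (pm c)"
proof -
  interpret metric_chart "dom c" "G c" by (rule metric_chart[OF assms(1)])
  have "(\<lambda>r. snd c (\<gamma> r)) ` J \<subseteq> dom c" using assms(3) by auto
  then have "continuous_on J (\<lambda>r. chr (G c) (snd c (\<gamma> r)) k i j)" for k i j
    using continuous_on_compose2[OF C1_on_continuous[OF chr_C1] L_cont(2)[OF assms]] by simp
  then show ?thesis
    unfolding pm_def
    by (intro continuous_on_vec_lambda continuous_on_minus continuous_on_sum continuous_on_mult continuous_on_component L_cont[OF assms])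
qed

lemma parallel_local_unique:
  assumes J: "is_interval J" "J \<subseteq> I" and c: "c \<in> A" "\<And>r. r \<in> J \<Longrightarrow> \<gamma> r \<in> fst c"
    and V: "\<And>r. r \<in> J \<Longrightarrow> ((\<lambda>s. V s c) has_vector_derivative - Gam (G c) (snd c (\<gamma> r)) (L (\<gamma> r) c) (V r c)) (at r within I)"
    and V': "\<And>r. r \<in> J \<Longrightarrow> ((\<lambda>s. V' s c) has_vector_derivative - Gam (G c) (snd c (\<gamma> r)) (L (\<gamma> r) c) (V' r c)) (at r within I)"
    and TS: "\<And>r. r \<in> J \<Longrightarrow> V r \<in> TS (\<gamma> r)" "\<And>r. r \<in> J \<Longrightarrow> V' r \<in> TS (\<gamma> r)"
    and s: "s \<in> J" "V s = V' s" and r: "r \<in> J"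
  shows "V r = V' r"
proof -
  have "V r c = V' r c"
  proof (rule linear_ode_unique[where V = "\<lambda>s. V s c" and V' = "\<lambda>s. V' s c" and s = s, OF bounded_bilinear_matrix_vector pm_cont[OF c(1) J(2) c(2)] J(1) _ _ s(1) _ r])
    show "((\<lambda>s. V s c) has_vector_derivative pm c t *v V t c) (at t within J)" if "t \<in> J" for t
      using has_vector_derivative_within_subset[OF V[OF that] J(2)] by (simp add: pm_eq)
    show "((\<lambda>s. V' s c) has_vector_derivative pm c t *v V' t c) (at t within J)" if "t \<in> J" for t
      using has_vector_derivative_within_subset[OF V'[OF that] J(2)] by (simp add: pm_eq)
  qed (use s in auto)
  then show ?thesis using TS_eqI[OF TS(1)[OF r] TS(2)[OF r] c(1) c(2)[OF r]] by blast
qed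

lemma parallel_unique:
  assumes V: "\<And>t. t \<in> I \<Longrightarrow> cov V tzero t" and V': "\<And>t. t \<in> I \<Longrightarrow> cov V' tzero t"
    and s: "s \<in> I" "V s = V' s" and t: "t \<in> I"
  shows "V t = V' t"
proof (rule local_constancy[OF I s(1), where Q = "\<lambda>t. V t = V' t"])
  fix t assume t: "t \<in> I"
  obtain c where c: "c \<in> A" "\<gamma> t \<in> fst c" using chart_ex .
  obtain d where d: "d > 0" "\<And>r. r \<in> I \<inter> ball t d \<Longrightarrow> \<gamma> r \<in> fst c \<and> snd c (\<gamma> r) \<in> UNIV"
    using chart_nbhd[OF t c open_UNIV UNIV_I] by metis
  have "V b = V' b" if ab: "a \<in> I \<inter> ball t d" "V a = V' a" "b \<in> I \<inter> ball t d" for a b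
  proof (rule parallel_local_unique[where V = V and V' = V' and s = a, OF is_interval_Int_ball[OF I, of t d] _ c(1) _ _ _ _ _ ab(1) _ ab(3)])
    fix r assume r: "r \<in> I \<inter> ball t d"
    then have rI: "r \<in> I" "\<gamma> r \<in> fst c" using d by auto
    show "((\<lambda>s. V s c) has_vector_derivative - Gam (G c) (snd c (\<gamma> r)) (L (\<gamma> r) c) (V r c)) (at r within I)"
      using covD[OF V[OF rI(1)] rI(1) c(1) rI(2)] by (simp add: tzero_def)
    show "((\<lambda>s. V' s c) has_vector_derivative - Gam (G c) (snd c (\<gamma> r)) (L (\<gamma> r) c) (V' r c)) (at r within I)"
      using covD[OF V'[OF rI(1)] rI(1) c(1) rI(2)] by (simp add: tzero_def)
    show "V r \<in> TS (\<gamma> r)" "V' r \<in> TS (\<gamma> r)" using cov_TS(1)[OF V] cov_TS(1)[OF V'] rI by blast+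
  qed (use d ab in auto)
  then show "\<exists>d>0. (\<exists>r\<in>I \<inter> ball t d. V r = V' r) \<longrightarrow> (\<forall>r\<in>I \<inter> ball t d. V r = V' r)"
    using d(1) by blast
qed (rule s t)+

text \<open>Local solutions come from a linear system in one chart, \<open>covI\<close> carries them
  over to the other charts, and \<open>patch_solutions\<close> joins them.\<close>

lemma parallel_exists:
  assumes t0: "t0 \<in> I" and v: "v \<in> TS (\<gamma> t0)"
  obtains E where "E t0 = v" "\<And>t. t \<in> I \<Longrightarrow> cov E tzero t"
proof -
  \<comment> \<open>The equation is demanded in every chart around the point, since it must keep its
    meaning while the curve passes from chart to chart.\<close>
  define P where "P V t \<longleftrightarrow> (\<forall>c\<in>A. \<gamma> t \<in> fst c \<longrightarrow>
    ((\<lambda>s. V s c) has_vector_derivative - Gam (G c) (snd c (\<gamma> t)) (L (\<gamma> t) c) (V t c)) (at t within I))" for V t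
  have "\<exists>V. V t0 = v \<and> (\<forall>t\<in>I. V t \<in> TS (\<gamma> t) \<and> P V t)"
  proof (rule patch_solutions[where X = "\<lambda>t. TS (\<gamma> t)", OF I t0 v])
    fix V V' :: "real \<Rightarrow> ('m, 'n) tvec" and t d
    assume t: "t \<in> I" "d > 0" and V: "P V t" and eq: "\<And>r. r \<in> I \<inter> ball t d \<Longrightarrow> V r = V' r"
    have Vt: "V t = V' t" using eq[of t] t by auto
    show "P V' t"
      unfolding P_def
    proof (intro ballI impI)
      fix c assume c: "c \<in> A" "\<gamma> t \<in> fst c"
      have "((\<lambda>s. V s c) has_vector_derivative - Gam (G c) (snd c (\<gamma> t)) (L (\<gamma> t) c) (V t c)) (at t within I)"
        using V c unfolding P_def by blast
      then show "((\<lambda>s. V' s c) has_vector_derivative - Gam (G c) (snd c (\<gamma> t)) (L (\<gamma> t) c) (V' t c)) (at t within I)"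
        unfolding Vt by (rule has_vector_derivative_transform_within[OF _ t(2,1)]) (use eq in \<open>auto simp: dist_commute\<close>)
    qed
  next
    fix t assume t: "t \<in> I"
    obtain c where c: "c \<in> A" "\<gamma> t \<in> fst c" using chart_ex .
    obtain d where d: "d > 0" "\<And>r. r \<in> I \<inter> ball t d \<Longrightarrow> \<gamma> r \<in> fst c \<and> snd c (\<gamma> r) \<in> UNIV"
      using chart_nbhd[OF t c open_UNIV UNIV_I] by metis
    let ?J = "I \<inter> ball t d"
    have J: "?J \<subseteq> I" "\<And>r. r \<in> ?J \<Longrightarrow> \<gamma> r \<in> fst c" using d by auto
    have "\<exists>V. V s = v \<and> (\<forall>r\<in>?J. V r \<in> TS (\<gamma> r) \<and> P V r)" if s: "s \<in> ?J" and v: "v \<in> TS (\<gamma> s)" for s v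
    proof -
      obtain U where U: "U s = v c" "\<And>r. r \<in> ?J \<Longrightarrow> (U has_vector_derivative pm c r *v U r) (at r within ?J)"
        using linear_ode_exists[OF bounded_bilinear_matrix_vector pm_cont[OF c(1) J] is_interval_Int_ball[OF I] s, of "v c"] by metis
      define V where "V r = (if r \<in> ?J then tv c (\<gamma> r) (U r) else tzero)" for r
      have VT: "V r \<in> TS (\<gamma> r)" for r
        using tv_TS[OF c(1) J(2)] by (auto simp: V_def)
      have "P V r" if r: "r \<in> ?J" for r
      proof -
        have rI: "r \<in> I" using r by auto
        have Vr: "V r c = U r" using r J tv_self[OF c(1)] by (simp add: V_def)
        have "((\<lambda>s. V s c) has_vector_derivative pm c r *v U r) (at r within ?J)"
          by (rule has_vector_derivative_transform[OF r _ U(2)[OF r]]) (use J tv_self[OF c(1)] in \<open>simp add: V_def\<close>)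
        then have "((\<lambda>s. V s c) has_vector_derivative - Gam (G c) (snd c (\<gamma> r)) (L (\<gamma> r) c) (V r c)) (at r within I)"
          unfolding within_ball[OF r] pm_eq Vr .
        from covI[OF c(1) J(2)[OF r] rI VT this]
        have "cov V (tv c (\<gamma> r) 0) r" by simp
        moreover have "tv c (\<gamma> r) 0 d = 0" for d
          using linear_0[OF trans_linear[OF c(1) _ J(2)[OF r]]] by (simp add: tv_def)
        ultimately show ?thesis
          unfolding P_def using covD[OF _ rI] by (metis diff_0)
      qed
      moreover have "V s = v" using s U(1) TS_tv[OF v c(1) J(2)[OF s]] by (simp add: V_def)
      ultimately show ?thesis using VT by blast
    qed
    then show "\<exists>d>0. \<forall>s\<in>I \<inter> ball t d. \<forall>v\<in>TS (\<gamma> s). \<exists>V. V s = v \<and> (\<forall>r\<in>I \<inter> ball t d. V r \<in> TS (\<gamma> r) \<and> P V r)"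
      using d(1) by blast
    show "\<exists>d>0. \<forall>J V V' s. is_interval J \<longrightarrow> J \<subseteq> I \<inter> ball t d \<longrightarrow> openin (top_of_set I) J \<longrightarrow>
       (\<forall>r\<in>J. V r \<in> TS (\<gamma> r) \<and> P V r) \<longrightarrow> (\<forall>r\<in>J. V' r \<in> TS (\<gamma> r) \<and> P V' r) \<longrightarrow>
       s \<in> J \<longrightarrow> V s = V' s \<longrightarrow> (\<forall>r\<in>J. V r = V' r)"
    proof (intro exI[of _ d] conjI allI impI ballI d(1))
      fix K V V' s r
      assume K: "is_interval K" "K \<subseteq> ?J" and sr: "s \<in> K" "V s = V' s" "r \<in> K"
        and V: "\<forall>r\<in>K. V r \<in> TS (\<gamma> r) \<and> P V r" and V': "\<forall>r\<in>K. V' r \<in> TS (\<gamma> r) \<and> P V' r"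
      have KI: "K \<subseteq> I" "\<And>r. r \<in> K \<Longrightarrow> \<gamma> r \<in> fst c" using K J by blast+
      show "V r = V' r"
        by (rule parallel_local_unique[where V = V and V' = V' and s = s, OF K(1) KI(1) c(1) KI(2) _ _ _ _ sr])
          (use V V' c(1) KI(2) in \<open>auto simp: P_def\<close>)
    qed
  qed
  then obtain V where V: "V t0 = v" "\<And>t. t \<in> I \<Longrightarrow> V t \<in> TS (\<gamma> t)" "\<And>t. t \<in> I \<Longrightarrow> P V t" by blast
  have "cov V tzero t" if "t \<in> I" for t
    by (rule cov_allI[OF V(2) TS_zero that]) (use V(3)[OF that] in \<open>auto simp: P_def tzero_def\<close>)
  then show ?thesis using that V(1) by blast
qed

text \<open>In a chart the differences J - K and J' - K' satisfy a linear first-order system, to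
  which \<open>gronwall_zero\<close> applies. Together with \<open>parallel_unique\<close> this
  makes \<open>det_J\<close> a well-defined number.\<close>

lemma jacobi_unique:
  assumes J: "\<And>t. t \<in> I \<Longrightarrow> cov J (J' t) t"
      "\<And>t. t \<in> I \<Longrightarrow> cov J' (tscale (-1) (curvature A g (\<gamma> t) (L (\<gamma> t)) (J t) (L (\<gamma> t)))) t"
    and K: "\<And>t. t \<in> I \<Longrightarrow> cov K (K' t) t"
      "\<And>t. t \<in> I \<Longrightarrow> cov K' (tscale (-1) (curvature A g (\<gamma> t) (L (\<gamma> t)) (K t) (L (\<gamma> t)))) t"
    and s: "s \<in> I" "J s = K s" "J' s = K' s" and t: "t \<in> I"
  shows "J t = K t \<and> J' t = K' t"
proof (rule local_constancy[OF I s(1), where Q = "\<lambda>t. J t = K t \<and> J' t = K' t"])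
  fix t assume t: "t \<in> I"
  obtain c where c: "c \<in> A" "\<gamma> t \<in> fst c" using chart_ex .
  interpret metric_chart "dom c" "G c" by (rule metric_chart[OF c(1)])
  obtain d0 where d0: "d0 > 0" "\<And>r. r \<in> I \<inter> ball t d0 \<Longrightarrow> \<gamma> r \<in> fst c \<and> snd c (\<gamma> r) \<in> UNIV"
    using chart_nbhd[OF t c open_UNIV UNIV_I] by metis
  let ?J = "I \<inter> ball t d0"
  have JI: "?J \<subseteq> I" "\<And>r. r \<in> ?J \<Longrightarrow> \<gamma> r \<in> fst c" using d0 by auto
  have tJ: "t \<in> ?J" using t d0 by auto
  have xd: "(\<lambda>r. snd c (\<gamma> r)) ` ?J \<subseteq> dom c" using JI by auto
  define R where "R r = matrix (\<lambda>v. curv (G c) (snd c (\<gamma> r)) (L (\<gamma> r) c) v (L (\<gamma> r) c))" for r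
  have R: "R r *v v = curv (G c) (snd c (\<gamma> r)) (L (\<gamma> r) c) v (L (\<gamma> r) c)" if "r \<in> ?J" for r v
    unfolding R_def by (rule matrix_works[OF curv_linear[unfolded linear_matrix_vector_mul_eq[symmetric]]]) (use xd that in auto)
  have Rc: "continuous_on ?J R"
    unfolding R_def matrix_def
    by (intro continuous_on_vec_lambda continuous_on_component curv_continuous L_cont[OF c(1) JI] xd continuous_on_const)
  obtain d1 M1 where M1: "d1 > 0" "M1 > 0" "\<And>r x. r \<in> ?J \<inter> ball t d1 \<Longrightarrow> norm (pm c r *v x) \<le> M1 * norm x"
    using bounded_bilinear_local_bound[OF bounded_bilinear_matrix_vector pm_cont[OF c(1) JI] tJ] by metis
  obtain d2 M2 where M2: "d2 > 0" "M2 > 0" "\<And>r x. r \<in> ?J \<inter> ball t d2 \<Longrightarrow> norm (R r *v x) \<le> M2 * norm x"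
    using bounded_bilinear_local_bound[OF bounded_bilinear_matrix_vector Rc tJ] by metis
  define d where "d = min d0 (min d1 d2)"
  have d: "d > 0" "ball t d \<subseteq> ball t d0 \<inter> ball t d1 \<inter> ball t d2"
    using d0 M1 M2 by (auto simp: d_def)
  have "J b = K b \<and> J' b = K' b"
    if a: "a \<in> I \<inter> ball t d" "J a = K a" "J' a = K' a" and b: "b \<in> I \<inter> ball t d" for a b
  proof -
    let ?u = "\<lambda>r. J r c - K r c" and ?w = "\<lambda>r. J' r c - K' r c"
    have "(?u b, ?w b) = 0"
    proof (rule gronwall_zero[OF is_interval_Int_ball[OF I, of t d] a(1) _ b, where f = "\<lambda>r. (?u r, ?w r)"
          and f' = "\<lambda>r. (?w r + pm c r *v ?u r, - (R r *v ?u r) + pm c r *v ?w r)" and K = "1 + M1 + M2 + M1"])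
      show "(?u a, ?w a) = 0" using a by (simp add: zero_prod_def)
      fix r assume r: "r \<in> I \<inter> ball t d"
      have rI: "r \<in> I" "\<gamma> r \<in> fst c" "r \<in> ?J" "r \<in> ?J \<inter> ball t d1" "r \<in> ?J \<inter> ball t d2"
        using r d(2) JI by blast+
      have cv: "tscale (-1) (curvature A g (\<gamma> r) (L (\<gamma> r)) Y (L (\<gamma> r))) c = - (R r *v Y c)" for Y
        using R[OF rI(3), of "Y c"] by (simp add: tscale_def curvature_curv c rI)
      have 1: "(?u has_vector_derivative ?w r + pm c r *v ?u r) (at r within I)"
        using has_vector_derivative_diff[OF covD[OF J(1)[OF rI(1)] rI(1) c(1) rI(2)] covD[OF K(1)[OF rI(1)] rI(1) c(1) rI(2)]]
        by (simp add: pm_eq[symmetric] matrix_vector_mult_diff_distrib) (simp add: algebra_simps pm_eq)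
      have 2: "(?w has_vector_derivative - (R r *v ?u r) + pm c r *v ?w r) (at r within I)"
        using has_vector_derivative_diff[OF covD[OF J(2)[OF rI(1)] rI(1) c(1) rI(2)] covD[OF K(2)[OF rI(1)] rI(1) c(1) rI(2)]]
        unfolding cv by (simp add: pm_eq matrix_vector_mult_diff_distrib algebra_simps)
      have "((\<lambda>r. (?u r, ?w r)) has_vector_derivative (?w r + pm c r *v ?u r, - (R r *v ?u r) + pm c r *v ?w r)) (at r within I)"
        by (rule has_vector_derivative_Pair[OF 1 2])
      then show "((\<lambda>r. (?u r, ?w r)) has_vector_derivative (?w r + pm c r *v ?u r, - (R r *v ?u r) + pm c r *v ?w r)) (at r within I \<inter> ball t d)"
        by (rule has_vector_derivative_within_subset) auto
      let ?n = "norm (?u r, ?w r)"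
      have un: "norm (?u r) \<le> ?n" "norm (?w r) \<le> ?n"
        using norm_fst_le[of "?u r" "?w r"] norm_snd_le[of "?w r" "?u r"] by auto
      have "norm (?w r + pm c r *v ?u r, - (R r *v ?u r) + pm c r *v ?w r)
          \<le> norm (?w r + pm c r *v ?u r) + norm (- (R r *v ?u r) + pm c r *v ?w r)"
        by (rule norm_Pair_le)
      also have "\<dots> \<le> (norm (?w r) + norm (pm c r *v ?u r)) + (norm (R r *v ?u r) + norm (pm c r *v ?w r))"
        using norm_triangle_ineq[of "?w r" "pm c r *v ?u r"] norm_triangle_ineq[of "- (R r *v ?u r)" "pm c r *v ?w r"]
        by (simp add: add_mono)
      also have "\<dots> \<le> (?n + M1 * ?n) + (M2 * ?n + M1 * ?n)"
      proof (intro add_mono un)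
        show "norm (pm c r *v ?u r) \<le> M1 * ?n"
          using M1(3)[OF rI(4), of "?u r"] mult_left_mono[OF un(1), of M1] M1(2) by linarith
        show "norm (pm c r *v ?w r) \<le> M1 * ?n"
          using M1(3)[OF rI(4), of "?w r"] mult_left_mono[OF un(2), of M1] M1(2) by linarith
        show "norm (R r *v ?u r) \<le> M2 * ?n"
          using M2(3)[OF rI(5), of "?u r"] mult_left_mono[OF un(1), of M2] M2(2) by linarith
      qed
      finally show "norm (?w r + pm c r *v ?u r, - (R r *v ?u r) + pm c r *v ?w r) \<le> (1 + M1 + M2 + M1) * ?n"
        by (simp add: algebra_simps)
    qed
    then have "J b c = K b c" "J' b c = K' b c" by (auto simp: zero_prod_def)
    moreover have "b \<in> I" "\<gamma> b \<in> fst c" using b d(2) JI(2) by blast+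
    ultimately show ?thesis
      using TS_eqI[OF cov_TS(1)[OF J(1)] cov_TS(1)[OF K(1)] c(1)] TS_eqI[OF cov_TS(1)[OF J(2)] cov_TS(1)[OF K(2)] c(1)] by blast
  qed
  then show "\<exists>d>0. (\<exists>r\<in>I \<inter> ball t d. J r = K r \<and> J' r = K' r) \<longrightarrow> (\<forall>r\<in>I \<inter> ball t d. J r = K r \<and> J' r = K' r)"
    using d(1) by blast
qed (use s t in blast)+

end

section \<open>Frames\<close>

context lorentz begin

lemma g_sum:
  assumes "\<And>i. i \<in> S \<Longrightarrow> e i \<in> TS p" and v: "v \<in> TS p"
  shows "g p (\<lambda>c. \<Sum>i\<in>S. a i *\<^sub>R e i c) v = (\<Sum>i\<in>S. a i * g p (e i) v)"
    "g p v (\<lambda>c. \<Sum>i\<in>S. a i *\<^sub>R e i c) = (\<Sum>i\<in>S. a i * g p v (e i))"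
proof -
  obtain c where c: "c \<in> A" "p \<in> fst c" using chart_ex .
  have s: "(\<lambda>c. \<Sum>i\<in>S. a i *\<^sub>R e i c) \<in> TS p" by (rule TS_sum) (rule assms(1))
  show "g p (\<lambda>c. \<Sum>i\<in>S. a i *\<^sub>R e i c) v = (\<Sum>i\<in>S. a i * g p (e i) v)"
    unfolding g_chart[OF s v c] by (simp add: ip_bilinear g_chart[OF assms(1) v c])
  show "g p v (\<lambda>c. \<Sum>i\<in>S. a i *\<^sub>R e i c) = (\<Sum>i\<in>S. a i * g p v (e i))"
    unfolding g_chart[OF v s c] by (simp add: ip_bilinear g_chart[OF v assms(1) c])
qed

lemma g_scale:
  assumes "u \<in> TS p" "v \<in> TS p"
  shows "g p (tscale a u) v = a * g p u v" "g p u (tscale a v) = a * g p u v"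
proof -
  obtain c where c: "c \<in> A" "p \<in> fst c" using chart_ex .
  show "g p (tscale a u) v = a * g p u v"
    unfolding g_chart[OF TS_scale[OF assms(1)] assms(2) c] g_chart[OF assms c] by (simp add: tscale_def ip_bilinear)
  show "g p u (tscale a v) = a * g p u v"
    unfolding g_chart[OF assms(1) TS_scale[OF assms(2)] c] g_chart[OF assms c] by (simp add: tscale_def ip_bilinear)
qed

text \<open>Pairing with D shows that the E are independent; their number is the dimension, so they
  span, and the same pairing gives the coefficients.\<close>

lemma dual_frame_expand:
  fixes D E :: "'n \<Rightarrow> ('m, 'n) tvec"
  assumes D: "\<And>i. D i \<in> TS p" and E: "\<And>i. E i \<in> TS p"
    and DE: "\<And>i j. g p (D i) (E j) = (if i = j then 1 else 0)" and v: "v \<in> TS p"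
  shows "v = (\<lambda>c. \<Sum>i\<in>UNIV. g p (D i) v *\<^sub>R E i c)"
proof -
  obtain c where c: "c \<in> A" "p \<in> fst c" using chart_ex .
  define \<Lambda> where "\<Lambda> a = (\<Sum>i\<in>UNIV. a $ i *\<^sub>R E i c)" for a :: "real^'n"
  have lin: "linear \<Lambda>"
    by (rule linearI) (simp_all add: \<Lambda>_def scaleR_add_left sum.distrib scaleR_sum_right)
  have pair: "ip (G c (snd c p)) (D j c) (\<Lambda> a) = a $ j" for a j
  proof -
    have "ip (G c (snd c p)) (D j c) (\<Lambda> a) = (\<Sum>i\<in>UNIV. a $ i * g p (D j) (E i))"
      by (simp add: \<Lambda>_def ip_bilinear g_chart[OF D E c])
    then show ?thesis by (simp add: DE if_distrib cong: if_cong)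
  qed
  have "inj \<Lambda>" by (rule injI) (metis pair Finite_Cartesian_Product.vec_eq_iff)
  then have "surj \<Lambda>" using linear_injective_imp_surjective[OF lin] by blast
  then obtain a where a: "v c = \<Lambda> a" by (metis surjD)
  have "g p (D i) v = a $ i" for i unfolding g_chart[OF D v c] a by (rule pair)
  then have "v c = (\<Sum>i\<in>UNIV. g p (D i) v *\<^sub>R E i c)" by (simp add: a \<Lambda>_def)
  then show ?thesis by (intro TS_eqI[OF v TS_sum c]) (simp_all add: E)
qed

text \<open>\<open>E i0\<close> and \<open>E i1\<close> are null with product 1, the other \<open>E i\<close> are orthonormal and orthogonal to
  both; thus the dual basis is \<open>E\<close> composed with the transposition of \<open>i0\<close> and \<open>i1\<close>.\<close>

definition null_frame :: "'m \<Rightarrow> 'n \<Rightarrow> 'n \<Rightarrow> ('n \<Rightarrow> ('m, 'n) tvec) \<Rightarrow> bool" where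
  "null_frame p i0 i1 E \<longleftrightarrow> i0 \<noteq> i1 \<and> (\<forall>i. E i \<in> TS p) \<and>
     (\<forall>i j. g p (E i) (E j) = (if j = Transposition.transpose i0 i1 i then 1 else 0))"

lemma null_frame_expand:
  assumes E: "null_frame p i0 i1 E" and v: "v \<in> TS p"
  shows "v = (\<lambda>c. \<Sum>i\<in>UNIV. g p (E (Transposition.transpose i0 i1 i)) v *\<^sub>R E i c)"
  by (rule dual_frame_expand) (use E v in \<open>auto simp: null_frame_def\<close>)

text \<open>A trace is the sum of the diagonal coefficients in any basis; for a null frame these are
  products with the transposed frame vector.\<close>

lemma null_frame_trace:
  assumes E: "null_frame p i0 i1 E" and c: "c \<in> A" "p \<in> fst c" and S: "linear S"
  shows "(\<Sum>a\<in>UNIV. S (axis a 1) $ a)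
    = (\<Sum>i\<in>UNIV. ip (G c (snd c p)) (E (Transposition.transpose i0 i1 i) c) (S (E i c)))"
proof -
  let ?\<theta> = "\<lambda>i. ip (G c (snd c p)) (E (Transposition.transpose i0 i1 i) c)"
  have TE: "E i \<in> TS p" for i using E by (simp add: null_frame_def)
  have ex: "w = (\<Sum>i\<in>UNIV. ?\<theta> i w *\<^sub>R E i c)" for w
    using fun_cong[OF null_frame_expand[OF E tv_TS[OF c, of w]], of c]
    by (simp add: g_chart[OF TE tv_TS[OF c] c] tv_self[OF c])
  have "(\<Sum>a\<in>UNIV. S (axis a 1) $ a) = (\<Sum>a\<in>UNIV. \<Sum>i\<in>UNIV. ?\<theta> i (axis a 1) * S (E i c) $ a)"
  proof (intro sum.cong refl)
    fix a
    have "S (axis a 1) = (\<Sum>i\<in>UNIV. ?\<theta> i (axis a 1) *\<^sub>R S (E i c))"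
      by (subst ex) (simp only: linear_sum[OF S] linear_cmul[OF S])
    then show "S (axis a 1) $ a = (\<Sum>i\<in>UNIV. ?\<theta> i (axis a 1) * S (E i c) $ a)" by simp
  qed
  also have "\<dots> = (\<Sum>i\<in>UNIV. \<Sum>a\<in>UNIV. S (E i c) $ a * ?\<theta> i (axis a 1))"
    by (subst sum.swap) (simp add: mult.commute)
  also have "\<dots> = (\<Sum>i\<in>UNIV. ?\<theta> i (\<Sum>a\<in>UNIV. S (E i c) $ a *\<^sub>R axis a 1))"
    by (simp only: ip_bilinear)
  also have "\<dots> = (\<Sum>i\<in>UNIV. ?\<theta> i (S (E i c)))"
    by (simp only: basis_expansion scalar_mult_eq_scaleR[symmetric])
  finally show ?thesis .
qed

text \<open>In an orthonormal basis a null vector is \<alpha> times the sum of the timelike basis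
  vector w0 and a unit spacelike vector u. A Euclidean reflection makes u a member w1 of a new
  orthonormal basis; then l = \<alpha> (w0 + w1), and (w1 - w0) / (2 \<alpha>) is null with product
  1 against l.\<close>

lemma null_frame_ex:
  assumes n: "CARD('n) \<ge> 2" and l: "l \<in> TS p" "l \<noteq> tzero" "g p l l = 0"
  obtains E i0 i1 where "null_frame p i0 i1 E" "E i0 = l"
proof -
  obtain b :: "'n \<Rightarrow> ('m, 'n) tvec" and i0 where b: "\<And>i. b i \<in> TS p"
    "\<And>i j. g p (b i) (b j) = (if i \<noteq> j then 0 else if i = i0 then -1 else 1)"
    using lorentz_form[of p] unfolding lorentz_form_def by blast
  define sg where "sg i = (if i = i0 then -1 else 1 :: real)" for i
  define li where "li i = g p (tscale (sg i) (b i)) l" for i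
  have lexp: "l = (\<lambda>c. \<Sum>i\<in>UNIV. li i *\<^sub>R b i c)"
    unfolding li_def
    by (rule dual_frame_expand[OF TS_scale[OF b(1)] b(1) _ l(1)])
      (auto simp: g_scale[OF b(1) b(1)] b(2) sg_def)
  define vb where "vb w = (\<lambda>c. \<Sum>i\<in>UNIV. w $ i *\<^sub>R b i c)" for w :: "real^'n"
  have vbT: "vb w \<in> TS p" for w unfolding vb_def by (rule TS_sum) (rule b(1))
  \<comment> \<open>The Lorentz product in terms of the Euclidean one: the timelike coordinate
    counts with the opposite sign.\<close>
  have gvb: "g p (vb w) (vb w') = w \<bullet> w' - 2 * w $ i0 * w' $ i0" for w w'
  proof -
    have "g p (vb w) (vb w') = (\<Sum>i\<in>UNIV. w $ i * (\<Sum>j\<in>UNIV. w' $ j * g p (b i) (b j)))"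
      unfolding vb_def using g_sum(1)[of UNIV b p "vb w'" "\<lambda>i. w $ i", OF b(1) vbT] g_sum(2)[of UNIV b p _ "\<lambda>i. w' $ i", OF b(1) b(1)]
      by (simp add: vb_def)
    also have "\<dots> = (\<Sum>i\<in>UNIV. w $ i * (w' $ i * sg i))"
    proof (intro sum.cong refl arg_cong2[where f = "(*)"])
      fix i
      have "(\<Sum>j\<in>UNIV. w' $ j * g p (b i) (b j)) = (\<Sum>j\<in>UNIV. if j = i then w' $ i * sg i else 0)"
        by (intro sum.cong refl) (auto simp: b(2) sg_def)
      then show "(\<Sum>j\<in>UNIV. w' $ j * g p (b i) (b j)) = w' $ i * sg i" by simp
    qed
    also have "\<dots> = (\<Sum>i\<in>UNIV. w $ i * w' $ i - (if i = i0 then 2 * w $ i0 * w' $ i0 else 0))"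
      by (intro sum.cong refl) (simp add: sg_def)
    also have "\<dots> = w \<bullet> w' - 2 * w $ i0 * w' $ i0"
      by (simp add: sum_subtractf inner_vec_def)
    finally show ?thesis .
  qed
  define \<alpha> where "\<alpha> = li i0"
  have lvb: "l = vb (\<chi> i. li i)" unfolding vb_def using lexp by simp
  have nn: "(\<chi> i. li i) \<bullet> (\<chi> i. li i) = 2 * \<alpha> * \<alpha>"
    using l(3) gvb[of "\<chi> i. li i" "\<chi> i. li i"] by (simp add: lvb[symmetric] \<alpha>_def)
  have \<alpha>: "\<alpha> \<noteq> 0"
  proof
    assume "\<alpha> = 0"
    then have "(\<chi> i. li i) = (0 :: real^'n)" using nn by simp
    then have "l = tzero" using lvb by (simp add: vb_def tzero_def)
    then show False using l(2) by simp
  qed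
  \<comment> \<open>The spacelike part of l / \<alpha>; it has length 1 because l is null.\<close>
  define u where "u = (1 / \<alpha>) *\<^sub>R (\<chi> i. li i) - axis i0 1"
  have u0: "u $ i0 = 0" using \<alpha> by (simp add: u_def \<alpha>_def)
  have uu: "u \<bullet> u = 1"
  proof -
    have "u \<bullet> u = (1 / \<alpha>) * (1 / \<alpha>) * ((\<chi> i. li i) \<bullet> (\<chi> i. li i)) - 2 * (1 / \<alpha> * li i0) + 1"
      by (simp add: u_def inner_diff_left inner_diff_right inner_axis inner_axis' inner_commute)
    then show ?thesis unfolding nn using \<alpha> by (simp add: \<alpha>_def[symmetric])
  qed
  obtain i1 where i1: "i1 \<noteq> i0"
  proof -
    have "card {i0} < CARD('n)" using n by simp
    then show ?thesis using that by (metis UNIV_I card_mono finite insertI1 not_less singletonD subsetI)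
  qed
  \<comment> \<open>The vectors \<open>w k\<close> are the images of the axis vectors under the
    reflection in the hyperplane orthogonal to d, which takes the i1-th one to u and fixes the i0-th
    one. If d = 0 the formula yields the identity.\<close>
  define d where "d = axis i1 1 - u"
  define w where "w k = axis k 1 - (2 * (axis k 1 \<bullet> d) / (d \<bullet> d)) *\<^sub>R d" for k :: 'n
  have ww: "w k \<bullet> w j = (if k = j then 1 else 0)" for k j
  proof (cases "d = 0")
    case True
    then show ?thesis by (simp add: w_def inner_axis_axis)
  next
    case False
    then have dd: "d \<bullet> d \<noteq> 0" by simp
    have "w k \<bullet> w j = axis k 1 \<bullet> (axis j 1 :: real^'n) - 2 * (axis j 1 \<bullet> d) / (d \<bullet> d) * (axis k 1 \<bullet> d)
       - 2 * (axis k 1 \<bullet> d) / (d \<bullet> d) * (axis j 1 \<bullet> d) + 2 * (axis k 1 \<bullet> d) / (d \<bullet> d) * (2 * (axis j 1 \<bullet> d) / (d \<bullet> d)) * (d \<bullet> d)"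
      by (simp add: w_def inner_diff_left inner_diff_right inner_commute algebra_simps)
    also have "\<dots> = axis k 1 \<bullet> (axis j 1 :: real^'n)" using dd by (simp add: field_simps)
    finally show ?thesis by (simp add: inner_axis_axis)
  qed
  have d0: "axis i0 1 \<bullet> d = 0" using u0 i1 by (simp add: d_def inner_diff_right inner_axis_axis inner_axis') (simp add: axis_def)
  have w0: "w i0 = axis i0 1" unfolding w_def d0 by simp
  have w1: "w i1 = u"
  proof (cases "d = 0")
    case True
    then show ?thesis by (simp add: w_def d_def)
  next
    case False
    have "2 * (axis i1 1 \<bullet> d) = d \<bullet> d"
      unfolding d_def inner_diff_left inner_diff_right uu inner_axis_axis inner_commute[of u "axis i1 1"] by simp
    then have q: "2 * (axis i1 1 \<bullet> d) / (d \<bullet> d) = 1" using False by (simp only: divide_self_if inner_eq_zero_iff if_False)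
    have "w i1 = axis i1 1 - 1 *\<^sub>R d" unfolding w_def q ..
    then show ?thesis by (simp add: d_def)
  qed
  have wi0: "w k $ i0 = (if k = i0 then 1 else 0)" for k
    using ww[of i0 k] unfolding w0 by (simp add: inner_axis' eq_commute)
  define e where "e k = (if k = i0 then \<alpha> *\<^sub>R (w i0 + w i1) else if k = i1 then (1 / (2 * \<alpha>)) *\<^sub>R (w i1 - w i0) else w k)" for k
  have ee: "e k \<bullet> e j - 2 * e k $ i0 * e j $ i0 = (if j = Transposition.transpose i0 i1 k then 1 else 0)" for k j
    unfolding e_def Transposition.transpose_def using i1 \<alpha>
    by (auto simp: inner_add_left inner_add_right inner_diff_left inner_diff_right ww wi0 field_simps)
  have "null_frame p i0 i1 (\<lambda>k. vb (e k))"
    unfolding null_frame_def using i1 by (auto simp: vbT gvb ee)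
  moreover have "vb (e i0) = l"
  proof -
    have "e i0 = (\<chi> i. li i)" using \<alpha> by (simp add: e_def w0 w1 u_def)
    then show ?thesis using lvb by simp
  qed
  ultimately show ?thesis using that[of i0 i1 "\<lambda>k. vb (e k)"] by blast
qed

end

context null_hyp begin

text \<open>Pairing with E i0 = L reads off the coefficient of E i1, so tangency to H means that
  this coefficient is zero.\<close>

lemma null_frame_TH:
  assumes E: "null_frame p i0 i1 E" "E i0 = L p" and p: "p \<in> H"
  shows "v \<in> TH p \<longleftrightarrow> v \<in> TS p \<and> g p (E i0) v = 0"
    "E k \<in> TH p \<longleftrightarrow> k \<noteq> i1"
    "v \<in> TH p \<Longrightarrow> v = (\<lambda>c. \<Sum>i\<in>-{i1}. g p (E (Transposition.transpose i0 i1 i)) v *\<^sub>R E i c)"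
proof -
  show 1: "v \<in> TH p \<longleftrightarrow> v \<in> TS p \<and> g p (E i0) v = 0" for v
    unfolding E(2) by (rule TH_perp[OF p])
  show "E k \<in> TH p \<longleftrightarrow> k \<noteq> i1" unfolding 1 using E(1) by (auto simp: null_frame_def)
  assume v: "v \<in> TH p"
  have "v = (\<lambda>c. \<Sum>i\<in>UNIV. g p (E (Transposition.transpose i0 i1 i)) v *\<^sub>R E i c)"
    by (rule null_frame_expand[OF E(1)]) (use v 1 in blast)
  also have "\<dots> = (\<lambda>c. \<Sum>i\<in>-{i1}. g p (E (Transposition.transpose i0 i1 i)) v *\<^sub>R E i c)"
    by (intro ext sum.mono_neutral_right) (use v 1 in auto)
  finally show "v = (\<lambda>c. \<Sum>i\<in>-{i1}. g p (E (Transposition.transpose i0 i1 i)) v *\<^sub>R E i c)" .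
qed

text \<open>On the tangent space of H the metric is the sum of squares of the frame coordinates
  other than that of L.\<close>

lemma null_tangent:
  assumes n: "CARD('n) \<ge> 2" and p: "p \<in> H" and v: "v \<in> TH p" "g p v v = 0"
  obtains r where "v = tscale r (L p)"
proof -
  obtain E i0 i1 where E: "null_frame p i0 i1 E" "E i0 = L p"
    using null_frame_ex[OF n L_TS[OF p] L_nz[OF p] L_TH(2)[OF p]] by blast
  have TE: "E i \<in> TS p" for i using E by (simp add: null_frame_def)
  have i01: "i0 \<noteq> i1" using E by (simp add: null_frame_def)
  let ?t = "Transposition.transpose i0 i1"
  have vT: "v \<in> TS p" and v0: "g p (E i0) v = 0" using v(1) null_frame_TH(1)[OF E p] by auto
  have vexp: "v = (\<lambda>c. \<Sum>i\<in>-{i1}. g p (E (?t i)) v *\<^sub>R E i c)" by (rule null_frame_TH(3)[OF E p v(1)])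
  have "g p v v = g p v (\<lambda>c. \<Sum>i\<in>-{i1}. g p (E (?t i)) v *\<^sub>R E i c)" using vexp by simp
  also have "\<dots> = (\<Sum>i\<in>-{i1}. g p (E (?t i)) v * g p (E i) v)"
    by (simp add: g_sum(2)[OF TE vT] g_sym[OF vT TE])
  also have "\<dots> = (\<Sum>i\<in>-{i0, i1}. (g p (E i) v)\<^sup>2)"
  proof -
    have "- {i1} = insert i0 (- {i0, i1})" using i01 by auto
    then show ?thesis
      by (simp add: v0 power2_eq_square)
  qed
  finally have "(\<Sum>i\<in>-{i0, i1}. (g p (E i) v)\<^sup>2) = 0" using v(2) by simp
  then have z: "g p (E i) v = 0" if "i \<in> - {i0, i1}" for i
    using that sum_nonneg_eq_0_iff[of "- {i0, i1}" "\<lambda>i. (g p (E i) v)\<^sup>2"] by auto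
  have "v = (\<lambda>c. g p (E i1) v *\<^sub>R L p c)"
  proof -
    have "(\<Sum>i\<in>-{i1}. g p (E (?t i)) v *\<^sub>R E i c) = (\<Sum>i\<in>{i0}. g p (E (?t i)) v *\<^sub>R E i c)" for c
      by (rule sum.mono_neutral_right) (use z i01 in \<open>auto simp: Transposition.transpose_def\<close>)
    then show ?thesis using vexp E(2) by simp
  qed
  then show ?thesis using that by (simp add: tscale_def)
qed

end

section \<open>Geodesics\<close>

lemma C1_on_Lipschitz:
  fixes f :: "'a::euclidean_space \<Rightarrow> 'b::real_normed_vector"
  assumes f: "C1_on f S" and C: "compact C" "convex C" "C \<subseteq> S"
  obtains B where "B > 0" "\<And>x y. x \<in> C \<Longrightarrow> y \<in> C \<Longrightarrow> norm (f x - f y) \<le> B * norm (x - y)"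
proof -
  obtain B where B: "B > 0" "\<And>x v. x \<in> C \<Longrightarrow> norm (fd f x v) \<le> B * norm v"
    using C1_on_uniform_bound[OF f C(1,3)] by metis
  have "norm (f x - f y) \<le> B * norm (x - y)" if "x \<in> C" "y \<in> C" for x y
  proof (rule differentiable_bound[OF C(2) _ _ that])
    fix z assume z: "z \<in> C"
    show "(f has_derivative fd f z) (at z within C)"
      using C1_onD[OF f] z C(3) has_derivative_at_withinI by blast
    show "onorm (fd f z) \<le> B" by (rule onorm_bound) (use B z in auto)
  qed
  then show ?thesis using that B(1) by blast
qed

context lorentz begin

lemma geodesicD:
  assumes "geodesic A g I \<gamma> V"
  shows "open I" "is_interval I" "continuous_on I \<gamma>" "\<And>t. t \<in> I \<Longrightarrow> V t \<in> TS (\<gamma> t)"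
    "\<And>t. t \<in> I \<Longrightarrow> has_velocity A I \<gamma> (V t) t" "\<And>t. t \<in> I \<Longrightarrow> has_cov_deriv A g I \<gamma> V tzero t"
    "\<And>t c. t \<in> I \<Longrightarrow> c \<in> A \<Longrightarrow> \<gamma> t \<in> fst c \<Longrightarrow> ((\<lambda>s. snd c (\<gamma> s)) has_vector_derivative V t c) (at t within I)"
    "\<And>t c. t \<in> I \<Longrightarrow> c \<in> A \<Longrightarrow> \<gamma> t \<in> fst c \<Longrightarrow>
       ((\<lambda>s. V s c) has_vector_derivative - Gam (G c) (snd c (\<gamma> t)) (V t c) (V t c)) (at t within I)"
proof -
  show o: "open I" and "is_interval I" "continuous_on I \<gamma>"
    and v: "\<And>t. t \<in> I \<Longrightarrow> has_velocity A I \<gamma> (V t) t" and cv: "\<And>t. t \<in> I \<Longrightarrow> has_cov_deriv A g I \<gamma> V tzero t"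
    using assms unfolding geodesic_def by auto
  show "\<And>t. t \<in> I \<Longrightarrow> V t \<in> TS (\<gamma> t)" using velocityD(1) v by blast
  show vc: "((\<lambda>s. snd c (\<gamma> s)) has_vector_derivative V t c) (at t within I)" if "t \<in> I" "c \<in> A" "\<gamma> t \<in> fst c" for t c
    using velocityD(2)[OF v] that by blast
  show "((\<lambda>s. V s c) has_vector_derivative - Gam (G c) (snd c (\<gamma> t)) (V t c) (V t c)) (at t within I)"
    if t: "t \<in> I" "c \<in> A" "\<gamma> t \<in> fst c" for t c
    using has_cov_derivD[OF cv[OF t(1)] t(2,3) vc[OF t]] at_within_open[OF t(1) o] by (simp add: tzero_def)
qed

text \<open>Where the positions differ, the Hausdorff property keeps the curves apart nearby. Where
  they agree, one chart holds both curves, and the geodesic system, locally Lipschitz in position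
  and velocity, is subject to \<open>gronwall_zero\<close>. Either way agreement is locally
  constant.\<close>

lemma geodesic_unique:
  assumes g1: "geodesic A g I1 \<gamma> V" and g2: "geodesic A g I2 \<eta> Y"
    and s: "s \<in> I1" "s \<in> I2" "\<gamma> s = \<eta> s" "V s = Y s" and t: "t \<in> I1" "t \<in> I2"
  shows "\<gamma> t = \<eta> t \<and> V t = Y t"
proof -
  note d1 = geodesicD[OF g1] and d2 = geodesicD[OF g2]
  let ?J = "I1 \<inter> I2"
  have Jint: "is_interval ?J" using d1(2) d2(2) by (rule is_interval_Int)
  have oJ: "open ?J" using d1(1) d2(1) by auto
  have evball: "\<exists>d>0. \<forall>r\<in>?J \<inter> ball t d. \<zeta> r \<in> S" if zc: "continuous_on ?J \<zeta>" "open S" and z: "\<zeta> t \<in> S" "t \<in> ?J" for \<zeta> :: "real \<Rightarrow> 'z::topological_space" and S t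
  proof -
    have "open (?J \<inter> \<zeta> -` S)" by (rule continuous_open_preimage[OF zc(1) oJ zc(2)])
    moreover have "t \<in> ?J \<inter> \<zeta> -` S" using z by simp
    ultimately have "\<exists>d>0. ball t d \<subseteq> ?J \<inter> \<zeta> -` S" by (meson open_contains_ball)
    then show ?thesis by blast
  qed
  have c1: "continuous_on ?J \<gamma>" and c2: "continuous_on ?J \<eta>"
    using d1(3) d2(3) by (auto intro: continuous_on_subset)
  show ?thesis
  proof (rule local_constancy[OF Jint, where s = s and Q = "\<lambda>t. \<gamma> t = \<eta> t \<and> V t = Y t"])
    fix t assume t: "t \<in> ?J"
    show "\<exists>d>0. (\<exists>r\<in>?J \<inter> ball t d. \<gamma> r = \<eta> r \<and> V r = Y r) \<longrightarrow> (\<forall>r\<in>?J \<inter> ball t d. \<gamma> r = \<eta> r \<and> V r = Y r)"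
    proof (cases "\<gamma> t = \<eta> t")
      case False
      then obtain S1 S2 where S: "open S1" "open S2" "\<gamma> t \<in> S1" "\<eta> t \<in> S2" "S1 \<inter> S2 = {}"
        using hausdorff[OF False] by (elim exE conjE)
      obtain e1 where e1: "e1 > 0" "\<forall>r\<in>?J \<inter> ball t e1. \<gamma> r \<in> S1" using evball[OF c1 S(1,3) t] by (elim exE conjE)
      obtain e2 where e2: "e2 > 0" "\<forall>r\<in>?J \<inter> ball t e2. \<eta> r \<in> S2" using evball[OF c2 S(2,4) t] by (elim exE conjE)
      have "\<gamma> r \<noteq> \<eta> r" if "r \<in> ?J \<inter> ball t (min e1 e2)" for r
      proof -
        have "\<gamma> r \<in> S1" "\<eta> r \<in> S2"
          using bspec[OF e1(2), of r] bspec[OF e2(2), of r] that by simp_all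
        then show ?thesis using S(5) by auto
      qed
      then show ?thesis using e1(1) e2(1) by (intro exI[of _ "min e1 e2"]) auto
    next
      case True
      obtain c where c: "c \<in> A" "\<gamma> t \<in> fst c" using chart_ex .
      interpret metric_chart "dom c" "G c" by (rule metric_chart[OF c(1)])
      let ?x0 = "snd c (\<gamma> t)"
      obtain R where R: "R > 0" "cball ?x0 R \<subseteq> dom c"
        using open_contains_cball[of "dom c"] open_U c by blast
      obtain e0 where e0: "e0 > 0" "\<forall>r\<in>?J \<inter> ball t e0. \<gamma> r \<in> fst c"
        using evball[OF c1 chart_open(1)[OF c(1)] c(2) t] by (elim exE conjE)
      obtain e0' where e0': "e0' > 0" "\<forall>r\<in>?J \<inter> ball t e0'. \<eta> r \<in> fst c"
        using evball[OF c2 chart_open(1)[OF c(1)] _ t] c(2) True by metis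
      \<comment> \<open>A strict bound for both velocities at t, so that both stay in one ball
        nearby even if they differ.\<close>
      define M where "M = norm (V t c) + norm (Y t c) + 1"
      have oU: "open (fst c \<inter> snd c -` ball ?x0 R)"
        by (rule continuous_open_preimage[OF chart_cont(1)[OF c(1)] chart_open(1)[OF c(1)] open_ball])
      obtain e1 where e1: "e1 > 0" "\<forall>r\<in>?J \<inter> ball t e1. \<gamma> r \<in> fst c \<inter> snd c -` ball ?x0 R"
        using evball[OF c1 oU _ t] c(2) R(1) by auto
      obtain e2 where e2: "e2 > 0" "\<forall>r\<in>?J \<inter> ball t e2. \<eta> r \<in> fst c \<inter> snd c -` ball ?x0 R"
        using evball[OF c2 oU _ t] c(2) R(1) True by auto
      have cV: "continuous (at t within ?J) (\<lambda>s. V s c)" "continuous (at t within ?J) (\<lambda>s. Y s c)"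
        using has_vector_derivative_continuous[OF has_vector_derivative_within_subset[OF d1(8)[of t c], of ?J]]
          has_vector_derivative_continuous[OF has_vector_derivative_within_subset[OF d2(8)[of t c], of ?J]] t c True by auto
      have bnd: "\<exists>d>0. \<forall>r\<in>?J \<inter> ball t d. norm (Z r) < M" if "continuous (at t within ?J) Z" "norm (Z t) < M" for Z :: "real \<Rightarrow> real^'n"
      proof -
        have "\<forall>\<^sub>F r in at t within ?J. norm (Z r) < M"
          using that by (intro order_tendstoD(2)[of "\<lambda>r. norm (Z r)" "norm (Z t)"] tendsto_norm) (auto simp: continuous_within)
        then obtain d where "d > 0" "\<And>r. r \<in> ?J \<Longrightarrow> r \<noteq> t \<Longrightarrow> dist r t < d \<Longrightarrow> norm (Z r) < M"
          unfolding eventually_at by metis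
        then show ?thesis using that(2) by (intro exI[of _ d]) (metis Int_iff dist_commute mem_ball)
      qed
      obtain e3 where e3: "e3 > 0" "\<forall>r\<in>?J \<inter> ball t e3. norm (V r c) < M"
        using bnd[OF cV(1)] by (auto simp: M_def add_nonneg_pos)
      obtain e4 where e4: "e4 > 0" "\<forall>r\<in>?J \<inter> ball t e4. norm (Y r c) < M"
        using bnd[OF cV(2)] by (auto simp: M_def add_nonneg_pos)
      let ?\<Phi> = "\<lambda>z. Gam (G c) (fst z) (snd z) (snd z)"
      have C1f: "C1_on fst (dom c \<times> UNIV)" "C1_on snd (dom c \<times> UNIV)"
        by (rule C1_on_bounded_linear[OF bounded_linear_fst] C1_on_bounded_linear[OF bounded_linear_snd])+
      have \<Phi>: "C1_on ?\<Phi> (dom c \<times> UNIV)"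
        by (rule Gam_C1[OF C1f(1) _ C1f(2) C1f(2)]) auto
      obtain B where B: "B > 0" "\<And>x y. x \<in> cball ?x0 R \<times> cball 0 M \<Longrightarrow> y \<in> cball ?x0 R \<times> cball 0 M \<Longrightarrow>
          norm (?\<Phi> x - ?\<Phi> y) \<le> B * norm (x - y)"
      proof (rule C1_on_Lipschitz[OF \<Phi>, of "cball ?x0 R \<times> cball 0 M"])
        show "compact (cball ?x0 R \<times> cball (0::real^'n) M)" by (intro compact_Times compact_cball)
        show "convex (cball ?x0 R \<times> cball (0::real^'n) M)" by (intro convex_Times convex_cball)
        show "cball ?x0 R \<times> cball (0::real^'n) M \<subseteq> dom c \<times> UNIV" using R by auto
      qed blast
      define d where "d = min (min e1 e2) (min e3 e4)"
      have d: "d > 0" using e1 e2 e3 e4 by (simp add: d_def)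
      have inb: "\<gamma> r \<in> fst c" "\<eta> r \<in> fst c" "(snd c (\<gamma> r), V r c) \<in> cball ?x0 R \<times> cball 0 M"
        "(snd c (\<eta> r), Y r c) \<in> cball ?x0 R \<times> cball 0 M" "r \<in> I1" "r \<in> I2" if "r \<in> ?J \<inter> ball t d" for r
      proof -
        have r: "r \<in> ?J \<inter> ball t e1" "r \<in> ?J \<inter> ball t e2" "r \<in> ?J \<inter> ball t e3" "r \<in> ?J \<inter> ball t e4"
          using that by (auto simp: d_def)
        show "\<gamma> r \<in> fst c" "\<eta> r \<in> fst c" using e1(2) e2(2) r by blast+
        show "(snd c (\<gamma> r), V r c) \<in> cball ?x0 R \<times> cball 0 M"
          using bspec[OF e1(2) r(1)] bspec[OF e3(2) r(3)] by auto
        show "(snd c (\<eta> r), Y r c) \<in> cball ?x0 R \<times> cball 0 M"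
          using bspec[OF e2(2) r(2)] bspec[OF e4(2) r(4)] by auto
        show "r \<in> I1" "r \<in> I2" using that by auto
      qed
      have "\<gamma> b = \<eta> b \<and> V b = Y b" if a: "a \<in> ?J \<inter> ball t d" "\<gamma> a = \<eta> a \<and> V a = Y a" and b: "b \<in> ?J \<inter> ball t d" for a b
      proof -
        let ?f = "\<lambda>r. (snd c (\<gamma> r), V r c) - (snd c (\<eta> r), Y r c)"
        have "?f b = 0"
        proof (rule gronwall_zero[OF is_interval_Int_ball[OF Jint, of t d] a(1) _ b, where f = ?f and K = "1 + B"
            and f' = "\<lambda>r. (V r c, - ?\<Phi> (snd c (\<gamma> r), V r c)) - (Y r c, - ?\<Phi> (snd c (\<eta> r), Y r c))"])
          show "?f a = 0" using a by simp
          fix r assume r: "r \<in> ?J \<inter> ball t d"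
          have sub: "?J \<inter> ball t d \<subseteq> I1" "?J \<inter> ball t d \<subseteq> I2" by auto
          show "(?f has_vector_derivative (V r c, - ?\<Phi> (snd c (\<gamma> r), V r c)) - (Y r c, - ?\<Phi> (snd c (\<eta> r), Y r c))) (at r within ?J \<inter> ball t d)"
            using has_vector_derivative_within_subset[OF d1(7)[OF inb(5)[OF r] c(1) inb(1)[OF r]] sub(1)]
              has_vector_derivative_within_subset[OF d1(8)[OF inb(5)[OF r] c(1) inb(1)[OF r]] sub(1)]
              has_vector_derivative_within_subset[OF d2(7)[OF inb(6)[OF r] c(1) inb(2)[OF r]] sub(2)]
              has_vector_derivative_within_subset[OF d2(8)[OF inb(6)[OF r] c(1) inb(2)[OF r]] sub(2)]
            by (intro has_vector_derivative_diff has_vector_derivative_Pair) simp_all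
          have 1: "norm (V r c - Y r c) \<le> norm (?f r)" using norm_snd_le[of "V r c - Y r c" "snd c (\<gamma> r) - snd c (\<eta> r)"] by simp
          have 2: "norm (?\<Phi> (snd c (\<gamma> r), V r c) - ?\<Phi> (snd c (\<eta> r), Y r c)) \<le> B * norm (?f r)"
            by (rule B(2)[OF inb(3)[OF r] inb(4)[OF r]])
          have "norm ((V r c, - ?\<Phi> (snd c (\<gamma> r), V r c)) - (Y r c, - ?\<Phi> (snd c (\<eta> r), Y r c)))
             \<le> norm (V r c - Y r c) + norm (- ?\<Phi> (snd c (\<gamma> r), V r c) - - ?\<Phi> (snd c (\<eta> r), Y r c))"
            unfolding minus_prod_def fst_conv snd_conv by (rule norm_Pair_le)
          also have "\<dots> = norm (V r c - Y r c) + norm (?\<Phi> (snd c (\<gamma> r), V r c) - ?\<Phi> (snd c (\<eta> r), Y r c))"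
            by (simp add: norm_minus_commute)
          also have "\<dots> \<le> norm (?f r) + B * norm (?f r)" using 1 2 by (rule add_mono)
          finally show "norm ((V r c, - ?\<Phi> (snd c (\<gamma> r), V r c)) - (Y r c, - ?\<Phi> (snd c (\<eta> r), Y r c))) \<le> (1 + B) * norm (?f r)"
            by (simp add: algebra_simps)
        qed
        then have eq: "snd c (\<gamma> b) = snd c (\<eta> b)" "V b c = Y b c" by (auto simp: zero_prod_def)
        have "\<gamma> b = \<eta> b" using eq(1) chart_inv_simps(1)[OF c(1)] inb(1,2)[OF b] by metis
        moreover have "V b = Y b"
          using TS_eqI[where v = "V b" and w = "Y b", OF d1(4)[OF inb(5)[OF b]] _ c(1) inb(1)[OF b] eq(2)] d2(4)[OF inb(6)[OF b]] \<open>\<gamma> b = \<eta> b\<close> by simp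
        ultimately show ?thesis by simp
      qed
      then show ?thesis using d by blast
    qed
  qed (use s t in auto)
qed

lemma geodesic_rescale:
  assumes "geodesic A g I \<gamma> V"
  shows "geodesic A g {s. r * s \<in> I} (\<lambda>s. \<gamma> (r * s)) (\<lambda>s. tscale r (V (r * s)))"
proof -
  note d = geodesicD[OF assms]
  let ?K = "{s. r * s \<in> I}"
  have K: "?K = (\<lambda>s. r * s) -` I" by auto
  have oK: "open ?K" unfolding K by (rule open_vimage[OF d(1)]) (intro continuous_intros)
  have iK: "is_interval ?K"
    unfolding K is_interval_convex_1
    by (rule convex_linear_vimage) (use d(2) in \<open>auto simp: is_interval_convex_1 intro: linearI simp: algebra_simps\<close>)
  have chain: "((\<lambda>s. h (r * s)) has_vector_derivative r *\<^sub>R h') (at s within ?K)"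
    if "(h has_vector_derivative h') (at (r * s) within I)" for h :: "real \<Rightarrow> real^'n" and h' s
  proof -
    have "((\<lambda>s. r * s) has_vector_derivative r) (at s within ?K)"
      by (auto intro!: derivative_eq_intros simp: has_vector_derivative_def mult.commute)
    moreover have "(h has_vector_derivative h') (at (r * s) within (\<lambda>s. r * s) ` ?K)"
      by (rule has_vector_derivative_within_subset[OF that]) auto
    ultimately show ?thesis using vector_diff_chain_within[of "\<lambda>s. r * s" r s ?K h h'] by (simp add: o_def)
  qed
  have TSs: "tscale r (V (r * s)) \<in> TS (\<gamma> (r * s))" if "s \<in> ?K" for s
    using TS_scale d(4) that by auto
  have vel: "((\<lambda>s. snd c (\<gamma> (r * s))) has_vector_derivative tscale r (V (r * s)) c) (at s within ?K)"
    if "s \<in> ?K" "c \<in> A" "\<gamma> (r * s) \<in> fst c" for s c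
    using chain[OF d(7)] that by (simp add: tscale_def)
  show ?thesis
    unfolding geodesic_def
  proof (intro conjI ballI oK iK)
    show "continuous_on ?K (\<lambda>s. \<gamma> (r * s))"
      by (rule continuous_on_compose2[OF d(3)]) (auto intro: continuous_intros)
    fix s assume s: "s \<in> ?K"
    show "has_velocity A ?K (\<lambda>s. \<gamma> (r * s)) (tscale r (V (r * s))) s"
      unfolding has_velocity_def using TSs[OF s] vel[OF s] by blast
    show "has_cov_deriv A g ?K (\<lambda>s. \<gamma> (r * s)) (\<lambda>s. tscale r (V (r * s))) tzero s"
      unfolding has_cov_deriv_iff
    proof (intro conjI ballI impI TSs TS_zero)
      fix c assume c: "c \<in> A" "\<gamma> (r * s) \<in> fst c"
      let ?Ga = "Gam (G c) (snd c (\<gamma> (r * s)))"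
      let ?v = "V (r * s) c"
      have "((\<lambda>s. r *\<^sub>R V (r * s) c) has_vector_derivative r *\<^sub>R (r *\<^sub>R (- ?Ga ?v ?v))) (at s within ?K)"
        by (rule bounded_linear.has_vector_derivative[OF bounded_linear_scaleR_right chain[OF d(8)]]) (use s c in auto)
      then show "\<exists>\<gamma>' V'. ((\<lambda>s. snd c (\<gamma> (r * s))) has_vector_derivative \<gamma>') (at s within ?K) \<and>
           ((\<lambda>s. tscale r (V (r * s)) c) has_vector_derivative V') (at s within ?K) \<and>
           tzero c = V' + ?Ga \<gamma>' (tscale r (V (r * s)) c)"
        using vel[OF s c]
        by (intro exI[of _ "tscale r (V (r * s)) c"] exI[of _ "r *\<^sub>R (r *\<^sub>R (- ?Ga ?v ?v))"])
          (simp add: tscale_def tzero_def Gam_linear)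
    qed (use s in auto)
  qed
qed

lemma exp_rel_unique: "exp_rel A g p v q \<Longrightarrow> exp_rel A g p v q' \<Longrightarrow> q = q'"
  unfolding exp_rel_def using geodesic_unique[where s = 0 and t = 1] by (metis atLeastAtMost_iff order_refl subsetD zero_le_one)

lemma exp_map_eq: "exp_rel A g p v q \<Longrightarrow> exp_map A g p v = q"
  unfolding exp_map_def using exp_rel_unique by blast

text \<open>\<open>Psi\<close> applies the exponential map to a different vector for each time. One
  geodesic \<eta> for the time t, reparametrised by the factor 1/t, yields the geodesics for all
  other times of its interval by further rescaling, so \<open>Psi\<close> is this single curve
  there.\<close>

lemma Psi_geodesic:
  assumes t: "tscale t (L z) \<in> exp_dom A g z" "t \<noteq> 0"
  obtains U V where "geodesic A g U (Psi A g L z) V" "0 \<in> U" "t \<in> U" "Psi A g L z 0 = z" "V 0 = L z"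
proof -
  obtain D \<eta> Y where *: "{0..1} \<subseteq> D" "geodesic A g D \<eta> Y" "\<eta> 0 = z" "Y 0 = tscale t (L z)"
    using t(1) unfolding exp_dom_def exp_rel_def by blast
  let ?U = "{s. (1 / t) * s \<in> D}" and ?\<gamma> = "\<lambda>s. \<eta> ((1 / t) * s)" and ?V = "\<lambda>s. tscale (1 / t) (Y ((1 / t) * s))"
  have g: "geodesic A g ?U ?\<gamma> ?V" by (rule geodesic_rescale[OF *(2)])
  have V0: "?V 0 = L z" using *(4) t(2) by (simp add: tscale_def)
  have U0: "0 \<in> ?U" "t \<in> ?U" using *(1) t(2) by auto
  have eq: "Psi A g L z r = ?\<gamma> r" if r: "r \<in> ?U" for r
  proof -
    have gr: "geodesic A g {s. r * s \<in> ?U} (\<lambda>s. ?\<gamma> (r * s)) (\<lambda>s. tscale r (?V (r * s)))"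
      by (rule geodesic_rescale[OF g])
    have "{0..1} \<subseteq> {s. r * s \<in> ?U}"
    proof
      fix s :: real assume "s \<in> {0..1}"
      moreover have "convex ?U" using geodesicD(2)[OF g] by (simp add: is_interval_convex_1)
      ultimately have "(1 - s) *\<^sub>R 0 + s *\<^sub>R r \<in> ?U" using U0(1) r by (intro convexD) auto
      then show "s \<in> {s. r * s \<in> ?U}" by (simp add: mult.commute)
    qed
    then have "exp_rel A g z (tscale r (L z)) (?\<gamma> r)"
      unfolding exp_rel_def using gr *(3) V0
      by (intro exI[of _ "{s. r * s \<in> ?U}"] exI[of _ "\<lambda>s. ?\<gamma> (r * s)"] exI[of _ "\<lambda>s. tscale r (?V (r * s))"]) simp
    then show ?thesis unfolding Psi_def by (rule exp_map_eq)
  qed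
  have "geodesic A g ?U (Psi A g L z) ?V"
  proof -
    note d = geodesicD[OF g]
    have tr: "((\<lambda>s. snd c (Psi A g L z s)) has_vector_derivative x) (at s within ?U)"
      if "((\<lambda>s. snd c (?\<gamma> s)) has_vector_derivative x) (at s within ?U)" "s \<in> ?U" for c x s
      by (rule has_vector_derivative_transform[OF that(2) _ that(1)]) (simp only: eq)
    have "continuous_on ?U (Psi A g L z)"
      using d(3) by (rule continuous_on_eq) (simp only: eq)
    moreover have "has_velocity A ?U (Psi A g L z) (?V s) s" if s: "s \<in> ?U" for s
      using d(5)[OF s] tr[OF _ s] unfolding has_velocity_def eq[OF s] by blast
    moreover have "has_cov_deriv A g ?U (Psi A g L z) ?V tzero s" if s: "s \<in> ?U" for s
    proof -
      have cd: "has_cov_deriv A g ?U ?\<gamma> ?V tzero s" by (rule d(6)[OF s])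
      have "\<forall>s\<in>?U. ?V s \<in> TS (Psi A g L z s)" using d(4) eq by metis
      moreover have "\<exists>\<gamma>' V'. ((\<lambda>s. snd c (Psi A g L z s)) has_vector_derivative \<gamma>') (at s within ?U) \<and>
         ((\<lambda>s. ?V s c) has_vector_derivative V') (at s within ?U) \<and>
         tzero c = V' + Gam (G c) (snd c (Psi A g L z s)) \<gamma>' (?V s c)" if c: "c \<in> A" "Psi A g L z s \<in> fst c" for c
      proof -
        have "?\<gamma> s \<in> fst c" using c(2) eq[OF s] by simp
        then obtain \<gamma>' V' where "((\<lambda>s. snd c (?\<gamma> s)) has_vector_derivative \<gamma>') (at s within ?U)"
         "((\<lambda>s. ?V s c) has_vector_derivative V') (at s within ?U)"
         "tzero c = V' + Gam (G c) (snd c (?\<gamma> s)) \<gamma>' (?V s c)"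
          using cd c(1) unfolding has_cov_deriv_iff by blast
        then show ?thesis using tr[OF _ s] eq[OF s] by metis
      qed
      ultimately show ?thesis unfolding has_cov_deriv_iff using TS_zero by blast
    qed
    ultimately show ?thesis unfolding geodesic_def using d(1,2) by blast
  qed
  moreover have "Psi A g L z 0 = z" using eq[OF U0(1)] *(3) by simp
  ultimately show ?thesis using that U0 V0 by blast
qed

end

context null_hyp begin

text \<open>The product g(V, V) is conserved and zero at s, so V is null; on K it is tangent to H,
  hence V = a L by \<open>null_tangent\<close>. Both V and L satisfy the geodesic equation, which
  forces a' = 0, and a = 1 at s.\<close>

lemma velocity_is_L:
  assumes n: "CARD('n) \<ge> 2" and geo: "geodesic A g U \<gamma> V" and K: "K \<subseteq> U" "is_interval K"
    and lim: "\<And>t. t \<in> K \<Longrightarrow> at t within K \<noteq> bot" and KH: "\<And>t. t \<in> K \<Longrightarrow> \<gamma> t \<in> H"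
    and s: "s \<in> K" "V s = L (\<gamma> s)" and t: "t \<in> K"
  shows "V t = L (\<gamma> t)"
proof -
  note d = geodesicD[OF geo]
  have null: "g (\<gamma> r) (V r) (V r) = 0" if r: "r \<in> K" for r
  proof (rule gronwall_zero[where f = "\<lambda>r. g (\<gamma> r) (V r) (V r)" and f' = "\<lambda>r. 0" and K = 0 and s = s and J = U])
    show "is_interval U" "s \<in> U" "r \<in> U" using d(2) K s r by auto
    show "g (\<gamma> s) (V s) (V s) = 0" using L_TH(2)[OF KH[OF s(1)]] s(2) by simp
    fix r assume r: "r \<in> U"
    have at: "at r within U \<noteq> bot" using at_within_open[OF r d(1)] by simp
    have "((\<lambda>r. g (\<gamma> r) (V r) (V r)) has_real_derivative g (\<gamma> r) tzero (V r) + g (\<gamma> r) (V r) tzero) (at r within U)"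
      by (rule metric_derivative[OF d(5)[OF r] _ r at d(6)[OF r] d(6)[OF r]])
        (use d(3) r in \<open>simp add: continuous_on_eq_continuous_within\<close>)
    moreover have "g (\<gamma> r) tzero (V r) = 0" "g (\<gamma> r) (V r) tzero = 0"
      using g_scale[OF d(4)[OF r] d(4)[OF r], of 0] by (simp_all add: tscale_def tzero_def)
    ultimately show "((\<lambda>r. g (\<gamma> r) (V r) (V r)) has_vector_derivative 0) (at r within U)"
      by (simp add: has_real_derivative_iff_has_vector_derivative)
  qed auto
  show ?thesis
  proof (rule local_constancy[OF K(2) s(1), where Q = "\<lambda>t. V t = L (\<gamma> t)"])
    fix t assume t: "t \<in> K"
    have tU: "t \<in> U" using t K by auto
    obtain c where c: "c \<in> A" "\<gamma> t \<in> fst c" using chart_ex .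
    obtain N f \<rho> F where e: "extension c N f \<rho> F" "snd c (\<gamma> t) \<in> N" using extension_ex[OF KH[OF t] c] .
    note ex = e(1) c(1)
    have "L (\<gamma> t) c \<noteq> 0"
      using TS_eqI[OF L_TS[OF KH[OF t]] TS_zero c] L_nz[OF KH[OF t]] by (auto simp: tzero_def)
    then obtain k where k: "F (snd c (\<gamma> t)) $ k \<noteq> 0"
      using ext_H(3)[OF ex KH[OF t] c(2) e(2)] by (metis Finite_Cartesian_Product.vec_eq_iff zero_index)
    define N' where "N' = N \<inter> (\<lambda>x. F x $ k) -` (- {0})"
    have oN': "open N'"
      unfolding N'_def
      by (rule continuous_open_preimage[OF C1_on_continuous[OF C1_on_component[OF ext_F[OF ex]]] ext_open[OF ex]]) (simp add: open_Compl)
    have o: "open (fst c \<inter> snd c -` N')"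
      by (rule continuous_open_preimage[OF chart_cont(1)[OF c(1)] chart_open(1)[OF c(1)] oN'])
    have o2: "open (U \<inter> \<gamma> -` (fst c \<inter> snd c -` N'))"
      by (rule continuous_open_preimage[OF d(3,1) o])
    have "t \<in> U \<inter> \<gamma> -` (fst c \<inter> snd c -` N')" using tU c e k by (simp add: N'_def)
    then have "\<exists>r>0. ball t r \<subseteq> U \<inter> \<gamma> -` (fst c \<inter> snd c -` N')" using o2 by (meson open_contains_ball)
    then obtain r where r: "r > 0" "ball t r \<subseteq> U \<inter> \<gamma> -` (fst c \<inter> snd c -` N')" by (elim exE conjE)
    let ?J = "K \<inter> ball t r"
    let ?x = "\<lambda>s. snd c (\<gamma> s)"
    have J: "s \<in> K" "s \<in> U" "\<gamma> s \<in> fst c" "?x s \<in> N" "F (?x s) $ k \<noteq> 0" "\<gamma> s \<in> H" if "s \<in> ?J" for s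
      using that r(2) KH by (auto simp: N'_def)
    have JU: "?J \<subseteq> U" using K by auto
    have Jlim: "at s within ?J \<noteq> bot" if "s \<in> ?J" for s
      using lim[OF J(1)[OF that]] at_within_nhd[of s "ball t r" K ?J] that by auto
    have VL: "\<exists>a. V s c = a *\<^sub>R F (?x s) \<and> V s = tscale a (L (\<gamma> s))" if s: "s \<in> ?J" for s
    proof -
      have fC1: "C1_on f N" by (rule defining_C1(1)[OF ext_def[OF ex]])
      have "(?x has_vector_derivative V s c) (at s within ?J)"
        by (rule has_vector_derivative_within_subset[OF d(7)[OF J(2)[OF s] c(1) J(3)[OF s]] JU])
      from has_derivative_compose[OF this[unfolded has_vector_derivative_def] C1_onD[OF fC1 J(4)[OF s]]]
      have "((\<lambda>s. f (?x s)) has_vector_derivative fd f (?x s) (V s c)) (at s within ?J)"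
        unfolding has_vector_derivative_def linear_cmul[OF C1_on_linear[OF fC1 J(4)[OF s]]] .
      then have "((\<lambda>s. 0) has_vector_derivative fd f (?x s) (V s c)) (at s within ?J)"
        by (rule has_vector_derivative_transform[OF s, rotated]) (simp add: ext_H(1)[OF ex J(6) J(3) J(4)])
      then have "fd f (?x s) (V s c) = 0"
        using vector_derivative_unique_within[OF Jlim[OF s] has_vector_derivative_const] by metis
      then have "V s \<in> TH (\<gamma> s)"
        unfolding ext_H(4)[OF ex J(6)[OF s] J(3)[OF s] J(4)[OF s]] using d(4)[OF J(2)[OF s]] by simp
      then obtain a where "V s = tscale a (L (\<gamma> s))"
        using null_tangent[OF n J(6)[OF s] _ null[OF J(1)[OF s]]] by metis
      then show ?thesis
        using ext_H(3)[OF ex J(6)[OF s] J(3)[OF s] J(4)[OF s]] by (auto simp: tscale_def)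
    qed
    \<comment> \<open>A quotient of k-th components, k being chosen so that the one of F does not
      vanish; this form shows that the factor is differentiable.\<close>
    define a where "a s = V s c $ k / F (?x s) $ k" for s
    have Va: "V s c = a s *\<^sub>R F (?x s)" "V s = tscale (a s) (L (\<gamma> s))" if "s \<in> ?J" for s
      using VL[OF that] J(5)[OF that] by (auto simp: a_def)
    have da: "(a has_derivative (\<lambda>h. 0)) (at s within ?J)" if s: "s \<in> ?J" for s
    proof -
      let ?Ga = "Gam (G c) (?x s)" and ?F = "F (?x s)"
      have 1: "((\<lambda>s. V s c $ k) has_real_derivative (- ?Ga (V s c) (V s c)) $ k) (at s within ?J)"
        using bounded_linear.has_vector_derivative[OF bounded_linear_vec_nth
            has_vector_derivative_within_subset[OF d(8)[OF J(2)[OF s] c(1) J(3)[OF s]] JU]]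
        by (simp only: has_real_derivative_iff_has_vector_derivative)
      have "(?x has_vector_derivative V s c) (at s within ?J)"
        by (rule has_vector_derivative_within_subset[OF d(7)[OF J(2)[OF s] c(1) J(3)[OF s]] JU])
      from has_derivative_compose[OF this[unfolded has_vector_derivative_def] C1_onD[OF ext_F[OF ex] J(4)[OF s]]]
      have "((\<lambda>s. F (?x s)) has_vector_derivative fd F (?x s) (V s c)) (at s within ?J)"
        unfolding has_vector_derivative_def linear_cmul[OF C1_on_linear[OF ext_F[OF ex] J(4)[OF s]]] .
      then have 2: "((\<lambda>s. F (?x s) $ k) has_real_derivative fd F (?x s) (V s c) $ k) (at s within ?J)"
        using bounded_linear.has_vector_derivative[OF bounded_linear_vec_nth]
        by (simp only: has_real_derivative_iff_has_vector_derivative)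
      have 3: "fd F (?x s) (V s c) = - (a s *\<^sub>R ?Ga ?F ?F)"
        using ext_geodesic[OF ex J(4)[OF s]] ext_H(2)[OF ex J(6)[OF s] J(3)[OF s] J(4)[OF s]]
        unfolding Va(1)[OF s] linear_cmul[OF C1_on_linear[OF ext_F[OF ex] J(4)[OF s]]] by simp
      have 4: "?Ga (V s c) (V s c) = (a s * a s) *\<^sub>R ?Ga ?F ?F"
        unfolding Va(1)[OF s] Gam_linear by simp
      have "(a has_real_derivative ((- ?Ga (V s c) (V s c)) $ k * ?F $ k - V s c $ k * fd F (?x s) (V s c) $ k) / (?F $ k * ?F $ k)) (at s within ?J)"
        unfolding a_def by (rule DERIV_divide[OF 1 2 J(5)[OF s]])
      \<comment> \<open>Along the curve V' = - a^2 \<open>Gam\<close> (F, F) and F' = - a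
        \<open>Gam\<close> (F, F), while V = a F, so the two products cancel.\<close>
      moreover have "(- ?Ga (V s c) (V s c)) $ k * ?F $ k - V s c $ k * fd F (?x s) (V s c) $ k = 0"
        unfolding 3 4 by (subst Va(1)[OF s]) simp
      ultimately have "(a has_real_derivative 0) (at s within ?J)" by simp
      moreover have "(*) (0::real) = (\<lambda>h. 0)" by (simp add: fun_eq_iff)
      ultimately show ?thesis unfolding has_field_derivative_def by (simp only:)
    qed
    have cvx: "convex ?J" using K(2) is_interval_Int_ball[of K t r] by (simp add: is_interval_convex_1)
    have "V v = L (\<gamma> v)" if u: "u \<in> ?J" "V u = L (\<gamma> u)" and v: "v \<in> ?J" for u v
    proof -
      obtain q where q: "\<And>s. s \<in> ?J \<Longrightarrow> a s = q"
        using has_derivative_zero_constant[OF cvx da] by blast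
      have "V u c = F (?x u)" using u(2) ext_H(3)[OF ex J(6)[OF u(1)] J(3)[OF u(1)] J(4)[OF u(1)]] by simp
      then have "a u = 1" using J(5)[OF u(1)] by (simp add: a_def)
      then have "a v = 1" using q u v by metis
      then show ?thesis using Va(2)[OF v] by (simp add: tscale_def)
    qed
    then show "\<exists>d>0. (\<exists>r\<in>K \<inter> ball t d. V r = L (\<gamma> r)) \<longrightarrow> (\<forall>r\<in>K \<inter> ball t d. V r = L (\<gamma> r))"
      using r(1) by blast
  qed (rule s t)+
qed

section \<open>The curve \<open>Psi\<close> and its interval of definition\<close>

lemma Psi_interval_facts:
  shows "is_interval (Psi_interval A g H L z)"
    and "t \<in> Psi_interval A g H L z \<Longrightarrow> tscale t (L z) \<in> exp_dom A g z \<and> Psi A g L z t \<in> H"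
    and "t \<in> Psi_interval A g H L z \<Longrightarrow> 0 \<in> Psi_interval A g H L z"
proof -
  let ?S = "{t. tscale t (L z) \<in> exp_dom A g z \<and> Psi A g L z t \<in> H}"
  show "is_interval (Psi_interval A g H L z)"
    unfolding Psi_interval_def is_interval_connected_1 by (rule connected_connected_component)
  show "t \<in> Psi_interval A g H L z \<Longrightarrow> tscale t (L z) \<in> exp_dom A g z \<and> Psi A g L z t \<in> H"
    unfolding Psi_interval_def using connected_component_subset[of ?S 0] by blast
  show "t \<in> Psi_interval A g H L z \<Longrightarrow> 0 \<in> Psi_interval A g H L z"
    unfolding Psi_interval_def using connected_component_in(1)[of ?S 0 t] connected_component_refl[of 0 ?S] by simp
qed

text \<open>The segment from 0 to t lies in the interval, so \<open>velocity_is_L\<close> applies on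
  it. The point t1 ensures that the interval is not a single point and provides a segment at the
  time 0.\<close>

lemma Psi_null_curve:
  assumes n: "CARD('n) \<ge> 2" and z: "z \<in> H"
    and t1: "t1 \<in> Psi_interval A g H L z" "t1 \<noteq> 0"
  shows "null_curve A g T H L (Psi_interval A g H L z) (Psi A g L z)" "Psi A g L z 0 = z"
proof -
  let ?I = "Psi_interval A g H L z" and ?\<gamma> = "Psi A g L z"
  note I = Psi_interval_facts
  have 0: "0 \<in> ?I" using I(3)[OF t1(1)] .
  have key: "\<exists>U. open U \<and> r \<in> U \<and> continuous_on U ?\<gamma> \<and> has_velocity A U ?\<gamma> (L (?\<gamma> r)) r"
    if t: "t \<in> ?I" "t \<noteq> 0" and r: "r \<in> closed_segment 0 t" for t r
  proof -
    obtain U V where U: "geodesic A g U ?\<gamma> V" "0 \<in> U" "t \<in> U" "?\<gamma> 0 = z" "V 0 = L z"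
      using Psi_geodesic[where L = L and z = z, OF conjunct1[OF I(2)[OF t(1)]] t(2)] .
    note d = geodesicD[OF U(1)]
    let ?K = "closed_segment 0 t"
    have KU: "?K \<subseteq> U" using closed_segment_subset[OF U(2,3)] d(2) by (simp add: is_interval_convex_1)
    have KI: "?K \<subseteq> ?I" using closed_segment_subset[OF 0 t(1)] I(1) by (simp add: is_interval_convex_1)
    have "V r = L (?\<gamma> r)"
    proof (rule velocity_is_L[OF n U(1) KU _ _ _ _ _ r])
      show "is_interval ?K" by (simp add: is_interval_convex_1)
      show "at r within ?K \<noteq> bot" if "r \<in> ?K" for r
      proof -
        have "r islimpt ?K" by (rule connected_imp_perfect[of ?K]) (use t that in \<open>auto simp: closed_segment_eq_real_ivl split: if_splits\<close>)
        then show ?thesis by (simp add: trivial_limit_within)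
      qed
      show "?\<gamma> r \<in> H" if "r \<in> ?K" for r using I(2) KI that by blast
      show "V 0 = L (?\<gamma> 0)" using U(4,5) by simp
    qed auto
    then show ?thesis using d(1,3) d(5)[of r] KU r by (intro exI[of _ U]) auto
  qed
  have key': "\<exists>U. open U \<and> r \<in> U \<and> continuous_on U ?\<gamma> \<and> has_velocity A U ?\<gamma> (L (?\<gamma> r)) r" if "r \<in> ?I" for r
    using key[OF that, of r] key[OF t1, of r] by (cases "r = 0") auto
  show "?\<gamma> 0 = z"
    using Psi_geodesic[where L = L and z = z, OF conjunct1[OF I(2)[OF t1(1)]] t1(2)] by metis
  show "null_curve A g T H L ?I ?\<gamma>"
  proof
    show "is_interval ?I" by (rule I(1))
    show "at t within ?I \<noteq> bot" if "t \<in> ?I" for t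
    proof -
      have "t islimpt ?I"
        by (rule connected_imp_perfect[of ?I]) (use I(1) that 0 t1 in \<open>auto simp: is_interval_connected_1\<close>)
      then show ?thesis by (simp add: trivial_limit_within)
    qed
    show "?\<gamma> t \<in> H" if "t \<in> ?I" for t using I(2)[OF that] by simp
    show "continuous_on ?I ?\<gamma>"
      unfolding continuous_on_eq_continuous_within
    proof
      fix r assume "r \<in> ?I"
      then obtain U where "open U" "r \<in> U" "continuous_on U ?\<gamma>" using key' by blast
      then have "isCont ?\<gamma> r" using continuous_on_eq_continuous_at by blast
      then show "continuous (at r within ?I) ?\<gamma>" using continuous_at_imp_continuous_at_within by blast
    qed
    fix r assume r: "r \<in> ?I"
    then obtain U where U: "open U" "r \<in> U" "has_velocity A U ?\<gamma> (L (?\<gamma> r)) r" using key' by blast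
    show "has_velocity A ?I ?\<gamma> (L (?\<gamma> r)) r"
      using U(3) at_within_open[OF U(2,1)] has_vector_derivative_at_within unfolding has_velocity_def by metis
  qed
qed

end

section \<open>Derivatives of determinants\<close>

text \<open>Liouville's formula, column by column: the derivative of column i is the combination of
  all columns k with weights \<beta> k i, and a determinant with column i replaced by column k is
  the old one for k = i and zero otherwise.\<close>

lemma det_has_real_derivative:
  fixes M :: "nat \<Rightarrow> nat \<Rightarrow> real \<Rightarrow> real" and \<beta> :: "nat \<Rightarrow> nat \<Rightarrow> real"
  assumes M: "\<And>i j. i < m \<Longrightarrow> j < m \<Longrightarrow> (M i j has_real_derivative (\<Sum>k<m. M i k t * \<beta> k j)) (at t within S)"
  shows "((\<lambda>s. Determinant.det (Matrix.mat m m (\<lambda>(i, j). M i j s))) has_real_derivative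
    (\<Sum>k<m. \<beta> k k) * Determinant.det (Matrix.mat m m (\<lambda>(i, j). M i j t))) (at t within S)"
proof -
  let ?P = "{p. p permutes {0..<m}}"
  \<comment> \<open>The Leibniz sum indexed by columns, since \<beta> acts on the columns of
    M.\<close>
  have tr: "Determinant.det (Matrix.mat m m (\<lambda>(i, j). N i j)) = (\<Sum>p\<in>?P. signof p * (\<Prod>i = 0..<m. N (p i) i))"
    for N :: "nat \<Rightarrow> nat \<Rightarrow> real"
  proof -
    have "Determinant.det (Matrix.mat m m (\<lambda>(i, j). N i j)) = Determinant.det (Matrix.mat m m (\<lambda>(i, j). N j i))"
      by (subst Determinant.det_transpose[symmetric, of _ m]) (auto intro!: arg_cong[where f = Determinant.det] Matrix.eq_matI)
    also have "\<dots> = (\<Sum>p\<in>?P. signof p * (\<Prod>i = 0..<m. N (p i) i))"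
      by (subst Determinant.det_def'[of _ m])
        (auto intro!: sum.cong prod.cong simp: permutes_in_image[of _ "{0..<m}"] atLeast0LessThan)
    finally show ?thesis .
  qed
  have fin: "finite ?P" by (rule finite_permutations) simp
  \<comment> \<open>The expansion of the determinant of M at t with column i replaced by column
    k.\<close>
  define repl where "repl i k = (\<Sum>p\<in>?P. signof p * (M (p i) k t * (\<Prod>j\<in>{0..<m} - {i}. M (p j) j t)))" for i k
  have repl: "repl i k = (if i = k then Determinant.det (Matrix.mat m m (\<lambda>(i, j). M i j t)) else 0)"
    if i: "i < m" and k: "k < m" for i k
  proof -
    define N where "N r c = (if c = i then M r k t else M r c t)" for r c
    have "repl i k = (\<Sum>p\<in>?P. signof p * (\<Prod>j = 0..<m. N (p j) j))"
      unfolding repl_def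
    proof (intro sum.cong refl arg_cong2[where f = "(*)"])
      fix p
      have "(\<Prod>j = 0..<m. N (p j) j) = N (p i) i * (\<Prod>j\<in>{0..<m} - {i}. N (p j) j)"
        using i by (intro prod.remove) auto
      also have "(\<Prod>j\<in>{0..<m} - {i}. N (p j) j) = (\<Prod>j\<in>{0..<m} - {i}. M (p j) j t)"
        by (intro prod.cong) (auto simp: N_def)
      finally show "M (p i) k t * (\<Prod>j\<in>{0..<m} - {i}. M (p j) j t) = (\<Prod>j = 0..<m. N (p j) j)"
        by (simp add: N_def)
    qed
    then have 1: "repl i k = Determinant.det (Matrix.mat m m (\<lambda>(i, j). N i j))" by (simp add: tr)
    show ?thesis
    proof (cases "i = k")
      case True
      then have "N = (\<lambda>r c. M r c t)" by (auto simp: N_def fun_eq_iff)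
      then show ?thesis using 1 True by simp
    next
      case False
      have "Determinant.det (Matrix.mat m m (\<lambda>(i, j). N i j)) = Determinant.det (Matrix.mat m m (\<lambda>(i, j). N j i))"
        by (subst Determinant.det_transpose[symmetric, of _ m]) (auto intro!: arg_cong[where f = Determinant.det] Matrix.eq_matI)
      also have "\<dots> = 0"
      proof (rule Determinant.det_identical_rows[of _ m i k])
        show "Matrix.row (Matrix.mat m m (\<lambda>(i, j). N j i)) i = Matrix.row (Matrix.mat m m (\<lambda>(i, j). N j i)) k"
          using i k False by (intro Matrix.eq_vecI) (auto simp: N_def)
      qed (use i k False in auto)
      finally show ?thesis using 1 False by simp
    qed
  qed
  have "((\<lambda>s. \<Sum>p\<in>?P. signof p * (\<Prod>i = 0..<m. M (p i) i s)) has_real_derivative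
     (\<Sum>p\<in>?P. signof p * (\<Sum>i = 0..<m. (\<Sum>k<m. M (p i) k t * \<beta> k i) * (\<Prod>j\<in>{0..<m} - {i}. M (p j) j t)))) (at t within S)"
  proof (intro DERIV_sum DERIV_cmult)
    fix p assume p: "p \<in> ?P"
    have "((\<lambda>s. \<Prod>i = 0..<m. M (p i) i s) has_derivative
       (\<lambda>h. \<Sum>i = 0..<m. ((\<Sum>k<m. M (p i) k t * \<beta> k i) * h) * (\<Prod>j\<in>{0..<m} - {i}. M (p j) j t))) (at t within S)"
    proof (rule has_derivative_prod)
      fix i assume i: "i \<in> {0..<m}"
      then have "p i < m" using p permutes_in_image[of p "{0..<m}" i] by auto
      then show "(M (p i) i has_derivative (\<lambda>h. (\<Sum>k<m. M (p i) k t * \<beta> k i) * h)) (at t within S)"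
        using M[of "p i" i] i by (simp add: has_field_derivative_def)
    qed
    moreover have "(\<Sum>i = 0..<m. ((\<Sum>k<m. M (p i) k t * \<beta> k i) * h) * (\<Prod>j\<in>{0..<m} - {i}. M (p j) j t))
       = (\<Sum>i = 0..<m. (\<Sum>k<m. M (p i) k t * \<beta> k i) * (\<Prod>j\<in>{0..<m} - {i}. M (p j) j t)) * h" for h
      unfolding sum_distrib_right[of _ "{0..<m}"] by (intro sum.cong refl) (simp only: mult_ac)
    ultimately show "((\<lambda>s. \<Prod>i = 0..<m. M (p i) i s) has_real_derivative
       (\<Sum>i = 0..<m. (\<Sum>k<m. M (p i) k t * \<beta> k i) * (\<Prod>j\<in>{0..<m} - {i}. M (p j) j t))) (at t within S)"
      by (simp add: has_field_derivative_def)
  qed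
  moreover have "(\<Sum>p\<in>?P. signof p * (\<Sum>i = 0..<m. (\<Sum>k<m. M (p i) k t * \<beta> k i) * (\<Prod>j\<in>{0..<m} - {i}. M (p j) j t)))
     = (\<Sum>i = 0..<m. \<Sum>k<m. \<beta> k i * repl i k)"
  proof -
    have "(\<Sum>p\<in>?P. signof p * (\<Sum>i = 0..<m. (\<Sum>k<m. M (p i) k t * \<beta> k i) * (\<Prod>j\<in>{0..<m} - {i}. M (p j) j t)))
      = (\<Sum>p\<in>?P. \<Sum>i = 0..<m. \<Sum>k<m. \<beta> k i * (signof p * (M (p i) k t * (\<Prod>j\<in>{0..<m} - {i}. M (p j) j t))))"
      by (simp add: sum_distrib_left sum_distrib_right mult_ac)
    also have "\<dots> = (\<Sum>i = 0..<m. \<Sum>p\<in>?P. \<Sum>k<m. \<beta> k i * (signof p * (M (p i) k t * (\<Prod>j\<in>{0..<m} - {i}. M (p j) j t))))"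
      by (rule sum.swap)
    also have "\<dots> = (\<Sum>i = 0..<m. \<Sum>k<m. \<Sum>p\<in>?P. \<beta> k i * (signof p * (M (p i) k t * (\<Prod>j\<in>{0..<m} - {i}. M (p j) j t))))"
      by (intro sum.cong refl sum.swap)
    finally show ?thesis by (simp only: repl_def sum_distrib_left)
  qed
  moreover have "(\<Sum>i = 0..<m. \<Sum>k<m. \<beta> k i * repl i k) = (\<Sum>k<m. \<beta> k k) * Determinant.det (Matrix.mat m m (\<lambda>(i, j). M i j t))"
  proof -
    have "(\<Sum>i = 0..<m. \<Sum>k<m. \<beta> k i * repl i k) = (\<Sum>i = 0..<m. \<Sum>k<m. if k = i then \<beta> i i * Determinant.det (Matrix.mat m m (\<lambda>(i, j). M i j t)) else 0)"
      by (intro sum.cong refl) (auto simp: repl)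
    also have "\<dots> = (\<Sum>i<m. \<beta> i i * Determinant.det (Matrix.mat m m (\<lambda>(i, j). M i j t)))"
      by (simp add: atLeast0LessThan)
    finally show ?thesis by (simp add: sum_distrib_right)
  qed
  ultimately show ?thesis unfolding tr by simp
qed

text \<open>A product rule with h merely continuous: where f vanishes, the difference quotient of
  the product is that of f times h. It makes up for the unknown differentiability of
  \<open>wein\<close> in \<open>wein_riccati\<close>.\<close>

lemma has_real_derivative_mult_zero:
  fixes f h :: "real \<Rightarrow> real"
  assumes f: "(f has_real_derivative f') (at t within S)" "f t = 0" and h: "continuous (at t within S) h"
  shows "((\<lambda>s. f s * h s) has_real_derivative f' * h t) (at t within S)"
proof -
  have "((\<lambda>y. (f y - f t) / (y - t) * h y) \<longlongrightarrow> f' * h t) (at t within S)"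
    using f(1) h unfolding has_field_derivative_iff continuous_within by (intro tendsto_mult)
  then show ?thesis unfolding has_field_derivative_iff using f(2) by simp
qed

section \<open>The Riccati equation in a parallel null frame\<close>

lemma (in lorentz) g_zero:
  assumes "v \<in> TS p" shows "g p tzero v = 0" "g p v tzero = 0"
  using g_scale[OF assms assms, of 0] by (simp_all add: tscale_def tzero_def)

context null_curve begin

text \<open>Parallel transport preserves all products, hence the frame relations; as L is itself
  parallel, the vector that starts as L stays L.\<close>

lemma parallel_null_frame:
  assumes n: "CARD('n) \<ge> 2" and t0: "t0 \<in> I"
  obtains E i0 i1 where "\<And>t. t \<in> I \<Longrightarrow> null_frame (\<gamma> t) i0 i1 (\<lambda>i. E i t)"
    "\<And>i t. t \<in> I \<Longrightarrow> cov (E i) tzero t" "\<And>t. t \<in> I \<Longrightarrow> E i0 t = L (\<gamma> t)"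
proof -
  note z = in_H[OF t0]
  obtain e i0 i1 where e: "null_frame (\<gamma> t0) i0 i1 e" "e i0 = L (\<gamma> t0)"
    using null_frame_ex[OF n L_TS[OF z] L_nz[OF z] L_TH(2)[OF z]] by metis
  have "\<exists>V. V t0 = e i \<and> (\<forall>t\<in>I. cov V tzero t)" for i
    using parallel_exists[OF t0, of "e i"] e(1) unfolding null_frame_def by metis
  then obtain E where E: "\<And>i. E i t0 = e i" "\<And>i t. t \<in> I \<Longrightarrow> cov (E i) tzero t" by metis
  have T: "E i t \<in> TS (\<gamma> t)" if "t \<in> I" for i t using cov_TS(1)[OF E(2)[OF that] that] .
  have gc: "g (\<gamma> t) (E i t) (E j t) = g (\<gamma> t0) (e i) (e j)" if t: "t \<in> I" for i j t
  proof -
    have "g (\<gamma> t) (E i t) (E j t) - g (\<gamma> t0) (e i) (e j) = 0"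
    proof (rule gronwall_zero[OF I t0 _ t, where f = "\<lambda>t. g (\<gamma> t) (E i t) (E j t) - g (\<gamma> t0) (e i) (e j)" and f' = "\<lambda>t. 0" and K = 0])
      fix r assume r: "r \<in> I"
      have "((\<lambda>t. g (\<gamma> t) (E i t) (E j t)) has_real_derivative 0) (at r within I)"
        using metric_deriv[OF E(2)[OF r, of i] E(2)[OF r, of j] r] g_zero[OF T[OF r]] by simp
      then have "((\<lambda>t. g (\<gamma> t) (E i t) (E j t)) has_vector_derivative 0) (at r within I)"
        by (simp add: has_real_derivative_iff_has_vector_derivative)
      from has_vector_derivative_diff[OF this has_vector_derivative_const]
      show "((\<lambda>t. g (\<gamma> t) (E i t) (E j t) - g (\<gamma> t0) (e i) (e j)) has_vector_derivative 0) (at r within I)" by simp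
    qed (use E(1) in auto)
    then show ?thesis by simp
  qed
  have "null_frame (\<gamma> t) i0 i1 (\<lambda>i. E i t)" if "t \<in> I" for t
    using e(1) T[OF that] gc[OF that] unfolding null_frame_def by simp
  moreover have "E i0 t = L (\<gamma> t)" if "t \<in> I" for t
    by (rule parallel_unique[where V = "E i0" and V' = "\<lambda>t. L (\<gamma> t)", OF E(2) L_parallel t0 _ that]) (use E(1) e(2) in auto)
  ultimately show ?thesis using that E(2) by metis
qed

end

locale null_frame_curve = null_curve A g T H L I \<gamma>
  for A :: "('m::{t2_space, second_countable_topology}, 'n::finite) chart set"
    and g :: "('m, 'n) metric" and T :: "'m \<Rightarrow> ('m, 'n) tvec" and H and L and I and \<gamma> +
  fixes E :: "'n \<Rightarrow> real \<Rightarrow> ('m, 'n) tvec" and i0 i1 :: 'n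
  assumes frame: "t \<in> I \<Longrightarrow> null_frame (\<gamma> t) i0 i1 (\<lambda>i. E i t)"
    and par: "t \<in> I \<Longrightarrow> cov (E i) tzero t"
    and E0: "t \<in> I \<Longrightarrow> E i0 t = L (\<gamma> t)"
begin

abbreviation \<tau> :: "'n \<Rightarrow> 'n" where "\<tau> \<equiv> Transposition.transpose i0 i1"

lemma E_TS: "t \<in> I \<Longrightarrow> E i t \<in> TS (\<gamma> t)"
  using cov_TS(1)[OF par] by blast

lemma E_TH:
  assumes t: "t \<in> I" and k: "k \<noteq> i1" shows "E k t \<in> TH (\<gamma> t)"
  using null_frame_TH(2)[OF frame[OF t] E0[OF t] in_H[OF t]] k by blast

lemma g_E: "t \<in> I \<Longrightarrow> g (\<gamma> t) (E i t) (E j t) = (if j = \<tau> i then 1 else 0)"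
  using frame by (simp add: null_frame_def)

text \<open>The matrix of the Weingarten map: for k other than i1, the coefficient of E l in
  \<nabla> L in the direction E k, extracted by the dual vector \<open>E (\<tau> l)\<close>; see
  \<open>nab_E\<close>.\<close>

definition wein :: "'n \<Rightarrow> 'n \<Rightarrow> real \<Rightarrow> real" where
  "wein k l t = g (\<gamma> t) (nab t (E k t)) (E (\<tau> l) t)"

lemma nab_E_TS: "t \<in> I \<Longrightarrow> k \<noteq> i1 \<Longrightarrow> nab t (E k t) \<in> TS (\<gamma> t)"
  using TH_TS[OF in_H nabla_TH[OF in_H E_TH]] .

lemma nab_E:
  assumes t: "t \<in> I" and k: "k \<noteq> i1"
  shows "nab t (E k t) = (\<lambda>c. \<Sum>l\<in>-{i1}. wein k l t *\<^sub>R E l t c)"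
  unfolding wein_def g_sym[OF nab_E_TS[OF t k] E_TS[OF t]]
  by (rule null_frame_TH(3)[OF frame[OF t] E0[OF t] in_H[OF t] nabla_TH[OF in_H[OF t] E_TH[OF t k]]])

lemma wein_i0: "t \<in> I \<Longrightarrow> wein i0 l t = 0"
  unfolding wein_def by (simp add: E0 nabla_LL[OF in_H] g_zero[OF E_TS])

lemma wein_sym: "t \<in> I \<Longrightarrow> k \<in> -{i0, i1} \<Longrightarrow> l \<in> -{i0, i1} \<Longrightarrow> wein k l t = wein l k t"
  unfolding wein_def using nabla_sym[OF in_H E_TH E_TH] by (auto simp: Transposition.transpose_def)

text \<open>\<open>nabla\<close> contains the first derivative of F, which is a priori no more than
  continuous. Differentiability of the entries is a consequence of the Jacobi equation in
  \<open>wein_riccati\<close>.\<close>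

lemma wein_cont:
  assumes k: "k \<noteq> i1" shows "continuous_on I (wein k l)"
  unfolding continuous_on_eq_continuous_within
proof
  fix t assume t: "t \<in> I"
  obtain c where c: "c \<in> A" "\<gamma> t \<in> fst c" using chart_ex .
  interpret metric_chart "dom c" "G c" by (rule metric_chart[OF c(1)])
  obtain N f \<rho> F where e: "extension c N f \<rho> F" "snd c (\<gamma> t) \<in> N" using extension_ex[OF in_H[OF t] c] .
  note ex = e(1) c(1)
  obtain d where d: "d > 0" "\<And>r. r \<in> I \<inter> ball t d \<Longrightarrow> \<gamma> r \<in> fst c \<and> snd c (\<gamma> r) \<in> N"
    using chart_nbhd[OF t c ext_open[OF ex] e(2)] by metis
  let ?J = "I \<inter> ball t d" and ?x = "\<lambda>r. snd c (\<gamma> r)"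
  have J: "?J \<subseteq> I" "\<And>r. r \<in> ?J \<Longrightarrow> \<gamma> r \<in> fst c" "?x ` ?J \<subseteq> N" "?x ` ?J \<subseteq> dom c" using d(2) by auto
  have Ec: "continuous_on ?J (\<lambda>r. E i r c)" for i
  proof -
    have "continuous (at r within ?J) (\<lambda>r. E i r c)" if "r \<in> ?J" for r
      using has_vector_derivative_continuous[OF has_vector_derivative_within_subset[OF covD[OF par _ c(1)] J(1)]] J that by blast
    then show ?thesis by (simp add: continuous_on_eq_continuous_within)
  qed
  have xc: "continuous_on ?J ?x" and Lc: "continuous_on ?J (\<lambda>r. L (\<gamma> r) c)" using L_cont[OF c(1) J(1,2)] by auto
  have Gc: "continuous_on ?J (\<lambda>r. G c (?x r))" by (rule continuous_on_compose2[OF C1_on_continuous[OF G_C1] xc J(4)])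
  let ?n = "\<lambda>r. fd F (?x r) (E k r c) + Gam (G c) (?x r) (E k r c) (L (\<gamma> r) c)"
  have "continuous_on ?J ?n"
    by (intro continuous_on_add C1_on_continuous_compose[OF ext_F[OF ex] xc J(3) Ec] Gam_continuous xc J(4) Ec Lc)
  then have "continuous_on ?J (\<lambda>r. ip (G c (?x r)) (?n r) (E (\<tau> l) r c))"
    by (intro continuous_on_inner bounded_bilinear.continuous_on[OF bounded_bilinear_matrix_vector Gc] Ec)
  moreover have "ip (G c (?x r)) (?n r) (E (\<tau> l) r c) = wein k l r" if r: "r \<in> ?J" for r
  proof -
    have rI: "r \<in> I" "\<gamma> r \<in> fst c" "?x r \<in> N" using r d(2) by auto
    show ?thesis
      unfolding wein_def g_chart[OF nab_E_TS[OF rI(1) k] E_TS[OF rI(1)] c(1) rI(2)]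
        nabla_c[OF ex in_H[OF rI(1)] rI(2,3) E_TH[OF rI(1) k]] ..
  qed
  ultimately have "continuous_on ?J (wein k l)" by (rule continuous_on_eq)
  then have "continuous (at t within ?J) (wein k l)" using t d(1) by (simp add: continuous_on_eq_continuous_within)
  then show "continuous (at t within I) (wein k l)" using within_ball[of t t d] t d(1) by simp
qed

text \<open>The equation J' = \<nabla>_J L for the coefficients of J in the parallel frame. The
  matrix is padded with zeros at i1, the index transverse to H, to be square over the full index
  type.\<close>

lemma jacobi_coefficients:
  assumes t0: "t0 \<in> I"
  shows "\<exists>a :: real \<Rightarrow> real^'n. a t0 = w \<and> (\<forall>t\<in>I. \<forall>j. j \<noteq> i1 \<longrightarrow>
    ((\<lambda>s. a s $ j) has_real_derivative (\<Sum>k\<in>-{i1}. a t $ k * wein k j t)) (at t within I))"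
proof -
  define Bm where "Bm t = (\<chi> j k. if j \<noteq> i1 \<and> k \<noteq> i1 then wein k j t else 0)" for t
  have Bc: "continuous_on I Bm"
  proof -
    have "continuous_on I (\<lambda>t. if j \<noteq> i1 \<and> k \<noteq> i1 then wein k j t else 0)" for j k
      using wein_cont[of k j] by (cases "j \<noteq> i1 \<and> k \<noteq> i1") auto
    then show ?thesis unfolding Bm_def by (intro continuous_on_vec_lambda)
  qed
  obtain a where a: "a t0 = w" "\<And>t. t \<in> I \<Longrightarrow> (a has_vector_derivative Bm t *v a t) (at t within I)"
    using linear_ode_exists[OF bounded_bilinear_matrix_vector Bc I t0, of w] by metis
  have Ba: "(Bm t *v a t) $ j = (if j \<noteq> i1 then \<Sum>k\<in>-{i1}. a t $ k * wein k j t else 0)" for t j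
  proof -
    have "(Bm t *v a t) $ j = (\<Sum>k\<in>UNIV. if k \<in> -{i1} then (if j \<noteq> i1 then a t $ k * wein k j t else 0) else 0)"
      unfolding matrix_vector_mult_def vec_lambda_beta Bm_def by (intro sum.cong refl) auto
    also have "\<dots> = (\<Sum>k\<in>-{i1}. if j \<noteq> i1 then a t $ k * wein k j t else 0)"
      by (subst sum.inter_filter[symmetric]) (auto simp: Collect_neg_eq[symmetric] intro!: sum.cong)
    finally show ?thesis by auto
  qed
  have da: "((\<lambda>s. a s $ j) has_real_derivative (Bm t *v a t) $ j) (at t within I)" if "t \<in> I" for t j
    using bounded_linear.has_vector_derivative[OF bounded_linear_vec_nth a(2)[OF that]]
    by (simp only: has_real_derivative_iff_has_vector_derivative)
  have "((\<lambda>s. a s $ j) has_real_derivative (\<Sum>k\<in>-{i1}. a t $ k * wein k j t)) (at t within I)"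
    if "t \<in> I" "j \<noteq> i1" for t j
    using da[OF that(1), of j] that(2) by (simp add: Ba)
  then show ?thesis using a(1) by (intro exI[of _ a]) blast
qed

lemma jacobi_field_of_coefficients:
  fixes a :: "real \<Rightarrow> real^'n"
  assumes a: "\<And>t j. t \<in> I \<Longrightarrow> j \<noteq> i1 \<Longrightarrow> ((\<lambda>s. a s $ j) has_real_derivative (\<Sum>k\<in>-{i1}. a t $ k * wein k j t)) (at t within I)"
  defines "J \<equiv> \<lambda>t c. \<Sum>k\<in>-{i1}. a t $ k *\<^sub>R E k t c"
  assumes t: "t \<in> I"
  shows "J t \<in> TH (\<gamma> t)" "cov J (nab t (J t)) t"
    "nab t (J t) = (\<lambda>c. \<Sum>l\<in>-{i1}. (\<Sum>k\<in>-{i1}. a t $ k * wein k l t) *\<^sub>R E l t c)"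
    "cov (\<lambda>s. nab s (J s)) (tscale (-1) (curvature A g (\<gamma> t) (L (\<gamma> t)) (J t) (L (\<gamma> t)))) t"
proof -
  have TH: "J t \<in> TH (\<gamma> t)" if "t \<in> I" for t
    unfolding J_def by (rule nabla_lin(2)[OF in_H[OF that]]) (use E_TH[OF that] in auto)
  have nJ: "nab t (J t) = (\<lambda>c. \<Sum>l\<in>-{i1}. (\<Sum>k\<in>-{i1}. a t $ k * wein k l t) *\<^sub>R E l t c)" if t: "t \<in> I" for t
  proof -
    have "nab t (J t) = (\<lambda>c. \<Sum>k\<in>-{i1}. a t $ k *\<^sub>R nab t (E k t) c)"
      unfolding J_def by (rule nabla_lin(1)[OF in_H[OF t]]) (use E_TH[OF t] in auto)
    also have "\<dots> = (\<lambda>c. \<Sum>k\<in>-{i1}. \<Sum>l\<in>-{i1}. (a t $ k * wein k l t) *\<^sub>R E l t c)"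
      by (intro ext sum.cong refl) (use nab_E[OF t] in \<open>simp add: scaleR_sum_right\<close>)
    also have "\<dots> = (\<lambda>c. \<Sum>l\<in>-{i1}. \<Sum>k\<in>-{i1}. (a t $ k * wein k l t) *\<^sub>R E l t c)"
      by (intro ext sum.swap)
    finally show ?thesis by (simp add: scaleR_sum_left)
  qed
  have cJ: "cov J (nab t (J t)) t" if t: "t \<in> I" for t
  proof -
    have "cov J (\<lambda>c. (\<Sum>l\<in>-{i1}. (\<Sum>k\<in>-{i1}. a t $ k * wein k l t) *\<^sub>R E l t c) + (\<Sum>l\<in>-{i1}. a t $ l *\<^sub>R tzero c)) t"
      unfolding J_def by (rule cov_sum[OF par[OF t] t]) (use a[OF t] in auto)
    then show ?thesis unfolding nJ[OF t] by (simp add: tzero_def)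
  qed
  show "J t \<in> TH (\<gamma> t)" "cov J (nab t (J t)) t"
    "nab t (J t) = (\<lambda>c. \<Sum>l\<in>-{i1}. (\<Sum>k\<in>-{i1}. a t $ k * wein k l t) *\<^sub>R E l t c)"
    using TH[OF t] cJ[OF t] nJ[OF t] by auto
  show "cov (\<lambda>s. nab s (J s)) (tscale (-1) (curvature A g (\<gamma> t) (L (\<gamma> t)) (J t) (L (\<gamma> t)))) t"
    by (rule jacobi_of_weingarten[OF TH cJ t])
qed

text \<open>The second covariant derivative of a Jacobi field at a time when it equals E k.\<close>

definition tidal :: "'n \<Rightarrow> real \<Rightarrow> ('m, 'n) tvec" where
  "tidal k t = tscale (-1) (curvature A g (\<gamma> t) (L (\<gamma> t)) (E k t) (L (\<gamma> t)))"

text \<open>Let J be the Jacobi field with coefficients a that equals E k at t0. Then g(\<nabla>_J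
  L, E l), the sum of all a_j \<open>wein j l\<close>, is differentiable by the Jacobi equation. It
  differs from \<open>wein k l\<close> by the sum of (a_j - \<delta>_kj) \<open>wein j l\<close>,
  whose first factors vanish at t0, so that continuity of \<open>wein\<close> suffices to
  differentiate it there.\<close>

lemma wein_riccati:
  assumes t0: "t0 \<in> I" and k: "k \<in> -{i0, i1}" and l: "l \<in> -{i0, i1}"
  shows "(wein k l has_real_derivative g (\<gamma> t0) (tidal k t0) (E l t0) - (\<Sum>j\<in>-{i1}. wein k j t0 * wein j l t0)) (at t0 within I)"
    and "tidal k t0 \<in> TS (\<gamma> t0)"
proof -
  have k1: "k \<noteq> i1" "k \<in> -{i1}" and l1: "l \<noteq> i1" "l \<in> -{i1}" "\<tau> l = l"
    using k l by (auto simp: Transposition.transpose_def)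
  obtain a :: "real \<Rightarrow> real^'n" where a: "a t0 = axis k 1"
    "\<And>t j. t \<in> I \<Longrightarrow> j \<noteq> i1 \<Longrightarrow> ((\<lambda>s. a s $ j) has_real_derivative (\<Sum>k\<in>-{i1}. a t $ k * wein k j t)) (at t within I)"
    using jacobi_coefficients[OF t0, of "axis k 1"] by (elim exE conjE) blast
  define J where "J = (\<lambda>t c. \<Sum>k\<in>-{i1}. a t $ k *\<^sub>R E k t c)"
  have jf: "J t \<in> TH (\<gamma> t)" "cov J (nab t (J t)) t"
    "nab t (J t) = (\<lambda>c. \<Sum>l\<in>-{i1}. (\<Sum>k\<in>-{i1}. a t $ k * wein k l t) *\<^sub>R E l t c)"
    "cov (\<lambda>s. nab s (J s)) (tscale (-1) (curvature A g (\<gamma> t) (L (\<gamma> t)) (J t) (L (\<gamma> t)))) t"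
    if t: "t \<in> I" for t
    unfolding J_def
    by (rule jacobi_field_of_coefficients[OF _ t], rule a(2), assumption+)+
  have sel: "(\<Sum>j\<in>-{i1}. axis k 1 $ j * x j) = x k" for x :: "'n \<Rightarrow> real"
  proof -
    have "(\<Sum>j\<in>-{i1}. axis k 1 $ j * x j) = (\<Sum>j\<in>-{i1}. if j = k then x j else 0)"
      by (intro sum.cong refl) (auto simp: axis_def)
    then show ?thesis using k1 by simp
  qed
  have Jt0: "J t0 = E k t0"
  proof
    fix c
    have "(\<Sum>j\<in>-{i1}. axis k 1 $ j *\<^sub>R E j t0 c) = (\<Sum>j\<in>-{i1}. if j = k then E j t0 c else 0)"
      by (intro sum.cong refl) (auto simp: axis_def)
    then show "J t0 c = E k t0 c" using k1 by (simp add: J_def a(1))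
  qed
  have tid: "tscale (-1) (curvature A g (\<gamma> t0) (L (\<gamma> t0)) (J t0) (L (\<gamma> t0))) = tidal k t0"
    by (simp add: tidal_def Jt0)
  show "tidal k t0 \<in> TS (\<gamma> t0)" using cov_TS(2)[OF jf(4)[OF t0]] tid by simp
  have gJ: "g (\<gamma> t) (nab t (J t)) (E l t) = (\<Sum>j\<in>-{i1}. a t $ j * wein j l t)" if t: "t \<in> I" for t
  proof -
    have "g (\<gamma> t) (nab t (J t)) (E l t) = (\<Sum>m\<in>-{i1}. (\<Sum>j\<in>-{i1}. a t $ j * wein j m t) * g (\<gamma> t) (E m t) (E l t))"
      unfolding jf(3)[OF t] by (rule g_sum(1)[OF E_TS[OF t] E_TS[OF t]])
    also have "\<dots> = (\<Sum>m\<in>-{i1}. if m = l then (\<Sum>j\<in>-{i1}. a t $ j * wein j m t) else 0)"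
      by (intro sum.cong refl) (use l1 in \<open>auto simp: g_E[OF t] Transposition.transpose_def split: if_splits\<close>)
    also have "\<dots> = (\<Sum>j\<in>-{i1}. a t $ j * wein j l t)" using l1 by simp
    finally show ?thesis .
  qed
  have "((\<lambda>t. g (\<gamma> t) (nab t (J t)) (E l t)) has_real_derivative g (\<gamma> t0) (tidal k t0) (E l t0)) (at t0 within I)"
    using metric_deriv[OF jf(4)[OF t0] par[OF t0, of l] t0] g_zero(2)[OF cov_TS(1)[OF jf(4)[OF t0] t0]] tid by simp
  then have 1: "((\<lambda>t. \<Sum>j\<in>-{i1}. a t $ j * wein j l t) has_real_derivative g (\<gamma> t0) (tidal k t0) (E l t0)) (at t0 within I)"
    unfolding has_real_derivative_iff_has_vector_derivative
    by (rule has_vector_derivative_transform[OF t0 gJ[symmetric], rotated])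
  have 2: "((\<lambda>t. \<Sum>j\<in>-{i1}. (a t $ j - axis k 1 $ j) * wein j l t) has_real_derivative (\<Sum>j\<in>-{i1}. wein k j t0 * wein j l t0)) (at t0 within I)"
  proof (rule DERIV_sum)
    fix j assume j: "j \<in> -{i1}"
    have "((\<lambda>t. a t $ j - axis k 1 $ j) has_real_derivative wein k j t0 - 0) (at t0 within I)"
      using a(2)[OF t0, of j] j by (intro DERIV_diff DERIV_const) (simp add: a(1) sel)
    moreover have "continuous (at t0 within I) (wein j l)"
      using wein_cont[of j l] j t0 by (simp add: continuous_on_eq_continuous_within)
    ultimately show "((\<lambda>t. (a t $ j - axis k 1 $ j) * wein j l t) has_real_derivative wein k j t0 * wein j l t0) (at t0 within I)"
      using has_real_derivative_mult_zero[of "\<lambda>t. a t $ j - axis k 1 $ j" "wein k j t0" t0 I "wein j l"] a(1) by simp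
  qed
  have "wein k l = (\<lambda>t. (\<Sum>j\<in>-{i1}. a t $ j * wein j l t) - (\<Sum>j\<in>-{i1}. (a t $ j - axis k 1 $ j) * wein j l t))"
    by (simp add: fun_eq_iff left_diff_distrib sum_subtractf sel)
  then show "(wein k l has_real_derivative g (\<gamma> t0) (tidal k t0) (E l t0) - (\<Sum>j\<in>-{i1}. wein k j t0 * wein j l t0)) (at t0 within I)"
    using DERIV_diff[OF 1 2] by simp
qed

text \<open>Two terms of the trace in the null frame drop out: R(L, L)L = 0 for E i0, and for E i1
  the vector R(L, E i1)L is paired with L, which gives zero by \<open>curv_ip_zero\<close>.\<close>

lemma ricci_tidal:
  assumes t: "t \<in> I"
  shows "ricci A g (\<gamma> t) (L (\<gamma> t)) (L (\<gamma> t)) = - (\<Sum>k\<in>-{i0, i1}. g (\<gamma> t) (tidal k t) (E k t))"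
proof -
  let ?c = "SOME c. c \<in> A \<and> \<gamma> t \<in> fst c"
  have "\<exists>c. c \<in> A \<and> \<gamma> t \<in> fst c" using chart_ex[of "\<gamma> t"] by blast
  then have c: "?c \<in> A" "\<gamma> t \<in> fst ?c" using someI_ex[of "\<lambda>c. c \<in> A \<and> \<gamma> t \<in> fst c"] by auto
  define c where "c = ?c"
  note c = c[folded c_def]
  interpret metric_chart "dom c" "G c" by (rule metric_chart[OF c(1)])
  let ?x = "snd c (\<gamma> t)" and ?L = "L (\<gamma> t) c"
  have xd: "?x \<in> dom c" using c by auto
  have i01: "i0 \<noteq> i1" using frame[OF t] by (simp add: null_frame_def)
  define S where "S v = curv (G c) ?x ?L v ?L" for v
  have linS: "linear S" unfolding S_def by (rule curv_linear[OF xd])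
  have "ricci A g (\<gamma> t) (L (\<gamma> t)) (L (\<gamma> t)) = (\<Sum>a\<in>UNIV. S (axis a 1) $ a)"
    unfolding ricci_def Let_def c_def[symmetric] S_def
    by (simp add: curvature_curv[OF c] coord_vec_tv tv_self[OF c])
  also have "\<dots> = (\<Sum>i\<in>UNIV. ip (G c ?x) (E (\<tau> i) t c) (S (E i t c)))"
    by (rule null_frame_trace[OF frame[OF t] c linS])
  also have "\<dots> = (\<Sum>i\<in>-{i0, i1}. ip (G c ?x) (E (\<tau> i) t c) (S (E i t c)))"
  proof (rule sum.mono_neutral_right)
    show "\<forall>i\<in>UNIV - - {i0, i1}. ip (G c ?x) (E (\<tau> i) t c) (S (E i t c)) = 0"
    proof
      fix i assume "i \<in> UNIV - - {i0, i1}"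
      then consider "i = i0" | "i = i1" by auto
      then show "ip (G c ?x) (E (\<tau> i) t c) (S (E i t c)) = 0"
      proof cases
        case 1
        then have "S (E i t c) = 0" by (simp add: S_def E0[OF t] curv_def)
        then show ?thesis by simp
      next
        case 2
        then have "\<tau> i = i0" by simp
        then show ?thesis
          using curv_ip_zero[OF xd, of ?L "E i t c" ?L] ip_sym[OF xd, of ?L "S (E i t c)"] by (simp add: S_def E0[OF t])
      qed
    qed
  qed auto
  also have "\<dots> = (\<Sum>i\<in>-{i0, i1}. - g (\<gamma> t) (tidal i t) (E i t))"
  proof (rule sum.cong[OF refl])
    fix i assume i: "i \<in> -{i0, i1}"
    have "g (\<gamma> t) (tidal i t) (E i t) = ip (G c ?x) (tidal i t c) (E i t c)"
      by (rule g_chart[OF wein_riccati(2)[OF t i i] E_TS[OF t] c])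
    also have "tidal i t c = - S (E i t c)"
      unfolding tidal_def S_def by (simp add: tscale_def curvature_curv[OF c])
    finally have "g (\<gamma> t) (tidal i t) (E i t) = - ip (G c ?x) (S (E i t c)) (E i t c)" by (simp add: ip_bilinear)
    moreover have "\<tau> i = i" using i by (auto simp: Transposition.transpose_def)
    ultimately show "ip (G c ?x) (E (\<tau> i) t c) (S (E i t c)) = - g (\<gamma> t) (tidal i t) (E i t)"
      using ip_sym[OF xd, of "E i t c"] by simp
  qed
  finally show ?thesis by (simp add: sum_negf)
qed

text \<open>Cauchy-Schwarz for the n - 2 diagonal entries. The off-diagonal products may be dropped:
  they are squares by symmetry, or zero for j = i0.\<close>

lemma expansion_riccati:
  assumes t: "t \<in> I" and n: "CARD('n) \<ge> 3"
  defines "\<theta> \<equiv> \<lambda>t. \<Sum>k\<in>-{i0, i1}. wein k k t"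
  obtains \<theta>' where "(\<theta> has_real_derivative \<theta>') (at t within I)"
    "\<theta>' + (\<theta> t)\<^sup>2 / (real CARD('n) - 2) \<le> - ricci A g (\<gamma> t) (L (\<gamma> t)) (L (\<gamma> t))"
proof -
  let ?S = "-{i0, i1}"
  have i01: "i0 \<noteq> i1" using frame[OF t] by (simp add: null_frame_def)
  define \<theta>' where "\<theta>' = (\<Sum>k\<in>?S. g (\<gamma> t) (tidal k t) (E k t) - (\<Sum>j\<in>-{i1}. wein k j t * wein j k t))"
  have "(\<theta> has_real_derivative \<theta>') (at t within I)"
    unfolding \<theta>_def \<theta>'_def by (intro DERIV_sum wein_riccati(1)[OF t])
  moreover have "\<theta>' + (\<theta> t)\<^sup>2 / (real CARD('n) - 2) \<le> - ricci A g (\<gamma> t) (L (\<gamma> t)) (L (\<gamma> t))"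
  proof -
    have card: "real (card ?S) = real CARD('n) - 2"
    proof -
      have "card ?S = CARD('n) - card {i0, i1}" unfolding Compl_eq_Diff_UNIV by (rule card_Diff_subset) auto
      then show ?thesis using i01 n by simp
    qed
    have "(\<theta> t)\<^sup>2 \<le> (\<Sum>k\<in>?S. (wein k k t)\<^sup>2) * card ?S"
      unfolding \<theta>_def by (rule sum_squared_le_sum_of_squares) 
    also have "\<dots> \<le> (\<Sum>k\<in>?S. \<Sum>j\<in>-{i1}. wein k j t * wein j k t) * card ?S"
    proof (intro mult_right_mono sum_mono)
      fix k assume k: "k \<in> ?S"
      have nonneg: "0 \<le> wein k j t * wein j k t" if "j \<in> -{i1}" for j
        using wein_i0[OF t, of k] wein_sym[OF t k, of j] that by (cases "j = i0") auto
      have "(wein k k t)\<^sup>2 = (\<Sum>j\<in>{k}. wein k j t * wein j k t)" by (simp add: power2_eq_square)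
      also have "\<dots> \<le> (\<Sum>j\<in>-{i1}. wein k j t * wein j k t)"
        by (rule sum_mono2) (use nonneg k in auto)
      finally show "(wein k k t)\<^sup>2 \<le> (\<Sum>j\<in>-{i1}. wein k j t * wein j k t)" .
    qed simp
    finally have "(\<theta> t)\<^sup>2 / (real CARD('n) - 2) \<le> (\<Sum>k\<in>?S. \<Sum>j\<in>-{i1}. wein k j t * wein j k t)"
      using n unfolding card by (subst pos_divide_le_eq) auto
    then show ?thesis unfolding ricci_tidal[OF t] \<theta>'_def by (simp add: sum_subtractf)
  qed
  ultimately show ?thesis using that by blast
qed

end

section \<open>Well-definedness and evolution of the determinant\<close>

context null_curve begin

text \<open>The body of the description in \<open>det_J\<close>, for a general
  \<open>null_curve\<close>.\<close>

definition det_rel :: "real \<Rightarrow> real \<Rightarrow> bool" where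
  "det_rel t d \<longleftrightarrow> (\<exists>e E J J' a. basis_of (CARD('n) - 1) e (TH (\<gamma> 0)) \<and>
       (\<forall>i<CARD('n) - 1. (\<forall>t\<in>I. cov (E i) tzero t) \<and> E i 0 = e i) \<and>
       (\<forall>i<CARD('n) - 1. (\<forall>t\<in>I. cov (J i) (J' i t) t \<and>
           cov (J' i) (tscale (-1) (curvature A g (\<gamma> t) (L (\<gamma> t)) (J i t) (L (\<gamma> t)))) t) \<and>
          J i 0 = e i \<and> J' i 0 = nabla A g H L (\<gamma> 0) (e i)) \<and>
       (\<forall>i<CARD('n) - 1. J i t = lincomb (CARD('n) - 1) (a i) (\<lambda>j. E j t)) \<and>
       d = Determinant.det (Matrix.mat (CARD('n) - 1) (CARD('n) - 1) (\<lambda>(i, j). a i j)))"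

lemma cov_const_sum:
  assumes X: "\<And>i. i \<in> S \<Longrightarrow> cov (X i) (DX i) t" and t: "t \<in> I"
  shows "cov (\<lambda>s c. \<Sum>i\<in>S. p i *\<^sub>R X i s c) (\<lambda>c. \<Sum>i\<in>S. p i *\<^sub>R DX i c) t"
  using cov_sum[where S = S and X = X and DX = DX and t = t and a = "\<lambda>i s. p i" and a' = "\<lambda>i. 0", OF X t] by simp

lemma curvature_sum:
  assumes p: "p \<in> H"
  shows "tscale (-1) (curvature A g p X (\<lambda>c. \<Sum>i\<in>S. a i *\<^sub>R Y i c) X) = (\<lambda>c. \<Sum>i\<in>S. a i *\<^sub>R tscale (-1) (curvature A g p X (Y i) X) c)"
proof
  fix c
  show "tscale (-1) (curvature A g p X (\<lambda>c. \<Sum>i\<in>S. a i *\<^sub>R Y i c) X) c = (\<Sum>i\<in>S. a i *\<^sub>R tscale (-1) (curvature A g p X (Y i) X) c)"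
  proof (cases "c \<in> A \<and> p \<in> fst c")
    case True
    interpret metric_chart "dom c" "G c" by (rule metric_chart) (use True in blast)
    have l: "linear (\<lambda>Y. curv (G c) (snd c p) (X c) Y (X c))" by (rule curv_linear) (use True in auto)
    show ?thesis
      using True by (simp add: tscale_def curvature_curv linear_sum[OF l] linear_cmul[OF l] sum_negf)
  next
    case False
    then show ?thesis by (auto simp: tscale_def curvature_def)
  qed
qed

text \<open>Independence travels along the curve: a parallel combination that is zero at t is zero
  at 0.\<close>

lemma parallel_coefficients_unique:
  assumes 0: "0 \<in> I" and t: "t \<in> I" and e: "basis_of m e S"
    and E: "\<And>i t. i < m \<Longrightarrow> t \<in> I \<Longrightarrow> cov (E i) tzero t" "\<And>i. i < m \<Longrightarrow> E i 0 = e i"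
    and xy: "lincomb m x (\<lambda>j. E j t) = lincomb m y (\<lambda>j. E j t)" and i: "i < m"
  shows "x i = y i"
proof -
  define V where "V = (\<lambda>s c. \<Sum>i\<in>{..<m}. (x i - y i) *\<^sub>R E i s c)"
  have V: "cov V tzero s" if "s \<in> I" for s
    using cov_const_sum[of "{..<m}" E "\<lambda>_. tzero" s "\<lambda>i. x i - y i"] E(1) that by (simp add: V_def tzero_def)
  have Z: "cov (\<lambda>s. tzero) tzero s" if "s \<in> I" for s
    using cov_const_sum[of "{}" E "\<lambda>_. tzero" s "\<lambda>i. 0"] that by (simp add: tzero_def)
  have "V t = tzero"
    using xy by (simp add: V_def lincomb_def tzero_def fun_eq_iff scaleR_diff_left sum_subtractf)
  then have "V 0 = tzero" using parallel_unique[where V = V and V' = "\<lambda>s. tzero", OF V Z t _ 0] by simp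
  then have "lincomb m (\<lambda>i. x i - y i) e = tzero" using E(2) by (simp add: V_def lincomb_def)
  then have "\<forall>i<m. x i - y i = 0" using e unfolding basis_of_def by metis
  then show ?thesis using i by simp
qed

text \<open>The two bases are related by constant matrices P and Q with Q P = 1. By uniqueness P
  also relates the parallel fields and the Jacobi fields at all times, so a2 P = P a, and the
  determinants agree as det P is nonzero.\<close>

lemma det_rel_unique:
  assumes 0: "0 \<in> I" and t: "t \<in> I" and d: "det_rel t d" "det_rel t d'"
  shows "d = d'"
proof -
  define m where "m = CARD('n) - 1"
  obtain e E J J' a where 1: "basis_of m e (TH (\<gamma> 0))" "\<And>i t. i < m \<Longrightarrow> t \<in> I \<Longrightarrow> cov (E i) tzero t"
    "\<And>i. i < m \<Longrightarrow> E i 0 = e i" "\<And>i t. i < m \<Longrightarrow> t \<in> I \<Longrightarrow> cov (J i) (J' i t) t"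
    "\<And>i t. i < m \<Longrightarrow> t \<in> I \<Longrightarrow> cov (J' i) (tscale (-1) (curvature A g (\<gamma> t) (L (\<gamma> t)) (J i t) (L (\<gamma> t)))) t"
    "\<And>i. i < m \<Longrightarrow> J i 0 = e i" "\<And>i. i < m \<Longrightarrow> J' i 0 = nabla A g H L (\<gamma> 0) (e i)"
    "\<And>i. i < m \<Longrightarrow> J i t = lincomb m (a i) (\<lambda>j. E j t)"
    "d = Determinant.det (Matrix.mat m m (\<lambda>(i, j). a i j))"
    using d(1) unfolding det_rel_def m_def[symmetric] by (elim exE conjE) blast
  obtain e2 E2 J2 J2' a2 where 2: "basis_of m e2 (TH (\<gamma> 0))" "\<And>i t. i < m \<Longrightarrow> t \<in> I \<Longrightarrow> cov (E2 i) tzero t"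
    "\<And>i. i < m \<Longrightarrow> E2 i 0 = e2 i" "\<And>i t. i < m \<Longrightarrow> t \<in> I \<Longrightarrow> cov (J2 i) (J2' i t) t"
    "\<And>i t. i < m \<Longrightarrow> t \<in> I \<Longrightarrow> cov (J2' i) (tscale (-1) (curvature A g (\<gamma> t) (L (\<gamma> t)) (J2 i t) (L (\<gamma> t)))) t"
    "\<And>i. i < m \<Longrightarrow> J2 i 0 = e2 i" "\<And>i. i < m \<Longrightarrow> J2' i 0 = nabla A g H L (\<gamma> 0) (e2 i)"
    "\<And>i. i < m \<Longrightarrow> J2 i t = lincomb m (a2 i) (\<lambda>j. E2 j t)"
    "d' = Determinant.det (Matrix.mat m m (\<lambda>(i, j). a2 i j))"
    using d(2) unfolding det_rel_def m_def[symmetric] by (elim exE conjE) blast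
  have eTH: "e i \<in> TH (\<gamma> 0)" "e2 i \<in> TH (\<gamma> 0)" if "i < m" for i
    using 1(1) 2(1) that unfolding basis_of_def by blast+
  have "\<exists>p. e2 i = lincomb m p e" if "i < m" for i using 1(1) eTH(2)[OF that] unfolding basis_of_def by blast
  then obtain P where P: "\<And>i. i < m \<Longrightarrow> e2 i = lincomb m (P i) e" by metis
  have "\<exists>p. e i = lincomb m p e2" if "i < m" for i using 2(1) eTH(1)[OF that] unfolding basis_of_def by blast
  then obtain Q where Q: "\<And>i. i < m \<Longrightarrow> e i = lincomb m (Q i) e2" by metis
  have comp: "lincomb m x (\<lambda>j. lincomb m (R j) v) = lincomb m (\<lambda>l. \<Sum>j<m. x j * R j l) v"
    for x R and v :: "nat \<Rightarrow> ('m, 'n) tvec"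
  proof
    fix c
    have "(\<Sum>j<m. x j *\<^sub>R (\<Sum>l<m. R j l *\<^sub>R v l c)) = (\<Sum>j<m. \<Sum>l<m. (x j * R j l) *\<^sub>R v l c)"
      by (simp add: scaleR_sum_right)
    also have "\<dots> = (\<Sum>l<m. \<Sum>j<m. (x j * R j l) *\<^sub>R v l c)" by (rule sum.swap)
    finally show "lincomb m x (\<lambda>j. lincomb m (R j) v) c = lincomb m (\<lambda>l. \<Sum>j<m. x j * R j l) v c"
      by (simp add: lincomb_def scaleR_sum_left)
  qed
  have lc_cong: "lincomb m x v = lincomb m x w" if "\<And>j. j < m \<Longrightarrow> v j = w j" for x and v w :: "nat \<Rightarrow> ('m, 'n) tvec"
    using that by (simp add: lincomb_def)
  have QP: "(\<Sum>j<m. Q i j * P j l) = (if i = l then 1 else 0)" if i: "i < m" and l: "l < m" for i l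
  proof -
    have "e i = lincomb m (Q i) (\<lambda>j. lincomb m (P j) e)" using Q[OF i] lc_cong[of e2 "\<lambda>j. lincomb m (P j) e"] P by simp
    then have "e i = lincomb m (\<lambda>l. \<Sum>j<m. Q i j * P j l) e" unfolding comp .
    moreover have "e i = lincomb m (\<lambda>l. if i = l then 1 else 0) e"
    proof
      fix c
      have "(\<Sum>l<m. (if i = l then 1 else 0 :: real) *\<^sub>R e l c) = (\<Sum>l<m. if l = i then e l c else 0)"
        by (intro sum.cong refl) auto
      then show "e i c = lincomb m (\<lambda>l. if i = l then 1 else 0) e c" using i by (simp add: lincomb_def)
    qed
    ultimately have eq: "lincomb m (\<lambda>l. \<Sum>j<m. Q i j * P j l) e = lincomb m (\<lambda>l. if i = l then 1 else 0) e" by simp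
    have "lincomb m (\<lambda>l. (\<Sum>j<m. Q i j * P j l) - (if i = l then 1 else 0)) e = tzero"
    proof
      fix c
      show "lincomb m (\<lambda>l. (\<Sum>j<m. Q i j * P j l) - (if i = l then 1 else 0)) e c = tzero c"
        using fun_cong[OF eq, of c] unfolding lincomb_def tzero_def scaleR_diff_left sum_subtractf by simp
    qed
    from 1(1)[unfolded basis_of_def, THEN conjunct2, THEN conjunct1, rule_format, OF this l]
    show ?thesis by simp
  qed
  have E2: "E2 i s = lincomb m (P i) (\<lambda>j. E j s)" if i: "i < m" and s: "s \<in> I" for i s
  proof (rule parallel_unique[where V = "E2 i" and V' = "\<lambda>s. lincomb m (P i) (\<lambda>j. E j s)", OF 2(2)[OF i] _ 0 _ s])
    show "cov (\<lambda>s. lincomb m (P i) (\<lambda>j. E j s)) tzero s" if "s \<in> I" for s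
      using cov_const_sum[of "{..<m}" E "\<lambda>_. tzero" s "P i"] 1(2) that by (simp add: lincomb_def tzero_def)
    show "E2 i 0 = lincomb m (P i) (\<lambda>j. E j 0)"
      using P[OF i] 2(3)[OF i] lc_cong[of "\<lambda>j. E j 0" e] 1(3) by simp
  qed
  have J2: "J2 i s = lincomb m (P i) (\<lambda>j. J j s)" if i: "i < m" and s: "s \<in> I" for i s
  proof -
    have "J2 i s = lincomb m (P i) (\<lambda>j. J j s) \<and> J2' i s = lincomb m (P i) (\<lambda>j. J' j s)"
    proof (rule jacobi_unique[where J = "J2 i" and J' = "J2' i" and K = "\<lambda>s. lincomb m (P i) (\<lambda>j. J j s)" and K' = "\<lambda>s. lincomb m (P i) (\<lambda>j. J' j s)",
          OF 2(4)[OF i] 2(5)[OF i] _ _ 0 _ _ s])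
      fix r assume r: "r \<in> I"
      show "cov (\<lambda>s. lincomb m (P i) (\<lambda>j. J j s)) (lincomb m (P i) (\<lambda>j. J' j r)) r"
        unfolding lincomb_def by (rule cov_const_sum[OF _ r]) (use 1(4) r in auto)
      show "cov (\<lambda>s. lincomb m (P i) (\<lambda>j. J' j s))
         (tscale (-1) (curvature A g (\<gamma> r) (L (\<gamma> r)) (lincomb m (P i) (\<lambda>j. J j r)) (L (\<gamma> r)))) r"
        unfolding lincomb_def curvature_sum[OF in_H[OF r]] by (rule cov_const_sum[OF _ r]) (use 1(5) r in auto)
    next
      show "J2 i 0 = lincomb m (P i) (\<lambda>j. J j 0)"
        using P[OF i] 2(6)[OF i] lc_cong[of "\<lambda>j. J j 0" e] 1(6) by simp
      have "J2' i 0 = nabla A g H L (\<gamma> 0) (lincomb m (P i) e)" using P[OF i] 2(7)[OF i] by simp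
      also have "\<dots> = lincomb m (P i) (\<lambda>j. nabla A g H L (\<gamma> 0) (e j))"
        unfolding lincomb_def by (rule nabla_lin(1)[OF in_H[OF 0]]) (use eTH in auto)
      also have "\<dots> = lincomb m (P i) (\<lambda>j. J' j 0)" by (rule lc_cong) (simp add: 1(7))
      finally show "J2' i 0 = lincomb m (P i) (\<lambda>j. J' j 0)" .
    qed
    then show ?thesis by blast
  qed
  have aP: "(\<Sum>j<m. a2 i j * P j l) = (\<Sum>j<m. P i j * a j l)" if i: "i < m" and l: "l < m" for i l
  proof (rule parallel_coefficients_unique[OF 0 t 1(1,2,3) _ l])
    have "J2 i t = lincomb m (a2 i) (\<lambda>j. lincomb m (P j) (\<lambda>l. E l t))"
      using 2(8)[OF i] lc_cong[of "\<lambda>j. E2 j t" "\<lambda>j. lincomb m (P j) (\<lambda>l. E l t)"] E2 t by simp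
    moreover have "J2 i t = lincomb m (P i) (\<lambda>j. lincomb m (a j) (\<lambda>l. E l t))"
      using J2[OF i t] lc_cong[of "\<lambda>j. J j t" "\<lambda>j. lincomb m (a j) (\<lambda>l. E l t)"] 1(8) by simp
    ultimately show "lincomb m (\<lambda>l. \<Sum>j<m. a2 i j * P j l) (\<lambda>j. E j t) = lincomb m (\<lambda>l. \<Sum>j<m. P i j * a j l) (\<lambda>j. E j t)"
      unfolding comp by simp
  qed
  let ?M = "\<lambda>N. Matrix.mat m m (\<lambda>(i, j). N i j)"
  have mult: "?M X * ?M Y = ?M (\<lambda>i l. \<Sum>j<m. X i j * Y j l)" for X Y :: "nat \<Rightarrow> nat \<Rightarrow> real"
    by (rule Matrix.eq_matI) (auto simp: Matrix.scalar_prod_def atLeast0LessThan)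
  have detm: "Determinant.det (?M X * ?M Y) = Determinant.det (?M X) * Determinant.det (?M Y)" for X Y :: "nat \<Rightarrow> nat \<Rightarrow> real"
    by (rule Determinant.det_mult[of _ m]) auto
  have "?M Q * ?M P = 1\<^sub>m m" unfolding mult by (rule Matrix.eq_matI) (auto simp: QP)
  then have PQ: "Determinant.det (?M Q) * Determinant.det (?M P) = 1" using detm[of Q P] by simp
  have "?M a2 * ?M P = ?M P * ?M a" unfolding mult by (rule Matrix.eq_matI) (auto simp: aP)
  then have "Determinant.det (?M a2) * Determinant.det (?M P) = Determinant.det (?M P) * Determinant.det (?M a)"
    using detm by metis
  then show ?thesis using PQ 1(9) 2(9) by auto
qed

text \<open>The part of a parallel null frame tangent to H serves as basis, and
  \<open>jacobi_coefficients\<close> supplies the matrix. Since D = 1 at 0 and D' = \<theta> D,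
  uniqueness for linear equations keeps D from vanishing, and connectedness keeps it
  positive.\<close>

lemma det_rel_riccati:
  assumes n: "CARD('n) \<ge> 3" and 0: "0 \<in> I"
  obtains D \<theta> where "\<And>t. t \<in> I \<Longrightarrow> det_rel t (D t)" "\<And>t. t \<in> I \<Longrightarrow> D t > 0"
    "\<And>t. t \<in> I \<Longrightarrow> (D has_real_derivative \<theta> t * D t) (at t within I)"
    "\<And>t. t \<in> I \<Longrightarrow> \<exists>\<theta>'. (\<theta> has_real_derivative \<theta>') (at t within I) \<and>
       \<theta>' + (\<theta> t)\<^sup>2 / (real CARD('n) - 2) \<le> - ricci A g (\<gamma> t) (L (\<gamma> t)) (L (\<gamma> t))"
proof -
  define m where "m = CARD('n) - 1"
  have n2: "CARD('n) \<ge> 2" using n by simp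
  obtain E i0 i1 where fr: "\<And>t. t \<in> I \<Longrightarrow> null_frame (\<gamma> t) i0 i1 (\<lambda>i. E i t)"
    "\<And>i t. t \<in> I \<Longrightarrow> cov (E i) tzero t" "\<And>t. t \<in> I \<Longrightarrow> E i0 t = L (\<gamma> t)"
    using parallel_null_frame[OF n2 0] by metis
  interpret null_frame_curve A g T H L I \<gamma> E i0 i1 by unfold_locales (rule fr, assumption)+
  have i01: "i0 \<noteq> i1" using fr(1)[OF 0] by (simp add: null_frame_def)
  have "card (- {i1}) = m" unfolding m_def Compl_eq_Diff_UNIV by (subst card_Diff_subset) auto
  \<comment> \<open>\<open>det_J\<close> numbers a basis by naturals below n - 1, whereas the frame
    is indexed by \<open>'n\<close>; h translates.\<close>
  then obtain h where h: "bij_betw h {..<m} (- {i1})"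
    using ex_bij_betw_nat_finite[of "- {i1}"] by (auto simp: atLeast0LessThan)
  have hm: "h i \<noteq> i1" if "i < m" for i using bij_betwE[OF h] that by auto
  have hinj: "h i = h j \<longleftrightarrow> i = j" if "i < m" "j < m" for i j
    using bij_betw_imp_inj_on[OF h] that by (auto simp: inj_on_def)
  have reidx: "(\<Sum>k\<in>-{i1}. f k) = (\<Sum>k<m. f (h k))" for f :: "'n \<Rightarrow> 'z::comm_monoid_add"
    by (rule sum.reindex_bij_betw[OF h, symmetric])
  define good where "good k a \<longleftrightarrow> a 0 = axis k 1 \<and> (\<forall>t\<in>I. \<forall>j. j \<noteq> i1 \<longrightarrow>
      ((\<lambda>s. a s $ j) has_real_derivative (\<Sum>k\<in>-{i1}. a t $ k * wein k j t)) (at t within I))"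
    for k and a :: "real \<Rightarrow> real^'n"
  have "\<exists>a. good k a" for k unfolding good_def by (rule jacobi_coefficients[OF 0])
  then obtain a where good: "\<And>k. good k (a k)" by metis
  have a0: "a k 0 = axis k 1" for k using good[of k] by (simp add: good_def)
  have a: "((\<lambda>s. a k s $ j) has_real_derivative (\<Sum>l\<in>-{i1}. a k t $ l * wein l j t)) (at t within I)"
    if "k \<noteq> i1" "t \<in> I" "j \<noteq> i1" for k t j
    using good[of k] that(2,3) unfolding good_def by blast
  define J where "J k = (\<lambda>t c. \<Sum>l\<in>-{i1}. a k t $ l *\<^sub>R E l t c)" for k
  have jf: "cov (J k) (nab t (J k t)) t"
    "cov (\<lambda>s. nab s (J k s)) (tscale (-1) (curvature A g (\<gamma> t) (L (\<gamma> t)) (J k t) (L (\<gamma> t)))) t"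
    if k: "k \<noteq> i1" and t: "t \<in> I" for k t
    unfolding J_def
    by (rule jacobi_field_of_coefficients[OF _ t], rule a[OF k], assumption+)+
  define M where "M i j t = a (h i) t $ h j" for i j t
  define D where "D t = Determinant.det (Matrix.mat m m (\<lambda>(i, j). M i j t))" for t
  define \<theta> where "\<theta> t = (\<Sum>k\<in>-{i0, i1}. wein k k t)" for t
  \<comment> \<open>The direction of L contributes \<open>wein i0 i0\<close> = 0 to the trace, which
    leaves n - 2 indices.\<close>
  have tr: "(\<Sum>k<m. wein (h k) (h k) t) = \<theta> t" if t: "t \<in> I" for t
  proof -
    have "- {i1} = insert i0 (- {i0, i1})" using i01 by auto
    then have "(\<Sum>k\<in>-{i1}. wein k k t) = \<theta> t" by (simp add: \<theta>_def wein_i0[OF t])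
    then show ?thesis by (simp add: reidx)
  qed
  have dD: "(D has_real_derivative \<theta> t * D t) (at t within I)" if t: "t \<in> I" for t
    unfolding D_def tr[OF t, symmetric]
  proof (rule det_has_real_derivative[where M = M and \<beta> = "\<lambda>k j. wein (h k) (h j) t"])
    fix i j assume ij: "i < m" "j < m"
    show "(M i j has_real_derivative (\<Sum>k<m. M i k t * wein (h k) (h j) t)) (at t within I)"
      using a[OF hm[OF ij(1)] t hm[OF ij(2)]] by (simp add: M_def[abs_def] reidx)
  qed
  have D0: "D 0 = 1"
  proof -
    have "Matrix.mat m m (\<lambda>(i, j). M i j 0) = 1\<^sub>m m"
      by (rule Matrix.eq_matI) (auto simp: M_def a0 axis_def hinj)
    then show ?thesis by (simp add: D_def)
  qed
  have \<theta>c: "continuous_on I \<theta>"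
    unfolding \<theta>_def by (intro continuous_on_sum wein_cont) auto
  have Dnz: "D t \<noteq> 0" if t: "t \<in> I" for t
  proof
    assume z: "D t = 0"
    have "D 0 = (\<lambda>_. 0) 0"
    proof (rule linear_ode_unique[OF bounded_bilinear_mult \<theta>c I _ _ t _ 0, where V = D and V' = "\<lambda>_. 0"])
      show "(D has_vector_derivative \<theta> s * D s) (at s within I)" if "s \<in> I" for s
        using dD[OF that] by (simp add: has_real_derivative_iff_has_vector_derivative)
    qed (use z in auto)
    then show False using D0 by simp
  qed
  have Dpos: "D t > 0" if t: "t \<in> I" for t
  proof (rule ccontr)
    assume "\<not> D t > 0"
    then have neg: "D t \<le> 0" by simp
    have "continuous_on I D"
      using dD DERIV_continuous by (metis continuous_on_eq_continuous_within)
    then have "connected (D ` I)" using I by (intro connected_continuous_image) (simp_all add: is_interval_connected_1)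
    then have "is_interval (D ` I)" by (simp add: is_interval_connected_1)
    then have "0 \<in> D ` I" using neg D0 t 0 mem_is_interval_1_I[of "D ` I" "D t" "D 0" 0] by auto
    then show False using Dnz by auto
  qed
  have rel: "det_rel t (D t)" if t: "t \<in> I" for t
    unfolding det_rel_def m_def[symmetric]
  proof (intro exI conjI allI impI ballI)
    have gh: "g (\<gamma> 0) (E (Transposition.transpose i0 i1 (h i)) 0) (E (h j) 0) = (if i = j then 1 else 0)"
      if "i < m" "j < m" for i j
      using g_E[OF 0, of "Transposition.transpose i0 i1 (h i)" "h j"] hinj[OF that] by auto
    show "basis_of m (\<lambda>i. E (h i) 0) (TH (\<gamma> 0))"
      unfolding basis_of_def
    proof (intro conjI allI impI ballI)
      show "E (h i) 0 \<in> TH (\<gamma> 0)" if "i < m" for i by (rule E_TH[OF 0 hm[OF that]])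
      fix x i assume x: "lincomb m x (\<lambda>i. E (h i) 0) = tzero" and i: "i < m"
      have ET: "E k 0 \<in> TS (\<gamma> 0)" for k by (rule E_TS[OF 0])
      let ?v = "E (Transposition.transpose i0 i1 (h i)) 0"
      have "0 = g (\<gamma> 0) ?v (lincomb m x (\<lambda>i. E (h i) 0))" using x g_zero(2)[OF ET] by simp
      also have "\<dots> = (\<Sum>j<m. x j * g (\<gamma> 0) ?v (E (h j) 0))"
        unfolding lincomb_def by (rule g_sum(2)[OF ET ET])
      also have "\<dots> = (\<Sum>j<m. if j = i then x j else 0)"
        by (intro sum.cong refl) (auto simp: gh[OF i])
      finally show "x i = 0" using i by simp
    next
      fix v assume v: "v \<in> TH (\<gamma> 0)"
      have "v = (\<lambda>c. \<Sum>i\<in>-{i1}. g (\<gamma> 0) (E (Transposition.transpose i0 i1 i) 0) v *\<^sub>R E i 0 c)"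
        by (rule null_frame_TH(3)[OF fr(1)[OF 0] fr(3)[OF 0] in_H[OF 0] v])
      then show "\<exists>a. v = lincomb m a (\<lambda>i. E (h i) 0)"
        unfolding reidx lincomb_def by (intro exI[of _ "\<lambda>i. g (\<gamma> 0) (E (Transposition.transpose i0 i1 (h i)) 0) v"])
    qed
    fix i assume i: "i < m"
    show "cov (E (h i)) tzero s" if "s \<in> I" for s by (rule fr(2)[OF that])
    show "E (h i) 0 = E (h i) 0" ..
    show "cov (J (h i)) (nab s (J (h i) s)) s" if "s \<in> I" for s by (rule jf(1)[OF hm[OF i] that])
    show "cov (\<lambda>s. nab s (J (h i) s)) (tscale (-1) (curvature A g (\<gamma> s) (L (\<gamma> s)) (J (h i) s) (L (\<gamma> s)))) s" if "s \<in> I" for s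
      by (rule jf(2)[OF hm[OF i] that])
    show J0: "J (h i) 0 = E (h i) 0"
    proof
      fix c
      have "(\<Sum>l\<in>-{i1}. axis (h i) 1 $ l *\<^sub>R E l 0 c) = (\<Sum>l\<in>-{i1}. if l = h i then E l 0 c else 0)"
        by (intro sum.cong refl) (auto simp: axis_def)
      then show "J (h i) 0 c = E (h i) 0 c" using hm[OF i] by (simp add: J_def a0)
    qed
    show "nab 0 (J (h i) 0) = nabla A g H L (\<gamma> 0) (E (h i) 0)" unfolding J0 ..
    show "J (h i) t = lincomb m (\<lambda>j. M i j t) (\<lambda>j. E (h j) t)"
      unfolding J_def lincomb_def M_def reidx ..
  next
    show "D t = Determinant.det (Matrix.mat m m (\<lambda>(i, j). M i j t))" by (simp add: D_def)
  qed
  have "\<exists>\<theta>'. (\<theta> has_real_derivative \<theta>') (at t within I) \<and>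
       \<theta>' + (\<theta> t)\<^sup>2 / (real CARD('n) - 2) \<le> - ricci A g (\<gamma> t) (L (\<gamma> t)) (L (\<gamma> t))" if t: "t \<in> I" for t
    using expansion_riccati[OF t n] unfolding \<theta>_def by blast
  then show ?thesis using that rel Dpos dD by blast
qed

end

theorem proposition4p3:
  fixes A :: "('m::{t2_space, second_countable_topology}, 'n::finite) chart set"
    and g :: "('m, 'n) metric"
    and T L :: "'m \<Rightarrow> ('m, 'n) tvec"
    and H :: "'m set" and z :: 'm
  assumes "CARD('n) \<ge> 3"
    and "lorentzian_manifold A g T"
    and "null_hypersurface A g H"
    and "null_geodesic_field A g H T L"
    and "z \<in> H"
  shows "\<exists>W' W'' :: real \<Rightarrow> real. \<forall>t\<in>Psi_interval A g H L z.
      (W A g H L z has_real_derivative W' t) (at t within Psi_interval A g H L z) \<and>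
      (W' has_real_derivative W'' t) (at t within Psi_interval A g H L z) \<and>
      W'' t + (W' t)\<^sup>2 / (real CARD('n) - 2)
        \<le> - ricci A g (Psi A g L z t) (L (Psi A g L z t)) (L (Psi A g L z t))"
proof -
  let ?I = "Psi_interval A g H L z" and ?\<gamma> = "Psi A g L z"
  let ?Ric = "\<lambda>t. ricci A g (?\<gamma> t) (L (?\<gamma> t)) (L (?\<gamma> t))"
  interpret null_hyp A g T H L by unfold_locales (fact assms)+
  show ?thesis
  proof (cases "\<exists>t1\<in>?I. t1 \<noteq> 0")
    \<comment> \<open>The interval contains at most the point 0. Any number is then a derivative
      within it, so W' = 0 and W'' = - Ric satisfy the claim with equality.\<close>
    case False
    have z: "s = 0" if "s \<in> ?I" for s using False that by blast
    have triv: "at t within ?I = bot" if "t \<in> ?I" for t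
    proof -
      have "x = t" if "x \<in> ?I" for x using z[OF that] z[OF \<open>t \<in> ?I\<close>] by simp
      then have e: "?I - {t} = {}" by auto
      show ?thesis unfolding at_within_def e by simp
    qed
    show ?thesis
      by (intro exI[of _ "\<lambda>t. 0"] exI[of _ "\<lambda>t. - ?Ric t"]) (simp add: triv has_field_derivative_iff)
  next
    case True
    then obtain t1 where t1: "t1 \<in> ?I" "t1 \<noteq> 0" by blast
    have n2: "CARD('n) \<ge> 2" using assms(1) by simp
    interpret null_curve A g T H L ?I ?\<gamma> by (rule Psi_null_curve(1)[OF n2 assms(5) t1])
    have \<gamma>0: "?\<gamma> 0 = z" by (rule Psi_null_curve(2)[OF n2 assms(5) t1])
    have 0: "0 \<in> ?I" by (rule Psi_interval_facts(3)[OF t1(1)])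
    obtain D \<theta> where D: "\<And>t. t \<in> ?I \<Longrightarrow> det_rel t (D t)" "\<And>t. t \<in> ?I \<Longrightarrow> D t > 0"
      "\<And>t. t \<in> ?I \<Longrightarrow> (D has_real_derivative \<theta> t * D t) (at t within ?I)"
      "\<And>t. t \<in> ?I \<Longrightarrow> \<exists>\<theta>'. (\<theta> has_real_derivative \<theta>') (at t within ?I) \<and>
         \<theta>' + (\<theta> t)\<^sup>2 / (real CARD('n) - 2) \<le> - ?Ric t"
      using det_rel_riccati[OF assms(1) 0] by metis
    \<comment> \<open>Unfolding \<open>det_J\<close> gives \<open>det_rel\<close> once the base
      point z is written as \<open>Psi\<close> at 0.\<close>
    have rel: "det_J A g H L z t = (THE d. det_rel t d)" for t
      unfolding det_J_def det_rel_def parallel_along_def jacobi_field_def Let_def \<gamma>0 by simp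
    have WD: "W A g H L z t = ln (D t)" if t: "t \<in> ?I" for t
    proof -
      have "(THE d. det_rel t d) = D t" by (rule the_equality[where P = "det_rel t", OF D(1)[OF t]]) (rule det_rel_unique[OF 0 t _ D(1)[OF t]])
      then show ?thesis by (simp add: W_def rel)
    qed
    have dW: "(W A g H L z has_real_derivative \<theta> t) (at t within ?I)" if t: "t \<in> ?I" for t
    proof -
      have "((\<lambda>s. ln (D s)) has_real_derivative (1 / D t) * (\<theta> t * D t)) (at t within ?I)"
        by (rule DERIV_chain2[OF DERIV_ln_divide[OF D(2)[OF t]] D(3)[OF t]])
      then have "((\<lambda>s. ln (D s)) has_real_derivative \<theta> t) (at t within ?I)" using D(2)[OF t] by simp
      then show ?thesis
        unfolding has_real_derivative_iff_has_vector_derivative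
        by (rule has_vector_derivative_transform[OF t WD, rotated])
    qed
    obtain \<theta>' where "\<And>t. t \<in> ?I \<Longrightarrow> (\<theta> has_real_derivative \<theta>' t) (at t within ?I) \<and>
         \<theta>' t + (\<theta> t)\<^sup>2 / (real CARD('n) - 2) \<le> - ?Ric t"
      using D(4) by metis
    then show ?thesis using dW by (intro exI[of _ \<theta>] exI[of _ \<theta>']) simp
  qed
qed

end
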